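(* Let $H=H_1(\lambda)$. There exist positive constants $C$, $c$, and $\lambda_0$ such that for every $\lambda\in(0,\lambda_0]$, every $N$, and all integers $i,j\in(0,N)$, $$\mathrm{Cov}(X_i,X_j)\le C H^{5/2}\exp\bigl\{-c\,|i-j|\,H^{-2}\bigr\},$$ where $\mathrm{Cov}$ denotes the covariance under $\mathrm{P}_{N,+,\lambda}$.
   Context: Setting. $p(\cdot)$ is the step distribution of an integer-valued one-dimensional random walk with zero mean and finite second moment, strictly aperiodic: there is $A>0$ such that $\min\{p^n(-1),p^n(0),p^n(1)\}>0$ for all $n\ge A$, where $p^n$ denotes the $n$-step transition probabilities ($n$-fold convolution of $p$). $V:[0,\infty)\to[0,\infty)$ is convex, continuous, increasing from $0$ to $\infty$, with $V(0)=0$, and there is $f:\mathbb{R}^+\to\mathbb{R}^+$ such that for every $\alpha>0$, $\limsup_{x\to\infty}V(\alpha x)/V(x)\le f(\alpha)<\infty$. Both $p$ and $V$ are fixed; constants may depend on them. For $\lambda\ge0$, an integer $N\ge1$ and integers $a,b\ge0$, $\mathrm{P}_{N,+,\lambda}^{a,b}$ is the probability measure on the set of non-negative integer paths $\mathbb{X}=(X_i)_{1\le i\le N-1}$, $X_i\ge0$, given by $$\mathrm{P}_{N,+,\lambda}^{a,b}(\mathbb{X})=\bigl(Z_{N,+,\lambda}^{a,b}\bigr)^{-1}\exp\Bigl\{-\lambda\sum_{i=1}^{N-1}V(X_i)\Bigr\}\prod_{i=0}^{N-1}p(X_{i+1}-X_i),\qquad X_0=a,\ X_N=b,$$ with $Z_{N,+,\lambda}^{a,b}$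 the normalizing constant (the measure is considered when this constant is positive). When $a=b=0$ the superscripts are omitted. For $\lambda>0$, $H_1(\lambda)$ is the unique $H>0$ with $\lambda H^2V(2H)=1$. *)

theory Defs
  imports "HOL-Probability.Probability"
begin

primrec nstep :: "int pmf \<Rightarrow> nat \<Rightarrow> int pmf" where
  "nstep p 0 = return_pmf 0"
| "nstep p (Suc n) = map_pmf (\<lambda>(x, y). x + y) (pair_pmf (nstep p n) p)"

definition walk_step :: "int pmf \<Rightarrow> bool" where
  "walk_step p \<longleftrightarrow>
     integrable (measure_pmf p) (\<lambda>x. (real_of_int x)\<^sup>2) \<and>
     measure_pmf.expectation p real_of_int = 0 \<and>
     (\<exists>A::nat. A > 0 \<and>
        (\<forall>n\<ge>A. Min {pmf (nstep p n) (-1), pmf (nstep p n) 0, pmf (nstep p n) 1} > 0))"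

text \<open>Only the values of \<open>V\<close> and \<open>f\<close> on \<open>[0,\<infinity>)\<close> and \<open>(0,\<infinity>)\<close> matter. The upper limit is taken
  in the extended reals, so that an unbounded quotient has upper limit \<open>\<infinity>\<close> and violates the
  condition.\<close>

definition potential :: "(real \<Rightarrow> real) \<Rightarrow> bool" where
  "potential V \<longleftrightarrow>
     (\<forall>x\<ge>0. V x \<ge> 0) \<and>
     convex_on {0..} V \<and> continuous_on {0..} V \<and> mono_on {0..} V \<and>
     V 0 = 0 \<and> filterlim V at_top at_top \<and>
     (\<exists>f :: real \<Rightarrow> real. \<forall>\<alpha>>0. f \<alpha> > 0 \<and>
        Limsup at_top (\<lambda>x. ereal (V (\<alpha> * x) / V x)) \<le> ereal (f \<alpha>))"

definition H1 :: "(real \<Rightarrow> real) \<Rightarrow> real \<Rightarrow> real" where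
  "H1 V lam = (THE H. H > 0 \<and> lam * H\<^sup>2 * V (2 * H) = 1)"

text \<open>A path is stored through its free part \<open>(X\<^sub>i)\<close>, \<open>1 \<le> i \<le> N - 1\<close>, as an extensional function;
  \<open>with_ends\<close> adds the boundary values \<open>X\<^sub>0 = a\<close> and \<open>X\<^sub>N = b\<close>.\<close>

definition paths :: "nat \<Rightarrow> (nat \<Rightarrow> nat) set" where
  "paths N = {1..<N} \<rightarrow>\<^sub>E UNIV"

definition with_ends :: "nat \<Rightarrow> nat \<Rightarrow> nat \<Rightarrow> (nat \<Rightarrow> nat) \<Rightarrow> nat \<Rightarrow> nat" where
  "with_ends N a b X i = (if i = 0 then a else if i = N then b else X i)"

definition path_weight ::
  "int pmf \<Rightarrow> (real \<Rightarrow> real) \<Rightarrow> real \<Rightarrow> nat \<Rightarrow> nat \<Rightarrow> nat \<Rightarrow> (nat \<Rightarrow> nat) \<Rightarrow> real" where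
  "path_weight p V lam N a b X =
     exp (- lam * (\<Sum>i=1..<N. V (real (X i)))) *
     (\<Prod>i<N. pmf p (int (with_ends N a b X (Suc i)) - int (with_ends N a b X i)))"

text \<open>For \<open>lam \<ge> 0\<close> and \<open>V \<ge> 0\<close> the weights are summable with sum at most 1, since the products of
  step probabilities are.\<close>

definition partition_fun ::
  "int pmf \<Rightarrow> (real \<Rightarrow> real) \<Rightarrow> real \<Rightarrow> nat \<Rightarrow> nat \<Rightarrow> nat \<Rightarrow> real" where
  "partition_fun p V lam N a b = (\<Sum>\<^sub>\<infinity>X\<in>paths N. path_weight p V lam N a b X)"

text \<open>A probability measure exactly when \<open>partition_fun\<close> is positive; otherwise it is the null
  measure.\<close>

definition path_measure ::
  "int pmf \<Rightarrow> (real \<Rightarrow> real) \<Rightarrow> real \<Rightarrow> nat \<Rightarrow> nat \<Rightarrow> nat \<Rightarrow> (nat \<Rightarrow> nat) measure" where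
  "path_measure p V lam N a b =
     point_measure (paths N)
       (\<lambda>X. ennreal (path_weight p V lam N a b X / partition_fun p V lam N a b))"

definition covariance :: "'a measure \<Rightarrow> ('a \<Rightarrow> real) \<Rightarrow> ('a \<Rightarrow> real) \<Rightarrow> real" where
  "covariance M F G =
     (LINT x|M. (F x - (LINT y|M. F y)) * (G x - (LINT y|M. G y)))"

end

theory Submission imports Defs begin

text \<open>Put \<open>u x = exp (- lam * V x / 2)\<close> for \<open>x \<ge> 0\<close> and \<open>u x = 0\<close> otherwise. Splitting every site weight
  between the two adjacent steps turns the path measure into the bridge of the killed kernel
  \<open>T x y = u x * u y * p (y - x)\<close>, and moments into matrix elements of products of powers of \<open>T\<close>.

  At the scale \<open>r = \<lfloor>H\<rfloor>\<close> the kernel is studied over \<open>m\<close> steps, \<open>m\<close> of order \<open>r\<^sup>2\<close>. The potential costs only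
  \<open>O(1)\<close> there, so the local limit theorem gives \<open>T^m x y\<close> of order \<open>1 / r\<close> in the bulk \<open>[r, M0 * r]\<close>; convexity
  of \<open>V\<close> makes the row sums of \<open>T^m\<close> at height \<open>x\<close> at most of order \<open>(r / x)\<^sup>2\<close>, hence paths return to the
  bulk; and a path started at the wall is compared with the walk conditioned to climb to \<open>r\<close> before
  turning negative. This bounds second moments by \<open>O(r\<^sup>2)\<close> for all bridges of length at least \<open>6 * m\<close>; a
  bridge that is too short for \<open>r\<close> is treated at a smaller scale.

  For the covariance, let \<open>f x\<close> be the weight of the bridges from \<open>x\<close> to \<open>0\<close> multiplied by the height at time \<open>j\<close>. It
  is compared with multiples of \<open>\<rho> x\<close>, the same weight without that factor. Doeblin's minorization shows
  that each block of \<open>3 * m\<close> steps between \<open>i\<close> and \<open>j\<close> reduces the best error by a fixed factor \<open>1 - \<epsilon> / 2\<close>. The outcome is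
  \<open>Cov \<le> C * H\<^sup>2 * exp (- c * |i - j| / H\<^sup>2)\<close>, which suffices as \<open>H \<ge> 1\<close>.\<close>

section \<open>Local limit theorem\<close>

text \<open>The scale \<open>H\<close> is chosen so that \<open>H^2\<close> steps at height
  \<open>2 * H\<close> cost a factor of order one; this is why \<open>m\<close> is of order
  \<open>r^2\<close>. Two obstacles shape the argument. Leaving the wall has a small probability
  \<open>q\<close>: every estimate from \<open>0\<close> carries it as a factor, above and below, so
  that it cancels against the partition function. And \<open>p\<close> need not be symmetric, so no
  spectral decomposition is at hand; each estimate is proved for the walk and for its reversal, and
  a bridge is handled from both ends. Since row sums of \<open>T^m\<close> tend to zero at large
  heights, the minorization holds only below a height \<open>M2 * r\<close>; above it, smallness
  comes from the decay \<open>(r / x)^2\<close>, whose exponent is just large enough for second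
  moments. The constants have to be chosen in a definite order: first the time and bulk parameters
  \<open>C0\<close> and \<open>M0\<close>, then \<open>\<kappa>\<close>, then a cut-off height
  \<open>M1\<close> with its constant, then \<open>\<delta>\<close>, then \<open>M3\<close> and
  \<open>\<kappa>3\<close>, and last \<open>M2\<close> and \<open>\<kappa>2\<close>. In this order
  no cut-off height depends on the constant of its own region.\<close>

lemma integral_bind_pmf_bounded:
  fixes f :: "'a \<Rightarrow> complex"
  assumes "\<And>x. norm (f x) \<le> B"
  shows "integral\<^sup>L (bind_pmf M N) f = (\<integral>x. integral\<^sup>L (N x) f \<partial>measure_pmf M)"
proof -
  have int: "integrable (measure_pmf q) f" for q
    by (rule measure_pmf.integrable_const_bound[where B=B]) (auto simp: assms)
  have r: "integral\<^sup>L (bind_pmf M N) g = (\<integral>x. integral\<^sup>L (N x) g \<partial>measure_pmf M)"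
    if "\<And>x. \<bar>g x\<bar> \<le> B" for g :: "'a \<Rightarrow> real"
    unfolding measure_pmf_bind
    by (rule integral_bind[where K="count_space UNIV" and B=B and B'=1])
       (auto simp: that measure_subprob measure_pmf.finite_measure_axioms measure_pmf.emeasure_space_1[simplified])
  have i2: "integrable (measure_pmf M) (\<lambda>x. integral\<^sup>L (measure_pmf (N x)) f)"
  proof (rule measure_pmf.integrable_const_bound[where B=B])
    show "AE x in measure_pmf M. norm (integral\<^sup>L (measure_pmf (N x)) f) \<le> B"
    proof (rule AE_I2)
      fix x
      have "norm (integral\<^sup>L (measure_pmf (N x)) f) \<le> (\<integral>y. norm (f y) \<partial>measure_pmf (N x))"
        by (rule integral_norm_bound)
      also have "\<dots> \<le> (\<integral>y. B \<partial>measure_pmf (N x))"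
        by (rule integral_mono) (auto simp: assms int)
      finally show "norm (integral\<^sup>L (measure_pmf (N x)) f) \<le> B" by simp
    qed
  qed auto
  have "Re (integral\<^sup>L (bind_pmf M N) f) = Re (\<integral>x. integral\<^sup>L (N x) f \<partial>measure_pmf M)"
    using r[of "\<lambda>x. Re (f x)"] order_trans[OF abs_Re_le_cmod assms] int i2
    by (simp add: integral_Re[symmetric] del: integral_Re)
  moreover have "Im (integral\<^sup>L (bind_pmf M N) f) = Im (\<integral>x. integral\<^sup>L (N x) f \<partial>measure_pmf M)"
    using r[of "\<lambda>x. Im (f x)"] order_trans[OF abs_Im_le_cmod assms] int i2
    by (simp add: integral_Im[symmetric] del: integral_Im)
  ultimately show ?thesis by (simp add: complex_eq_iff)
qed

definition cf :: "int pmf \<Rightarrow> real \<Rightarrow> complex" where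
  "cf q t = char (distr (measure_pmf q) borel real_of_int) t"

lemma cf_eq: "cf q t = (\<integral>x. iexp (t * of_int x) \<partial>measure_pmf q)"
  unfolding cf_def char_def by (subst integral_distr) auto

lemma real_dist: "real_distribution (distr (measure_pmf q) borel real_of_int)"
  by (rule prob_space.real_distribution_distr[OF measure_pmf.prob_space_axioms]) simp

lemma norm_cf_le_1: "norm (cf q t) \<le> 1"
  unfolding cf_def by (rule real_distribution.cmod_char_le_1[OF real_dist])

lemma cf_measurable [measurable]: "cf q \<in> borel_measurable borel"
  unfolding cf_def by (rule real_distribution.char_measurable[OF real_dist])

lemma cf_nstep: "cf (nstep p n) t = cf p t ^ n"
proof (induction n)
  case 0
  then show ?case by (simp add: cf_eq)
next
  case (Suc n)
  have "cf (nstep p (Suc n)) t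
      = (\<integral>(x,y). iexp (t * of_int (x + y)) \<partial>measure_pmf (pair_pmf (nstep p n) p))"
    by (simp add: cf_eq split_beta')
  also have "\<dots> = (\<integral>x. \<integral>y. iexp (t * of_int (x + y)) \<partial>measure_pmf p \<partial>measure_pmf (nstep p n))"
    unfolding pair_pmf_def
    by (subst integral_bind_pmf_bounded[where B=1], simp add: case_prod_beta,
        subst integral_bind_pmf_bounded[where B=1], simp_all add: case_prod_beta)
  also have "\<dots> = (\<integral>x. iexp (t * of_int x) * cf p t \<partial>measure_pmf (nstep p n))"
    by (simp add: cf_eq exp_add distrib_left)
  also have "\<dots> = cf (nstep p n) t * cf p t" by (simp add: cf_eq)
  finally show ?case using Suc by simp
qed

lemma integral_iexp_period:
  "(CLINT t|lborel. indicator {-pi..pi} t *\<^sub>R iexp (t * of_int n)) = (if n = 0 then of_real (2 * pi) else 0)"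
proof (cases "n = 0")
  case True
  then show ?thesis by (simp add: scaleR_conv_of_real)
next
  case False
  let ?F = "\<lambda>t::real. iexp (t * of_int n) / (\<i> * of_int n)"
  have "(CLINT t|lborel. indicator {-pi..pi} t *\<^sub>R iexp (t * of_int n)) = ?F pi - ?F (-pi)"
  proof (rule integral_FTC_atLeastAtMost)
    fix t :: real
    have "((\<lambda>z. exp (\<i> * z * of_int n) / (\<i> * of_int n)) has_field_derivative exp (\<i> * of_real t * of_int n)) (at (of_real t))"
      using False by (auto intro!: derivative_eq_intros simp: field_simps)
    then have "((\<lambda>z. exp (\<i> * of_real z * of_int n) / (\<i> * of_int n)) has_vector_derivative exp (\<i> * of_real t * of_int n)) (at t within {-pi..pi})"
      by (rule has_vector_derivative_real_field)
    then show "(?F has_vector_derivative iexp (t * of_int n)) (at t within {-pi..pi})"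
      by (simp add: mult.assoc)
  qed (auto intro!: continuous_intros)
  also have "iexp (pi * of_int n) = iexp (- pi * of_int n)"
  proof -
    have "iexp (pi * of_int n) = iexp (- pi * of_int n) * exp (2 * of_int n * pi * \<i>)"
      unfolding exp_add[symmetric] by (simp add: algebra_simps)
    also have "exp (2 * of_int n * pi * \<i>) = 1" by (rule exp_integer_2pi) auto
    finally show ?thesis by simp
  qed
  finally show ?thesis using False by simp
qed

text \<open>Averaging \<open>iexp (t * (x - k))\<close> over one period in \<open>t\<close> leaves
  the indicator of \<open>x = k\<close>; the rest is an exchange of two integrals.\<close>

lemma fourier_inversion:
  "2 * pi * pmf q k = (CLINT t|lborel. indicator {-pi..pi} t *\<^sub>R (cf q t * iexp (- t * of_int k)))"
proof -
  \<comment> \<open>The uniform law on one period. With two probability measures, boundedness of the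
    integrand already justifies Fubini.\<close>
  define U where "U = density lborel (\<lambda>t. ennreal (indicator {-pi..pi} t / (2 * pi)))"
  interpret U: prob_space U
  proof
    have "emeasure U (space U) = (\<integral>\<^sup>+t. ennreal (1 / (2*pi)) * indicator {-pi..pi} t \<partial>lborel)"
      unfolding U_def by (subst emeasure_density) (auto intro!: nn_integral_cong simp: indicator_def)
    also have "\<dots> = ennreal (1 / (2 * pi)) * ennreal (2 * pi)"
      by (simp add: nn_integral_cmult)
    also have "\<dots> = 1" by (simp add: ennreal_mult[symmetric])
    finally show "emeasure U (space U) = 1" .
  qed
  have U: "integral\<^sup>L U f = (1 / (2 * pi)) *\<^sub>R (CLINT t|lborel. indicator {-pi..pi} t *\<^sub>R f t)"
    if [measurable]: "f \<in> borel_measurable borel" for f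
  proof -
    have "integral\<^sup>L U f = (CLINT t|lborel. (indicator {-pi..pi} t / (2 * pi)) *\<^sub>R f t)"
      unfolding U_def by (subst integral_density) auto
    also have "\<dots> = (CLINT t|lborel. (1 / (2 * pi)) *\<^sub>R (indicator {-pi..pi} t *\<^sub>R f t))"
      by (auto intro!: Bochner_Integration.integral_cong simp: indicator_def)
    finally show ?thesis by (simp only: integral_scaleR_right)
  qed
  interpret P: pair_prob_space "measure_pmf q" U ..
  have [measurable_cong]: "sets U = sets borel" by (simp add: U_def)
  have m: "(\<lambda>x. iexp (snd x * of_int (fst x - k))) \<in> borel_measurable (measure_pmf q \<Otimes>\<^sub>M U)"
    by measurable
  have "integral\<^sup>L U (\<lambda>t. cf q t * iexp (- t * of_int k)) =
      (\<integral>t. \<integral>x. iexp (t * of_int (x - k)) \<partial>measure_pmf q \<partial>U)"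
  proof (rule Bochner_Integration.integral_cong[OF refl])
    fix t
    have "cf q t * iexp (- t * of_int k) = (\<integral>x. iexp (t * of_int x) * iexp (- t * of_int k) \<partial>measure_pmf q)"
      by (simp add: cf_eq)
    also have "\<dots> = (\<integral>x. iexp (t * of_int (x - k)) \<partial>measure_pmf q)"
      by (rule Bochner_Integration.integral_cong) (simp_all add: exp_add[symmetric] algebra_simps)
    finally show "cf q t * iexp (- t * of_int k) = (\<integral>x. iexp (t * of_int (x - k)) \<partial>measure_pmf q)" .
  qed
  also have "\<dots> = (\<integral>x. \<integral>t. iexp (t * of_int (x - k)) \<partial>U \<partial>measure_pmf q)"
    by (rule P.Fubini_integral, rule P.integrable_const_bound[where B=1])
       (use m in \<open>auto simp: case_prod_beta\<close>)
  also have "\<dots> = (\<integral>x. of_real (indicator {k} x) \<partial>measure_pmf q)"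
  proof (intro Bochner_Integration.integral_cong refl)
    fix x
    have "(\<integral>t. iexp (t * of_int (x - k)) \<partial>U)
        = (1 / (2 * pi)) *\<^sub>R (if x - k = 0 then of_real (2 * pi) else 0)"
      by (subst U, measurable, subst integral_iexp_period, rule refl)
    then show "(\<integral>t. iexp (t * of_int (x - k)) \<partial>U) = of_real (indicator {k} x)"
      by (auto simp: indicator_def scaleR_conv_of_real)
  qed
  also have "\<dots> = pmf q k" by (simp add: measure_pmf_single)
  finally have "integral\<^sup>L U (\<lambda>t. cf q t * iexp (- t * of_int k)) = pmf q k" .
  then show ?thesis by (subst (asm) U) (auto simp: scaleR_conv_of_real field_simps)
qed

text \<open>For \<open>y = |t| / 2 \<le> 2\<close>, Taylor's formula gives
  \<open>sin y \<ge> y * (1 - 4/6 - 16/120) = y / 5\<close>. Then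
  \<open>cos t = 1 - 2 * (sin y)^2\<close> is at most \<open>1 - 2 * t^2 / 100\<close>.\<close>

lemma cos_le_quadratic:
  assumes "\<bar>t\<bar> \<le> pi"
  shows "cos t \<le> 1 - t\<^sup>2 / 50"
proof -
  define y where "y = \<bar>t\<bar> / 2"
  have y: "0 \<le> y" "y \<le> 2" using assms pi_half_less_two by (auto simp: y_def)
  have "\<bar>sin y - (\<Sum>m<5. sin_coeff m * y ^ m)\<bar> \<le> inverse (fact 5) * \<bar>y\<bar> ^ 5"
    by (rule Maclaurin_sin_bound)
  also have "(\<Sum>m<5. sin_coeff m * y ^ m) = y - y ^ 3 / 6"
    by (simp add: sin_coeff_def lessThan_nat_numeral lessThan_Suc fact_numeral)
  also have "inverse (fact 5) * \<bar>y\<bar> ^ 5 = y ^ 5 / 120"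
    using y by (simp add: fact_numeral)
  finally have *: "sin y \<ge> y - y ^ 3 / 6 - y ^ 5 / 120"
    by linarith
  have y2: "y\<^sup>2 \<le> 4" using y power_mono[of y 2 2] by simp
  have y4: "y ^ 4 \<le> 16" using y power_mono[of y 2 4] by simp
  have "y ^ 3 = y * y\<^sup>2" "y ^ 5 = y * y ^ 4" by (simp_all add: eval_nat_numeral)
  moreover have "y * y\<^sup>2 \<le> y * 4" "y * y ^ 4 \<le> y * 16"
    using y y2 y4 by (auto intro!: mult_left_mono)
  ultimately have "sin y \<ge> y / 5" using * y by linarith
  then have "(y / 5)\<^sup>2 \<le> (sin y)\<^sup>2" using y by (intro power_mono) auto
  moreover have "cos t = 1 - 2 * (sin y)\<^sup>2"
  proof -
    have "cos t = cos (2 * y)" by (simp add: y_def)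
    then show ?thesis by (simp add: cos_double_sin)
  qed
  moreover have "(y / 5)\<^sup>2 = t\<^sup>2 / 100" by (simp add: y_def power_divide)
  ultimately show ?thesis by simp
qed

lemma norm_one_plus_iexp_le:
  assumes "\<bar>t\<bar> \<le> pi"
  shows "norm (1 + iexp t) \<le> 2 - t\<^sup>2 / 100"
proof -
  have t2: "t\<^sup>2 \<le> 16"
  proof -
    have "\<bar>t\<bar> \<le> 4" using assms pi_less_4 by linarith
    then have "\<bar>t\<bar>\<^sup>2 \<le> 4\<^sup>2" by (intro power_mono) auto
    then show ?thesis by simp
  qed
  have "(norm (1 + iexp t))\<^sup>2 = (1 + cos t)\<^sup>2 + (sin t)\<^sup>2"
    by (simp add: cmod_def Re_exp Im_exp)
  also have "\<dots> = 2 + 2 * cos t"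
    using sin_cos_squared_add[of t] by (simp add: power2_sum)
  also have "\<dots> \<le> 4 - t\<^sup>2 / 25" using cos_le_quadratic[OF assms] by simp
  also have "\<dots> \<le> (2 - t\<^sup>2 / 100)\<^sup>2" by (simp add: power2_diff)
  finally show ?thesis by (rule power2_le_imp_le) (use t2 in simp)
qed

text \<open>Mass \<beta> is taken out of each of the atoms 0 and 1. What remains contributes at most
  its mass \<open>1 - 2 * \<beta>\<close>, while the two removed atoms contribute \<beta> times the
  modulus of \<open>1 + iexp t\<close>, which falls short of \<open>2 * \<beta>\<close> by an amount
  of order \<open>\<beta> * t^2\<close>.\<close>

lemma norm_cf_two_atoms:
  assumes "0 < \<beta>" "\<beta> \<le> pmf q 0" "\<beta> \<le> pmf q 1" "\<bar>t\<bar> \<le> pi"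
  shows "norm (cf q t) \<le> exp (- (\<beta> / 100) * t\<^sup>2)"
proof -
  define h :: "int \<Rightarrow> real" where
    "h x = 1 - \<beta> / pmf q 0 * indicator {0} x - \<beta> / pmf q 1 * indicator {1} x" for x
  have h0: "0 \<le> h x" for x using assms by (auto simp: h_def indicator_def field_simps)
  have h1: "h x \<le> 1" for x using assms by (auto simp: h_def indicator_def field_simps)
  have int: "integrable (measure_pmf q) (\<lambda>x. of_real (h x) * iexp (t * of_int x))"
    by (rule measure_pmf.integrable_const_bound[where B=1]) (auto simp: norm_mult h0 h1)
  have int0: "integrable (measure_pmf q) (\<lambda>x. indicator {a} x *\<^sub>R (c::complex))" for a c
    by (rule measure_pmf.integrable_const_bound[where B="norm c"]) (auto simp: indicator_def)
  have ind: "(\<integral>x. indicator {a} x *\<^sub>R (c::complex) \<partial>measure_pmf q) = pmf q a *\<^sub>R c" for a c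
    by (subst integral_scaleR_left) (auto simp: measure_pmf_single intro!: measure_pmf.integrable_const_bound[where B=1])
  have split: "iexp (t * of_int x) = of_real (h x) * iexp (t * of_int x)
      + indicator {0} x *\<^sub>R of_real (\<beta> / pmf q 0) + indicator {1} x *\<^sub>R (of_real (\<beta> / pmf q 1) * iexp t)" for x
    by (auto simp: h_def indicator_def algebra_simps)
  have "cf q t = (\<integral>x. of_real (h x) * iexp (t * of_int x) \<partial>measure_pmf q)
      + pmf q 0 *\<^sub>R of_real (\<beta> / pmf q 0) + pmf q 1 *\<^sub>R (of_real (\<beta> / pmf q 1) * iexp t)"
    unfolding cf_eq
    by (subst split, subst Bochner_Integration.integral_add, intro Bochner_Integration.integrable_add int int0, rule int0,
        subst Bochner_Integration.integral_add, rule int, rule int0)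
       (simp only: ind)
  also have "pmf q 0 *\<^sub>R of_real (\<beta> / pmf q 0) = (of_real \<beta> :: complex)"
    using assms by (simp add: scaleR_conv_of_real)
  also have "pmf q 1 *\<^sub>R (of_real (\<beta> / pmf q 1) * iexp t) = of_real \<beta> * iexp t"
    using assms by (simp add: scaleR_conv_of_real)
  finally have "cf q t = (\<integral>x. of_real (h x) * iexp (t * of_int x) \<partial>measure_pmf q) + of_real \<beta> * (1 + iexp t)"
    by (simp add: algebra_simps)
  then have "norm (cf q t) \<le> norm (\<integral>x. of_real (h x) * iexp (t * of_int x) \<partial>measure_pmf q) + norm (of_real \<beta> * (1 + iexp t))"
    using norm_triangle_ineq by simp
  also have "norm (\<integral>x. of_real (h x) * iexp (t * of_int x) \<partial>measure_pmf q) \<le> (\<integral>x. h x \<partial>measure_pmf q)"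
    by (rule order_trans[OF integral_norm_bound]) (simp add: norm_mult h0)
  also have "(\<integral>x. h x \<partial>measure_pmf q) = 1 - 2 * \<beta>"
  proof -
    have i: "integrable (measure_pmf q) (\<lambda>x. c * indicator {a} x :: real)" for c a
      by (rule measure_pmf.integrable_const_bound[where B="\<bar>c\<bar>"]) (auto simp: indicator_def)
    have "(\<integral>x. h x \<partial>measure_pmf q) = (\<integral>x. 1 - \<beta> / pmf q 0 * indicator {0} x \<partial>measure_pmf q)
        - (\<integral>x. \<beta> / pmf q 1 * indicator {1} x \<partial>measure_pmf q)"
      unfolding h_def by (rule Bochner_Integration.integral_diff) (intro Bochner_Integration.integrable_diff i, simp, rule i)
    also have "(\<integral>x. 1 - \<beta> / pmf q 0 * indicator {0} x \<partial>measure_pmf q) = 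
        (\<integral>x. 1 \<partial>measure_pmf q) - (\<integral>x. \<beta> / pmf q 0 * indicator {0} x \<partial>measure_pmf q)"
      by (rule Bochner_Integration.integral_diff) (simp, rule i)
    also have "(\<integral>x. \<beta> / pmf q 0 * indicator {0} x \<partial>measure_pmf q) = \<beta>"
      using assms by (subst integral_mult_right_zero) (simp add: measure_pmf_single)
    also have "(\<integral>x. \<beta> / pmf q 1 * indicator {1} x \<partial>measure_pmf q) = \<beta>"
      using assms by (subst integral_mult_right_zero) (simp add: measure_pmf_single)
    finally show ?thesis by simp
  qed
  also have "norm (of_real \<beta> * (1 + iexp t)) \<le> \<beta> * (2 - t\<^sup>2 / 100)"
    unfolding norm_mult using assms norm_one_plus_iexp_le[of t] by (auto intro!: mult_mono)
  finally have "norm (cf q t) \<le> 1 + (- (\<beta> / 100) * t\<^sup>2)" by (simp add: algebra_simps)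
  also have "\<dots> \<le> exp (- (\<beta> / 100) * t\<^sup>2)" by (rule exp_ge_add_one_self)
  finally show ?thesis .
qed

locale walk =
  fixes p :: "int pmf"
  assumes walk: "walk_step p"
begin

abbreviation E :: "(int \<Rightarrow> real) \<Rightarrow> real" where "E \<equiv> measure_pmf.expectation p"

definition s2 :: real where "s2 = E (\<lambda>x. (of_int x)\<^sup>2)"

lemma int_sq: "integrable (measure_pmf p) (\<lambda>x. (of_int x :: real)\<^sup>2)"
  using walk by (simp add: walk_step_def)

lemma int_id: "integrable (measure_pmf p) (\<lambda>x. of_int x :: real)"
  by (rule measure_pmf.square_integrable_imp_integrable[OF _ int_sq]) simp

lemma mean_zero: "E of_int = 0"
  using walk by (simp add: walk_step_def)

text \<open>Aperiodicity supplies a number \<open>A\<close> of steps after which both 0 and 1 carry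
  mass; an \<open>A\<close>-th root of the two-atom bound then gives the bound for a single
  step.\<close>

lemma cf_decay:
  obtains c where "c > 0" "\<And>t. \<bar>t\<bar> \<le> pi \<Longrightarrow> norm (cf p t) \<le> exp (- c * t\<^sup>2)"
proof -
  obtain A where A: "A > 0" "pmf (nstep p A) 0 > 0" "pmf (nstep p A) 1 > 0"
    using walk by (force simp: walk_step_def)
  define \<beta> where "\<beta> = min (pmf (nstep p A) 0) (pmf (nstep p A) 1)"
  have \<beta>: "0 < \<beta>" "\<beta> \<le> pmf (nstep p A) 0" "\<beta> \<le> pmf (nstep p A) 1"
    using A by (auto simp: \<beta>_def)
  have "norm (cf p t) \<le> exp (- (\<beta> / 100 / A) * t\<^sup>2)" if "\<bar>t\<bar> \<le> pi" for t
  proof -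
    have "norm (cf p t) ^ A \<le> exp (- (\<beta> / 100) * t\<^sup>2)"
      using norm_cf_two_atoms[OF \<beta> that] by (simp add: cf_nstep norm_power)
    also have "\<dots> = exp (- (\<beta> / 100 / A) * t\<^sup>2) ^ A"
      using A by (simp add: exp_of_nat_mult[symmetric])
    finally show ?thesis using A by (simp add: power_mono_iff)
  qed
  then show ?thesis using that[of "\<beta> / 100 / A"] \<beta> A by simp
qed

text \<open>Zero variance would make \<open>p\<close> the point mass at 0, whose characteristic
  function is constantly 1, against the decay at \<open>t = 1\<close>.\<close>

lemma s2_pos: "s2 > 0"
proof (rule ccontr)
  assume "\<not> s2 > 0"
  moreover have "s2 \<ge> 0" unfolding s2_def by simp
  ultimately have "s2 = 0" by linarith
  then have "E (\<lambda>x. (of_int x)\<^sup>2) = 0" by (simp add: s2_def)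
  then have "AE x in measure_pmf p. (of_int x :: real)\<^sup>2 = 0"
    using integral_nonneg_eq_0_iff_AE[OF int_sq] by simp
  then have "x = 0" if "x \<in> set_pmf p" for x using that by (auto simp: AE_measure_pmf_iff)
  then have "p = return_pmf 0" by (metis set_pmf_subset_singleton subsetI singletonI)
  then have "cf p t = 1" for t by (simp add: cf_eq)
  moreover obtain c where "c > 0" "\<And>t. \<bar>t\<bar> \<le> pi \<Longrightarrow> norm (cf p t) \<le> exp (- c * t\<^sup>2)"
    using cf_decay by blast
  from this(1) this(2)[of 1] have "norm (cf p 1) < 1" 
    using pi_ge_two by (auto elim!: order_le_less_trans)
  ultimately show False by simp
qed

text \<open>The error of the second-order expansion at \<open>t / sqrt n\<close> is the expectation
  of a minimum that is dominated by \<open>6 * x^2\<close> and tends to 0 pointwise. Hence two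
  moments suffice.\<close>

lemma cf_gaussian_limit:
  "(\<lambda>n. cf p (t / sqrt n) ^ n) \<longlonglongrightarrow> of_real (exp (- (s2 * t\<^sup>2) / 2))"
proof -
  have approx: "norm (cf p t - (1 - t\<^sup>2 * s2 / 2)) \<le> (t\<^sup>2 / 6) * E (\<lambda>x. min (6 * (of_int x)\<^sup>2) (\<bar>t\<bar> * \<bar>of_int x\<bar> ^ 3))" for t
    unfolding cf_def
    by (rule prob_space.char_approx3'[OF measure_pmf.prob_space_axioms, OF _ int_id int_sq mean_zero _ refl])
       (simp_all add: mean_zero s2_def)
  let ?e = "\<lambda>n. E (\<lambda>x. min (6 * (of_int x)\<^sup>2) (\<bar>t / sqrt n\<bar> * \<bar>of_int x\<bar> ^ 3))"
  have main: "\<forall>\<^sub>F n in sequentially.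
      norm (cf p (t / sqrt n) ^ n - (of_real ((1 + (- (s2 * t\<^sup>2) / 2) / n) ^ n))) \<le> t\<^sup>2 / 6 * ?e n"
  proof (rule eventually_sequentiallyI)
    fix n :: nat
    \<comment> \<open>This range of \<open>n\<close> keeps the modulus of
      \<open>1 - s2 * t^2 / (2 * n)\<close> at most 1, so that a difference of \<open>n\<close>-th
      powers is at most \<open>n\<close> times the difference of the bases.\<close>
    assume "n \<ge> max 1 (nat (ceiling (s2 * t\<^sup>2 / 4)))"
    hence n: "n \<ge> 1" "n \<ge> s2 * t\<^sup>2 / 4" by auto
    have b: "\<bar>1 + (- (s2 * t\<^sup>2) / 2) / n\<bar> \<le> 1"
      using n s2_pos by (auto simp: abs_le_iff field_simps)
    have "norm (cf p (t / sqrt n) ^ n - of_real ((1 + (- (s2 * t\<^sup>2) / 2) / n) ^ n)) \<le>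
        n * norm (cf p (t / sqrt n) - of_real (1 + (- (s2 * t\<^sup>2) / 2) / n))"
      unfolding of_real_power by (rule norm_power_diff) (use b norm_cf_le_1 in \<open>simp_all del: of_real_add of_real_diff of_real_divide\<close>)
    also have "of_real (1 + (- (s2 * t\<^sup>2) / 2) / n) = (1 - (of_real (t / sqrt n))\<^sup>2 * of_real s2 / 2 :: complex)"
      using n by (simp add: power_divide mult.commute flip: of_real_power)
    also have "n * norm (cf p (t / sqrt n) - (1 - (of_real (t / sqrt n))\<^sup>2 * of_real s2 / 2)) 
      \<le> n * ((t / sqrt n)\<^sup>2 / 6 * ?e n)"
      using approx[of "t / sqrt n"] by (intro mult_left_mono) auto
    also have "\<dots> = t\<^sup>2 / 6 * ?e n" using n by (simp add: power_divide)
    finally show "norm (cf p (t / sqrt n) ^ n - (of_real ((1 + (- (s2 * t\<^sup>2) / 2) / n) ^ n))) \<le> t\<^sup>2 / 6 * ?e n" .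
  qed
  have "(\<lambda>n. min (6 * (of_int x :: real)\<^sup>2) (\<bar>t / sqrt n\<bar> * \<bar>of_int x\<bar> ^ 3)) \<longlonglongrightarrow> min (6 * (of_int x)\<^sup>2) (\<bar>0\<bar> * \<bar>of_int x\<bar> ^ 3)" for x
    by (intro tendsto_intros tendsto_divide_0[OF tendsto_const] filterlim_at_top_imp_at_infinity
        filterlim_compose[OF sqrt_at_top filterlim_real_sequentially])
  then have "?e \<longlonglongrightarrow> E (\<lambda>x. 0)"
    by (intro integral_dominated_convergence[where w="\<lambda>x. 6 * (of_int x)\<^sup>2"])
       (auto simp: int_sq min_absorb2)
  then have *: "(\<lambda>n. t\<^sup>2 / 6 * ?e n) \<longlonglongrightarrow> 0"
    using tendsto_mult_right_zero by (simp only: integral_zero)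
  have "(\<lambda>n. complex_of_real ((1 + (- (s2 * t\<^sup>2) / 2) / n) ^ n)) \<longlonglongrightarrow> of_real (exp (- (s2 * t\<^sup>2) / 2))"
    by (rule isCont_tendsto_compose [OF _ tendsto_exp_limit_sequentially]) auto
  then show ?thesis
    by (rule Lim_transform) (rule Lim_null_comparison [OF main *])
qed

text \<open>After the substitution \<open>t = s / sqrt n\<close> the point \<open>k\<close> enters
  the inversion formula only through a phase of modulus 1. Convergence of \<open>g n\<close> to the
  Gaussian \<open>G\<close> in L1 therefore gives an error uniform in \<open>k\<close>;
  \<open>cf_decay\<close> provides the integrable majorant.\<close>

lemma local_limit:
  "\<exists>a. (\<forall>\<epsilon>>0. \<exists>n0. \<forall>n\<ge>n0. \<forall>k. \<bar>sqrt n * pmf (nstep p n) k - exp (- (of_int k)\<^sup>2 / (2 * s2 * n)) / a\<bar> \<le> \<epsilon>) \<and> a > 0"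
proof (rule exI, intro conjI allI impI)
  let ?a = "sqrt (2 * pi * s2)"
  show "?a > 0" using s2_pos by simp
  fix \<epsilon> :: real assume "\<epsilon> > 0"
  obtain c where c: "c > 0" "\<And>t. \<bar>t\<bar> \<le> pi \<Longrightarrow> norm (cf p t) \<le> exp (- c * t\<^sup>2)"
    using cf_decay by blast
  define g where "g n s = indicator {- pi * sqrt n .. pi * sqrt n} s *\<^sub>R cf p (s / sqrt n) ^ n" for n :: nat and s
  define G where "G s = complex_of_real (exp (- (s2 * s\<^sup>2) / 2))" for s
  have [measurable]: "g n \<in> borel_measurable borel" "G \<in> borel_measurable borel" for n
    unfolding g_def G_def by measurable
  have gauss_int: "integrable lborel (\<lambda>s. exp (- b * s\<^sup>2))" if "b > 0" for b :: real
  proof -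
    have "integrable lborel (\<lambda>s. sqrt (2 * pi) * std_normal_density (0 + sqrt (2 * b) * s))"
      using that by (intro integrable_mult_right lborel_integrable_real_affine) auto
    moreover have "sqrt (2 * pi) * std_normal_density (0 + sqrt (2 * b) * s) = exp (- b * s\<^sup>2)" for s
      using that by (simp add: std_normal_density_def power_mult_distrib)
    ultimately show ?thesis by (simp only:)
  qed
  have dom: "norm (g n s) \<le> exp (- c * s\<^sup>2)" if "n \<ge> 1" for n s
  proof (cases "\<bar>s\<bar> \<le> pi * sqrt n")
    case True
    then have "\<bar>s / sqrt n\<bar> \<le> pi" using that by (simp add: field_simps)
    from power_mono[OF c(2)[OF this] norm_ge_zero, of n]
    have "norm (cf p (s / sqrt n)) ^ n \<le> exp (- c * (s / sqrt n)\<^sup>2) ^ n" .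
    also have "\<dots> = exp (- c * s\<^sup>2)"
      using that by (simp add: exp_of_nat_mult[symmetric] power_divide)
    finally show ?thesis by (simp add: g_def norm_power indicator_def)
  qed (auto simp: g_def indicator_def abs_le_iff)
  have lim: "(\<lambda>n. g n s) \<longlonglongrightarrow> G s" for s
  proof -
    have "\<forall>\<^sub>F n in sequentially. \<bar>s\<bar> / pi \<le> sqrt (real n)"
      using filterlim_compose[OF sqrt_at_top filterlim_real_sequentially]
      by (simp add: filterlim_at_top)
    then have "\<forall>\<^sub>F n in sequentially. cf p (s / sqrt n) ^ n = g n s"
      by eventually_elim (auto simp: g_def indicator_def field_simps abs_le_iff)
    with cf_gaussian_limit[of s] show ?thesis unfolding G_def by (rule Lim_transform_eventually)
  qed
  have intg: "integrable lborel (g n)" if "n \<ge> 1" for n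
    by (rule Bochner_Integration.integrable_bound[OF gauss_int[OF c(1)]]) (use dom[OF that] in auto)
  have intG: "integrable lborel G"
    using integrable_of_real[OF gauss_int[of "s2 / 2"]] s2_pos by (simp add: G_def[abs_def])
  \<comment> \<open>The majorant is available from \<open>n = 1\<close> on, hence the shift by
    \<open>Suc\<close>.\<close>
  have "(\<lambda>n. \<integral>s. norm (g (Suc n) s - G s) \<partial>lborel) \<longlonglongrightarrow> integral\<^sup>L (lborel :: real measure) (\<lambda>s. 0)"
  proof (rule integral_dominated_convergence)
    show "integrable lborel (\<lambda>s. exp (- c * s\<^sup>2) + norm (G s))"
      using gauss_int[OF c(1)] intG by (intro Bochner_Integration.integrable_add integrable_norm)
    show "AE s in lborel. (\<lambda>n. norm (g (Suc n) s - G s)) \<longlonglongrightarrow> 0"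
      using LIMSEQ_Suc[OF lim] by (auto intro!: tendsto_norm_zero simp: LIM_zero_iff)
    show "AE s in lborel. norm (norm (g (Suc n) s - G s)) \<le> exp (- c * s\<^sup>2) + norm (G s)" for n
      using dom[of "Suc n"] by (auto intro!: order_trans[OF norm_triangle_ineq4] add_mono)
  qed auto
  then have "(\<lambda>n. \<integral>s. norm (g n s - G s) \<partial>lborel) \<longlonglongrightarrow> 0"
    by - (rule LIMSEQ_imp_Suc, simp)
  from order_tendstoD(2)[OF this, of "2 * pi * \<epsilon>"] obtain n0 where
    n0: "\<And>n. n \<ge> n0 \<Longrightarrow> (\<integral>s. norm (g n s - G s) \<partial>lborel) < 2 * pi * \<epsilon>"
    using \<open>\<epsilon> > 0\<close> by (auto simp: eventually_sequentially)
  show "\<exists>n0. \<forall>n\<ge>n0. \<forall>k. \<bar>sqrt n * pmf (nstep p n) k - exp (- (of_int k)\<^sup>2 / (2 * s2 * n)) / ?a\<bar> \<le> \<epsilon>"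
  proof (intro exI allI impI)
    fix n k assume "n \<ge> max 1 n0"
    then have n: "n \<ge> 1" "n \<ge> n0" by auto
    let ?w = "\<lambda>s. iexp (- s * (of_int k / sqrt n))"
    have "2 * pi * pmf (nstep p n) k = (1 / sqrt n) *\<^sub>R (CLINT s|lborel. g n s * ?w s)"
    proof -
      have "2 * pi * pmf (nstep p n) k = (CLINT t|lborel. indicator {-pi..pi} t *\<^sub>R (cf p t ^ n * iexp (- t * of_int k)))"
        by (subst fourier_inversion) (simp add: cf_nstep)
      also have "\<dots> = \<bar>1 / sqrt n\<bar> *\<^sub>R (CLINT s|lborel. indicator {-pi..pi} (0 + 1 / sqrt n * s) *\<^sub>R (cf p (0 + 1 / sqrt n * s) ^ n * iexp (- (0 + 1 / sqrt n * s) * of_int k)))"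
        by (rule lborel_integral_real_affine) (use n in auto)
      also have "(\<lambda>s. indicator {-pi..pi} (0 + 1 / sqrt n * s) *\<^sub>R (cf p (0 + 1 / sqrt n * s) ^ n * iexp (- (0 + 1 / sqrt n * s) * of_int k))) = (\<lambda>s. g n s * ?w s)"
      proof (rule ext)
        fix s
        have 1: "(indicator {-pi..pi} (s / sqrt n) :: real) = indicator {- pi * sqrt n..pi * sqrt n} s"
          using n by (auto simp: indicator_def field_simps)
        have 2: "0 + 1 / sqrt n * s = s / sqrt n" by simp
        have 3: "- (s / sqrt n) * of_int k = - s * (of_int k / sqrt n)" by simp
        show "indicator {-pi..pi} (0 + 1 / sqrt n * s) *\<^sub>R (cf p (0 + 1 / sqrt n * s) ^ n * iexp (- (0 + 1 / sqrt n * s) * of_int k)) = g n s * ?w s"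
          unfolding 2 1 3 g_def by simp
      qed
      finally show ?thesis using n by simp
    qed
    then have A: "(CLINT s|lborel. g n s * ?w s) = 2 * pi * (sqrt n * pmf (nstep p n) k)"
      using n by (simp add: scaleR_conv_of_real field_simps)
    have B: "(CLINT s|lborel. G s * ?w s) = 2 * pi * (exp (- (of_int k)\<^sup>2 / (2 * s2 * n)) / ?a)"
    proof -
      let ?t = "- of_int k / sqrt n / sqrt s2"
      have "exp (- (?t\<^sup>2) / 2) = char std_normal_distribution ?t"
        by (simp add: char_std_normal_distribution)
      also have "\<dots> = (CLINT x|lborel. std_normal_density x *\<^sub>R iexp (?t * x))"
        unfolding char_def by (subst integral_density) auto
      also have "\<dots> = \<bar>sqrt s2\<bar> *\<^sub>R (CLINT s|lborel. std_normal_density (0 + sqrt s2 * s) *\<^sub>R iexp (?t * (0 + sqrt s2 * s)))"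
        by (rule lborel_integral_real_affine) (use s2_pos in auto)
      also have "(\<lambda>s. std_normal_density (0 + sqrt s2 * s) *\<^sub>R iexp (?t * (0 + sqrt s2 * s))) = (\<lambda>s. (1 / sqrt (2 * pi)) *\<^sub>R (G s * ?w s))"
      proof (rule ext)
        fix s
        have 1: "?t * (0 + sqrt s2 * s) = - s * (of_int k / sqrt n)"
          using s2_pos by simp
        have 2: "std_normal_density (0 + sqrt s2 * s) = 1 / sqrt (2 * pi) * exp (- (s2 * s\<^sup>2) / 2)"
          using s2_pos by (simp add: std_normal_density_def power_mult_distrib)
        show "std_normal_density (0 + sqrt s2 * s) *\<^sub>R iexp (?t * (0 + sqrt s2 * s)) = (1 / sqrt (2 * pi)) *\<^sub>R (G s * ?w s)"
          unfolding 1 2 G_def by (simp only: scaleR_conv_of_real of_real_mult mult.assoc)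
      qed
      finally have "exp (- (?t\<^sup>2) / 2) = sqrt s2 / sqrt (2 * pi) * (CLINT s|lborel. G s * ?w s)"
        using s2_pos by (simp add: scaleR_conv_of_real)
      moreover have "?t\<^sup>2 / 2 = (of_int k)\<^sup>2 / (2 * s2 * n)"
        using s2_pos n by (simp add: power_divide field_simps)
      ultimately have "(CLINT s|lborel. G s * ?w s) = of_real (exp (- (of_int k)\<^sup>2 / (2 * s2 * n)) * sqrt (2 * pi) / sqrt s2)"
        using s2_pos by (simp add: field_simps)
      also have "exp (- (of_int k)\<^sup>2 / (2 * s2 * n)) * sqrt (2 * pi) / sqrt s2 = 2 * pi * (exp (- (of_int k)\<^sup>2 / (2 * s2 * n)) / ?a)"
      proof -
        have "e * a / b = a * a * (e / (a * b))" if "a > 0" "b > 0" for e a b :: real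
          using that by simp
        note this[of "sqrt (2 * pi)" "sqrt s2"]
        moreover have "sqrt (2 * pi) * sqrt (2 * pi) = 2 * pi"
          using real_sqrt_mult_self[of "2 * pi"] pi_gt_zero by linarith
        moreover have "?a = sqrt (2 * pi) * sqrt s2" by (rule real_sqrt_mult)
        ultimately show ?thesis using s2_pos by (simp only: real_sqrt_gt_0_iff mult_pos_pos pi_gt_zero zero_less_numeral)
      qed
      finally show ?thesis by simp
    qed
    have nw: "norm (?w s) = 1" for s by simp
    have i1: "integrable lborel (\<lambda>s. g n s * ?w s)"
      by (rule Bochner_Integration.integrable_bound[OF intg[OF n(1)]]) (auto simp: norm_mult)
    have i2: "integrable lborel (\<lambda>s. G s * ?w s)"
      by (rule Bochner_Integration.integrable_bound[OF intG]) (auto simp: norm_mult)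
    have "2 * pi * \<bar>sqrt n * pmf (nstep p n) k - exp (- (of_int k)\<^sup>2 / (2 * s2 * n)) / ?a\<bar>
      = norm ((CLINT s|lborel. g n s * ?w s) - (CLINT s|lborel. G s * ?w s))"
    proof -
      have "norm (complex_of_real (2 * pi * x) - complex_of_real (2 * pi * y)) = 2 * pi * \<bar>x - y\<bar>" for x y
        by (simp flip: of_real_diff right_diff_distrib add: norm_mult abs_mult del: of_real_mult)
      then show ?thesis unfolding A B by (simp only:)
    qed
    also have "\<dots> = norm (CLINT s|lborel. g n s * ?w s - G s * ?w s)"
      by (subst Bochner_Integration.integral_diff[OF i1 i2]) simp
    also have "\<dots> \<le> (\<integral>s. norm (g n s * ?w s - G s * ?w s) \<partial>lborel)" by (rule integral_norm_bound)
    also have "\<dots> = (\<integral>s. norm (g n s - G s) \<partial>lborel)"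
      by (simp add: left_diff_distrib[symmetric] norm_mult del: mult_minus_left)
    also have "\<dots> \<le> 2 * pi * \<epsilon>" using n0[OF n(2)] by simp
    finally show "\<bar>sqrt n * pmf (nstep p n) k - exp (- (of_int k)\<^sup>2 / (2 * s2 * n)) / ?a\<bar> \<le> \<epsilon>"
      by simp
  qed
qed

lemma local_lower:
  obtains c n0 where "c > 0" "n0 \<ge> 1" "\<And>n k. n \<ge> n0 \<Longrightarrow> \<bar>of_int k\<bar> \<le> sqrt n \<Longrightarrow> pmf (nstep p n) k \<ge> c / sqrt n"
proof -
  obtain a where a: "a > 0" "\<And>\<epsilon>. \<epsilon> > 0 \<Longrightarrow> \<exists>n0. \<forall>n\<ge>n0. \<forall>k. \<bar>sqrt n * pmf (nstep p n) k - exp (- (of_int k)\<^sup>2 / (2 * s2 * n)) / a\<bar> \<le> \<epsilon>"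
    using local_limit by blast
  \<comment> \<open>Half of the limiting density at distance \<open>sqrt n\<close>; the other half
    is left to the error.\<close>
  define c where "c = exp (- 1 / (2 * s2)) / a / 2"
  have c: "c > 0" using a by (simp add: c_def)
  obtain n0 where n0: "\<And>n k. n \<ge> n0 \<Longrightarrow> \<bar>sqrt n * pmf (nstep p n) k - exp (- (of_int k)\<^sup>2 / (2 * s2 * n)) / a\<bar> \<le> c"
    using a(2)[OF c] by blast
  show ?thesis
  proof (rule that[OF c, of "max 1 n0"])
    fix n k assume n: "n \<ge> max 1 n0" and k: "\<bar>of_int k\<bar> \<le> sqrt (real n)"
    have "(of_int k :: real)\<^sup>2 \<le> n" using power_mono[OF k, of 2] by simp
    then have "(of_int k)\<^sup>2 / (2 * s2 * n) \<le> 1 / (2 * s2)"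
      using n s2_pos by (simp add: field_simps)
    then have "2 * c \<le> exp (- (of_int k)\<^sup>2 / (2 * s2 * n)) / a"
      using a by (simp add: c_def divide_right_mono)
    then have "c \<le> sqrt n * pmf (nstep p n) k" using n0[of n k] n by (simp add: abs_le_iff)
    then show "pmf (nstep p n) k \<ge> c / sqrt n" using n by (simp add: field_simps)
  qed simp
qed

lemma local_upper:
  obtains C where "C > 0" "\<And>n k. n \<ge> 1 \<Longrightarrow> pmf (nstep p n) k \<le> C / sqrt n"
proof -
  obtain a where a: "a > 0" "\<And>\<epsilon>. \<epsilon> > 0 \<Longrightarrow> \<exists>n0. \<forall>n\<ge>n0. \<forall>k. \<bar>sqrt n * pmf (nstep p n) k - exp (- (of_int k)\<^sup>2 / (2 * s2 * n)) / a\<bar> \<le> \<epsilon>"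
    using local_limit by blast
  obtain n0 where n0: "\<And>n k. n \<ge> n0 \<Longrightarrow> \<bar>sqrt n * pmf (nstep p n) k - exp (- (of_int k)\<^sup>2 / (2 * s2 * n)) / a\<bar> \<le> 1"
    using a(2)[of 1] by auto
  \<comment> \<open>From \<open>n0\<close> on, the peak \<open>1 / a\<close> plus the error 1 bounds
    \<open>sqrt n * pmf\<close>; before \<open>n0\<close> the trivial bound by
    \<open>sqrt n0\<close> does.\<close>
  define C where "C = 1 + 1 / a + sqrt n0"
  show ?thesis
  proof (rule that[of C])
    show "C > 0" using a by (simp add: C_def add_pos_nonneg)
    fix n k assume n: "n \<ge> (1::nat)"
    have "sqrt n * pmf (nstep p n) k \<le> C"
    proof (cases "n \<ge> n0")
      case True
      have "exp (- (of_int k)\<^sup>2 / (2 * s2 * n)) / a \<le> 1 / a"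
        using a s2_pos by (intro divide_right_mono) auto
      then show ?thesis using n0[OF True, of k] by (simp add: C_def abs_le_iff add_increasing2)
    next
      case False
      then have "sqrt n * pmf (nstep p n) k \<le> sqrt n0 * 1"
        by (intro mult_mono) (auto simp: pmf_le_1)
      also have "\<dots> \<le> C" using a by (simp add: C_def)
      finally show ?thesis .
    qed
    then show "pmf (nstep p n) k \<le> C / sqrt n" using n by (simp add: field_simps)
  qed
qed

end

section \<open>Exit from an interval\<close>

text \<open>Since \<open>p\<close> has only two moments, this is a natural class of test functions:
  they are integrable against every shift of \<open>p\<close>, and the class is mapped into itself
  by the transition operator \<open>P\<close> below.\<close>

definition quad_bounded :: "(int \<Rightarrow> real) \<Rightarrow> bool" where
  "quad_bounded f \<longleftrightarrow> (\<exists>C. \<forall>x. \<bar>f x\<bar> \<le> C * (1 + (of_int x)\<^sup>2))"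

lemma qbI: "(\<And>x. \<bar>f x\<bar> \<le> C * (1 + (of_int x)\<^sup>2)) \<Longrightarrow> quad_bounded f"
  by (auto simp: quad_bounded_def)

lemma qbE:
  assumes "quad_bounded f"
  obtains C where "C \<ge> 0" "\<And>x. \<bar>f x\<bar> \<le> C * (1 + (of_int x)\<^sup>2)"
proof -
  obtain C where C: "\<And>x. \<bar>f x\<bar> \<le> C * (1 + (of_int x)\<^sup>2)" using assms by (auto simp: quad_bounded_def)
  from C[of 0] have "C \<ge> 0" by simp
  with C that show ?thesis by blast
qed

lemma qb_bounded: "(\<And>x. \<bar>f x\<bar> \<le> C) \<Longrightarrow> quad_bounded f"
proof (rule qbI)
  fix x assume *: "\<And>x. \<bar>f x\<bar> \<le> C"
  have "0 \<le> C" using *[of 0] by linarith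
  then have "C * 1 \<le> C * (1 + (of_int x)\<^sup>2)" by (intro mult_left_mono) auto
  then show "\<bar>f x\<bar> \<le> C * (1 + (of_int x)\<^sup>2)" using *[of x] by simp
qed

lemma qb_dom: "quad_bounded g \<Longrightarrow> (\<And>x. \<bar>f x\<bar> \<le> \<bar>g x\<bar>) \<Longrightarrow> quad_bounded f"
  unfolding quad_bounded_def by (meson order_trans)

lemma qb_sq: "quad_bounded (\<lambda>x. (of_int x)\<^sup>2)"
  by (rule qbI[where C=1]) simp

lemma qb_id: "quad_bounded of_int"
proof (rule qbI[where C=1])
  fix x :: int
  have "2 * \<bar>of_int x :: real\<bar> \<le> 1 + (of_int x)\<^sup>2"
    using sum_squares_bound[of 1 "\<bar>of_int x :: real\<bar>"] by simp
  then show "\<bar>of_int x :: real\<bar> \<le> 1 * (1 + (of_int x)\<^sup>2)" by simp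
qed

lemma qb_ind: "quad_bounded (indicator A)"
  by (rule qb_bounded[where C=1]) (auto simp: indicator_def)

lemma qb_add: "quad_bounded f \<Longrightarrow> quad_bounded g \<Longrightarrow> quad_bounded (\<lambda>x. f x + g x)"
proof -
  assume "quad_bounded f" "quad_bounded g"
  then obtain C C' where "\<And>x. \<bar>f x\<bar> \<le> C * (1 + (of_int x)\<^sup>2)" "\<And>x. \<bar>g x\<bar> \<le> C' * (1 + (of_int x)\<^sup>2)"
    by (auto simp: quad_bounded_def)
  then show ?thesis
    by (intro qbI[where C="C + C'"]) (auto simp: distrib_right intro!: order_trans[OF abs_triangle_ineq] add_mono)
qed

lemma qb_cmult: "quad_bounded f \<Longrightarrow> quad_bounded (\<lambda>x. c * f x)"
proof -
  assume "quad_bounded f"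
  then obtain C where "\<And>x. \<bar>f x\<bar> \<le> C * (1 + (of_int x)\<^sup>2)" by (auto simp: quad_bounded_def)
  then show ?thesis
    by (intro qbI[where C="\<bar>c\<bar> * C"]) (auto simp: abs_mult mult.assoc intro!: mult_left_mono)
qed

lemma qb_uminus: "quad_bounded f \<Longrightarrow> quad_bounded (\<lambda>x. - f x)"
  using qb_cmult[of f "-1"] by simp

lemma qb_diff: "quad_bounded f \<Longrightarrow> quad_bounded g \<Longrightarrow> quad_bounded (\<lambda>x. f x - g x)"
  using qb_add[OF _ qb_uminus, of f g] by simp

context walk
begin

definition P :: "(int \<Rightarrow> real) \<Rightarrow> int \<Rightarrow> real" where
  "P f x = E (\<lambda>\<xi>. f (x + \<xi>))"

lemma qb_int_aux:
  fixes C :: real assumes "C \<ge> 0"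
  shows "C * (1 + (of_int (x + \<xi>))\<^sup>2) \<le> C * (1 + 2 * (of_int x)\<^sup>2 + 2 * (of_int \<xi>)\<^sup>2)"
proof -
  have "(a + b)\<^sup>2 \<le> 2 * a\<^sup>2 + 2 * b\<^sup>2" for a b :: real
    using sum_squares_bound[of a b] by (simp add: power2_sum)
  from this[of "of_int x" "of_int \<xi>"] show ?thesis using assms by (intro mult_left_mono) auto
qed

lemma qb_int: "quad_bounded f \<Longrightarrow> integrable (measure_pmf p) (\<lambda>\<xi>. f (x + \<xi>))"
proof -
  assume "quad_bounded f"
  then obtain C where C: "C \<ge> 0" "\<And>x. \<bar>f x\<bar> \<le> C * (1 + (of_int x)\<^sup>2)" by (meson qbE)
  have "integrable (measure_pmf p) (\<lambda>\<xi>. C * (1 + 2 * (of_int x)\<^sup>2 + 2 * (of_int \<xi>)\<^sup>2))"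
    using int_sq by auto
  then show ?thesis
    by (rule Bochner_Integration.integrable_bound)
       (auto intro!: order_trans[OF C(2)] order_trans[OF qb_int_aux[OF C(1)]])
qed

lemma P_mono: "quad_bounded f \<Longrightarrow> quad_bounded g \<Longrightarrow> (\<And>y. f y \<le> g y) \<Longrightarrow> P f x \<le> P g x"
  unfolding P_def by (intro integral_mono qb_int) auto

lemma P_add: "quad_bounded f \<Longrightarrow> quad_bounded g \<Longrightarrow> P (\<lambda>x. f x + g x) x = P f x + P g x"
  unfolding P_def by (intro Bochner_Integration.integral_add qb_int)

lemma P_diff: "quad_bounded f \<Longrightarrow> quad_bounded g \<Longrightarrow> P (\<lambda>x. f x - g x) x = P f x - P g x"
  unfolding P_def by (intro Bochner_Integration.integral_diff qb_int)

lemma P_cmult: "P (\<lambda>x. c * f x) x = c * P f x"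
  unfolding P_def by simp

lemma P_uminus: "P (\<lambda>x. - f x) x = - P f x"
  unfolding P_def by simp

lemma P_const: "P (\<lambda>x. c) x = c"
  unfolding P_def by simp

lemma P_sq: "P (\<lambda>x. (of_int x)\<^sup>2) x = (of_int x)\<^sup>2 + s2"
proof -
  have "P (\<lambda>x. (of_int x)\<^sup>2) x = E (\<lambda>\<xi>. (of_int x)\<^sup>2 + (2 * of_int x * of_int \<xi> + (of_int \<xi>)\<^sup>2))"
    unfolding P_def by (intro Bochner_Integration.integral_cong) (auto simp: power2_sum algebra_simps)
  also have "\<dots> = (of_int x)\<^sup>2 + s2"
    using int_id int_sq mean_zero by (simp add: s2_def)
  finally show ?thesis .
qed

lemma P_id: "P of_int x = of_int x"
  unfolding P_def using int_id mean_zero by simp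

lemma qb_P: "quad_bounded f \<Longrightarrow> quad_bounded (P f)"
proof -
  assume f: "quad_bounded f"
  then obtain C where C: "C \<ge> 0" "\<And>x. \<bar>f x\<bar> \<le> C * (1 + (of_int x)\<^sup>2)" by (meson qbE)
  have q: "quad_bounded (\<lambda>x. C * (1 + (of_int x)\<^sup>2))" by (intro qb_cmult qb_add qb_sq qb_bounded[where C=1]) auto
  have e: "P (\<lambda>x. C * (1 + (of_int x)\<^sup>2)) x = C * (1 + s2 + (of_int x)\<^sup>2)" for x
    by (subst P_cmult, subst P_add) (auto simp: P_const P_sq qb_sq intro!: qb_bounded[where C=1])
  have 1: "P f x \<le> C * (1 + s2 + (of_int x)\<^sup>2)" for x
    unfolding e[symmetric] by (rule P_mono[OF f q]) (use C(2) in \<open>simp add: abs_le_iff\<close>)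
  have 2: "- P f x \<le> C * (1 + s2 + (of_int x)\<^sup>2)" for x
    unfolding e[symmetric] P_uminus[symmetric]
    by (rule P_mono[OF qb_uminus[OF f] q]) (use C(2) in \<open>simp add: abs_le_iff\<close>)
  show ?thesis
  proof (rule qbI)
    fix x
    have "\<bar>P f x\<bar> \<le> C * (1 + s2 + (of_int x)\<^sup>2)" using 1 2 by (simp add: abs_le_iff)
    also have "\<dots> \<le> C * ((1 + s2) * (1 + (of_int x)\<^sup>2))"
      using C(1) s2_pos by (intro mult_left_mono) (auto simp: algebra_simps)
    finally show "\<bar>P f x\<bar> \<le> C * (1 + s2) * (1 + (of_int x)\<^sup>2)" by (simp add: mult.assoc)
  qed
qed

text \<open>With \<tau> the first time outside \<open>D\<close>, \<open>stop D g n x\<close> is the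
  expectation of \<open>g\<close> at time min(\<tau>, n) for the walk from \<open>x\<close>, and
  \<open>exit_time D n x\<close> is the expectation of min(\<tau>, n). The recursion on the first
  step avoids a path space.\<close>

primrec stop :: "int set \<Rightarrow> (int \<Rightarrow> real) \<Rightarrow> nat \<Rightarrow> int \<Rightarrow> real" where
  "stop D g 0 = g"
| "stop D g (Suc n) = (\<lambda>x. if x \<in> D then P (stop D g n) x else g x)"

primrec exit_time :: "int set \<Rightarrow> nat \<Rightarrow> int \<Rightarrow> real" where
  "exit_time D 0 = (\<lambda>_. 0)"
| "exit_time D (Suc n) = (\<lambda>x. if x \<in> D then 1 + P (exit_time D n) x else 0)"

lemma qb_if: "quad_bounded f \<Longrightarrow> quad_bounded g \<Longrightarrow> quad_bounded (\<lambda>x. if x \<in> A then f x else g x)"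
proof -
  assume "quad_bounded f" "quad_bounded g"
  then obtain C C' where C: "C \<ge> 0" "\<And>x. \<bar>f x\<bar> \<le> C * (1 + (of_int x)\<^sup>2)" "C' \<ge> 0" "\<And>x. \<bar>g x\<bar> \<le> C' * (1 + (of_int x)\<^sup>2)"
    by (metis qbE)
  show ?thesis
  proof (rule qbI)
    fix x
    have "0 \<le> C * (1 + (of_int x)\<^sup>2)" "0 \<le> C' * (1 + (of_int x)\<^sup>2)" using C by auto
    then show "\<bar>if x \<in> A then f x else g x\<bar> \<le> (C + C') * (1 + (of_int x)\<^sup>2)"
      using C(2,4)[of x] by (auto simp: distrib_right)
  qed
qed

lemma qb_stop: "quad_bounded g \<Longrightarrow> quad_bounded (stop D g n)"
  by (induction n) (auto intro: qb_if qb_P)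

lemma exit_time_bounds: "0 \<le> exit_time D n x \<and> exit_time D n x \<le> n" and qb_et: "quad_bounded (exit_time D n)"
proof (induction n arbitrary: x)
  case 0
  { case 1 then show ?case by simp }
  { case 2 then show ?case by (auto intro: qb_bounded[where C=0]) }
next
  case (Suc n)
  have "P (\<lambda>x. 0) x \<le> P (exit_time D n) x" "P (exit_time D n) x \<le> P (\<lambda>x. n) x" for x
    using Suc by (auto intro!: P_mono qb_bounded[where C="real n"])
  then have *: "0 \<le> P (exit_time D n) x" "P (exit_time D n) x \<le> n" for x by (auto simp: P_const)
  { case 1 then show ?case using * by auto }
  { case 2 then show ?case using * by (intro qb_bounded[where C="Suc n"]) auto }
qed

lemma stop_out: "x \<notin> D \<Longrightarrow> stop D g n x = g x"
  by (cases n) auto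

lemma stop_mono:
  assumes "quad_bounded f" "quad_bounded g" "\<And>x. f x \<le> g x"
  shows "stop D f n x \<le> stop D g n x"
  using assms by (induction n arbitrary: x) (auto intro!: P_mono qb_stop)

lemma stop_const: "stop D (\<lambda>_. c) n x = c"
proof (induction n arbitrary: x)
  case (Suc n)
  then have "stop D (\<lambda>_. c) n = (\<lambda>_. c)" by auto
  then show ?case by (simp add: P_const)
qed simp

lemma stop_add:
  assumes "quad_bounded f" "quad_bounded g"
  shows "stop D (\<lambda>x. f x + g x) n x = stop D f n x + stop D g n x"
proof (induction n arbitrary: x)
  case (Suc n)
  then have "stop D (\<lambda>x. f x + g x) n = (\<lambda>x. stop D f n x + stop D g n x)" by auto
  then show ?case using assms by (simp add: P_add qb_stop)
qed simp

lemma stop_cmult: "stop D (\<lambda>x. c * f x) n x = c * stop D f n x"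
proof (induction n arbitrary: x)
  case (Suc n)
  then have "stop D (\<lambda>x. c * f x) n = (\<lambda>x. c * stop D f n x)" by auto
  then show ?case by (simp add: P_cmult)
qed simp

lemma stop_uminus: "stop D (\<lambda>x. - f x) n x = - stop D f n x"
  using stop_cmult[of D "-1" f n x] by simp

lemma stop_diff:
  assumes "quad_bounded f" "quad_bounded g"
  shows "stop D (\<lambda>x. f x - g x) n x = stop D f n x - stop D g n x"
  using stop_add[OF assms(1) qb_uminus[OF assms(2)]] by (simp add: stop_uminus)

text \<open>Dynkin's formula as an inequality: the drift in \<open>D\<close> accumulates at most
  \<kappa> per step spent there.\<close>

lemma dynkin_le:
  assumes "quad_bounded g" "\<And>x. x \<in> D \<Longrightarrow> P g x \<le> g x + \<kappa>"
  shows "stop D g n x \<le> g x + \<kappa> * exit_time D n x"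
proof (induction n arbitrary: x)
  case (Suc n)
  show ?case
  proof (cases "x \<in> D")
    case True
    have "P (stop D g n) x \<le> P (\<lambda>x. g x + \<kappa> * exit_time D n x) x"
      by (intro P_mono qb_stop qb_add qb_cmult qb_et assms Suc)
    also have "\<dots> = P g x + \<kappa> * P (exit_time D n) x"
      by (subst P_add) (auto simp: P_cmult intro!: assms qb_cmult qb_et)
    also have "\<dots> \<le> g x + \<kappa> * (1 + P (exit_time D n) x)"
      using assms(2)[OF True] by (simp add: algebra_simps)
    finally show ?thesis using True by simp
  qed auto
qed simp

lemma dynkin_ge:
  assumes "quad_bounded g" "\<And>x. x \<in> D \<Longrightarrow> P g x \<ge> g x + \<kappa>"
  shows "stop D g n x \<ge> g x + \<kappa> * exit_time D n x"
proof -
  have "stop D (\<lambda>x. - g x) n x \<le> - g x + (- \<kappa>) * exit_time D n x"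
  proof (rule dynkin_le[OF qb_uminus[OF assms(1)]])
    fix x assume "x \<in> D"
    from assms(2)[OF this] show "P (\<lambda>x. - g x) x \<le> - g x + (- \<kappa>)" by (simp add: P_uminus)
  qed
  then show ?thesis by (simp add: stop_uminus)
qed

lemma sq_tail:
  assumes "\<delta> > 0"
  obtains R :: nat where "\<And>r. r \<ge> R \<Longrightarrow> E (\<lambda>\<xi>. (of_int \<xi>)\<^sup>2 * indicator {\<xi>. \<bar>\<xi>\<bar> \<ge> int r} \<xi>) \<le> \<delta>"
proof -
  have "(\<lambda>r. E (\<lambda>\<xi>. (of_int \<xi>)\<^sup>2 * indicator {\<xi>. \<bar>\<xi>\<bar> \<ge> int r} \<xi>)) \<longlonglongrightarrow> E (\<lambda>\<xi>. 0)"
  proof (rule integral_dominated_convergence[OF _ _ int_sq])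
    show "AE \<xi> in measure_pmf p. (\<lambda>r. (of_int \<xi>)\<^sup>2 * indicator {\<xi>. \<bar>\<xi>\<bar> \<ge> int r} \<xi> :: real) \<longlonglongrightarrow> 0"
    proof (rule AE_I2)
      fix \<xi>
      have "\<forall>\<^sub>F r in sequentially. 0 = ((of_int \<xi>)\<^sup>2 * indicator {\<xi>. \<bar>\<xi>\<bar> \<ge> int r} \<xi> :: real)"
        by (rule eventually_sequentiallyI[of "Suc (nat \<bar>\<xi>\<bar>)"]) (auto simp: indicator_def)
      then show "(\<lambda>r. (of_int \<xi>)\<^sup>2 * indicator {\<xi>. \<bar>\<xi>\<bar> \<ge> int r} \<xi> :: real) \<longlonglongrightarrow> 0"
        by (rule Lim_transform_eventually[OF tendsto_const])
    qed
  qed (auto simp: indicator_def)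
  then have "(\<lambda>r. E (\<lambda>\<xi>. (of_int \<xi>)\<^sup>2 * indicator {\<xi>. \<bar>\<xi>\<bar> \<ge> int r} \<xi>)) \<longlonglongrightarrow> 0" by simp
  from order_tendstoD(2)[OF this assms] obtain N where
    "\<And>r. r \<ge> N \<Longrightarrow> E (\<lambda>\<xi>. (of_int \<xi>)\<^sup>2 * indicator {\<xi>. \<bar>\<xi>\<bar> \<ge> int r} \<xi>) < \<delta>"
    by (auto simp: eventually_sequentially)
  then show ?thesis by (intro that[of N] less_imp_le)
qed

text \<open>A walk of mean zero that never steps down does not move at all, which positive variance
  excludes.\<close>

lemma neg_step: obtains d :: nat where "d \<ge> 1" "pmf p (- int d) > 0"
proof (rule ccontr)
  assume "\<not> thesis"
  with that have *: "\<And>d::nat. d \<ge> 1 \<Longrightarrow> \<not> pmf p (- int d) > 0" by blast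
  have nn: "x \<ge> 0" if "x \<in> set_pmf p" for x
  proof (rule ccontr)
    assume "\<not> x \<ge> 0"
    then have "nat (- x) \<ge> 1" "- int (nat (- x)) = x" by auto
    with *[of "nat (- x)"] that show False by (auto simp: set_pmf_iff pmf_nonneg less_le)
  qed
  then have "AE x in measure_pmf p. (of_int x :: real) = 0"
    using integral_nonneg_eq_0_iff_AE[OF int_id] mean_zero by (auto simp: AE_measure_pmf_iff)
  then have "AE x in measure_pmf p. (of_int x :: real)\<^sup>2 = 0" by auto
  then have "s2 = 0"
    unfolding s2_def using integral_nonneg_eq_0_iff_AE[OF int_sq] by simp
  then show False using s2_pos by simp
qed

text \<open>The bounded function \<open>\<beta>\<close> pays one unit for each visit to \<open>[0, R)\<close> before the walk turns negative.\<close>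

lemma visit_potential:
  obtains \<beta> :: "int \<Rightarrow> real" and B where "B \<ge> 0" "\<And>x. 0 \<le> \<beta> x \<and> \<beta> x \<le> B"
    "\<And>x. x \<ge> 0 \<Longrightarrow> P \<beta> x \<le> \<beta> x - (if x < int R then 1 else 0)"
proof -
  obtain d where d: "d \<ge> 1" "pmf p (- int d) > 0" by (rule neg_step)
  define q where "q = pmf p (- int d)"
  have q: "0 < q" "q \<le> 1" using d by (auto simp: q_def pmf_le_1)
  \<comment> \<open>The levels are spaced so that one jump by \<open>- d\<close>, of probability
    \<open>q\<close>, raises the mean by a full unit:
    \<open>q * a (Suc i) = a i + 1\<close>.\<close>
  define a :: "nat \<Rightarrow> real" where "a = rec_nat 0 (\<lambda>_ y. (y + 1) / q)"
  have a0: "a 0 = 0" and aS: "\<And>i. q * a (Suc i) = a i + 1" using q by (auto simp: a_def)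
  have ann: "0 \<le> a i" for i
  proof (induction i)
    case (Suc i)
    then have "0 \<le> q * a (Suc i)" by (simp add: aS)
    then show ?case using q by (simp add: zero_le_mult_iff)
  qed (simp add: a0)
  have amono: "a i \<le> a (Suc i)" for i
  proof -
    have "q * a (Suc i) \<le> 1 * a (Suc i)" using q ann by (intro mult_right_mono) auto
    then show ?thesis by (simp add: aS)
  qed
  then have amono: "i \<le> j \<Longrightarrow> a i \<le> a j" for i j by (rule lift_Suc_mono_le)
  define J where "J = R"
  \<comment> \<open>Each jump by \<open>- d\<close> lowers \<open>x div d\<close> by one and so
    climbs one level of \<open>a\<close>; the top level \<open>Suc J\<close> is reserved for
    negative heights.\<close>
  define c where "c x = (if x < 0 then a (Suc J) else a (J - nat (x div int d)))" for x :: int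
  have c: "0 \<le> c x" "c x \<le> a (Suc J)" for x
    unfolding c_def using ann amono by auto
  have key: "c x + (if x < int R then 1 else 0) \<le> q * c (x - int d)" if x: "x \<ge> 0" for x
  proof (cases "x < int d")
    case True
    then have "x div int d = 0" using x by simp
    then show ?thesis using True x by (auto simp: c_def aS)
  next
    case False
    define l where "l = nat (x div int d)"
    have xd: "x div int d \<ge> 1" using False d zdiv_mono1[of "int d" x "int d"] by simp
    have "(x - int d) div int d = x div int d - 1"
      using d div_add_self2[of "int d" "x - int d"] by simp
    then have c1: "c (x - int d) = a (J - (l - 1))" using False xd by (simp add: c_def l_def nat_diff_distrib)
    have c2: "c x = a (J - l)" using x by (simp add: c_def l_def)
    show ?thesis
    proof (cases "l \<le> J")
      case True
      then have "J - (l - 1) = Suc (J - l)" using xd by (auto simp: l_def)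
      then show ?thesis by (simp add: c1 c2 aS)
    next
      case l: False
      have "int J < int l" using l by simp
      also have "int l = x div int d" using xd by (simp add: l_def)
      also have "\<dots> \<le> x" using zdiv_mono2[of x 1 "int d"] x d by simp
      finally have "\<not> x < int R" by (simp add: J_def)
      then show ?thesis using l ann q by (simp add: c1 c2 a0)
    qed
  qed
  define \<beta> where "\<beta> x = a (Suc J) - c x" for x
  show ?thesis
  proof (rule that[of "a (Suc J)" \<beta>])
    fix x :: int assume x: "x \<ge> 0"
    have qbc: "quad_bounded c" using c by (intro qb_bounded[where C="a (Suc J)"]) auto
    have "q * c (x - int d) = E (\<lambda>\<xi>. c (x - int d) * indicator {- int d} \<xi>)"
      by (subst integral_mult_right_zero) (simp add: measure_pmf_single q_def)
    also have "\<dots> \<le> P c x"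
      unfolding P_def
    proof (rule integral_mono)
      show "integrable (measure_pmf p) (\<lambda>\<xi>. c (x - int d) * indicator {- int d} \<xi>)"
        using c ann by (intro measure_pmf.integrable_const_bound[where B="a (Suc J)"]) (auto simp: indicator_def)
    qed (use c qb_int[OF qbc] in \<open>auto simp: indicator_def\<close>)
    finally have "q * c (x - int d) \<le> P c x" .
    moreover have "P \<beta> x = a (Suc J) - P c x"
      unfolding \<beta>_def by (subst P_diff) (auto simp: P_const qbc intro!: qb_bounded[where C="a (Suc J)"] ann)
    ultimately show "P \<beta> x \<le> \<beta> x - (if x < int R then 1 else 0)"
      using key[OF x] by (simp add: \<beta>_def)
  qed (use c ann in \<open>auto simp: \<beta>_def\<close>)
qed

text \<open>From below \<open>r\<close> the height \<open>2 * r\<close> is reached only by a step of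
  size at least \<open>r\<close>, and the landing height is at most twice the step. The truncated
  second moment of the step controls both quantities.\<close>

lemma P_upper_tail:
  assumes x: "x < int r" and r: "r \<ge> 1" and tail: "E (\<lambda>\<xi>. (of_int \<xi>)\<^sup>2 * indicator {\<xi>. \<bar>\<xi>\<bar> \<ge> int r} \<xi>) \<le> \<delta>"
  shows "P (\<lambda>y. (of_int y)\<^sup>2 * indicator {2 * int r..} y) x \<le> 4 * \<delta>"
    "P (\<lambda>y. of_int y * indicator {2 * int r..} y) x \<le> 2 * \<delta> / r"
proof -
  let ?t = "\<lambda>\<xi>. (of_int \<xi>)\<^sup>2 * indicator {\<xi>. \<bar>\<xi>\<bar> \<ge> int r} \<xi> :: real"
  have intt: "integrable (measure_pmf p) ?t"
    by (rule Bochner_Integration.integrable_bound[OF int_sq]) (auto simp: indicator_def)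
  have q1: "quad_bounded (\<lambda>y. (of_int y)\<^sup>2 * indicator {2 * int r..} y)"
    by (rule qb_dom[OF qb_sq]) (auto simp: indicator_def)
  have q2: "quad_bounded (\<lambda>y. of_int y * indicator {2 * int r..} y)"
    by (rule qb_dom[OF qb_id]) (auto simp: indicator_def)
  have "P (\<lambda>y. (of_int y)\<^sup>2 * indicator {2 * int r..} y) x \<le> E (\<lambda>\<xi>. 4 * ?t \<xi>)"
    unfolding P_def
  proof (rule integral_mono[OF qb_int[OF q1]])
    fix \<xi>
    show "(of_int (x + \<xi>))\<^sup>2 * indicator {2 * int r..} (x + \<xi>) \<le> 4 * ?t \<xi>"
    proof (cases "x + \<xi> \<ge> 2 * int r")
      case True
      then have "0 \<le> x + \<xi>" "x + \<xi> \<le> 2 * \<xi>" and a: "\<bar>\<xi>\<bar> \<ge> int r" using x by auto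
      then have "(real_of_int (x + \<xi>))\<^sup>2 \<le> (real_of_int (2 * \<xi>))\<^sup>2" by (intro power_mono) linarith+
      then show ?thesis using True a by (simp add: power_mult_distrib)
    qed (auto simp: indicator_def)
  qed (use intt in simp)
  also have "\<dots> \<le> 4 * \<delta>" using tail by simp
  finally show "P (\<lambda>y. (of_int y)\<^sup>2 * indicator {2 * int r..} y) x \<le> 4 * \<delta>" .
  have "P (\<lambda>y. of_int y * indicator {2 * int r..} y) x \<le> E (\<lambda>\<xi>. 2 / r * ?t \<xi>)"
    unfolding P_def
  proof (rule integral_mono[OF qb_int[OF q2]])
    fix \<xi>
    show "of_int (x + \<xi>) * indicator {2 * int r..} (x + \<xi>) \<le> 2 / r * ?t \<xi>"
    proof (cases "x + \<xi> \<ge> 2 * int r")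
      case True
      then have "x + \<xi> \<le> 2 * \<xi>" and a: "\<bar>\<xi>\<bar> \<ge> int r" and b: "\<xi> \<ge> int r" using x by auto
      then have "of_int (x + \<xi>) \<le> 2 * real_of_int \<xi>" by linarith
      also have "\<dots> \<le> 2 / r * (of_int \<xi>)\<^sup>2"
      proof -
        have "real r * of_int \<xi> \<le> of_int \<xi> * of_int \<xi>"
          using b by (intro mult_right_mono) linarith+
        then show ?thesis using r by (simp add: field_simps power2_eq_square)
      qed
      finally show ?thesis using True a by simp
    qed (auto simp: indicator_def)
  qed (use intt in simp)
  also have "\<dots> = 2 / r * E ?t" by (subst integral_mult_right_zero) simp
  also have "\<dots> \<le> 2 / r * \<delta>" using tail by (intro mult_left_mono) auto
  finally show "P (\<lambda>y. of_int y * indicator {2 * int r..} y) x \<le> 2 * \<delta> / r" by simp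
qed

lemma P_lower_tail:
  assumes x: "x \<ge> 0"
  shows "P (\<lambda>y. (of_int y)\<^sup>2 * indicator {..<0} y) x \<le> E (\<lambda>\<xi>. (of_int \<xi>)\<^sup>2 * indicator {\<xi>. \<bar>\<xi>\<bar> \<ge> int (nat x)} \<xi>)"
  unfolding P_def
proof (rule integral_mono)
  show "integrable (measure_pmf p) (\<lambda>\<xi>. (of_int (x + \<xi>))\<^sup>2 * indicator {..<0} (x + \<xi>) :: real)"
    by (rule qb_int, rule qb_dom[OF qb_sq]) (auto simp: indicator_def)
  show "integrable (measure_pmf p) (\<lambda>\<xi>. (of_int \<xi>)\<^sup>2 * indicator {\<xi>. \<bar>\<xi>\<bar> \<ge> int (nat x)} \<xi> :: real)"
    by (rule Bochner_Integration.integrable_bound[OF int_sq]) (auto simp: indicator_def)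
  fix \<xi>
  show "(of_int (x + \<xi>))\<^sup>2 * indicator {..<0} (x + \<xi>) \<le> ((of_int \<xi>)\<^sup>2 * indicator {\<xi>. \<bar>\<xi>\<bar> \<ge> int (nat x)} \<xi> :: real)"
  proof (cases "x + \<xi> < 0")
    case True
    then have "\<bar>x + \<xi>\<bar> \<le> \<bar>\<xi>\<bar>" and a: "\<bar>\<xi>\<bar> \<ge> int (nat x)" using x by auto
    then have "\<bar>real_of_int (x + \<xi>)\<bar>\<^sup>2 \<le> \<bar>real_of_int \<xi>\<bar>\<^sup>2"
      by (intro power_mono) linarith+
    then have "(real_of_int (x + \<xi>))\<^sup>2 \<le> (real_of_int \<xi>)\<^sup>2" by (simp only: power2_abs)
    then show ?thesis using True a by simp
  qed (auto simp: indicator_def)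
qed

text \<open>The probability that the walk, stopped on leaving \<open>[0, r)\<close> or at time
  \<open>n\<close>, is not negative.\<close>

definition surv :: "nat \<Rightarrow> nat \<Rightarrow> int \<Rightarrow> real" where
  "surv r n x = stop {0..<int r} (indicator {0..}) n x"

text \<open>The bound \<open>C * r^2\<close> alone would be useless for a start at the wall; the
  factor \<open>surv\<close> says that the time is mostly spent on paths that survive. It comes from
  testing with the square, truncated outside \<open>[0, 2r)\<close>: only nonnegative exit positions
  then contribute, each at most \<open>4 * r^2\<close>.\<close>

lemma exit_time_bound:
  obtains C r0 where "C > 0" "r0 \<ge> 1"
    "\<And>r n x. r \<ge> r0 \<Longrightarrow> 0 \<le> x \<Longrightarrow> x < int r \<Longrightarrow> exit_time {0..<int r} n x \<le> C * (real r)\<^sup>2 * surv r n x"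
proof -
  obtain r1 where r1: "\<And>r. r \<ge> r1 \<Longrightarrow> E (\<lambda>\<xi>. (of_int \<xi>)\<^sup>2 * indicator {\<xi>. \<bar>\<xi>\<bar> \<ge> int r} \<xi>) \<le> s2 / 32"
    using sq_tail[of "s2 / 32"] s2_pos by auto
  obtain \<beta> B where \<beta>: "B \<ge> 0" "\<And>x. 0 \<le> \<beta> x \<and> \<beta> x \<le> B"
    "\<And>x. x \<ge> 0 \<Longrightarrow> P \<beta> x \<le> \<beta> x - (if x < int r1 then 1 else 0)"
    using visit_potential[of r1] by metis
  define C where "C = 2 / s2 * (4 + 8 * s2 * B)"
  define r0 where "r0 = max (max 1 r1) (nat \<lceil>s2 * B\<rceil>)"
  show ?thesis
  proof (rule that[of C r0])
    show "C > 0" unfolding C_def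
      using s2_pos \<beta>(1) by (intro mult_pos_pos divide_pos_pos add_pos_nonneg mult_nonneg_nonneg) auto
    show "r0 \<ge> 1" by (simp add: r0_def)
    fix r n :: nat and x :: int
    assume r: "r \<ge> r0" and x: "0 \<le> x" "x < int r"
    have r': "r \<ge> 1" "r \<ge> r1" "s2 * B \<le> r" using r by (auto simp: r0_def)
    let ?D = "{0..<int r}"
    let ?Q = "surv r n x" let ?e = "exit_time ?D n x"
    let ?g2 = "\<lambda>y. (of_int y)\<^sup>2 * indicator {2 * int r..} y :: real"
    let ?g3 = "\<lambda>y. (of_int y)\<^sup>2 * indicator {..<0} y :: real"
    let ?g4 = "\<lambda>y. of_int y * indicator {2 * int r..} y :: real"
    \<comment> \<open>The upper truncation costs a drift of at most \<open>s2 / 8\<close>. The lower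
      one costs at most \<open>s2 / 32\<close>, except at heights below \<open>r1\<close>, where it
      may consume all of \<open>s2\<close>; there the term with \<beta> pays. A drift of at least
      \<open>s2 / 2\<close> remains everywhere in \<open>[0, r)\<close>.\<close>
    let ?G = "\<lambda>y. (of_int y)\<^sup>2 - ?g2 y - ?g3 y - s2 * \<beta> y"
    have q2: "quad_bounded ?g2" and q3: "quad_bounded ?g3" and q4: "quad_bounded ?g4"
      by (rule qb_dom[OF qb_sq] qb_dom[OF qb_id]; auto simp: indicator_def)+
    have qbeta: "quad_bounded \<beta>" using \<beta> by (intro qb_bounded[where C=B]) auto
    have qG: "quad_bounded ?G" by (intro qb_diff qb_sq q2 q3 qb_cmult qbeta)
    have "stop ?D ?G n x \<ge> ?G x + (s2 / 2) * ?e"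
    proof (rule dynkin_ge[OF qG])
      fix y assume y: "y \<in> ?D"
      have gen: "PG \<ge> Gy + s2 / 2" if "PG = sq + s2 - a - b - d" "a \<le> 4 * (s2 / 32)"
        "b \<le> (if Q then s2 else s2 / 32)" "d \<le> s2 * (be - (if Q then 1 else 0))" "Gy = sq - s2 * be"
        for PG Gy sq a b d be and Q :: bool
        using that s2_pos by (cases Q) (auto simp: algebra_simps)
      have "P ?G y = (of_int y)\<^sup>2 + s2 - P ?g2 y - P ?g3 y - s2 * P \<beta> y"
        by (simp add: P_diff P_sq P_cmult qb_diff qb_sq q2 q3 qb_cmult qbeta)
      moreover have "P ?g2 y \<le> 4 * (s2 / 32)" using y r' by (intro P_upper_tail r1) auto
      moreover have "P ?g3 y \<le> (if y < int r1 then s2 else s2 / 32)"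
      proof -
        have "P ?g3 y \<le> E (\<lambda>\<xi>. (of_int \<xi>)\<^sup>2 * indicator {\<xi>. \<bar>\<xi>\<bar> \<ge> int (nat y)} \<xi>)"
          using y by (intro P_lower_tail) auto
        also have "\<dots> \<le> (if y < int r1 then s2 else s2 / 32)"
        proof (cases "y < int r1")
          case True
          have "E (\<lambda>\<xi>. (of_int \<xi>)\<^sup>2 * indicator {\<xi>. \<bar>\<xi>\<bar> \<ge> int (nat y)} \<xi>) \<le> s2"
            unfolding s2_def by (rule integral_mono'[OF int_sq]) (auto simp: indicator_def)
          then show ?thesis using True by simp
        next
          case False
          then show ?thesis using r1[of "nat y"] by (simp add: le_nat_iff)
        qed
        finally show ?thesis .
      qed
      moreover have "s2 * P \<beta> y \<le> s2 * (\<beta> y - (if y < int r1 then 1 else 0))"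
        using y \<beta>(3)[of y] s2_pos by (intro mult_left_mono) auto
      moreover have "?G y = (of_int y)\<^sup>2 - s2 * \<beta> y" using y by (auto simp: indicator_def)
      ultimately show "P ?G y \<ge> ?G y + s2 / 2"
        by (rule gen)
    qed
    moreover have "stop ?D ?G n x \<le> stop ?D (\<lambda>y. 4 * (real r)\<^sup>2 * indicator {0..} y) n x"
    proof (rule stop_mono[OF qG qb_cmult[OF qb_ind]])
      fix y
      have "(of_int y)\<^sup>2 \<le> 4 * (real r)\<^sup>2" if "0 \<le> y" "y < 2 * int r"
      proof -
        have "(real_of_int y)\<^sup>2 \<le> (2 * real r)\<^sup>2" using that by (intro power_mono) linarith+
        then show ?thesis by (simp add: power_mult_distrib)
      qed
      moreover have "0 \<le> s2 * \<beta> y" using s2_pos \<beta>(2)[of y] by simp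
      moreover have "0 \<le> 4 * (real r)\<^sup>2" by simp
      ultimately show "?G y \<le> 4 * (real r)\<^sup>2 * indicator {0..} y"
        by (auto simp: indicator_def intro: order_trans[of _ 0])
    qed
    moreover have "?G x \<ge> - (s2 * B)"
    proof -
      have "s2 * \<beta> x \<le> s2 * B" using s2_pos \<beta>(2)[of x] by simp
      moreover have "?G x = (of_int x)\<^sup>2 - s2 * \<beta> x" using x by (auto simp: indicator_def)
      ultimately show ?thesis using zero_le_power2[of "real_of_int x"] by linarith
    qed
    ultimately have "(s2 / 2) * ?e \<le> 4 * (real r)\<^sup>2 * ?Q + s2 * B"
      unfolding surv_def stop_cmult by linarith
    then have e1: "?e \<le> 2 / s2 * (4 * (real r)\<^sup>2 * ?Q + s2 * B)"
      using s2_pos by (simp add: field_simps)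
    \<comment> \<open>The additive term \<open>s2 * B\<close> must be absorbed, so
      \<open>surv\<close> is needed to be at least of order \<open>1 / r\<close>. This follows from
      the martingale \<open>y\<close>: a negative exit position is at most -1, the others count at
      most \<open>2 * r\<close>.\<close>
    let ?L = "\<lambda>y. of_int y - ?g4 y"
    have qL: "quad_bounded ?L" by (intro qb_diff qb_id q4)
    have q1: "quad_bounded (\<lambda>_. 1)" by (rule qb_bounded[where C=1]) simp
    have "stop ?D ?L n x \<ge> ?L x + (- (2 * (s2 / 32) / r)) * ?e"
    proof (rule dynkin_ge[OF qL])
      fix y assume y: "y \<in> ?D"
      have "P ?L y = of_int y - P ?g4 y" by (simp add: P_diff P_id qb_id q4)
      moreover have "P ?g4 y \<le> 2 * (s2 / 32) / r" using y r' by (intro P_upper_tail r1) auto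
      moreover have "?L y = of_int y" using y by (auto simp: indicator_def)
      ultimately show "P ?L y \<ge> ?L y + (- (2 * (s2 / 32) / r))" by linarith
    qed
    moreover have "stop ?D ?L n x \<le> stop ?D (\<lambda>y. (2 * real r + 1) * indicator {0..} y - 1) n x"
    proof (rule stop_mono[OF qL])
      show "quad_bounded (\<lambda>y. (2 * real r + 1) * indicator {0..} y - 1)"
        by (rule qb_diff[OF qb_cmult[OF qb_ind] q1])
      fix y show "?L y \<le> (2 * real r + 1) * indicator {0..} y - 1"
        by (auto simp: indicator_def)
    qed
    moreover have "stop ?D (\<lambda>y. (2 * real r + 1) * indicator {0..} y - 1) n x = (2 * real r + 1) * ?Q - 1"
      by (simp add: stop_diff[OF qb_cmult[OF qb_ind] q1] stop_cmult stop_const surv_def)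
    moreover have "?L x = of_int x" using x by (auto simp: indicator_def)
    ultimately have "1 \<le> (2 * real r + 1) * ?Q + s2 / (16 * r) * ?e"
      using x by simp
    also have "s2 / (16 * r) * ?e \<le> s2 / (16 * r) * (2 / s2 * (4 * (real r)\<^sup>2 * ?Q + s2 * B))"
      using e1 s2_pos by (intro mult_left_mono) auto
    also have "\<dots> = r * ?Q / 2 + s2 * B / (8 * r)"
      using s2_pos r' by (simp add: field_simps power2_eq_square)
    also have "s2 * B / (8 * r) \<le> 1 / 2" using r' by (simp add: field_simps)
    finally have "1 / 2 \<le> (2.5 * r + 1) * ?Q" by (simp add: algebra_simps)
    moreover have Q0: "?Q \<ge> 0"
      using stop_mono[of "\<lambda>_. 0" "indicator {0..}" ?D n x]
      by (simp add: stop_const surv_def qb_ind qb_bounded[where C=0])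
    ultimately have "1 \<le> 8 * r * ?Q"
      using r' mult_right_mono[of "2.5 * r + 1" "4 * real r" ?Q] by (simp add: algebra_simps)
    also have "\<dots> \<le> 8 * (real r)\<^sup>2 * ?Q"
      using r' Q0 by (intro mult_right_mono) (auto simp: power2_eq_square)
    finally have "s2 * B * 1 \<le> s2 * B * (8 * (real r)\<^sup>2 * ?Q)"
      using s2_pos \<beta>(1) by (intro mult_left_mono) auto
    then have "2 / s2 * (4 * (real r)\<^sup>2 * ?Q + s2 * B) \<le> 2 / s2 * (4 * (real r)\<^sup>2 * ?Q + s2 * B * (8 * (real r)\<^sup>2 * ?Q))"
      using s2_pos by (intro mult_left_mono) auto
    also have "\<dots> = C * (real r)\<^sup>2 * ?Q" by (simp add: C_def algebra_simps)
    finally show "?e \<le> C * (real r)\<^sup>2 * ?Q" using e1 by simp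
  qed
qed

lemma stop_ind_bounds: "0 \<le> stop D (indicator A) n x" "stop D (indicator A) n x \<le> 1"
proof -
  have "stop D (\<lambda>_. 0) n x \<le> stop D (indicator A) n x" "stop D (indicator A) n x \<le> stop D (\<lambda>_. 1) n x"
    by (auto intro!: stop_mono qb_ind qb_bounded[where C=1] simp: indicator_def)
  then show "0 \<le> stop D (indicator A) n x" "stop D (indicator A) n x \<le> 1" by (simp_all add: stop_const)
qed

lemma surv_bounds: "0 \<le> surv r n x" "surv r n x \<le> 1"
  unfolding surv_def by (rule stop_ind_bounds)+

text \<open>Markov's inequality for the exit time: on the event of being still inside at time
  \<open>n\<close>, all \<open>n\<close> steps count.\<close>

lemma survive_inside: "real n * stop D (indicator D) n x \<le> exit_time D n x"
proof (induction n arbitrary: x)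
  case (Suc n)
  show ?case
  proof (cases "x \<in> D")
    case True
    let ?s = "P (stop D (indicator D) n) x"
    have "stop D (indicator D) (Suc n) x = ?s" using True by simp
    with stop_ind_bounds(2)[of D D "Suc n" x] have "?s \<le> 1" by simp
    moreover have "P (\<lambda>x. real n * stop D (indicator D) n x) x \<le> P (exit_time D n) x"
      by (intro P_mono qb_cmult qb_stop qb_ind qb_et Suc)
    ultimately show ?thesis using True by (simp add: P_cmult algebra_simps)
  qed auto
qed simp

text \<open>In each step inside, Chebyshev bounds the chance of jumping by more than
  \<open>(M - 1) * r\<close>; the expected number of such steps is the exit time.\<close>

lemma far_landing:
  assumes "M \<ge> 2" "r \<ge> 1"
  shows "stop {0..<int r} (indicator {int (M * r)<..}) n x \<le> indicator {int (M * r)<..} x + s2 / ((real M - 1) * r)\<^sup>2 * exit_time {0..<int r} n x"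
proof (rule dynkin_le[OF qb_ind])
  fix y assume y: "y \<in> {0..<int r}"
  let ?m = "(real M - 1) * r"
  have m: "?m > 0" using assms by simp
  have "P (indicator {int (M * r)<..}) y \<le> E (\<lambda>\<xi>. (of_int \<xi>)\<^sup>2 / ?m\<^sup>2)"
    unfolding P_def
  proof (rule integral_mono[OF qb_int[OF qb_ind]])
    fix \<xi>
    show "indicator {int (M * r)<..} (y + \<xi>) \<le> (of_int \<xi>)\<^sup>2 / ?m\<^sup>2"
    proof (cases "y + \<xi> > int (M * r)")
      case True
      then have "\<xi> > int (M * r) - int r" using y by simp
      then have "real_of_int \<xi> > of_int (int (M * r) - int r)" by (simp only: of_int_less_iff)
      then have "real_of_int \<xi> \<ge> ?m" by (simp add: algebra_simps)
      then have "?m\<^sup>2 \<le> (of_int \<xi>)\<^sup>2" using m by (intro power_mono) auto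
      moreover have "0 < ?m\<^sup>2" using m by (rule zero_less_power)
      ultimately have "1 \<le> (of_int \<xi>)\<^sup>2 / ?m\<^sup>2" by (simp only: le_divide_eq_1_pos)
      then show ?thesis using True by simp
    qed (auto simp: indicator_def)
  qed (use int_sq in simp)
  also have "\<dots> = s2 / ?m\<^sup>2" by (simp add: s2_def)
  finally show "P (indicator {int (M * r)<..}) y \<le> indicator {int (M * r)<..} y + s2 / ?m\<^sup>2"
    by (simp add: add_increasing)
qed

text \<open>Compared with \<open>surv\<close>, two events are lost: still being inside, and landing
  above \<open>M * r\<close>. By \<open>exit_time_bound\<close> each costs at most a quarter of
  \<open>surv\<close> once \<open>C0 \<ge> 4 * C\<close> and
  \<open>(M - 1)^2 \<ge> 4 * s2 * C\<close>.\<close>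

lemma good_exit:
  obtains C0 M0 r0 :: nat where "C0 \<ge> 1" "M0 \<ge> 2" "r0 \<ge> 1"
    "\<And>r n M x. r \<ge> r0 \<Longrightarrow> n \<ge> C0 * r\<^sup>2 \<Longrightarrow> M \<ge> M0 \<Longrightarrow> 0 \<le> x \<Longrightarrow> x < int r \<Longrightarrow>
       stop {0..<int r} (indicator {int r..int (M * r)}) n x \<ge> surv r n x / 2"
    "\<And>r n x. r \<ge> r0 \<Longrightarrow> 0 \<le> x \<Longrightarrow> x < int r \<Longrightarrow> exit_time {0..<int r} n x \<le> C0 * (real r)\<^sup>2 * surv r n x"
proof -
  obtain C r0 where C: "C > 0" "r0 \<ge> 1"
    "\<And>r n x. r \<ge> r0 \<Longrightarrow> 0 \<le> x \<Longrightarrow> x < int r \<Longrightarrow> exit_time {0..<int r} n x \<le> C * (real r)\<^sup>2 * surv r n x"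
    by (rule exit_time_bound) blast
  define C0 where "C0 = nat \<lceil>4 * C\<rceil> + 1"
  define M0 where "M0 = 2 + nat \<lceil>4 * s2 * C\<rceil>"
  have C0: "real C0 \<ge> 4 * C" unfolding C0_def using C(1) by linarith
  show ?thesis
  proof (rule that[of C0 M0 r0])
    show "C0 \<ge> 1" "M0 \<ge> 2" "r0 \<ge> 1" using C by (auto simp: C0_def M0_def)
    fix r n :: nat and x :: int
    assume r: "r \<ge> r0" and x: "0 \<le> x" "x < int r"
    let ?D = "{0..<int r}" let ?Q = "surv r n x" let ?e = "exit_time ?D n x"
    have e: "?e \<le> C * (real r)\<^sup>2 * ?Q" by (rule C(3)[OF r x])
    show "?e \<le> C0 * (real r)\<^sup>2 * ?Q"
      by (rule order_trans[OF e]) (use C0 C(1) surv_bounds in \<open>auto intro!: mult_right_mono\<close>)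
    fix M :: nat
    assume n: "n \<ge> C0 * r\<^sup>2" and M: "M \<ge> M0"
    have r1: "r \<ge> 1" using r C by simp
    have n': "real n \<ge> 4 * C * (real r)\<^sup>2"
    proof -
      have "4 * C * (real r)\<^sup>2 \<le> C0 * (real r)\<^sup>2" using C0 by (intro mult_right_mono) auto
      also have "\<dots> \<le> n" using n by (metis of_nat_le_iff of_nat_mult of_nat_power)
      finally show ?thesis .
    qed
    have n0: "real n > 0" using n' C(1) r1 by (smt (verit) mult_pos_pos of_nat_0_less_iff zero_less_power less_le_trans zero_less_one)
    have M1: "real M - 1 \<ge> 1" "real M - 1 \<ge> 4 * s2 * C" using M real_nat_ceiling_ge[of "4 * s2 * C"] by (auto simp: M0_def)
    have M2: "(real M - 1)\<^sup>2 \<ge> 4 * s2 * C"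
    proof -
      have "4 * s2 * C \<le> (real M - 1) * 1" using M1 by simp
      also have "\<dots> \<le> (real M - 1) * (real M - 1)" using M1 by (intro mult_left_mono) auto
      finally show ?thesis by (simp add: power2_eq_square)
    qed
    have eq: "indicator {int r..int (M * r)} = (\<lambda>y. (indicator {0..} y - indicator ?D y) - indicator {int (M * r)<..} y :: real)"
    proof -
      have "1 * r \<le> M * r" using M by (intro mult_right_mono) (auto simp: M0_def)
      then have "int r \<le> int (M * r)" by (simp only: mult_1 of_nat_le_iff)
      then show ?thesis by (auto simp: indicator_def fun_eq_iff)
    qed
    have "stop ?D (indicator {int r..int (M * r)}) n x = ?Q - stop ?D (indicator ?D) n x - stop ?D (indicator {int (M * r)<..}) n x"
      unfolding eq by (simp add: stop_diff qb_diff qb_ind surv_def)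
    moreover have "stop ?D (indicator ?D) n x \<le> ?Q / 4"
    proof -
      have "n * stop ?D (indicator ?D) n x \<le> C * (real r)\<^sup>2 * ?Q"
        using survive_inside[of n ?D x] e by simp
      also have "\<dots> \<le> n / 4 * ?Q" using n' surv_bounds by (intro mult_right_mono) auto
      finally show ?thesis using n0 by simp
    qed
    moreover have "stop ?D (indicator {int (M * r)<..}) n x \<le> ?Q / 4"
    proof -
      have "M \<ge> 2" using M by (simp add: M0_def)
      have "1 * r \<le> M * r" using M by (intro mult_right_mono) (auto simp: M0_def)
      then have "int r \<le> int (M * r)" by (simp only: mult_1 of_nat_le_iff)
      then have "\<not> int (M * r) < x" using x by linarith
      then have "indicator {int (M * r)<..} x = (0::real)" by (simp only: indicator_def greaterThan_iff of_bool_eq)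
      then have "stop ?D (indicator {int (M * r)<..}) n x \<le> s2 / ((real M - 1) * r)\<^sup>2 * ?e"
        using far_landing[OF \<open>M \<ge> 2\<close> r1, of n x] by simp
      also have "\<dots> \<le> s2 / ((real M - 1) * r)\<^sup>2 * (C * (real r)\<^sup>2 * ?Q)"
        using e s2_pos by (intro mult_left_mono) auto
      also have "\<dots> = s2 * C / (real M - 1)\<^sup>2 * ?Q" using r1 by (simp add: power_mult_distrib)
      also have "\<dots> \<le> 1 / 4 * ?Q"
        using M1 M2 surv_bounds by (intro mult_right_mono) (auto simp: divide_le_eq)
      finally show ?thesis by simp
    qed
    ultimately show "stop ?D (indicator {int r..int (M * r)}) n x \<ge> ?Q / 2" by simp
  qed
qed

text \<open>After leaving \<open>[0, r)\<close> the clock of the half line runs on only for paths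
  that have not turned negative, and for at most \<open>n + s\<close> steps.\<close>

lemma exit_time_half_line:
  "exit_time {0..} (n + s) x \<le> exit_time {0..<int r} n x + real (n + s) * surv r n x"
proof (induction n arbitrary: x)
  case 0
  show ?case
  proof (cases "x \<ge> 0")
    case True
    then show ?thesis using exit_time_bounds[of "{0..}" s x] by (simp add: surv_def)
  next
    case False
    then have "exit_time {0..} s x = 0" by (cases s) auto
    then show ?thesis by (simp add: surv_def)
  qed
next
  case (Suc n)
  consider "x < 0" | "x \<in> {0..<int r}" | "x \<ge> int r" by fastforce
  then show ?case
  proof cases
    case 1
    then show ?thesis using surv_bounds by simp
  next
    case 2
    have q: "quad_bounded (surv r n)" unfolding surv_def[abs_def] by (intro qb_stop qb_ind)
    have "P (exit_time {0..} (n + s)) x \<le> P (\<lambda>x. exit_time {0..<int r} n x + real (n + s) * surv r n x) x"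
      by (intro P_mono qb_et qb_add qb_cmult q Suc)
    also have "\<dots> = P (exit_time {0..<int r} n) x + real (n + s) * P (surv r n) x"
      by (simp add: P_add P_cmult qb_et qb_cmult q)
    also have "P (surv r n) x = surv r (Suc n) x" using 2 by (simp add: surv_def[abs_def])
    also have "real (n + s) * surv r (Suc n) x \<le> real (Suc n + s) * surv r (Suc n) x"
      using surv_bounds by (intro mult_right_mono) auto
    finally show ?thesis using 2 by simp
  next
    case 3
    then have "surv r (Suc n) x = 1" by (simp add: surv_def)
    moreover have "exit_time {0..<int r} (Suc n) x = 0" using 3 by simp
    ultimately show ?thesis using exit_time_bounds[of "{0..}" "Suc n + s" x] by simp
  qed
qed

lemma exit_time_mono_time: "exit_time D n x \<le> exit_time D (n + k) x"
proof (induction n arbitrary: x)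
  case 0 then show ?case using exit_time_bounds by simp
next
  case (Suc n)
  show ?case by (auto intro!: P_mono qb_et Suc)
qed

lemma stop_half_line_sq: "stop {0..} (\<lambda>x. (of_int x)\<^sup>2 * indicator {0..} x) t x \<le> (of_int x)\<^sup>2 + s2 * exit_time {0..} t x"
proof -
  have q: "quad_bounded (\<lambda>x. (of_int x)\<^sup>2 * indicator {0..} x)" by (rule qb_dom[OF qb_sq]) (auto simp: indicator_def)
  have "stop {0..} (\<lambda>x. (of_int x)\<^sup>2 * indicator {0..} x) t x \<le> (of_int x)\<^sup>2 * indicator {0..} x + s2 * exit_time {0..} t x"
  proof (rule dynkin_le[OF q])
    fix x :: int assume "x \<in> {0..}"
    have "P (\<lambda>x. (of_int x)\<^sup>2 * indicator {0..} x) x \<le> P (\<lambda>x. (of_int x)\<^sup>2) x"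
      by (intro P_mono q qb_sq) (auto simp: indicator_def)
    then show "P (\<lambda>x. (of_int x)\<^sup>2 * indicator {0..} x) x \<le> (of_int x)\<^sup>2 * indicator {0..} x + s2"
      using \<open>x \<in> {0..}\<close> by (simp add: P_sq)
  qed
  moreover have "(of_int x)\<^sup>2 * indicator {0..} x \<le> ((of_int x)\<^sup>2 :: real)" by (auto simp: indicator_def)
  ultimately show ?thesis by linarith
qed

end

section \<open>Powers of a killed kernel\<close>

text \<open>With values in \<open>ennreal\<close> every sum exists and every exchange of sums is
  free; reals return only where differences are formed.\<close>

abbreviation nsum :: "(int \<Rightarrow> ennreal) \<Rightarrow> ennreal" where
  "nsum f \<equiv> \<integral>\<^sup>+x. f x \<partial>count_space UNIV"

lemma nsum_mono: "(\<And>x. f x \<le> g x) \<Longrightarrow> nsum f \<le> nsum g"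
  by (rule nn_integral_mono)

lemma nsum_add: "nsum (\<lambda>x. f x + g x) = nsum f + nsum g"
  by (rule nn_integral_add) auto

lemma nsum_cmult: "nsum (\<lambda>x. c * f x) = c * nsum f"
  by (rule nn_integral_cmult) auto

lemma nsum_multc: "nsum (\<lambda>x. f x * c) = nsum f * c"
  by (rule nn_integral_multc) auto

lemma nsum_swap: "nsum (\<lambda>x. nsum (\<lambda>y. f x y)) = nsum (\<lambda>y. nsum (\<lambda>x. f x y))"
  by (rule nn_integral_count_space_nn_integral) auto

lemma nsum_delta: "nsum (\<lambda>x. of_bool (a = x) * f x) = f a"
proof -
  have "nsum (\<lambda>x. of_bool (a = x) * f x) = nsum (\<lambda>x. f a * indicator {a} x)"
    by (intro nn_integral_cong) (auto simp: indicator_def)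
  then show ?thesis by (simp add: nn_integral_cmult_indicator)
qed

lemma nsum_delta': "nsum (\<lambda>x. f x * of_bool (x = a)) = f a"
  using nsum_delta[of a f] by (simp add: mult.commute eq_commute)

lemma nsum_indicator: "finite A \<Longrightarrow> nsum (\<lambda>x. c * indicator A x) = c * of_nat (card A)"
  by (simp add: nn_integral_cmult_indicator)

primrec kpow :: "(int \<Rightarrow> int \<Rightarrow> ennreal) \<Rightarrow> nat \<Rightarrow> int \<Rightarrow> int \<Rightarrow> ennreal" where
  "kpow T 0 = (\<lambda>x y. of_bool (x = y))"
| "kpow T (Suc n) = (\<lambda>x y. nsum (\<lambda>z. T x z * kpow T n z y))"

definition row_sum :: "(int \<Rightarrow> int \<Rightarrow> ennreal) \<Rightarrow> nat \<Rightarrow> int \<Rightarrow> ennreal" where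
  "row_sum T n x = nsum (kpow T n x)"

lemma nsum_kpow_Suc: "nsum (\<lambda>y. kpow T (Suc n) x y * f y) = nsum (\<lambda>z. T x z * nsum (\<lambda>y. kpow T n z y * f y))"
proof -
  have "nsum (\<lambda>y. kpow T (Suc n) x y * f y) = nsum (\<lambda>y. nsum (\<lambda>z. T x z * kpow T n z y * f y))"
    by (simp add: nsum_multc)
  also have "\<dots> = nsum (\<lambda>z. nsum (\<lambda>y. T x z * (kpow T n z y * f y)))"
    by (subst nsum_swap) (simp add: mult.assoc)
  finally show ?thesis by (simp add: nsum_cmult)
qed

lemma kpow_add: "kpow T (m + n) x y = nsum (\<lambda>z. kpow T m x z * kpow T n z y)"
proof (induction m arbitrary: x)
  case 0
  then show ?case by (simp add: nsum_delta)
next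
  case (Suc m)
  then show ?case by (subst nsum_kpow_Suc) simp
qed

lemma nsum_kpow_add: "nsum (\<lambda>y. kpow T (m + n) x y * f y) = nsum (\<lambda>z. kpow T m x z * nsum (\<lambda>y. kpow T n z y * f y))"
proof (induction m arbitrary: x)
  case 0
  then show ?case by (simp add: nsum_delta)
next
  case (Suc m)
  have "nsum (\<lambda>y. kpow T (Suc m + n) x y * f y) = nsum (\<lambda>z. T x z * nsum (\<lambda>y. kpow T (m + n) z y * f y))"
    using nsum_kpow_Suc[of T "m + n" x f] by simp
  also have "\<dots> = nsum (\<lambda>z. T x z * nsum (\<lambda>w. kpow T m z w * nsum (\<lambda>y. kpow T n w y * f y)))"
    by (simp add: Suc)
  also have "\<dots> = nsum (\<lambda>z. kpow T (Suc m) x z * nsum (\<lambda>y. kpow T n z y * f y))"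
    by (rule nsum_kpow_Suc[symmetric])
  finally show ?case .
qed

lemma row_sum_add: "row_sum T (m + n) x = nsum (\<lambda>z. kpow T m x z * row_sum T n z)"
  using nsum_kpow_add[of T m n x "\<lambda>_. 1"] by (simp add: row_sum_def)

lemma row_sum_Suc: "row_sum T (Suc n) x = nsum (\<lambda>z. T x z * row_sum T n z)"
  using nsum_kpow_Suc[of T n x "\<lambda>_. 1"] by (simp add: row_sum_def)

lemma row_sum_0: "row_sum T 0 x = 1"
  using nsum_delta[of x "\<lambda>_. 1"] by (simp add: row_sum_def)

lemma kpow_1: "kpow T (Suc 0) x y = T x y"
  by (simp add: nsum_delta')

lemma kpow_Suc': "kpow T (Suc n) x y = nsum (\<lambda>z. kpow T n x z * T z y)"
  using kpow_add[of T n 1 x y] by (simp add: kpow_1[simplified])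

lemma kpow_transpose: "kpow (\<lambda>x y. T y x) n x y = kpow T n y x"
proof (induction n arbitrary: x y)
  case (Suc n)
  have "kpow (\<lambda>x y. T y x) (Suc n) x y = nsum (\<lambda>z. T z x * kpow T n y z)" by (simp add: Suc)
  also have "\<dots> = kpow T (Suc n) y x" unfolding kpow_Suc' by (simp add: mult.commute)
  finally show ?case .
qed auto

lemma kpow_mono:
  assumes "\<And>x y. T x y \<le> T' x y"
  shows "kpow T n x y \<le> kpow T' n x y"
  using assms by (induction n arbitrary: x) (auto intro!: nsum_mono mult_mono)

lemma kpow_scale:
  assumes "\<And>x y. c * T x y \<le> T' x y"
  shows "c ^ n * kpow T n x y \<le> kpow T' n x y"
proof (induction n arbitrary: x)
  case (Suc n)
  have "c ^ Suc n * kpow T (Suc n) x y = nsum (\<lambda>z. (c * T x z) * (c ^ n * kpow T n z y))"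
    by (simp add: nsum_cmult[symmetric] mult_ac)
  also have "\<dots> \<le> nsum (\<lambda>z. T' x z * kpow T' n z y)"
    by (intro nsum_mono mult_mono assms Suc) auto
  finally show ?case by simp
qed auto

text \<open>Overlapping short steps of length at most \<open>2 * d\<close> are chained: each further step gains a
  distance \<open>d\<close> and may end at any of \<open>d\<close> consecutive sites.\<close>

lemma kpow_chain:
  fixes a b d :: int and \<beta> :: real
  assumes d: "d \<ge> 1" "2 * d \<le> b - a" and \<beta>: "\<beta> \<ge> 0"
    and base: "\<And>x y t. a \<le> x \<Longrightarrow> x \<le> b \<Longrightarrow> a \<le> y \<Longrightarrow> y \<le> b \<Longrightarrow> \<bar>x - y\<bar> \<le> 2 * d \<Longrightarrow> t = k \<or> t = Suc k \<Longrightarrow>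
      ennreal \<beta> \<le> kpow T t x y"
  shows "a \<le> x \<Longrightarrow> x \<le> b \<Longrightarrow> a \<le> y \<Longrightarrow> y \<le> b \<Longrightarrow> \<bar>x - y\<bar> \<le> (int i + 2) * d \<Longrightarrow>
     Suc i * k \<le> t \<Longrightarrow> t \<le> Suc i * Suc k \<Longrightarrow> ennreal (\<beta> * (\<beta> * of_int d) ^ i) \<le> kpow T t x y"
proof (induction i arbitrary: x y t)
  case 0
  then show ?case using base[of x y t] by (simp add: le_Suc_eq)
next
  case (Suc i)
  \<comment> \<open>The two admissible lengths \<open>k\<close> and \<open>Suc k\<close> of a short
    step make every total time between the extremes attainable.\<close>
  obtain t1 where t1: "t1 = k \<or> t1 = Suc k" "t1 \<le> t" "Suc i * k \<le> t - t1" "t - t1 \<le> Suc i * Suc k"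
  proof (cases "t - k \<le> Suc i * Suc k")
    case True
    then show ?thesis using Suc.prems(6) by (intro that[of k]) auto
  next
    case False
    then have "t \<ge> Suc (Suc i) * Suc k" by simp
    then have "t = Suc (Suc i) * Suc k" using Suc.prems(7) by linarith
    then show ?thesis by (intro that[of "Suc k"]) auto
  qed
  define q where "q = int i * d"
  have q: "q \<ge> 0" using d by (simp add: q_def)
  have xy: "\<bar>x - y\<bar> \<le> q + 3 * d" using Suc.prems(5) by (simp add: q_def algebra_simps)
  \<comment> \<open>An intermediate window of length \<open>d\<close> inside \<open>[a, b]\<close>:
    near \<open>x\<close>, on the side of \<open>y\<close> where the distance asks for it, and
    shifted back where the boundary leaves no room.\<close>
  obtain w where w: "a \<le> w" "w + d \<le> b" "\<And>z. w \<le> z \<Longrightarrow> z \<le> w + d \<Longrightarrow> \<bar>x - z\<bar> \<le> 2 * d \<and> \<bar>z - y\<bar> \<le> q + 2 * d"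
  proof -
    consider (A) "x + d < y" "x + 2 * d \<le> b" | (B) "x + d < y" "x + 2 * d > b"
      | (C) "y + d < x" "x - 2 * d \<ge> a" | (D) "y + d < x" "x - 2 * d < a"
      | (F) "\<bar>x - y\<bar> \<le> d" "x + d \<le> b" | (G) "\<bar>x - y\<bar> \<le> d" "x + d > b" by linarith
    then show ?thesis
    proof cases
      case A then show ?thesis using d q xy Suc.prems(1-4) by (intro that[of "x + d"]) auto
    next
      case B then show ?thesis using d q xy Suc.prems(1-4) by (intro that[of x]) auto
    next
      case C then show ?thesis using d q xy Suc.prems(1-4) by (intro that[of "x - 2 * d"]) auto
    next
      case D then show ?thesis using d q xy Suc.prems(1-4) by (intro that[of "x - d"]) auto
    next
      case F then show ?thesis using d q xy Suc.prems(1-4) by (intro that[of x]) auto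
    next
      case G then show ?thesis using d q xy Suc.prems(1-4) by (intro that[of "x - d"]) auto
    qed
  qed
  let ?\<gamma> = "\<beta> * (\<beta> * (\<beta> * of_int d) ^ i)"
  have "ennreal (\<beta> * (\<beta> * of_int d) ^ Suc i) = ennreal ?\<gamma> * ennreal (of_int d)"
    using \<beta> d by (subst ennreal_mult[symmetric]) (auto simp: mult_ac)
  also have "\<dots> \<le> ennreal ?\<gamma> * of_nat (card {w..w + d})"
  proof (rule mult_left_mono)
    have "ennreal (of_int d) \<le> ennreal (real (card {w..w + d}))" using d by (intro ennreal_leI) simp
    then show "ennreal (of_int d) \<le> of_nat (card {w..w + d})" by (simp add: ennreal_of_nat_eq_real_of_nat)
  qed simp
  also have "\<dots> = nsum (\<lambda>z. ennreal ?\<gamma> * indicator {w..w + d} z)"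
    by (simp add: nsum_indicator)
  also have "\<dots> \<le> nsum (\<lambda>z. kpow T t1 x z * kpow T (t - t1) z y)"
  proof (rule nsum_mono)
    fix z
    show "ennreal ?\<gamma> * indicator {w..w + d} z \<le> kpow T t1 x z * kpow T (t - t1) z y"
    proof (cases "z \<in> {w..w + d}")
      case True
      then have z: "w \<le> z" "z \<le> w + d" by auto
      have "ennreal \<beta> \<le> kpow T t1 x z" using z w(1,2) w(3)[OF z] t1(1) Suc.prems(1,2) by (intro base) auto
      moreover have "ennreal (\<beta> * (\<beta> * of_int d) ^ i) \<le> kpow T (t - t1) z y"
        using z w(1,2) w(3)[OF z] t1(3,4) Suc.prems(3,4) by (intro Suc.IH) (auto simp: q_def algebra_simps)
      ultimately have "ennreal \<beta> * ennreal (\<beta> * (\<beta> * of_int d) ^ i) \<le> kpow T t1 x z * kpow T (t - t1) z y"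
        by (intro mult_mono) auto
      then show ?thesis using True \<beta> d by (simp add: ennreal_mult[symmetric])
    qed auto
  qed
  also have "\<dots> = kpow T t x y" using kpow_add[of T t1 "t - t1" x y] t1(2) by simp
  finally show ?case .
qed

section \<open>Kernels with site weights: reversal and comparison with the free walk\<close>

definition tk :: "int pmf \<Rightarrow> (int \<Rightarrow> real) \<Rightarrow> int \<Rightarrow> int \<Rightarrow> ennreal" where
  "tk p u x y = ennreal (u x * u y * pmf p (y - x))"

text \<open>Reversing the steps transposes the kernel (\<open>tk_mirror\<close>), so every estimate
  of rows for a general walk is also one of columns.\<close>

definition mirror :: "int pmf \<Rightarrow> int pmf" where
  "mirror p = map_pmf uminus p"

lemma pmf_mirror: "pmf (mirror p) x = pmf p (- x)"
proof -
  have "pmf (map_pmf uminus p) (- (- x)) = pmf p (- x)" by (rule pmf_map_inj') (auto intro: injI)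
  then show ?thesis by (simp add: mirror_def)
qed

lemma tk_mirror: "tk (mirror p) u x y = tk p u y x"
  by (simp add: tk_def pmf_mirror mult_ac)

lemma kpow_mirror: "kpow (tk (mirror p) u) n x y = kpow (tk p u) n y x"
proof -
  have "tk (mirror p) u = (\<lambda>x y. tk p u y x)" by (auto simp: tk_mirror fun_eq_iff)
  then show ?thesis using kpow_transpose[of "tk p u"] by simp
qed

lemma nstep_mirror: "nstep (mirror p) n = mirror (nstep p n)"
proof (induction n)
  case (Suc n)
  have "nstep (mirror p) (Suc n) = map_pmf (\<lambda>(x, y). x + y) (pair_pmf (mirror (nstep p n)) (mirror p))"
    by (simp add: Suc)
  also have "\<dots> = map_pmf (\<lambda>(x, y). x + y) (pair_pmf (map_pmf uminus (nstep p n)) (map_pmf uminus p))"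
    by (simp add: mirror_def)
  also have "\<dots> = map_pmf (\<lambda>(x, y). - (x + y)) (pair_pmf (nstep p n) p)"
    by (simp add: pair_map_pmf1 pair_map_pmf2 pmf.map_comp o_def apfst_def apsnd_def map_prod_def split_beta' add.commute)
  finally show ?case by (simp add: mirror_def pmf.map_comp o_def split_beta')
qed (simp add: mirror_def)

lemma walk_step_mirror: "walk_step p \<Longrightarrow> walk_step (mirror p)"
  unfolding walk_step_def
  by (auto simp: mirror_def[of p] nstep_mirror[unfolded mirror_def] pmf_mirror[unfolded mirror_def])

lemma nsum_shift: "nsum (\<lambda>y. f (y - x)) = nsum f"
  by (rule nn_integral_bij_count_space[of "\<lambda>y. y - x" UNIV UNIV f])
     (auto intro!: bij_betwI[where g="\<lambda>y. y + x"])

lemma nsum_pmf_shift: "nsum (\<lambda>y. ennreal (pmf q (y - x)) * f y) = (\<integral>\<^sup>+\<xi>. f (x + \<xi>) \<partial>measure_pmf q)"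
  unfolding nn_integral_measure_pmf using nsum_shift[of "\<lambda>y. ennreal (pmf q y) * f (x + y)" x] by simp

lemma kpow_free: "kpow (tk p (\<lambda>_. 1)) n x y = ennreal (pmf (nstep p n) (y - x))"
proof (induction n arbitrary: y)
  case 0
  then show ?case by (simp add: indicator_def)
next
  case (Suc n)
  have "kpow (tk p (\<lambda>_. 1)) (Suc n) x y = nsum (\<lambda>z. ennreal (pmf (nstep p n) (z - x)) * ennreal (pmf p (y - z)))"
    unfolding kpow_Suc' by (simp add: Suc tk_def)
  also have "\<dots> = (\<integral>\<^sup>+\<xi>. ennreal (pmf p (y - x - \<xi>)) \<partial>measure_pmf (nstep p n))"
    unfolding nsum_pmf_shift by (simp add: algebra_simps)
  also have "\<dots> = ennreal (pmf (nstep p (Suc n)) (y - x))"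
  proof -
    have "ennreal (pmf (nstep p (Suc n)) (y - x)) = (\<integral>\<^sup>+(a, b). indicator {y - x} (a + b) \<partial>measure_pmf (pair_pmf (nstep p n) p))"
      unfolding nstep.simps ennreal_pmf_map by (intro nn_integral_cong) (auto simp: indicator_def)
    also have "\<dots> = (\<integral>\<^sup>+a. \<integral>\<^sup>+b. indicator {y - x - a} b \<partial>measure_pmf p \<partial>measure_pmf (nstep p n))"
      unfolding nn_integral_pair_pmf' case_prod_conv by (intro nn_integral_cong) (auto simp: indicator_def)
    finally show ?thesis by (simp add: emeasure_pmf_single)
  qed
  finally show ?case .
qed

context walk
begin

lemma nsum_pmf_P:
  assumes "quad_bounded f" "\<And>x. f x \<ge> 0"
  shows "nsum (\<lambda>y. ennreal (pmf p (y - x)) * ennreal (f y)) = ennreal (P f x)"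
  unfolding nsum_pmf_shift P_def by (rule nn_integral_eq_integral) (use assms qb_int in auto)

lemma nsum_pmf_1: "nsum (\<lambda>y. ennreal (pmf p (y - x))) = 1"
  using nsum_pmf_shift[of p x "\<lambda>_. 1"] by simp

lemma walk_mirror: "walk (mirror p)"
  using walk by (simp add: walk_def walk_step_mirror)

lemma s2_mirror: "walk.s2 (mirror p) = s2"
  unfolding walk.s2_def[OF walk_mirror] s2_def by (simp add: mirror_def)

lemma tk_le_pmf:
  assumes "\<And>x. 0 \<le> u x \<and> u x \<le> 1"
  shows "tk p u x y \<le> ennreal (pmf p (y - x))"
proof -
  have "u x * u y * pmf p (y - x) \<le> 1 * 1 * pmf p (y - x)"
    using assms[of x] assms[of y] by (intro mult_mono) auto
  then show ?thesis unfolding tk_def by (intro ennreal_leI) simp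
qed

lemma kpow_le_free:
  assumes "\<And>x. 0 \<le> u x \<and> u x \<le> 1"
  shows "kpow (tk p u) n x y \<le> ennreal (pmf (nstep p n) (y - x))"
proof -
  have "kpow (tk p u) n x y \<le> kpow (tk p (\<lambda>_. 1)) n x y"
    by (rule kpow_mono) (use tk_le_pmf[OF assms] in \<open>simp add: tk_def\<close>)
  then show ?thesis by (simp add: kpow_free)
qed

lemma qb_sq_shift: "quad_bounded (\<lambda>y. (of_int y - of_int a)\<^sup>2)"
proof (rule qb_dom)
  show "quad_bounded (\<lambda>y. 2 * (of_int y)\<^sup>2 + 2 * (of_int a)\<^sup>2)"
    by (intro qb_add qb_cmult qb_sq qb_bounded[where C="2 * (of_int a)\<^sup>2"]) simp
  fix y :: int
  have "(c - d)\<^sup>2 \<le> 2 * c\<^sup>2 + 2 * d\<^sup>2" for c d :: real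
    using zero_le_power2[of "c + d"] by (simp add: power2_sum power2_diff)
  from this[of "of_int y" "of_int a"]
  show "\<bar>(of_int y - of_int a)\<^sup>2\<bar> \<le> \<bar>2 * (of_int y)\<^sup>2 + 2 * (of_int a :: real)\<^sup>2\<bar>"
    by simp
qed

lemma P_sq_shift: "P (\<lambda>y. (of_int y - of_int a)\<^sup>2) x = (of_int x - of_int a)\<^sup>2 + s2"
proof -
  have "P (\<lambda>y. (of_int y - of_int a)\<^sup>2) x = E (\<lambda>\<xi>. (of_int x - of_int a)\<^sup>2 + (2 * (of_int x - of_int a) * of_int \<xi> + (of_int \<xi>)\<^sup>2))"
    unfolding P_def by (intro Bochner_Integration.integral_cong) (auto simp: power2_eq_square algebra_simps)
  then show ?thesis using int_id int_sq mean_zero by (simp add: s2_def)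
qed

text \<open>The function \<open>((x - x0)^2 + s2 * t) / r^2\<close>, with \<open>t\<close> the
  remaining time, is preserved by the free walk and is at least 1 outside \<open>W\<close>. Hence it
  dominates the probability of leaving \<open>W\<close>.\<close>

lemma window_defect:
  assumes r: "r > 0" and win: "\<And>y. y \<notin> W \<Longrightarrow> \<bar>of_int y - of_int x0\<bar> \<ge> r" and x: "x \<in> W"
  shows "1 \<le> row_sum (tk p (indicator W)) t x + ennreal (((of_int x - of_int x0)\<^sup>2 + s2 * t) / r\<^sup>2)"
  using x
proof (induction t arbitrary: x)
  case 0
  then show ?case by (simp add: row_sum_0)
next
  case (Suc t)
  define h where "h y = ((of_int y - of_int x0)\<^sup>2 + s2 * t) / r\<^sup>2" for y
  have h0: "h y \<ge> 0" for y using s2_pos by (auto simp: h_def)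
  note qsq = qb_sq_shift[of x0]
  have qh: "quad_bounded h"
    unfolding h_def[abs_def] divide_inverse
    by (subst mult.commute) (intro qb_cmult qb_add qsq qb_bounded[where C="\<bar>s2 * t\<bar>"], simp)
  have Ph: "P h x = ((of_int x - of_int x0)\<^sup>2 + s2 * Suc t) / r\<^sup>2"
  proof -
    note P_sq_shift[of x0 x]
    moreover have "P h x = (P (\<lambda>y. (of_int y - of_int x0)\<^sup>2) x + s2 * t) / r\<^sup>2"
    proof -
      have qc: "quad_bounded (\<lambda>_. s2 * t)" by (rule qb_bounded[where C="\<bar>s2 * t\<bar>"]) simp
      have "h = (\<lambda>y. inverse (r\<^sup>2) * ((of_int y - of_int x0)\<^sup>2 + s2 * t))"
        by (auto simp: h_def fun_eq_iff divide_inverse)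
      then have "P h x = inverse (r\<^sup>2) * P (\<lambda>y. (of_int y - of_int x0)\<^sup>2 + s2 * t) x"
        by (simp only: P_cmult)
      also have "\<dots> = inverse (r\<^sup>2) * (P (\<lambda>y. (of_int y - of_int x0)\<^sup>2) x + s2 * t)"
        by (simp only: P_add[OF qsq qc] P_const)
      finally show ?thesis by (simp add: divide_inverse)
    qed
    ultimately show ?thesis by (simp add: algebra_simps)
  qed
  have "1 = nsum (\<lambda>y. ennreal (pmf p (y - x)))" by (simp add: nsum_pmf_1)
  also have "\<dots> \<le> nsum (\<lambda>y. tk p (indicator W) x y * row_sum (tk p (indicator W)) t y + ennreal (pmf p (y - x)) * ennreal (h y))"
  proof (rule nsum_mono)
    fix y
    show "ennreal (pmf p (y - x)) \<le> tk p (indicator W) x y * row_sum (tk p (indicator W)) t y + ennreal (pmf p (y - x)) * ennreal (h y)"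
    proof (cases "y \<in> W")
      case True
      have "ennreal (pmf p (y - x)) * 1 \<le> ennreal (pmf p (y - x)) * (row_sum (tk p (indicator W)) t y + ennreal (h y))"
        using Suc.IH[OF True] by (intro mult_left_mono) (auto simp: h_def)
      then show ?thesis using True Suc.prems by (simp add: tk_def distrib_left)
    next
      case False
      have "r\<^sup>2 \<le> \<bar>of_int y - of_int x0\<bar>\<^sup>2" using win[OF False] r by (intro power_mono) auto
      then have "1 \<le> h y" using r s2_pos by (simp add: h_def add_increasing2)
      then have "1 \<le> ennreal (h y)" using ennreal_leI[of 1 "h y"] by simp
      then have "ennreal (pmf p (y - x)) * 1 \<le> ennreal (pmf p (y - x)) * ennreal (h y)"
        by (intro mult_left_mono) auto
      then show ?thesis by (simp add: add_increasing)
    qed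
  qed
  also have "\<dots> = row_sum (tk p (indicator W)) (Suc t) x + ennreal (P h x)"
    by (subst nsum_add) (simp add: row_sum_Suc nsum_pmf_P[OF qh h0])
  finally show ?case by (simp add: Ph)
qed

lemma defect_row:
  assumes r: "r > 0" and win: "\<And>y. y \<notin> W \<Longrightarrow> \<bar>of_int y - of_int x\<bar> \<ge> r" and x: "x \<in> W"
  shows "nsum (\<lambda>z. kpow (tk p (\<lambda>_. 1)) t x z - kpow (tk p (indicator W)) t x z) \<le> ennreal (s2 * t / r\<^sup>2)"
proof -
  let ?K = "tk p (indicator W)"
  have le: "kpow ?K t x z \<le> kpow (tk p (\<lambda>_. 1)) t x z" for z
    using kpow_le_free[of "indicator W"] by (simp add: kpow_free indicator_def)
  have one: "nsum (kpow (tk p (\<lambda>_. 1)) t x) = 1"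
    by (simp add: kpow_free[abs_def] nsum_pmf_shift[of "nstep p t" x "\<lambda>_. 1", simplified])
  have rs1: "nsum (kpow ?K t x) \<le> 1" unfolding one[symmetric] by (intro nsum_mono le)
  have "nsum (\<lambda>z. kpow (tk p (\<lambda>_. 1)) t x z - kpow ?K t x z) = 1 - row_sum ?K t x"
    using le rs1 by (subst nn_integral_diff) (auto simp: one row_sum_def top_unique)
  also have "\<dots> \<le> ennreal (s2 * t / r\<^sup>2)"
    using window_defect[OF r win x, of t] x by (simp add: ennreal_minus_le_iff add.commute)
  finally show ?thesis .
qed

end

lemma defect_col:
  assumes "walk p" "r > 0" "\<And>x. x \<notin> W \<Longrightarrow> \<bar>of_int x - of_int y\<bar> \<ge> r" "y \<in> W"
  shows "nsum (\<lambda>z. kpow (tk p (\<lambda>_. 1)) t z y - kpow (tk p (indicator W)) t z y) \<le> ennreal (walk.s2 p * t / r\<^sup>2)"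
proof -
  interpret walk p by fact
  show ?thesis
    using walk.defect_row[OF walk_mirror assms(2-4), of t] by (simp add: kpow_mirror s2_mirror)
qed

context walk
begin

text \<open>Killing must be controlled at a single end point, not only in total mass. The time is
  cut in two: where one part carries the loss, summed over sites by \<open>defect_row\<close> or
  \<open>defect_col\<close>, the other part supplies the pointwise factor \<open>U\<close>.\<close>

lemma killed_lower:
  assumes r: "r > 0" and winx: "\<And>y. y \<notin> W \<Longrightarrow> \<bar>of_int y - of_int x\<bar> \<ge> r" and x: "x \<in> W"
    and winy: "\<And>z. z \<notin> W \<Longrightarrow> \<bar>of_int z - of_int y\<bar> \<ge> r" and y: "y \<in> W"
    and U: "U \<ge> 0" "\<And>k. pmf (nstep p t1) k \<le> U" "\<And>k. pmf (nstep p t2) k \<le> U"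
  shows "ennreal (pmf (nstep p (t1 + t2)) (y - x)) \<le> kpow (tk p (indicator W)) (t1 + t2) x y + ennreal (U * (s2 * (t1 + t2) / r\<^sup>2))"
proof -
  let ?K = "tk p (indicator W)" let ?F = "tk p (\<lambda>_. 1)"
  have le: "kpow ?K t a b \<le> kpow ?F t a b" for t a b
    using kpow_le_free[of "indicator W"] by (simp add: kpow_free indicator_def)
  have fin: "kpow ?F t a b \<noteq> \<top>" for t a b by (simp add: kpow_free)
  have split: "kpow ?F t a b = kpow ?K t a b + (kpow ?F t a b - kpow ?K t a b)" for t a b
    using le[of t a b] fin[of t a b] by (metis add_diff_inverse_ennreal)
  have FU: "kpow ?F t1 a b \<le> ennreal U" "kpow ?F t2 a b \<le> ennreal U" for a b
    using U by (auto simp: kpow_free ennreal_leI)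
  have "kpow ?F (t1 + t2) x y = nsum (\<lambda>z. kpow ?F t1 x z * kpow ?F t2 z y)" by (rule kpow_add)
  also have "\<dots> \<le> nsum (\<lambda>z. kpow ?K t1 x z * kpow ?K t2 z y + ((kpow ?F t1 x z - kpow ?K t1 x z) * ennreal U
      + ennreal U * (kpow ?F t2 z y - kpow ?K t2 z y)))"
  proof (rule nsum_mono)
    fix z
    have "kpow ?F t1 x z * kpow ?F t2 z y = kpow ?K t1 x z * kpow ?F t2 z y + (kpow ?F t1 x z - kpow ?K t1 x z) * kpow ?F t2 z y"
      by (subst split) (rule distrib_right)
    also have "kpow ?K t1 x z * kpow ?F t2 z y = kpow ?K t1 x z * kpow ?K t2 z y + kpow ?K t1 x z * (kpow ?F t2 z y - kpow ?K t2 z y)"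
      by (subst (1) split) (rule distrib_left)
    also have "kpow ?K t1 x z * (kpow ?F t2 z y - kpow ?K t2 z y) \<le> ennreal U * (kpow ?F t2 z y - kpow ?K t2 z y)"
      by (intro mult_right_mono order_trans[OF le FU(1)]) auto
    also have "(kpow ?F t1 x z - kpow ?K t1 x z) * kpow ?F t2 z y \<le> (kpow ?F t1 x z - kpow ?K t1 x z) * ennreal U"
      by (intro mult_left_mono FU) auto
    finally show "kpow ?F t1 x z * kpow ?F t2 z y \<le> kpow ?K t1 x z * kpow ?K t2 z y + ((kpow ?F t1 x z - kpow ?K t1 x z) * ennreal U
      + ennreal U * (kpow ?F t2 z y - kpow ?K t2 z y))" by (simp add: add_ac)
  qed
  also have "\<dots> = kpow ?K (t1 + t2) x y + (nsum (\<lambda>z. kpow ?F t1 x z - kpow ?K t1 x z) * ennreal U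
      + ennreal U * nsum (\<lambda>z. kpow ?F t2 z y - kpow ?K t2 z y))"
    by (simp only: nsum_add nsum_cmult nsum_multc kpow_add)
  also have "\<dots> \<le> kpow ?K (t1 + t2) x y + (ennreal (s2 * t1 / r\<^sup>2) * ennreal U + ennreal U * ennreal (s2 * t2 / r\<^sup>2))"
    by (intro add_left_mono add_mono mult_left_mono mult_right_mono defect_row[OF r winx x] defect_col[OF walk_axioms r winy y]) auto
  also have "ennreal (s2 * t1 / r\<^sup>2) * ennreal U + ennreal U * ennreal (s2 * t2 / r\<^sup>2) = ennreal (U * (s2 * (t1 + t2) / r\<^sup>2))"
    using U s2_pos by (simp add: ennreal_mult[symmetric] ennreal_plus[symmetric] del: ennreal_plus) (simp add: algebra_simps add_divide_distrib)
  finally show ?thesis by (simp add: kpow_free)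
qed

end

section \<open>Lower bounds in the bulk by chaining short steps\<close>

context walk
begin

text \<open>Over times short compared with \<open>r^2\<close> the loss at the boundary of the window
  is at most half of the local lower bound; \<open>J\<close> such steps are then chained.\<close>

lemma bulk_lower_window:
  fixes M :: nat and \<sigma> \<tau> :: real
  assumes M: "M \<ge> 2" and \<sigma>: "\<sigma> > 0" and \<tau>: "\<tau> > 0"
  obtains c :: real and r0 :: nat where "c > 0" "r0 \<ge> 1"
    "\<And>r x y t. r \<ge> r0 \<Longrightarrow> x \<in> {int r..int (M * r)} \<Longrightarrow> y \<in> {int r..int (M * r)} \<Longrightarrow>
      \<sigma> * (real r)\<^sup>2 \<le> real t \<Longrightarrow> real t \<le> \<tau> * (real r)\<^sup>2 \<Longrightarrow>
      ennreal (c / r) \<le> kpow (tk p (indicator {0..int ((M + 1) * r)})) t x y"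
proof -
  obtain c0 n0 where c0: "c0 > 0" "n0 \<ge> 1"
    "\<And>n k. n \<ge> n0 \<Longrightarrow> \<bar>of_int k\<bar> \<le> sqrt n \<Longrightarrow> pmf (nstep p n) k \<ge> c0 / sqrt n"
    by (rule local_lower) blast
  obtain C where C: "C > 0" "\<And>n k. n \<ge> 1 \<Longrightarrow> pmf (nstep p n) k \<le> C / sqrt n"
    by (rule local_upper) blast
  \<comment> \<open>The three lower bounds on \<open>J\<close> let \<open>J\<close> steps of length
    \<open>d\<close> cross the bulk, keep \<open>sqrt k \<le> r\<close>, and make the killing loss
    at most half of the local lower bound.\<close>
  define J where "J = Suc (nat \<lceil>max (32 * (real M)\<^sup>2 / \<sigma>) (max \<tau> (8 * C * s2 * \<tau> / c0))\<rceil>)"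
  have "real J \<ge> max (32 * (real M)\<^sup>2 / \<sigma>) (max \<tau> (8 * C * s2 * \<tau> / c0))" and J1: "J \<ge> 1"
    unfolding J_def by linarith+
  then have J: "real J \<ge> 32 * (real M)\<^sup>2 / \<sigma>" "real J \<ge> \<tau>" "real J \<ge> 8 * C * s2 * \<tau> / c0" by auto
  define r0 where "r0 = Suc (nat \<lceil>2 * J * (16 + real n0) / \<sigma>\<rceil>)"
  define c where "c = c0 / 4 / sqrt \<tau> * (c0 / 16) ^ (J - 1)"
  show ?thesis
  proof (rule that[of c r0])
    show "c > 0" using c0 \<tau> by (simp add: c_def)
    show "r0 \<ge> 1" by (simp add: r0_def)
    fix r t :: nat and x y :: int
    assume r: "r \<ge> r0" and x: "x \<in> {int r..int (M * r)}" and y: "y \<in> {int r..int (M * r)}"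
      and t: "\<sigma> * (real r)\<^sup>2 \<le> real t" "real t \<le> \<tau> * (real r)\<^sup>2"
    have r1: "real r \<ge> 1" using r by (simp add: r0_def)
    let ?W = "{0..int ((M + 1) * r)}"
    let ?K = "tk p (indicator ?W)"
    have "real r \<ge> 2 * J * (16 + real n0) / \<sigma>" using r unfolding r0_def by linarith
    then have "\<sigma> * real r \<ge> 2 * J * (16 + real n0)" using \<sigma> by (simp add: field_simps)
    also have "\<sigma> * real r \<le> \<sigma> * (real r)\<^sup>2"
      using \<sigma> r1 by (intro mult_left_mono) (auto simp: power2_eq_square)
    finally have tJ: "real t \<ge> 2 * J * (16 + real n0)" using t by linarith
    define k where "k = t div J"
    have kt: "J * k \<le> t" "t \<le> J * Suc k"
    proof -
      show "J * k \<le> t" by (simp add: k_def)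
      have "t < J * Suc k" using dividend_less_div_times[of J t] J1 by (simp add: k_def mult.commute)
      then show "t \<le> J * Suc k" by simp
    qed
    have ktR: "real J * k \<le> t" "t \<le> real J * k + J"
    proof -
      show "real J * k \<le> t" using kt(1) by (metis of_nat_le_iff of_nat_mult)
      have "real t \<le> real (J * Suc k)" using kt(2) by (simp only: of_nat_le_iff)
      then show "t \<le> real J * k + J" by (simp add: algebra_simps)
    qed
    have Jpos: "real J \<ge> 1" using J1 by simp
    have k16: "real k \<ge> 16 + real n0"
    proof -
      have "real J * (16 + real n0) \<ge> real J * 1" by (intro mult_left_mono) auto
      with tJ ktR have "real J * (16 + real n0) \<le> real J * k" by linarith
      then show ?thesis using Jpos by simp
    qed
    have k2: "real t \<le> 2 * (real J * real k)"
    proof -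
      have "real J * 1 \<le> real J * k" using k16 by (intro mult_left_mono) auto
      then show ?thesis using ktR by simp
    qed
    have sk: "sqrt k \<ge> 4" using k16 real_le_rsqrt[of 4 "real k"] by simp
    \<comment> \<open>A chain step covers up to \<open>2 * d \<le> sqrt k\<close>, the range of the
      local lower bound.\<close>
    define d where "d = \<lfloor>sqrt k / 2\<rfloor>"
    have d1: "real_of_int d \<le> sqrt k / 2" "real_of_int d \<ge> sqrt k / 4"
      unfolding d_def using sk by linarith+
    have d2: "d \<ge> 1" using d1 sk by linarith
    have kr: "real k \<le> (real r)\<^sup>2"
    proof -
      have "real J * k \<le> \<tau> * (real r)\<^sup>2" using ktR t by linarith
      also have "\<dots> \<le> real J * (real r)\<^sup>2" using J by (intro mult_right_mono) auto
      finally show ?thesis using Jpos by simp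
    qed
    have krs: "sqrt k \<le> r" using kr by (simp add: real_le_lsqrt)
    define \<beta> where "\<beta> = c0 / 4 / sqrt k"
    have base: "ennreal \<beta> \<le> kpow ?K t' a b"
      if a: "int r \<le> a" "a \<le> int (M * r)" and b: "int r \<le> b" "b \<le> int (M * r)" and ab: "\<bar>a - b\<bar> \<le> 2 * d" and t': "t' = k \<or> t' = Suc k"
      for a b t'
    proof -
      \<comment> \<open>Both halves are at least a third of \<open>t'\<close>, so both have
        transition probabilities of order \<open>1 / sqrt t'\<close>.\<close>
      define t1 where "t1 = t' div 2"
      define t2 where "t2 = t' - t1"
      have tt: "t' = t1 + t2" "t' \<le> 3 * t1" "t' \<le> 3 * t2" "t1 \<ge> 1" "t2 \<ge> 1"
        using t' k16 by (auto simp: t1_def t2_def)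
      have t'k: "k \<le> t'" "real t' \<le> 2 * real k" using t' k16 by auto
      have t'0: "real t' > 0" using t'k k16 by linarith
      have pm: "pmf (nstep p s) z \<le> C * 2 / sqrt t'" if "s \<ge> 1" "t' \<le> 3 * s" for s z
      proof -
        have "pmf (nstep p s) z \<le> C / sqrt s" using C(2) that by blast
        also have "\<dots> \<le> C * 2 / sqrt t'"
        proof -
          have "sqrt t' \<le> sqrt (4 * s)" using that by (intro real_sqrt_le_mono) linarith
          also have "\<dots> = 2 * sqrt s" by (simp add: real_sqrt_mult)
          finally show ?thesis using C(1) that t'0 by (simp add: field_simps)
        qed
        finally show ?thesis .
      qed
      let ?U = "C * 2 / sqrt t'"
      have win: "\<bar>of_int z - of_int a\<bar> \<ge> real r" if "int r \<le> a" "a \<le> int (M * r)" "z \<notin> ?W" for z a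
      proof -
        have "\<bar>z - a\<bar> \<ge> int r" using that by (auto simp: algebra_simps)
        then have "real_of_int \<bar>z - a\<bar> \<ge> of_int (int r)" by (simp only: of_int_le_iff)
        then show ?thesis by simp
      qed
      have inW: "a \<in> ?W" "b \<in> ?W" using a b by (auto simp: algebra_simps)
      have "ennreal (pmf (nstep p (t1 + t2)) (b - a)) \<le> kpow ?K (t1 + t2) a b + ennreal (?U * (s2 * (t1 + t2) / (real r)\<^sup>2))"
        by (rule killed_lower) (use r1 a b inW win pm tt C t'0 in auto)
      then have "ennreal (pmf (nstep p t') (b - a)) \<le> kpow ?K t' a b + ennreal (?U * (s2 * t' / (real r)\<^sup>2))"
        by (simp add: tt(1))
      also have "ennreal (?U * (s2 * t' / (real r)\<^sup>2)) \<le> ennreal (c0 / 2 / sqrt t')"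
      proof (rule ennreal_leI)
        have "real J * real t' \<le> real J * (2 * real k)" using t'k by (intro mult_left_mono) auto
        also have "\<dots> \<le> 2 * \<tau> * (real r)\<^sup>2" using ktR t by simp
        finally have "t' / (real r)\<^sup>2 \<le> 2 * \<tau> / J" using Jpos r1 by (simp add: field_simps)
        then have "C * 2 * s2 * (t' / (real r)\<^sup>2) \<le> C * 2 * s2 * (2 * \<tau> / J)"
          using C s2_pos by (intro mult_left_mono) auto
        also have "\<dots> \<le> c0 / 2" using J(3) c0 Jpos by (simp add: field_simps)
        finally have "C * 2 * s2 * (t' / (real r)\<^sup>2) / sqrt t' \<le> c0 / 2 / sqrt t'"
          by (rule divide_right_mono) simp
        then show "?U * (s2 * t' / (real r)\<^sup>2) \<le> c0 / 2 / sqrt t'" by (simp add: mult_ac)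
      qed
      finally have 1: "ennreal (pmf (nstep p t') (b - a)) \<le> kpow ?K t' a b + ennreal (c0 / 2 / sqrt t')"
        by (simp add: add_left_mono)
      have "\<bar>of_int (b - a)\<bar> \<le> sqrt t'"
      proof -
        have "real_of_int \<bar>b - a\<bar> \<le> of_int (2 * d)" using ab by (subst of_int_le_iff) auto
        also have "\<dots> \<le> sqrt k" using d1 by simp
        also have "\<dots> \<le> sqrt t'" using t'k by simp
        finally show ?thesis by simp
      qed
      then have "pmf (nstep p t') (b - a) \<ge> c0 / sqrt t'"
        using t'k k16 by (intro c0(3)) auto
      then have "ennreal (c0 / 2 / sqrt t' + c0 / 2 / sqrt t') \<le> ennreal (pmf (nstep p t') (b - a))"
        by (intro ennreal_leI) simp
      from this 1 have "ennreal (c0 / 2 / sqrt t' + c0 / 2 / sqrt t') \<le> kpow ?K t' a b + ennreal (c0 / 2 / sqrt t')"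
        by (rule order_trans)
      moreover have "ennreal (c0 / 2 / sqrt t' + c0 / 2 / sqrt t') = ennreal (c0 / 2 / sqrt t') + ennreal (c0 / 2 / sqrt t')"
        using c0 by (intro ennreal_plus) auto
      ultimately have "ennreal (c0 / 2 / sqrt t') + ennreal (c0 / 2 / sqrt t') \<le> kpow ?K t' a b + ennreal (c0 / 2 / sqrt t')"
        by (simp only:)
      then have "ennreal (c0 / 2 / sqrt t') \<le> kpow ?K t' a b"
        by (subst (asm) (1 2) add.commute) (simp add: ennreal_add_left_cancel_le)
      moreover have "\<beta> \<le> c0 / 2 / sqrt t'"
      proof -
        have "sqrt t' \<le> sqrt (4 * k)" using t'k by (intro real_sqrt_le_mono) simp
        also have "\<dots> = 2 * sqrt k" by (simp add: real_sqrt_mult)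
        finally have "c0 / 2 / (2 * sqrt k) \<le> c0 / 2 / sqrt t'"
          using c0(1) t'0 k16 by (intro divide_left_mono mult_pos_pos) auto
        then show ?thesis by (simp add: \<beta>_def)
      qed
      ultimately show ?thesis using ennreal_leI order_trans by blast
    qed
    have room: "2 * d \<le> int (M * r) - int r"
    proof -
      have "real_of_int (2 * d) \<le> r" using d1 krs by simp
      also have "real r \<le> real M * r - r" using M r1 mult_right_mono[of 2 "real M" "real r"] by simp
      finally have "real_of_int (2 * d) \<le> real_of_int (int (M * r) - int r)" by simp
      then show ?thesis by (simp only: of_int_le_iff)
    qed
    have dist: "\<bar>x - y\<bar> \<le> (int (J - 1) + 2) * d"
    proof -
      have "(real M * r)\<^sup>2 \<le> (J * sqrt k / 4)\<^sup>2"
      proof -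
        have "32 * (real M)\<^sup>2 \<le> \<sigma> * J" using J(1) \<sigma> by (simp add: field_simps)
        then have "32 * (real M)\<^sup>2 * (real r)\<^sup>2 \<le> \<sigma> * J * (real r)\<^sup>2" by (intro mult_right_mono) auto
        also have "\<dots> = J * (\<sigma> * (real r)\<^sup>2)" by simp
        also have "\<dots> \<le> real J * (2 * (real J * real k))" using t k2 by (intro mult_left_mono) auto
        finally show ?thesis by (simp add: power_mult_distrib power_divide power2_eq_square[of "real J"])
      qed
      then have "real M * r \<le> J * sqrt k / 4" by (rule power2_le_imp_le) simp
      also have "J * sqrt k / 4 = J * (sqrt k / 4)" by simp
      also have "\<dots> \<le> J * real_of_int d" using d1(2) by (rule mult_left_mono) simp
      finally have "int (M * r) \<le> int J * d" by (metis of_int_le_iff of_int_mult of_int_of_nat_eq of_nat_mult)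
      then have "\<bar>x - y\<bar> \<le> int J * d" using x y by auto
      also have "\<dots> \<le> (int (J - 1) + 2) * d" using d2 J1 by (intro mult_right_mono) auto
      finally show ?thesis .
    qed
    have "ennreal (\<beta> * (\<beta> * of_int d) ^ (J - 1)) \<le> kpow ?K t x y"
      by (rule kpow_chain[OF d2 room _ base])
         (use x y dist kt J1 c0 in \<open>auto simp: \<beta>_def\<close>)
    moreover have "c / r \<le> \<beta> * (\<beta> * of_int d) ^ (J - 1)"
    proof -
      have "c0 / 16 \<le> \<beta> * of_int d"
      proof -
        have "c0 / 16 = \<beta> * (sqrt k / 4)" using k16 by (simp add: \<beta>_def)
        also have "\<dots> \<le> \<beta> * of_int d" using d1 c0 by (intro mult_left_mono) (auto simp: \<beta>_def)
        finally show ?thesis .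
      qed
      then have 1: "(c0 / 16) ^ (J - 1) \<le> (\<beta> * of_int d) ^ (J - 1)" using c0 by (intro power_mono) auto
      have "real k \<le> \<tau> * (real r)\<^sup>2"
      proof -
        have "1 * real k \<le> real J * k" using Jpos by (intro mult_right_mono) auto
        then show ?thesis using ktR t by linarith
      qed
      then have "sqrt k \<le> sqrt (\<tau> * (real r)\<^sup>2)" by (rule real_sqrt_le_mono)
      then have "sqrt k \<le> sqrt \<tau> * r" by (simp add: real_sqrt_mult)
      then have "c0 / 4 / (sqrt \<tau> * r) \<le> \<beta>"
        unfolding \<beta>_def using c0(1) k16 \<tau> r1 by (intro divide_left_mono mult_pos_pos) auto
      then have "c0 / 4 / (sqrt \<tau> * r) * (c0 / 16) ^ (J - 1) \<le> \<beta> * (\<beta> * of_int d) ^ (J - 1)"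
        using 1 c0 by (intro mult_mono) (auto simp: \<beta>_def)
      then show ?thesis by (simp add: c_def)
    qed
    ultimately show "ennreal (c / r) \<le> kpow ?K t x y" using ennreal_leI order_trans by blast
  qed
qed

end

section \<open>The kernel at one scale\<close>

text \<open>The scale \<open>r\<close> is admissible for the site weight \<open>u\<close> if \<open>r\<^sup>2\<close> steps below height \<open>M * r\<close>
  cost at most a factor depending on \<open>M\<close> only.\<close>

definition adm :: "(nat \<Rightarrow> real) \<Rightarrow> (int \<Rightarrow> real) \<Rightarrow> nat \<Rightarrow> bool" where
  "adm b u r \<longleftrightarrow> (\<forall>x. 0 \<le> u x \<and> u x \<le> 1) \<and> (\<forall>x<0. u x = 0) \<and>
     (\<forall>M x. 0 \<le> x \<and> x \<le> int (M * r) \<longrightarrow> exp (- b M / (real r)\<^sup>2) \<le> u x)"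

lemma tk_lower:
  assumes "\<eta> \<ge> 0" "\<eta> \<le> u x" "\<eta> \<le> u y"
  shows "ennreal (\<eta>\<^sup>2) * ennreal (pmf p (y - x)) \<le> tk p u x y"
proof -
  have "\<eta> * \<eta> * pmf p (y - x) \<le> u x * u y * pmf p (y - x)"
    using assms by (intro mult_right_mono mult_mono) auto
  then show ?thesis
    by (simp add: tk_def ennreal_mult[symmetric] power2_eq_square ennreal_leI)
qed

lemma nsum_int_multc: "nsum (\<lambda>y. ennreal c * indicator {int a..int b} y) = ennreal (c * real (Suc b - a))" if "c \<ge> 0"
proof -
  have "card {int a..int b} = Suc b - a" by simp
  then show ?thesis
    using that by (simp add: nsum_indicator ennreal_of_nat_eq_real_of_nat ennreal_mult[symmetric])
qed

context walk
begin

text \<open>Inside the window the weights over at most \<open>\<tau> * r^2\<close> steps multiply to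
  at least \<gamma>, by admissibility at height \<open>M + 1\<close>.\<close>

lemma bulk_lower:
  fixes M :: nat and \<sigma> \<tau> :: real
  assumes M: "M \<ge> 2" and \<sigma>: "\<sigma> > 0" and \<tau>: "\<tau> > 0"
  obtains c :: real and r0 :: nat where "c > 0" "r0 \<ge> 1"
    "\<And>r u x y t. r \<ge> r0 \<Longrightarrow> adm b u r \<Longrightarrow> x \<in> {int r..int (M * r)} \<Longrightarrow> y \<in> {int r..int (M * r)} \<Longrightarrow>
      \<sigma> * (real r)\<^sup>2 \<le> real t \<Longrightarrow> real t \<le> \<tau> * (real r)\<^sup>2 \<Longrightarrow> ennreal (c / r) \<le> kpow (tk p u) t x y"
proof -
  obtain c r0 where c: "c > 0" "r0 \<ge> 1"
    "\<And>r x y t. r \<ge> r0 \<Longrightarrow> x \<in> {int r..int (M * r)} \<Longrightarrow> y \<in> {int r..int (M * r)} \<Longrightarrow>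
      \<sigma> * (real r)\<^sup>2 \<le> real t \<Longrightarrow> real t \<le> \<tau> * (real r)\<^sup>2 \<Longrightarrow>
      ennreal (c / r) \<le> kpow (tk p (indicator {0..int ((M + 1) * r)})) t x y"
    using bulk_lower_window[OF M \<sigma> \<tau>] by metis
  define \<gamma> where "\<gamma> = exp (- (2 * \<bar>b (M + 1)\<bar> * \<tau>))"
  show ?thesis
  proof (rule that[of "\<gamma> * c" r0])
    show "\<gamma> * c > 0" "r0 \<ge> 1" using c by (auto simp: \<gamma>_def)
    fix r t :: nat and u :: "int \<Rightarrow> real" and x y :: int
    assume r: "r \<ge> r0" and adm: "adm b u r" and xy: "x \<in> {int r..int (M * r)}" "y \<in> {int r..int (M * r)}"
      and t: "\<sigma> * (real r)\<^sup>2 \<le> real t" "real t \<le> \<tau> * (real r)\<^sup>2"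
    have r1: "real r \<ge> 1" using r c by simp
    define \<eta> where "\<eta> = exp (- b (M + 1) / (real r)\<^sup>2)"
    have \<eta>: "\<eta> > 0" by (simp add: \<eta>_def)
    have "\<gamma> \<le> (\<eta>\<^sup>2) ^ t"
    proof -
      have "2 * b (M + 1) * t \<le> 2 * \<bar>b (M + 1)\<bar> * t" by (intro mult_right_mono) auto
      also have "\<dots> \<le> 2 * \<bar>b (M + 1)\<bar> * (\<tau> * (real r)\<^sup>2)" using t by (intro mult_left_mono) auto
      finally have "2 * b (M + 1) * t / (real r)\<^sup>2 \<le> 2 * \<bar>b (M + 1)\<bar> * (\<tau> * (real r)\<^sup>2) / (real r)\<^sup>2"
        by (rule divide_right_mono) simp
      also have "\<dots> = 2 * \<bar>b (M + 1)\<bar> * \<tau>" using r1 by simp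
      finally have "\<gamma> \<le> exp (- (2 * b (M + 1) * t / (real r)\<^sup>2))" by (simp add: \<gamma>_def)
      also have "\<dots> = (\<eta>\<^sup>2) ^ t" by (simp add: \<eta>_def exp_of_nat_mult[symmetric] power_mult[symmetric])
      finally show ?thesis .
    qed
    have "ennreal (\<gamma> * c / r) = ennreal \<gamma> * ennreal (c / r)"
      using c(1) by (subst ennreal_mult[symmetric]) (auto simp: \<gamma>_def)
    also have "\<dots> \<le> ennreal ((\<eta>\<^sup>2) ^ t) * kpow (tk p (indicator {0..int ((M + 1) * r)})) t x y"
      using c(3)[OF r xy t] \<open>\<gamma> \<le> (\<eta>\<^sup>2) ^ t\<close> by (intro mult_mono ennreal_leI) auto
    also have "\<dots> = ennreal (\<eta>\<^sup>2) ^ t * kpow (tk p (indicator {0..int ((M + 1) * r)})) t x y"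
      by (simp add: ennreal_power)
    also have "\<dots> \<le> kpow (tk p u) t x y"
    proof (rule kpow_scale)
      fix a a'
      show "ennreal (\<eta>\<^sup>2) * tk p (indicator {0..int ((M + 1) * r)}) a a' \<le> tk p u a a'"
      proof (cases "a \<in> {0..int ((M + 1) * r)} \<and> a' \<in> {0..int ((M + 1) * r)}")
        case True
        then have "\<eta> \<le> u a" "\<eta> \<le> u a'" using adm unfolding adm_def \<eta>_def by (metis atLeastAtMost_iff)+
        then show ?thesis using tk_lower[of \<eta> u a a' p] \<eta> True by (simp add: tk_def[of p "indicator _"])
      qed (auto simp: tk_def[of p "indicator _"])
    qed
    finally show "ennreal (\<gamma> * c / r) \<le> kpow (tk p u) t x y" .
  qed
qed

lemma admD: "adm b u r \<Longrightarrow> 0 \<le> u x \<and> u x \<le> 1" "adm b u r \<Longrightarrow> x < 0 \<Longrightarrow> u x = 0"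
  by (auto simp: adm_def)

lemma row_sum_le_1: "adm b u r \<Longrightarrow> row_sum (tk p u) t x \<le> 1"
proof (induction t arbitrary: x)
  case (Suc t)
  have "row_sum (tk p u) (Suc t) x \<le> nsum (\<lambda>y. ennreal (pmf p (y - x)))"
    unfolding row_sum_Suc using Suc mult_mono[OF tk_le_pmf[of u x] Suc.IH] admD(1)[OF Suc.prems]
    by (intro nsum_mono) fastforce
  then show ?case by (simp add: nsum_pmf_1)
qed (simp add: row_sum_0)

lemma row_neg: "adm b u r \<Longrightarrow> x < 0 \<Longrightarrow> t \<ge> 1 \<Longrightarrow> kpow (tk p u) t x y = 0"
  by (cases t) (simp_all add: tk_def admD(2))

text \<open>Stopping at the first exit from \<open>[0, r)\<close> only increases the chance not to have turned negative.\<close>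

lemma nsum_le_stop:
  assumes adm: "adm b u r" and D: "D \<subseteq> {0..}" and quad_bounded: "quad_bounded g" and g: "\<And>x. g x \<ge> 0"
    and out: "\<And>x n. x \<notin> D \<or> n = 0 \<Longrightarrow> F n x \<le> ennreal (g x)"
    and step: "\<And>x n. x \<in> D \<Longrightarrow> F (Suc n) x \<le> nsum (\<lambda>y. tk p u x y * F n y)"
  shows "F n x \<le> ennreal (stop D g n x)"
proof (induction n arbitrary: x)
  case 0
  then show ?case using out by simp
next
  case (Suc n)
  show ?case
  proof (cases "x \<in> D")
    case True
    have nn: "stop D g n y \<ge> 0" for y
      using stop_mono[of "\<lambda>_. 0" g D n y] quad_bounded g by (simp add: stop_const qb_bounded[where C=0])
    have "F (Suc n) x \<le> nsum (\<lambda>y. tk p u x y * F n y)" by (rule step[OF True])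
    also have "\<dots> \<le> nsum (\<lambda>y. ennreal (pmf p (y - x)) * ennreal (stop D g n y))"
      by (intro nsum_mono mult_mono Suc tk_le_pmf) (use admD[OF adm] in auto)
    also have "\<dots> = ennreal (P (stop D g n) x)" by (rule nsum_pmf_P) (use nn quad_bounded qb_stop in auto)
    finally show ?thesis using True by simp
  next
    case False
    then show ?thesis using out by simp
  qed
qed

text \<open>At least one step after the stopping is required: it annihilates a negative position,
  where \<open>surv\<close> vanishes.\<close>

lemma row_sum_le_surv:
  assumes "adm b u r" "t \<ge> 1"
  shows "row_sum (tk p u) (t + n) x \<le> ennreal (surv r n x)"
proof -
  have neg: "row_sum (tk p u) (t + n) x \<le> ennreal (indicator {0..} x)" for n x
  proof (cases "x < 0")
    case True
    then show ?thesis using row_neg[OF assms(1), of x "t + n"] assms(2) by (simp add: row_sum_def)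
  qed (use row_sum_le_1[OF assms(1)] in auto)
  show ?thesis unfolding surv_def
    by (rule nsum_le_stop[OF assms(1), where F="\<lambda>n. row_sum (tk p u) (t + n)"])
       (use neg in \<open>auto simp: qb_ind row_sum_Suc\<close>)
qed

text \<open>A path that is at or above \<open>r\<close> at time \<open>i\<close> without having been
  killed must have left \<open>[0, r)\<close> upwards. Hence \<open>i\<close> and \<open>n\<close>
  are unrelated.\<close>

lemma high_le_surv:
  assumes adm: "adm b u r"
  shows "nsum (\<lambda>y. kpow (tk p u) i x y * indicator {int r..} y) \<le> ennreal (surv r n x)"
proof (induction n arbitrary: i x)
  case 0
  have row_sum: "nsum (\<lambda>y. kpow (tk p u) i x y * indicator {int r..} y) \<le> row_sum (tk p u) i x" for i x
    unfolding row_sum_def by (intro nsum_mono) (auto simp: indicator_def)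
  show ?case
  proof (cases "x < 0")
    case True
    have "nsum (\<lambda>y. kpow (tk p u) i x y * indicator {int r..} y) = 0"
    proof (cases "i = 0")
      case True
      then show ?thesis using \<open>x < 0\<close> nsum_delta[of x "indicator {int r..}"] by simp
    next
      case False
      then show ?thesis using row_neg[OF adm True] by simp
    qed
    then show ?thesis by simp
  next
    case False
    then show ?thesis using order_trans[OF row_sum row_sum_le_1[OF adm]] by (simp add: surv_def)
  qed
next
  case (Suc n)
  show ?case
  proof (cases "x \<in> {0..<int r}")
    case True
    show ?thesis
    proof (cases i)
      case 0
      then show ?thesis using True nsum_delta[of x "indicator {int r..}"] by simp
    next
      case (Suc j)
      have "nsum (\<lambda>y. kpow (tk p u) i x y * indicator {int r..} y) = nsum (\<lambda>z. tk p u x z * nsum (\<lambda>y. kpow (tk p u) j z y * indicator {int r..} y))"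
        unfolding Suc by (rule nsum_kpow_Suc)
      also have "\<dots> \<le> nsum (\<lambda>y. ennreal (pmf p (y - x)) * ennreal (surv r n y))"
        by (intro nsum_mono mult_mono Suc.IH tk_le_pmf) (use admD[OF adm] in auto)
      also have "\<dots> = ennreal (P (surv r n) x)"
        by (rule nsum_pmf_P) (use surv_bounds qb_stop[OF qb_ind] in \<open>auto simp: surv_def[abs_def]\<close>)
      also have "\<dots> = ennreal (surv r (Suc n) x)" using True by (simp add: surv_def[abs_def])
      finally show ?thesis .
    qed
  next
    case False
    then have "surv r (Suc n) x = surv r 0 x" by (auto simp: surv_def)
    moreover have "nsum (\<lambda>y. kpow (tk p u) i x y * indicator {int r..} y) \<le> ennreal (surv r 0 x)"
    proof (cases "x < 0")
      case True
      have "nsum (\<lambda>y. kpow (tk p u) i x y * indicator {int r..} y) = 0"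
        using True row_neg[OF adm True] nsum_delta[of x "indicator {int r..}"] by (cases "i = 0") auto
      then show ?thesis by simp
    next
      case False
      have "nsum (\<lambda>y. kpow (tk p u) i x y * indicator {int r..} y) \<le> row_sum (tk p u) i x"
        unfolding row_sum_def by (intro nsum_mono) (auto simp: indicator_def)
      then show ?thesis using False row_sum_le_1[OF adm, of i x] by (simp add: surv_def)
    qed
    ultimately show ?thesis by simp
  qed
qed

lemma sq_moment:
  assumes adm: "adm b u r" and x: "x \<ge> 0"
  shows "nsum (\<lambda>y. kpow (tk p u) t x y * ennreal ((of_int y)\<^sup>2)) \<le> ennreal ((of_int x)\<^sup>2 + s2 * exit_time {0..} t x)"
proof -
  let ?g = "\<lambda>x. (of_int x)\<^sup>2 * indicator {0..} x :: real"
  have pos: "kpow (tk p u) t x y * ennreal ((of_int y)\<^sup>2) = kpow (tk p u) t x y * ennreal (?g y)" if "x \<ge> 0 \<or> t \<ge> 1" for t x y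
  proof (cases "y < 0 \<and> x \<ge> 0")
    case True
    have "kpow (tk p u) t x y = 0"
    proof (cases t)
      case (Suc s)
      then show ?thesis unfolding Suc kpow_Suc' using True by (simp add: tk_def admD(2)[OF adm])
    qed (use True in auto)
    then show ?thesis by simp
  next
    case False
    then show ?thesis using row_neg[OF adm, of x t y] that by (auto simp: indicator_def)
  qed
  have "nsum (\<lambda>y. kpow (tk p u) t x y * ennreal (?g y)) \<le> ennreal (stop {0..} ?g t x)"
  proof (rule nsum_le_stop[OF adm, where F="\<lambda>t x. nsum (\<lambda>y. kpow (tk p u) t x y * ennreal (?g y))"])
    show "quad_bounded ?g" by (rule qb_dom[OF qb_sq]) (auto simp: indicator_def)
    fix x :: int and n :: nat
    assume "x \<notin> {0..} \<or> n = 0"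
    then show "nsum (\<lambda>y. kpow (tk p u) n x y * ennreal (?g y)) \<le> ennreal (?g x)"
      using row_neg[OF adm, of x n] nsum_delta[of x "\<lambda>x. ennreal (?g x)"] by (cases "n = 0") auto
  next
    fix x :: int and n :: nat
    show "nsum (\<lambda>y. kpow (tk p u) (Suc n) x y * ennreal (?g y)) \<le> nsum (\<lambda>y. tk p u x y * nsum (\<lambda>ya. kpow (tk p u) n y ya * ennreal (?g ya)))"
      by (simp only: nsum_kpow_Suc order_refl)
  qed auto
  also have "\<dots> \<le> ennreal ((of_int x)\<^sup>2 + s2 * exit_time {0..} t x)"
    by (intro ennreal_leI stop_half_line_sq)
  finally show ?thesis using pos x by simp
qed

text \<open>The path is followed until it leaves \<open>[0, r)\<close>, for at most \<open>n\<close>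
  steps at a price of at least \<open>\<eta>^2\<close> each; from its landing place in the bulk it
  has between \<open>t0\<close> and \<open>t1\<close> steps left, and \<open>bulk\<close>
  applies.\<close>

lemma enter_bulk:
  assumes adm: "adm b u r" and M: "M \<ge> 1" and c1: "c1 \<ge> 0"
    and bulk: "\<And>t z. t0 \<le> t \<Longrightarrow> t \<le> t1 \<Longrightarrow> z \<in> {int r..int (M * r)} \<Longrightarrow>
       ennreal c1 \<le> nsum (\<lambda>y. kpow (tk p u) t z y * indicator {int r..int (M * r)} y)"
    and \<eta>: "0 \<le> \<eta>" "\<eta> \<le> 1" "\<And>x. 0 \<le> x \<Longrightarrow> x \<le> int (M * r) \<Longrightarrow> \<eta> \<le> u x"
  shows "t0 + n \<le> t \<Longrightarrow> t \<le> t1 \<Longrightarrow> 0 \<le> x \<Longrightarrow> x \<le> int (M * r) \<Longrightarrow>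
    ennreal ((\<eta>\<^sup>2) ^ n * c1 * stop {0..<int r} (indicator {int r..int (M * r)}) n x)
      \<le> nsum (\<lambda>y. kpow (tk p u) t x y * indicator {int r..int (M * r)} y)"
proof (induction n arbitrary: t x)
  case 0
  then show ?case using bulk[of t x] by (auto simp: indicator_def)
next
  case (Suc n)
  let ?D = "{0..<int r}" let ?B = "{int r..int (M * r)}"
  let ?s = "stop ?D (indicator ?B) n"
  have e1: "(\<eta>\<^sup>2) ^ k \<le> 1" for k using \<eta> by (intro power_le_one) (auto simp: power_le_one)
  show ?case
  proof (cases "x \<in> ?D")
    case True
    obtain s where s: "t = Suc s" "t0 + n \<le> s" "s \<le> t1" using Suc.prems by (cases t) auto
    have s0: "?s y = 0" if "y < 0 \<or> y > int (M * r)" for y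
    proof -
      have "1 * r \<le> M * r" using M by (intro mult_right_mono) auto
      then have "int r \<le> int (M * r)" by (simp only: mult_1 of_nat_le_iff)
      with that have "y < 0 \<or> int r < y" by linarith
      with that have "y \<notin> ?D" "y \<notin> ?B" by auto
      then show ?thesis by (simp add: stop_out)
    qed
    have "ennreal ((\<eta>\<^sup>2) ^ Suc n * c1 * stop ?D (indicator ?B) (Suc n) x)
        = ennreal (\<eta>\<^sup>2) * (ennreal ((\<eta>\<^sup>2) ^ n * c1) * ennreal (P ?s x))"
      using True c1 \<eta>(1) by (simp add: ennreal_mult' ennreal_mult'' mult.assoc)
    also have "ennreal (P ?s x) = nsum (\<lambda>y. ennreal (pmf p (y - x)) * ennreal (?s y))"
      by (rule nsum_pmf_P[symmetric]) (use stop_ind_bounds qb_stop[OF qb_ind] in auto)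
    also have "ennreal (\<eta>\<^sup>2) * (ennreal ((\<eta>\<^sup>2) ^ n * c1) * \<dots>)
       = nsum (\<lambda>y. (ennreal (\<eta>\<^sup>2) * ennreal (pmf p (y - x))) * (ennreal ((\<eta>\<^sup>2) ^ n * c1) * ennreal (?s y)))"
      by (simp add: nsum_cmult[symmetric] mult_ac)
    also have "\<dots> \<le> nsum (\<lambda>z. tk p u x z * nsum (\<lambda>y. kpow (tk p u) s z y * indicator ?B y))"
    proof (rule nsum_mono)
      fix z
      show "(ennreal (\<eta>\<^sup>2) * ennreal (pmf p (z - x))) * (ennreal ((\<eta>\<^sup>2) ^ n * c1) * ennreal (?s z))
        \<le> tk p u x z * nsum (\<lambda>y. kpow (tk p u) s z y * indicator ?B y)"
      proof (cases "z < 0 \<or> z > int (M * r)")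
        case True
        have "?s z = 0" by (rule s0[OF True])
        then show ?thesis by (simp only: ennreal_0 mult_zero_right zero_le)
      next
        case False
        then have "0 \<le> z" "z \<le> int (M * r)" by auto
        then have "ennreal ((\<eta>\<^sup>2) ^ n * c1 * ?s z) \<le> nsum (\<lambda>y. kpow (tk p u) s z y * indicator ?B y)"
          using s by (intro Suc.IH) auto
        then have "ennreal ((\<eta>\<^sup>2) ^ n * c1) * ennreal (?s z) \<le> nsum (\<lambda>y. kpow (tk p u) s z y * indicator ?B y)"
          using c1 stop_ind_bounds by (subst ennreal_mult[symmetric]) auto
        moreover have "ennreal (\<eta>\<^sup>2) * ennreal (pmf p (z - x)) \<le> tk p u x z"
          using \<eta> \<open>0 \<le> z\<close> \<open>z \<le> int (M * r)\<close> Suc.prems by (intro tk_lower) auto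
        ultimately show ?thesis by (intro mult_mono) auto
      qed
    qed
    also have "\<dots> = nsum (\<lambda>y. kpow (tk p u) t x y * indicator ?B y)"
      unfolding s(1) by (rule nsum_kpow_Suc[symmetric])
    finally show ?thesis .
  next
    case False
    then have xB: "x \<in> ?B" using Suc.prems by auto
    have "(\<eta>\<^sup>2) ^ Suc n * c1 * stop ?D (indicator ?B) (Suc n) x = (\<eta>\<^sup>2) ^ Suc n * c1"
      using False xB by simp
    also have "\<dots> \<le> 1 * c1" by (intro mult_right_mono e1 c1)
    finally have "ennreal ((\<eta>\<^sup>2) ^ Suc n * c1 * stop ?D (indicator ?B) (Suc n) x) \<le> ennreal c1"
      by (intro ennreal_leI) simp
    also have "\<dots> \<le> nsum (\<lambda>y. kpow (tk p u) t x y * indicator ?B y)"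
      using Suc.prems xB by (intro bulk) auto
    finally show ?thesis .
  qed
qed

text \<open>Either the path stays above \<open>x0 / 2\<close> and loses a factor \<gamma> per step,
  or it comes down to \<open>x0 / 2\<close>, where \<open>4 * (x - x0)^2 / x0^2\<close> is at least
  1; the second alternative is Chebyshev's inequality in supermartingale form.\<close>

lemma row_sum_tail:
  assumes u: "\<And>x. 0 \<le> u x \<and> u x \<le> 1" and x0: "x0 > (0::int)" and \<gamma>: "0 \<le> \<gamma>" "\<And>y. 2 * y \<ge> x0 \<Longrightarrow> u y \<le> \<gamma>"
  shows "row_sum (tk p u) t x \<le> ennreal (\<gamma> ^ t + 4 / (of_int x0)\<^sup>2 * ((of_int x - of_int x0)\<^sup>2 + s2 * t))"
proof (induction t arbitrary: x)
  case 0
  show ?case using ennreal_leI[of 1 "1 + 4 / (of_int x0)\<^sup>2 * (of_int x - of_int x0)\<^sup>2"] by (simp add: row_sum_0)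
next
  case (Suc t)
  define h where "h x = \<gamma> ^ t + 4 / (of_int x0)\<^sup>2 * ((of_int x - of_int x0)\<^sup>2 + s2 * t)" for x :: int
  have h0: "h x \<ge> 0" for x using \<gamma>(1) s2_pos by (simp add: h_def)
  have qc: "quad_bounded (\<lambda>_. c)" for c by (rule qb_bounded[where C="\<bar>c\<bar>"]) simp
  have qh: "quad_bounded h" unfolding h_def[abs_def] by (intro qb_add qb_cmult qb_sq_shift qc)
  \<comment> \<open>Truncation at 1, the trivial bound on row sums, makes the step valid for
    \<open>\<gamma> > 1\<close>, too.\<close>
  have q1: "quad_bounded (\<lambda>y. min 1 (h y))"
  proof (rule qb_bounded[where C=1])
    fix y show "\<bar>min 1 (h y)\<bar> \<le> 1" using h0[of y] by (auto simp: min_def)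
  qed
  have Ph: "P h x = \<gamma> ^ t + 4 / (of_int x0)\<^sup>2 * ((of_int x - of_int x0)\<^sup>2 + s2 * Suc t)"
    unfolding h_def[abs_def]
    by (simp add: P_add P_cmult P_const qc qb_sq_shift qb_add qb_cmult P_sq_shift del: times_divide_eq_left) (simp add: algebra_simps)
  have le1: "row_sum (tk p u) t x \<le> 1" for t x
  proof (induction t arbitrary: x)
    case (Suc t)
    have "row_sum (tk p u) (Suc t) x \<le> nsum (\<lambda>y. ennreal (pmf p (y - x)))"
      unfolding row_sum_Suc
    proof (rule nsum_mono)
      fix y show "tk p u x y * row_sum (tk p u) t y \<le> ennreal (pmf p (y - x))"
        using mult_mono[OF tk_le_pmf[of u x y] Suc[of y]] u by simp
    qed
    then show ?case by (simp add: nsum_pmf_1)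
  qed (simp add: row_sum_0)
  show ?case
  proof (cases "2 * x \<ge> x0")
    case True
    have "row_sum (tk p u) (Suc t) x \<le> nsum (\<lambda>y. ennreal \<gamma> * (ennreal (pmf p (y - x)) * ennreal (min 1 (h y))))"
      unfolding row_sum_Suc
    proof (rule nsum_mono)
      fix y
      have "u x * u y * pmf p (y - x) \<le> \<gamma> * 1 * pmf p (y - x)"
        using u[of x] u[of y] \<gamma>(1) \<gamma>(2)[OF True] by (intro mult_right_mono mult_mono) auto
      then have "tk p u x y \<le> ennreal \<gamma> * ennreal (pmf p (y - x))"
        using \<gamma>(1) by (simp add: tk_def ennreal_mult[symmetric] ennreal_leI)
      moreover have "row_sum (tk p u) t y \<le> ennreal (min 1 (h y))"
        using Suc[of y] le1[of t y] by (simp add: h_def min_def)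
      ultimately have "tk p u x y * row_sum (tk p u) t y \<le> (ennreal \<gamma> * ennreal (pmf p (y - x))) * ennreal (min 1 (h y))"
        by (intro mult_mono) auto
      then show "tk p u x y * row_sum (tk p u) t y \<le> ennreal \<gamma> * (ennreal (pmf p (y - x)) * ennreal (min 1 (h y)))"
        by (simp add: mult.assoc)
    qed
    also have "\<dots> = ennreal \<gamma> * ennreal (P (\<lambda>y. min 1 (h y)) x)"
      by (subst nsum_cmult, subst nsum_pmf_P) (auto simp: h0 q1)
    also have "\<dots> = ennreal (\<gamma> * P (\<lambda>y. min 1 (h y)) x)"
      using \<gamma>(1) by (simp add: ennreal_mult')
    also have "\<dots> \<le> ennreal (\<gamma> ^ Suc t + 4 / (of_int x0)\<^sup>2 * ((of_int x - of_int x0)\<^sup>2 + s2 * Suc t))"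
    proof (rule ennreal_leI)
      let ?R = "4 / (of_int x0)\<^sup>2 * ((of_int x - of_int x0)\<^sup>2 + s2 * Suc t)"
      have R0: "?R \<ge> 0" using s2_pos by simp
      have g1: "\<gamma> * P (\<lambda>y. min 1 (h y)) x \<le> \<gamma> * (\<gamma> ^ t + ?R)"
        using \<gamma>(1) P_mono[OF q1 qh, of x] by (intro mult_left_mono) (auto simp: Ph)
      show "\<gamma> * P (\<lambda>y. min 1 (h y)) x \<le> \<gamma> ^ Suc t + ?R"
      proof (cases "\<gamma> \<le> 1")
        case True
        then have "\<gamma> * ?R \<le> 1 * ?R" using R0 by (intro mult_right_mono) auto
        then show ?thesis using g1 by (simp add: distrib_left)
      next
        case False
        have "P (\<lambda>y. min 1 (h y)) x \<le> P (\<lambda>y. 1) x" by (intro P_mono q1 qc) auto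
        then have "\<gamma> * P (\<lambda>y. min 1 (h y)) x \<le> \<gamma> * 1" using \<gamma>(1) by (intro mult_left_mono) (auto simp: P_const)
        also have "\<dots> \<le> \<gamma> ^ Suc t" using False one_le_power[of \<gamma> t] by simp
        finally show ?thesis using R0 by linarith
      qed
    qed
    finally show ?thesis .
  next
    case False
    have "(of_int x0 / 2)\<^sup>2 \<le> (of_int x0 - of_int x :: real)\<^sup>2"
      using False x0 by (intro power_mono) auto
    also have "\<dots> = (of_int x - of_int x0)\<^sup>2" by (rule power2_commute)
    finally have "1 \<le> 4 / (of_int x0)\<^sup>2 * (of_int x - of_int x0 :: real)\<^sup>2"
      using x0 by (simp add: field_simps power2_eq_square)
    also have "\<dots> \<le> 4 / (of_int x0)\<^sup>2 * ((of_int x - of_int x0)\<^sup>2 + s2 * Suc t)"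
    proof (rule mult_left_mono)
      have "0 \<le> s2 * Suc t" using s2_pos by simp
      then show "(of_int x - of_int x0)\<^sup>2 \<le> (of_int x - of_int x0)\<^sup>2 + s2 * Suc t" by linarith
    qed simp
    also have "\<dots> \<le> \<gamma> ^ Suc t + 4 / (of_int x0)\<^sup>2 * ((of_int x - of_int x0)\<^sup>2 + s2 * Suc t)"
      using \<gamma>(1) by simp
    finally show ?thesis using le1[of "Suc t" x] ennreal_leI order_trans by fastforce
  qed
qed

end

section \<open>Decay of row sums at large heights\<close>

definition tail :: "(int \<Rightarrow> int \<Rightarrow> ennreal) \<Rightarrow> nat \<Rightarrow> nat \<Rightarrow> real \<Rightarrow> bool" where
  "tail T r m C \<longleftrightarrow> (\<forall>x\<ge>int r. row_sum T m x \<le> ennreal (C * (real r / of_int x)\<^sup>2))"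

text \<open>The form in which convexity is used: above \<open>2 * H\<close> the potential is at
  least linear, and \<open>2 * H \<le> 4 * r\<close>. The constant 32 comes from
  \<open>2 * H^3 \<le> 16 * r^3\<close> and the halved site weight.\<close>

definition confining :: "(int \<Rightarrow> real) \<Rightarrow> nat \<Rightarrow> bool" where
  "confining u r \<longleftrightarrow> (\<forall>x\<ge>4 * int r. u x \<le> exp (- of_int x / (32 * real r ^ 3)))"

lemma exp_le_inverse_square: "y > 0 \<Longrightarrow> exp (- y) \<le> 2 / y\<^sup>2" for y :: real
proof -
  assume y: "y > 0"
  have "y\<^sup>2 / 2 \<le> exp y" using exp_lower_Taylor_quadratic[of y] y by simp
  then have "inverse (exp y) \<le> inverse (y\<^sup>2 / 2)" using y by (intro le_imp_inverse_le) auto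
  then show ?thesis by (simp add: exp_minus)
qed

text \<open>For \<open>x \<ge> 8 * r\<close> all heights above \<open>x / 2\<close> are confined, so
  staying there for \<open>m\<close> steps costs at least \<open>exp (- x / (32 * r))\<close>, which
  is below a multiple of \<open>(r / x)^2\<close>; coming down costs
  \<open>4 * s2 * m / x^2\<close>. Nearer to the bulk the claimed bound exceeds 1.\<close>

lemma (in walk) tail_bound:
  assumes adm: "adm b u r" and conf: "confining u r" and C0: "C0 \<ge> 1" and r: "r \<ge> 1"
  shows "tail (tk p u) r (2 * C0 * r\<^sup>2) (8192 + 8 * s2 * C0)"
  unfolding tail_def
proof (intro allI impI)
  fix x :: int assume x: "x \<ge> int r"
  let ?m = "2 * C0 * r\<^sup>2" let ?z = "real r / of_int x"
  have xp: "x > 0" and xr: "real_of_int x \<ge> r" using x r by linarith+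
  show "row_sum (tk p u) ?m x \<le> ennreal ((8192 + 8 * s2 * C0) * ?z\<^sup>2)"
  proof (cases "x \<ge> 8 * int r")
    case False
    then have "real_of_int x < 8 * r" by linarith
    then have "(1 / 8)\<^sup>2 \<le> ?z\<^sup>2" using xp by (intro power_mono) (auto simp: field_simps)
    then have "64 * (1 / 8)\<^sup>2 \<le> (8192 + 8 * s2 * C0) * ?z\<^sup>2" using s2_pos by (intro mult_mono) auto
    then have "1 \<le> (8192 + 8 * s2 * C0) * ?z\<^sup>2" by (simp add: power2_eq_square)
    then show ?thesis using row_sum_le_1[OF adm, of ?m x] ennreal_leI[of 1] order_trans by fastforce
  next
    case True
    \<comment> \<open>Half of the confining exponent at \<open>x\<close>, because it is applied at
      all \<open>y \<ge> x / 2\<close>.\<close>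
    define \<gamma> where "\<gamma> = exp (- of_int x / (64 * real r ^ 3))"
    have "row_sum (tk p u) ?m x \<le> ennreal (\<gamma> ^ ?m + 4 / (of_int x)\<^sup>2 * ((of_int x - of_int x)\<^sup>2 + s2 * real ?m))"
    proof (rule row_sum_tail[OF _ xp])
      show "0 \<le> u x \<and> u x \<le> 1" for x using admD[OF adm] by blast
      show "0 \<le> \<gamma>" by (simp add: \<gamma>_def)
      fix y assume y: "2 * y \<ge> x"
      then have "y \<ge> 4 * int r" using True by linarith
      then have "u y \<le> exp (- of_int y / (32 * real r ^ 3))" using conf by (simp add: confining_def)
      also have "\<dots> \<le> \<gamma>"
      proof -
        have "real_of_int x \<le> 2 * of_int y" using y by linarith
        then show ?thesis unfolding \<gamma>_def using r by (simp add: field_simps)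
      qed
      finally show "u y \<le> \<gamma>" .
    qed
    also have "\<dots> \<le> ennreal ((8192 + 8 * s2 * C0) * ?z\<^sup>2)"
    proof (rule ennreal_leI)
      have rp: "real r > 0" using r by simp
      have "\<gamma> ^ ?m = exp (- (real C0 * (of_int x / r) / 32))"
        using rp by (simp add: \<gamma>_def exp_of_nat_mult[symmetric] field_simps power2_eq_square power3_eq_cube)
      also have "\<dots> \<le> exp (- (of_int x / r / 32))"
      proof -
        have "1 * (of_int x / r) \<le> real C0 * (of_int x / r)" using C0 xp by (intro mult_right_mono) auto
        from divide_right_mono[OF this, of 32] show ?thesis by simp
      qed
      also have "\<dots> \<le> 2 / (of_int x / r / 32)\<^sup>2" using xp rp by (intro exp_le_inverse_square) auto
      also have "\<dots> \<le> 8192 * ?z\<^sup>2" using xp rp by (simp add: field_simps power2_eq_square)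
      finally have "\<gamma> ^ ?m \<le> 8192 * ?z\<^sup>2" .
      moreover have "4 / (of_int x)\<^sup>2 * ((of_int x - of_int x)\<^sup>2 + s2 * real ?m) = 8 * s2 * C0 * ?z\<^sup>2"
        by (simp add: power_divide)
      ultimately show "\<gamma> ^ ?m + 4 / (of_int x)\<^sup>2 * ((of_int x - of_int x)\<^sup>2 + s2 * real ?m) \<le> (8192 + 8 * s2 * C0) * ?z\<^sup>2"
        by (simp add: distrib_right)
    qed
    finally show ?thesis .
  qed
qed

definition kset :: "(int \<Rightarrow> int \<Rightarrow> ennreal) \<Rightarrow> nat \<Rightarrow> int \<Rightarrow> int set \<Rightarrow> ennreal" where
  "kset T t x A = nsum (\<lambda>y. kpow T t x y * indicator A y)"

text \<open>The kernel \<open>T\<close> at scale \<open>r\<close>, with \<open>m\<close> of order \<open>r\<^sup>2\<close> time steps and bulk \<open>[r, M0 * r]\<close>.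
  The number \<open>q\<close> is the probability that the walk from \<open>0\<close> climbs to height \<open>r\<close> before it
  turns negative.\<close>

locale side =
  fixes T :: "int \<Rightarrow> int \<Rightarrow> ennreal" and r m M0 :: nat and \<kappa> K :: real
  assumes pos: "\<kappa> > 0" "K > 0" "r \<ge> 1" "m \<ge> 1" "M0 \<ge> 2"
    and row_sum_le: "row_sum T t x \<le> 1"
    and neg: "x < 0 \<Longrightarrow> T x y = 0"
    and sup: "kpow T m x y \<le> ennreal (K / r)"
    and bulk2: "x \<in> {int r..int (M0 * r)} \<Longrightarrow> y \<in> {int r..int (M0 * r)} \<Longrightarrow> ennreal (\<kappa> / r) \<le> kpow T m x y"
    and bulk1: "x \<in> {int r..int (M0 * r)} \<Longrightarrow> m \<le> t \<Longrightarrow> t \<le> 25 * m \<Longrightarrow> ennreal \<kappa> \<le> kset T t x {int r..int (M0 * r)}"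
    and start: "\<exists>q\<ge>0. row_sum T m 0 \<le> ennreal q \<and> (\<forall>i. kset T i 0 {int r..} \<le> ennreal q)
      \<and> (\<forall>t. m \<le> t \<longrightarrow> t \<le> 25 * m \<longrightarrow> ennreal (\<kappa> * q) \<le> kset T t 0 {int r..int (M0 * r)})
      \<and> (\<forall>t\<le>25 * m. nsum (\<lambda>y. kpow T t 0 y * ennreal ((of_int y)\<^sup>2)) \<le> ennreal (K * (real r)\<^sup>2 * q))"

lemma side_mono:
  assumes "side T r m M0 \<kappa> K" and \<kappa>': "0 < \<kappa>'" "\<kappa>' \<le> \<kappa>" and K': "K \<le> K'"
  shows "side T r m M0 \<kappa>' K'"
proof -
  interpret side T r m M0 \<kappa> K by fact
  obtain q where q: "q \<ge> 0" "row_sum T m 0 \<le> ennreal q" "\<And>i. kset T i 0 {int r..} \<le> ennreal q"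
      "\<And>t. m \<le> t \<Longrightarrow> t \<le> 25 * m \<Longrightarrow> ennreal (\<kappa> * q) \<le> kset T t 0 {int r..int (M0 * r)}"
      "\<And>t. t \<le> 25 * m \<Longrightarrow> nsum (\<lambda>y. kpow T t 0 y * ennreal ((of_int y)\<^sup>2)) \<le> ennreal (K * (real r)\<^sup>2 * q)"
    using start by blast
  show ?thesis
  proof
    show "kpow T m x y \<le> ennreal (K' / r)" for x y
      by (rule order_trans[OF sup ennreal_leI]) (use K' in \<open>simp add: divide_right_mono\<close>)
    show "ennreal (\<kappa>' / r) \<le> kpow T m x y" if "x \<in> {int r..int (M0 * r)}" "y \<in> {int r..int (M0 * r)}" for x y
      by (rule order_trans[OF ennreal_leI bulk2[OF that]]) (use \<kappa>' in \<open>simp add: divide_right_mono\<close>)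
    show "ennreal \<kappa>' \<le> kset T t x {int r..int (M0 * r)}" if "x \<in> {int r..int (M0 * r)}" "m \<le> t" "t \<le> 25 * m" for x t
      by (rule order_trans[OF ennreal_leI bulk1[OF that]]) (use \<kappa>' in simp)
    have "ennreal (\<kappa>' * q) \<le> kset T t 0 {int r..int (M0 * r)}" if "m \<le> t" "t \<le> 25 * m" for t
      by (rule order_trans[OF ennreal_leI q(4)[OF that]]) (use \<kappa>' q(1) in \<open>simp add: mult_right_mono\<close>)
    moreover have "nsum (\<lambda>y. kpow T t 0 y * ennreal ((of_int y)\<^sup>2)) \<le> ennreal (K' * (real r)\<^sup>2 * q)" if "t \<le> 25 * m" for t
      by (rule order_trans[OF q(5)[OF that] ennreal_leI]) (use K' q(1) in \<open>auto intro!: mult_right_mono\<close>)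
    ultimately show "\<exists>q\<ge>0. row_sum T m 0 \<le> ennreal q \<and> (\<forall>i. kset T i 0 {int r..} \<le> ennreal q)
      \<and> (\<forall>t. m \<le> t \<longrightarrow> t \<le> 25 * m \<longrightarrow> ennreal (\<kappa>' * q) \<le> kset T t 0 {int r..int (M0 * r)})
      \<and> (\<forall>t\<le>25 * m. nsum (\<lambda>y. kpow T t 0 y * ennreal ((of_int y)\<^sup>2)) \<le> ennreal (K' * (real r)\<^sup>2 * q))"
      using q(1-3) by blast
  qed (use pos \<kappa>' K' row_sum_le neg in auto)
qed

text \<open>What survives \<open>m\<close> steps is found in the bulk at every time of the window,
  up to a factor. That factor depends on the height \<open>M\<close>; therefore this is kept apart
  from \<open>side\<close> and used for several \<open>M\<close>.\<close>

definition region :: "(int \<Rightarrow> int \<Rightarrow> ennreal) \<Rightarrow> nat \<Rightarrow> nat \<Rightarrow> nat \<Rightarrow> nat \<Rightarrow> real \<Rightarrow> bool" where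
  "region T r m M0 M \<kappa> \<longleftrightarrow> (\<forall>x t. x \<le> int (M * r) \<longrightarrow> m \<le> t \<longrightarrow> t \<le> 25 * m \<longrightarrow>
     ennreal \<kappa> * row_sum T m x \<le> kset T t x {int r..int (M0 * r)})"

lemma region_mono: "region T r m M0 M \<kappa> \<Longrightarrow> \<kappa>' \<le> \<kappa> \<Longrightarrow> region T r m M0 M \<kappa>'"
  unfolding region_def by (meson ennreal_leI mult_right_mono order_trans zero_le)

lemma bulk_card:
  assumes "M0 \<ge> 2"
  shows "real r \<le> real (Suc (M0 * r) - r)"
proof -
  have "2 * r \<le> M0 * r" using assms by (intro mult_right_mono) auto
  then have "r \<le> Suc (M0 * r) - r" by linarith
  then show ?thesis by (simp only: of_nat_le_iff)
qed

context walk
begin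

lemma bulk_mass:
  assumes c: "c \<ge> 0" and r: "r \<ge> 1" and M0: "M0 \<ge> 2"
    and low: "\<And>y. y \<in> {int r..int (M0 * r)} \<Longrightarrow> ennreal (c / r) \<le> kpow T t x y"
  shows "ennreal c \<le> kset T t x {int r..int (M0 * r)}"
proof -
  note * = bulk_card[OF M0, of r]
  have "c = c / r * r" using r by simp
  also have "\<dots> \<le> c / r * real (Suc (M0 * r) - r)" by (rule mult_left_mono[OF *]) (use c in simp)
  finally have "ennreal c \<le> ennreal (c / r * real (Suc (M0 * r) - r))" by (rule ennreal_leI)
  also have "\<dots> = nsum (\<lambda>y. ennreal (c / r) * indicator {int r..int (M0 * r)} y)"
    using c by (subst nsum_int_multc) auto
  also have "\<dots> \<le> kset T t x {int r..int (M0 * r)}"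
    unfolding kset_def by (intro nsum_mono) (auto simp: indicator_def low)
  finally show ?thesis .
qed

text \<open>After at most \<open>C0 * r^2\<close> steps spent on leaving \<open>[0, r)\<close>, a
  time of at least \<open>C0 * r^2\<close> remains for moving within the bulk.\<close>

lemma surv_nonneg_region:
  assumes adm: "adm b u r" and r: "r \<ge> 1" and M: "M \<ge> 1" and c: "c \<ge> 0"
    and exit: "surv r (C0 * r\<^sup>2) x / 2 \<le> stop {0..<int r} (indicator {int r..int (M * r)}) (C0 * r\<^sup>2) x"
    and bulk: "\<And>t z. C0 * r\<^sup>2 \<le> t \<Longrightarrow> t \<le> 50 * C0 * r\<^sup>2 \<Longrightarrow> z \<in> {int r..int (M * r)} \<Longrightarrow>
       ennreal c \<le> kset (tk p u) t z {int r..int (M * r)}"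
    and x: "0 \<le> x" "x < int r" and t: "2 * C0 * r\<^sup>2 \<le> t" "t \<le> 50 * C0 * r\<^sup>2"
  shows "ennreal (exp (- (2 * \<bar>b M\<bar> * C0)) * c / 2 * surv r (C0 * r\<^sup>2) x) \<le> kset (tk p u) t x {int r..int (M * r)}"
proof -
  define \<eta> where "\<eta> = exp (- \<bar>b M\<bar> / (real r)\<^sup>2)"
  have xM: "x \<le> int (M * r)"
  proof -
    have "1 * r \<le> M * r" using M by (intro mult_right_mono) auto
    then have "int r \<le> int (M * r)" by (simp only: mult_1 of_nat_le_iff)
    then show ?thesis using x by linarith
  qed
  have "ennreal ((\<eta>\<^sup>2) ^ (C0 * r\<^sup>2) * c * stop {0..<int r} (indicator {int r..int (M * r)}) (C0 * r\<^sup>2) x)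
      \<le> nsum (\<lambda>y. kpow (tk p u) t x y * indicator {int r..int (M * r)} y)"
  proof (rule enter_bulk[OF adm M c bulk[unfolded kset_def]])
    show "0 \<le> \<eta>" "\<eta> \<le> 1" by (auto simp: \<eta>_def)
    fix y :: int assume "0 \<le> y" "y \<le> int (M * r)"
    then have "exp (- b M / (real r)\<^sup>2) \<le> u y" using adm by (auto simp: adm_def)
    moreover have "\<eta> \<le> exp (- b M / (real r)\<^sup>2)" by (auto simp: \<eta>_def intro!: divide_right_mono)
    ultimately show "\<eta> \<le> u y" by simp
  qed (use t x xM in auto)
  moreover have "(\<eta>\<^sup>2) ^ (C0 * r\<^sup>2) = exp (- (2 * \<bar>b M\<bar> * C0))"
    using r by (simp add: \<eta>_def exp_of_nat_mult[symmetric])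
  moreover have "exp (- (2 * \<bar>b M\<bar> * C0)) * c / 2 * surv r (C0 * r\<^sup>2) x
      \<le> exp (- (2 * \<bar>b M\<bar> * C0)) * c * stop {0..<int r} (indicator {int r..int (M * r)}) (C0 * r\<^sup>2) x"
    using mult_left_mono[OF exit, of "exp (- (2 * \<bar>b M\<bar> * C0)) * c"] c by simp
  ultimately show ?thesis unfolding kset_def by (simp only: order_trans[OF ennreal_leI])
qed

lemma side_region_exist:
  obtains Cw Mw :: nat where "Cw \<ge> 1" "Mw \<ge> 2"
    "\<And>C0 M0 b. C0 \<ge> Cw \<Longrightarrow> M0 \<ge> Mw \<Longrightarrow> \<exists>\<kappa> K r0. \<kappa> > 0 \<and> K > 0 \<and> r0 \<ge> 1 \<and>
       (\<forall>r\<ge>r0. \<forall>u. adm b u r \<longrightarrow> side (tk p u) r (2 * C0 * r\<^sup>2) M0 \<kappa> K)"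
    "\<And>C0 M0 b M. C0 \<ge> Cw \<Longrightarrow> M0 \<ge> Mw \<Longrightarrow> M \<ge> M0 \<Longrightarrow> \<exists>\<kappa> r0. \<kappa> > 0 \<and> r0 \<ge> 1 \<and>
       (\<forall>r\<ge>r0. \<forall>u. adm b u r \<longrightarrow> region (tk p u) r (2 * C0 * r\<^sup>2) M0 M \<kappa>)"
proof -
  obtain Cw Mw re :: nat where w: "Cw \<ge> 1" "Mw \<ge> 2" "re \<ge> 1"
    and exit: "\<And>r n M x. r \<ge> re \<Longrightarrow> n \<ge> Cw * r\<^sup>2 \<Longrightarrow> M \<ge> Mw \<Longrightarrow> 0 \<le> x \<Longrightarrow> x < int r \<Longrightarrow>
       stop {0..<int r} (indicator {int r..int (M * r)}) n x \<ge> surv r n x / 2"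
    and exit_time: "\<And>r n x. r \<ge> re \<Longrightarrow> 0 \<le> x \<Longrightarrow> x < int r \<Longrightarrow> exit_time {0..<int r} n x \<le> Cw * (real r)\<^sup>2 * surv r n x"
    using good_exit by metis
  obtain Cu where Cu: "Cu > 0" "\<And>n k. n \<ge> 1 \<Longrightarrow> pmf (nstep p n) k \<le> Cu / sqrt n"
    by (rule local_upper) blast
  \<comment> \<open>The upper end \<open>50 * C0 * r^2\<close> is \<open>25 * m\<close> for
    \<open>m = 2 * C0 * r^2\<close>.\<close>
  have low: "\<exists>c r0. c > 0 \<and> r0 \<ge> 1 \<and> (\<forall>r\<ge>r0. \<forall>u. adm b u r \<longrightarrow> (\<forall>x\<in>{int r..int (M * r)}. \<forall>y\<in>{int r..int (M * r)}.
       \<forall>t. C0 * r\<^sup>2 \<le> t \<longrightarrow> t \<le> 50 * C0 * r\<^sup>2 \<longrightarrow> ennreal (c / r) \<le> kpow (tk p u) t x y))"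
    if M2: "M \<ge> 2" and C01: "C0 \<ge> 1" for M C0 :: nat and b
  proof -
    obtain c r0 where c: "c > 0" "r0 \<ge> 1"
      "\<And>r u x y t. r \<ge> r0 \<Longrightarrow> adm b u r \<Longrightarrow> x \<in> {int r..int (M * r)} \<Longrightarrow> y \<in> {int r..int (M * r)} \<Longrightarrow>
      real C0 * (real r)\<^sup>2 \<le> real t \<Longrightarrow> real t \<le> (50 * real C0) * (real r)\<^sup>2 \<Longrightarrow> ennreal (c / r) \<le> kpow (tk p u) t x y"
    proof (rule bulk_lower[OF M2, of "real C0" "50 * real C0" b])
      show "real C0 > 0" "50 * real C0 > 0" using C01 by auto
    qed blast
    have "ennreal (c / r) \<le> kpow (tk p u) t x y"
      if "r \<ge> r0" "adm b u r" "x \<in> {int r..int (M * r)}" "y \<in> {int r..int (M * r)}" "C0 * r\<^sup>2 \<le> t" "t \<le> 50 * C0 * r\<^sup>2" for r u x y t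
    proof (rule c(3)[OF that(1-4)])
      show "real C0 * (real r)\<^sup>2 \<le> real t" using that(5) by (metis of_nat_le_iff of_nat_mult of_nat_power)
      have "real t \<le> real (50 * C0 * r\<^sup>2)" using that(6) by (simp only: of_nat_le_iff)
      then show "real t \<le> (50 * real C0) * (real r)\<^sup>2" by simp
    qed
    then show ?thesis using c(1,2) by blast
  qed
  show ?thesis
  proof (rule that[of Cw Mw])
    show "Cw \<ge> 1" "Mw \<ge> 2" by fact+
    fix C0 M0 :: nat and b :: "nat \<Rightarrow> real"
    assume C0: "C0 \<ge> Cw" and M0: "M0 \<ge> Mw"
    have C1: "C0 \<ge> 1" "M0 \<ge> 2" using C0 M0 w by auto
    have exit': "stop {0..<int r} (indicator {int r..int (M * r)}) (C0 * r\<^sup>2) x \<ge> surv r (C0 * r\<^sup>2) x / 2"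
      if "r \<ge> re" "M \<ge> Mw" "0 \<le> x" "x < int r" for r M x
      using that C0 by (intro exit) auto
    obtain c r1 where c: "c > 0" "r1 \<ge> 1" and c3': "(\<forall>r\<ge>r1. \<forall>u. adm b u r \<longrightarrow> (\<forall>x\<in>{int r..int (M0 * r)}. \<forall>y\<in>{int r..int (M0 * r)}.
       \<forall>t. C0 * r\<^sup>2 \<le> t \<longrightarrow> t \<le> 50 * C0 * r\<^sup>2 \<longrightarrow> ennreal (c / r) \<le> kpow (tk p u) t x y))"
      using low[OF C1(2,1), of b] by blast
    have c3: "\<And>r u x y t. r \<ge> r1 \<Longrightarrow> adm b u r \<Longrightarrow> x \<in> {int r..int (M0 * r)} \<Longrightarrow> y \<in> {int r..int (M0 * r)} \<Longrightarrow>
        C0 * r\<^sup>2 \<le> t \<Longrightarrow> t \<le> 50 * C0 * r\<^sup>2 \<Longrightarrow> ennreal (c / r) \<le> kpow (tk p u) t x y"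
      using c3' by blast
    define \<gamma> where "\<gamma> = exp (- (2 * \<bar>b M0\<bar> * C0)) / 2"
    have "exp (- (2 * \<bar>b M0\<bar> * C0)) \<le> 1" by simp
    then have \<gamma>: "\<gamma> > 0" "\<gamma> \<le> 1" unfolding \<gamma>_def using exp_gt_zero[of "- (2 * \<bar>b M0\<bar> * C0)"] by linarith+
    define r0 where "r0 = max re r1"
    have mass: "ennreal c \<le> kset (tk p u) t z {int r..int (M0 * r)}"
      if "r \<ge> r0" "adm b u r" "z \<in> {int r..int (M0 * r)}" "C0 * r\<^sup>2 \<le> t" "t \<le> 50 * C0 * r\<^sup>2" for r u z t
      using that c c3 C1 by (intro bulk_mass) (auto simp: r0_def)
    have enter: "ennreal (\<gamma> * c * surv r (C0 * r\<^sup>2) x) \<le> kset (tk p u) t x {int r..int (M0 * r)}"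
      if "r \<ge> r0" "adm b u r" "0 \<le> x" "x < int r" "2 * C0 * r\<^sup>2 \<le> t" "t \<le> 50 * C0 * r\<^sup>2" for r u x t
    proof -
      have "ennreal (exp (- (2 * \<bar>b M0\<bar> * C0)) * c / 2 * surv r (C0 * r\<^sup>2) x) \<le> kset (tk p u) t x {int r..int (M0 * r)}"
        by (rule surv_nonneg_region[OF that(2)]) (use that w C1 c M0 exit' mass in \<open>auto simp: r0_def\<close>)
      then show ?thesis by (simp add: \<gamma>_def)
    qed
    have rs2: "row_sum (tk p u) (2 * C0 * r\<^sup>2) x \<le> ennreal (surv r (C0 * r\<^sup>2) x)" if "r \<ge> r0" "adm b u r" for r u x
    proof -
      have "C0 * r\<^sup>2 \<ge> 1" using that C1 c by (auto simp: r0_def Suc_le_eq)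
      from row_sum_le_surv[OF that(2) this, of "C0 * r\<^sup>2" x] show ?thesis by (simp add: mult_2[symmetric] mult.assoc)
    qed
    \<comment> \<open>The first entry serves the pointwise bound on the kernel, the second one the
      second moment of paths from the wall.\<close>
    define K where "K = max Cu (s2 * (Cw + 50 * C0))"
    show "\<exists>\<kappa> K r0. \<kappa> > 0 \<and> K > 0 \<and> r0 \<ge> 1 \<and>
       (\<forall>r\<ge>r0. \<forall>u. adm b u r \<longrightarrow> side (tk p u) r (2 * C0 * r\<^sup>2) M0 \<kappa> K)"
    proof (intro exI conjI allI impI)
      show "\<gamma> * c > 0" "K > 0" "r0 \<ge> 1" using \<gamma> c Cu w by (auto simp: K_def r0_def)
      fix r u assume r: "r \<ge> r0" and adm: "adm b u r"
      have r1: "r \<ge> 1" using r c by (simp add: r0_def)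
      let ?m = "2 * C0 * r\<^sup>2" let ?q = "surv r (C0 * r\<^sup>2) 0"
      have m1: "?m \<ge> 1" using r1 C1 by (simp add: Suc_le_eq)
      have gc: "\<gamma> * c \<le> c" using \<gamma> c by simp
      show "side (tk p u) r ?m M0 (\<gamma> * c) K"
      proof
        show "\<gamma> * c > 0" "K > 0" "r \<ge> 1" "?m \<ge> 1" "M0 \<ge> 2" using \<gamma> c Cu r1 m1 C1 by (auto simp: K_def)
        show "row_sum (tk p u) t x \<le> 1" for t x by (rule row_sum_le_1[OF adm])
        show "tk p u x y = 0" if "x < 0" for x y using admD(2)[OF adm that] by (simp add: tk_def)
        show "kpow (tk p u) ?m x y \<le> ennreal (K / r)" for x y
        proof -
          have "kpow (tk p u) ?m x y \<le> ennreal (pmf (nstep p ?m) (y - x))"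
            by (rule kpow_le_free) (use admD(1)[OF adm] in auto)
          also have "pmf (nstep p ?m) (y - x) \<le> Cu / sqrt ?m" by (rule Cu(2)[OF m1])
          also have "\<dots> \<le> Cu / r"
          proof -
            have "real r = sqrt ((real r)\<^sup>2)" by simp
            also have "\<dots> \<le> sqrt ?m"
            proof (rule real_sqrt_le_mono)
              have "1 * r\<^sup>2 \<le> 2 * C0 * r\<^sup>2" using C1 by (intro mult_right_mono) auto
              then show "(real r)\<^sup>2 \<le> real ?m" by (metis mult_1 of_nat_le_iff of_nat_power)
            qed
            finally have "real r \<le> sqrt ?m" .
            moreover have "real r > 0" using r1 by simp
            ultimately show ?thesis using Cu(1) by (intro divide_left_mono mult_pos_pos) linarith+
          qed
          also have "\<dots> \<le> K / r" by (simp add: K_def divide_right_mono)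
          finally show ?thesis by (simp add: ennreal_leI)
        qed
        show "ennreal (\<gamma> * c / r) \<le> kpow (tk p u) ?m x y" if "x \<in> {int r..int (M0 * r)}" "y \<in> {int r..int (M0 * r)}" for x y
        proof -
          have "ennreal (\<gamma> * c / r) \<le> ennreal (c / r)" using gc by (intro ennreal_leI divide_right_mono) auto
          also have "\<dots> \<le> kpow (tk p u) ?m x y" using r adm that by (intro c3) (auto simp: r0_def)
          finally show ?thesis .
        qed
        show "ennreal (\<gamma> * c) \<le> kset (tk p u) t x {int r..int (M0 * r)}" if "x \<in> {int r..int (M0 * r)}" "?m \<le> t" "t \<le> 25 * ?m" for x t
        proof -
          have "ennreal (\<gamma> * c) \<le> ennreal c" using gc by (rule ennreal_leI)
          also have "\<dots> \<le> kset (tk p u) t x {int r..int (M0 * r)}" using r adm that by (intro mass) auto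
          finally show ?thesis .
        qed
        show "\<exists>q\<ge>0. row_sum (tk p u) ?m 0 \<le> ennreal q \<and> (\<forall>i. kset (tk p u) i 0 {int r..} \<le> ennreal q)
          \<and> (\<forall>t. ?m \<le> t \<longrightarrow> t \<le> 25 * ?m \<longrightarrow> ennreal (\<gamma> * c * q) \<le> kset (tk p u) t 0 {int r..int (M0 * r)})
          \<and> (\<forall>t\<le>25 * ?m. nsum (\<lambda>y. kpow (tk p u) t 0 y * ennreal ((of_int y)\<^sup>2)) \<le> ennreal (K * (real r)\<^sup>2 * q))"
        proof (intro exI[of _ ?q] conjI allI impI)
          show "0 \<le> ?q" by (rule surv_bounds)
          show "row_sum (tk p u) ?m 0 \<le> ennreal ?q" by (rule rs2[OF r adm])
          show "kset (tk p u) i 0 {int r..} \<le> ennreal ?q" for i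
            unfolding kset_def by (rule high_le_surv[OF adm])
          show "ennreal (\<gamma> * c * ?q) \<le> kset (tk p u) t 0 {int r..int (M0 * r)}" if "?m \<le> t" "t \<le> 25 * ?m" for t
            using that r1 by (intro enter[OF r adm]) auto
          fix t assume t: "t \<le> 25 * ?m"
          have "nsum (\<lambda>y. kpow (tk p u) t 0 y * ennreal ((of_int y)\<^sup>2)) \<le> ennreal ((of_int 0)\<^sup>2 + s2 * exit_time {0..} t 0)"
            by (rule sq_moment[OF adm]) simp
          also have "\<dots> \<le> ennreal (K * (real r)\<^sup>2 * ?q)"
          proof (rule ennreal_leI)
            have "exit_time {0..} t 0 \<le> exit_time {0..} (t + (25 * ?m - t)) 0" by (rule exit_time_mono_time)
            \<comment> \<open>The first \<open>C0 * r^2\<close> steps are charged to the exit from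
              \<open>[0, r)\<close>, the other \<open>49 * C0 * r^2\<close> only to surviving paths;
              in this way both parts are multiples of \<open>surv\<close>.\<close>
            also have "t + (25 * ?m - t) = C0 * r\<^sup>2 + 49 * C0 * r\<^sup>2" using t by simp
            also have "exit_time {0..} (C0 * r\<^sup>2 + 49 * C0 * r\<^sup>2) 0 \<le> exit_time {0..<int r} (C0 * r\<^sup>2) 0 + real (C0 * r\<^sup>2 + 49 * C0 * r\<^sup>2) * ?q"
              by (rule exit_time_half_line)
            also have "exit_time {0..<int r} (C0 * r\<^sup>2) 0 \<le> Cw * (real r)\<^sup>2 * ?q" using r r1 by (intro exit_time) (auto simp: r0_def)
            finally have "exit_time {0..} t 0 \<le> (Cw + 50 * C0) * ((real r)\<^sup>2 * ?q)" by (simp add: algebra_simps)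
            then have "s2 * exit_time {0..} t 0 \<le> s2 * ((Cw + 50 * C0) * ((real r)\<^sup>2 * ?q))"
              using s2_pos by (intro mult_left_mono) auto
            also have "\<dots> \<le> K * ((real r)\<^sup>2 * ?q)"
              unfolding mult.assoc[symmetric] using surv_bounds by (intro mult_right_mono) (auto simp: K_def)
            finally show "(of_int 0)\<^sup>2 + s2 * exit_time {0..} t 0 \<le> K * (real r)\<^sup>2 * ?q" by simp
          qed
          finally show "nsum (\<lambda>y. kpow (tk p u) t 0 y * ennreal ((of_int y)\<^sup>2)) \<le> ennreal (K * (real r)\<^sup>2 * ?q)" .
        qed
      qed
    qed
    fix M assume M: "M \<ge> M0"
    have M2: "M \<ge> 2" using M C1 by simp
    obtain c' r2 where c': "c' > 0" "r2 \<ge> 1" and c'3': "(\<forall>r\<ge>r2. \<forall>u. adm b u r \<longrightarrow> (\<forall>x\<in>{int r..int (M * r)}. \<forall>y\<in>{int r..int (M * r)}.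
       \<forall>t. C0 * r\<^sup>2 \<le> t \<longrightarrow> t \<le> 50 * C0 * r\<^sup>2 \<longrightarrow> ennreal (c' / r) \<le> kpow (tk p u) t x y))"
      using low[OF M2 C1(1), of b] by blast
    have c'3: "\<And>r u x y t. r \<ge> r2 \<Longrightarrow> adm b u r \<Longrightarrow> x \<in> {int r..int (M * r)} \<Longrightarrow> y \<in> {int r..int (M * r)} \<Longrightarrow>
        C0 * r\<^sup>2 \<le> t \<Longrightarrow> t \<le> 50 * C0 * r\<^sup>2 \<Longrightarrow> ennreal (c' / r) \<le> kpow (tk p u) t x y"
      using c'3' by blast
    define \<kappa> where "\<kappa> = min (\<gamma> * c) c'"
    show "\<exists>\<kappa> r0. \<kappa> > 0 \<and> r0 \<ge> 1 \<and> (\<forall>r\<ge>r0. \<forall>u. adm b u r \<longrightarrow> region (tk p u) r (2 * C0 * r\<^sup>2) M0 M \<kappa>)"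
    proof (intro exI conjI allI impI)
      show "\<kappa> > 0" "max r0 r2 \<ge> 1" using \<gamma> c c' by (auto simp: \<kappa>_def)
      fix r u assume r: "r \<ge> max r0 r2" and adm: "adm b u r"
      have r1: "r \<ge> 1" using r c' by simp
      show "region (tk p u) r (2 * C0 * r\<^sup>2) M0 M \<kappa>"
        unfolding region_def
      proof (intro allI impI)
        fix x :: int and t assume x: "x \<le> int (M * r)" and t: "2 * C0 * r\<^sup>2 \<le> t" "t \<le> 25 * (2 * C0 * r\<^sup>2)"
        consider "x < 0" | "0 \<le> x" "x < int r" | "x \<in> {int r..int (M * r)}" using x by fastforce
        then show "ennreal \<kappa> * row_sum (tk p u) (2 * C0 * r\<^sup>2) x \<le> kset (tk p u) t x {int r..int (M0 * r)}"
        proof cases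
          case 1
          then show ?thesis using row_neg[OF adm 1, of "2 * C0 * r\<^sup>2"] r1 C1 by (simp add: row_sum_def Suc_le_eq)
        next
          case 2
          have "ennreal \<kappa> * row_sum (tk p u) (2 * C0 * r\<^sup>2) x \<le> ennreal (\<gamma> * c) * ennreal (surv r (C0 * r\<^sup>2) x)"
            using r adm by (intro mult_mono rs2 ennreal_leI) (auto simp: \<kappa>_def)
          also have "\<dots> = ennreal (\<gamma> * c * surv r (C0 * r\<^sup>2) x)"
            using \<gamma> c surv_bounds by (subst ennreal_mult[symmetric]) auto
          also have "\<dots> \<le> kset (tk p u) t x {int r..int (M0 * r)}"
            using r 2 t by (intro enter[OF _ adm]) auto
          finally show ?thesis .
        next
          case 3
          have "M0 * r \<le> M * r" using M by simp
          then have sub: "int (M0 * r) \<le> int (M * r)" by (simp only: of_nat_le_iff)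
          have "ennreal \<kappa> * row_sum (tk p u) (2 * C0 * r\<^sup>2) x \<le> ennreal c' * 1"
            by (intro mult_mono row_sum_le_1[OF adm] ennreal_leI) (auto simp: \<kappa>_def)
          also have "ennreal c' * 1 = ennreal c'" by simp
          also have "\<dots> \<le> kset (tk p u) t x {int r..int (M0 * r)}"
          proof (rule bulk_mass)
            fix y assume "y \<in> {int r..int (M0 * r)}"
            then have "int r \<le> y" "y \<le> int (M * r)" using sub unfolding atLeastAtMost_iff by linarith+
            then have "y \<in> {int r..int (M * r)}" by simp
            then show "ennreal (c' / r) \<le> kpow (tk p u) t x y" using r t 3 by (intro c'3[OF _ adm]) auto
          qed (use c' r1 C1 in auto)
          finally show ?thesis .
        qed
      qed
    qed
  qed
qed

end

section \<open>Second moments of the bridge\<close>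

text \<open>The kernel and its transpose satisfy the same estimates with the same constants. This
  makes the lemmas below available for both ends of a bridge.\<close>

locale band = fw: side T r m M0 \<kappa> K + bw: side "\<lambda>x y. T y x" r m M0 \<kappa> K
  for T r m M0 \<kappa> K
begin

abbreviation T' :: "int \<Rightarrow> int \<Rightarrow> ennreal" where "T' \<equiv> \<lambda>x y. T y x"
abbreviation Bk :: "int set" where "Bk \<equiv> {int r..int (M0 * r)}"

lemma dual: "band (\<lambda>x y. T y x) r m M0 \<kappa> K"
  by (simp add: band_def fw.side_axioms bw.side_axioms)

lemma kpow': "kpow T' t x y = kpow T t y x"
  by (rule kpow_transpose)

lemma kset_add: "kset T (s + t) x A = nsum (\<lambda>y. kpow T s x y * kset T t y A)"
  unfolding kset_def by (rule nsum_kpow_add)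

lemma kset_le_rs: "kset T t x A \<le> row_sum T t x"
  unfolding kset_def row_sum_def by (intro nsum_mono) (auto simp: indicator_def)

lemma row_sum_decr: "row_sum T (s + t) x \<le> row_sum T s x"
proof -
  have "row_sum T (s + t) x \<le> nsum (\<lambda>z. kpow T s x z * 1)"
    unfolding row_sum_add by (intro nsum_mono mult_left_mono fw.row_sum_le) auto
  then show ?thesis by (simp add: row_sum_def)
qed

lemma sup_ge: "m \<le> t \<Longrightarrow> kpow T t x y \<le> ennreal (K / r)"
proof -
  assume "m \<le> t"
  then have "kpow T t x y = nsum (\<lambda>z. kpow T (t - m) x z * kpow T m z y)"
    using kpow_add[of T "t - m" m x y] by simp
  also have "\<dots> \<le> nsum (\<lambda>z. kpow T (t - m) x z * ennreal (K / r))"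
    by (intro nsum_mono mult_left_mono fw.sup) auto
  also have "\<dots> = row_sum T (t - m) x * ennreal (K / r)" by (simp add: nsum_multc row_sum_def)
  also have "\<dots> \<le> 1 * ennreal (K / r)" by (intro mult_right_mono fw.row_sum_le) auto
  finally show ?thesis by simp
qed

text \<open>\<open>m\<close> steps are cut off at each end and bounded by row sums; at least
  \<open>m\<close> steps remain in the middle, where \<open>K / r\<close> is a uniform
  bound.\<close>

lemma upper: "3 * m \<le> t \<Longrightarrow> kpow T t x y \<le> ennreal (K / r) * row_sum T m x * row_sum T' m y"
proof -
  assume t: "3 * m \<le> t"
  have "kpow T t x y = nsum (\<lambda>z. kpow T m x z * nsum (\<lambda>w. kpow T (t - 2 * m) z w * kpow T m w y))"
  proof -
    have "kpow T t x y = kpow T (m + ((t - 2 * m) + m)) x y" using t by (intro arg_cong[where f="\<lambda>n. kpow T n x y"]) simp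
    then show ?thesis by (simp only: kpow_add)
  qed
  also have "\<dots> \<le> nsum (\<lambda>z. kpow T m x z * nsum (\<lambda>w. ennreal (K / r) * kpow T m w y))"
    by (intro nsum_mono mult_left_mono mult_right_mono sup_ge) (use t in auto)
  also have "\<dots> = nsum (\<lambda>z. kpow T m x z * (ennreal (K / r) * row_sum T' m y))"
    by (simp add: nsum_cmult row_sum_def kpow'[abs_def])
  also have "\<dots> = row_sum T m x * (ennreal (K / r) * row_sum T' m y)"
    unfolding nsum_multc row_sum_def[of T] ..
  also have "\<dots> = ennreal (K / r) * row_sum T m x * row_sum T' m y" by (simp only: mult_ac)
  finally show ?thesis .
qed

text \<open>The counterpart of \<open>upper\<close>: both ends are sent into the bulk, any two sites
  of which are joined by \<open>m\<close> steps with weight at least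
  \<open>\<kappa> / r\<close>.\<close>

lemma lower: "ennreal (\<kappa> / r) * kset T t1 x Bk * kset T' t2 y Bk \<le> kpow T (t1 + m + t2) x y"
proof -
  have "ennreal (\<kappa> / r) * kset T t1 x Bk * kset T' t2 y Bk
     = nsum (\<lambda>z. kpow T t1 x z * nsum (\<lambda>w. (ennreal (\<kappa> / r) * indicator Bk z * indicator Bk w) * kpow T t2 w y))"
  proof -
    have "nsum (\<lambda>w. (ennreal (\<kappa> / r) * indicator Bk z * indicator Bk w) * kpow T t2 w y)
        = (ennreal (\<kappa> / r) * indicator Bk z) * kset T' t2 y Bk" for z
      unfolding kset_def kpow' nsum_cmult[symmetric] by (simp only: mult_ac)
    then have "nsum (\<lambda>z. kpow T t1 x z * nsum (\<lambda>w. (ennreal (\<kappa> / r) * indicator Bk z * indicator Bk w) * kpow T t2 w y))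
       = nsum (\<lambda>z. (kpow T t1 x z * indicator Bk z) * (ennreal (\<kappa> / r) * kset T' t2 y Bk))"
      by (simp only: mult_ac)
    also have "\<dots> = kset T t1 x Bk * (ennreal (\<kappa> / r) * kset T' t2 y Bk)"
      unfolding nsum_multc kset_def[of T] ..
    finally show ?thesis by (simp only: mult_ac)
  qed
  also have "\<dots> \<le> nsum (\<lambda>z. kpow T t1 x z * nsum (\<lambda>w. kpow T m z w * kpow T t2 w y))"
    by (intro nsum_mono mult_left_mono mult_right_mono) (auto simp: indicator_def fw.bulk2)
  also have "\<dots> = kpow T (t1 + (m + t2)) x y" by (simp only: kpow_add)
  finally show ?thesis by (simp add: add.assoc)
qed

lemma bulk_pairing:
  assumes "m \<le> t1" "t1 \<le> 25 * m" "m \<le> t2" "t2 \<le> 25 * m"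
  shows "ennreal (\<kappa>\<^sup>2 * r) \<le> nsum (\<lambda>x. kset T' t2 x Bk * kset T t1 x Bk)"
proof -
  have "\<kappa>\<^sup>2 * r \<le> \<kappa>\<^sup>2 * real (Suc (M0 * r) - r)"
    by (intro mult_left_mono bulk_card fw.pos) simp
  then have "ennreal (\<kappa>\<^sup>2 * r) \<le> ennreal (\<kappa>\<^sup>2 * real (Suc (M0 * r) - r))" by (rule ennreal_leI)
  also have "\<dots> = nsum (\<lambda>x. ennreal (\<kappa>\<^sup>2) * indicator Bk x)" by (subst nsum_int_multc) auto
  also have "\<dots> \<le> nsum (\<lambda>x. kset T' t2 x Bk * kset T t1 x Bk)"
  proof (rule nsum_mono)
    fix x
    show "ennreal (\<kappa>\<^sup>2) * indicator Bk x \<le> kset T' t2 x Bk * kset T t1 x Bk"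
    proof (cases "x \<in> Bk")
      case True
      have "ennreal (\<kappa>\<^sup>2) = ennreal \<kappa> * ennreal \<kappa>"
        using fw.pos by (simp add: ennreal_mult[symmetric] power2_eq_square)
      also have "\<dots> \<le> kset T' t2 x Bk * kset T t1 x Bk"
        using True assms by (intro mult_mono fw.bulk1 bw.bulk1) auto
      finally show ?thesis using True by simp
    qed auto
  qed
  finally show ?thesis .
qed

text \<open>Bulk mass is never lost for good: it can be delayed by \<open>2 * m + t\<close> steps at
  the price \<open>\<kappa>^3\<close>. One factor joins two bulk sites with weight
  \<open>1 / r\<close>, two more come from bulk returns; the at least \<open>r\<close> bulk sites
  cancel the \<open>1 / r\<close>.\<close>

lemma growth:
  assumes "m \<le> t" "t \<le> 25 * m"
  shows "ennreal (\<kappa> ^ 3) * kset T (s + m) x Bk \<le> kset T (s + 3 * m + t) x Bk"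
proof -
  have "ennreal (\<kappa> ^ 3) = ennreal (\<kappa> / r) * ennreal (\<kappa>\<^sup>2 * r)"
    using fw.pos by (simp add: ennreal_mult[symmetric] power2_eq_square power3_eq_cube)
  then have "ennreal (\<kappa> ^ 3) * kset T (s + m) x Bk
     = nsum (\<lambda>y. (ennreal (\<kappa> / r) * ennreal (\<kappa>\<^sup>2 * r)) * (kpow T s x y * kset T m y Bk))"
    by (simp only: kset_add nsum_cmult)
  also have "\<dots> = nsum (\<lambda>y. kpow T s x y * ((ennreal (\<kappa> / r) * kset T m y Bk) * ennreal (\<kappa>\<^sup>2 * r)))"
    by (simp only: mult_ac)
  also have "\<dots> \<le> nsum (\<lambda>y. kpow T s x y * ((ennreal (\<kappa> / r) * kset T m y Bk) * nsum (\<lambda>z. kset T' m z Bk * kset T t z Bk)))"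
    using fw.pos assms by (intro nsum_mono mult_left_mono bulk_pairing) auto
  also have "\<dots> = nsum (\<lambda>y. kpow T s x y * nsum (\<lambda>z. (ennreal (\<kappa> / r) * kset T m y Bk * kset T' m z Bk) * kset T t z Bk))"
    by (simp only: nsum_cmult[symmetric] mult.assoc)
  also have "\<dots> \<le> nsum (\<lambda>y. kpow T s x y * nsum (\<lambda>z. kpow T (m + m + m) y z * kset T t z Bk))"
    by (intro nsum_mono mult_left_mono mult_right_mono lower) auto
  also have "\<dots> = kset T (s + ((m + m + m) + t)) x Bk" by (simp only: kset_add)
  also have "s + ((m + m + m) + t) = s + 3 * m + t" by simp
  finally show ?thesis .
qed

text \<open>The total mass of the starting side is kept at the time \<open>m + (i - 3 * m)\<close>,
  earlier than \<open>m + i\<close>; this is what makes an induction on time possible.\<close>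

lemma upper_split: "3 * m \<le> i \<Longrightarrow> kpow T i x y \<le> ennreal (K / r) * row_sum T' m y * row_sum T (m + (i - 3 * m)) x"
proof -
  assume i: "3 * m \<le> i"
  have "kpow T i x y = nsum (\<lambda>z. kpow T (i - 3 * m) x z * kpow T (3 * m) z y)"
    using kpow_add[of T "i - 3 * m" "3 * m" x y] i by simp
  also have "\<dots> \<le> nsum (\<lambda>z. kpow T (i - 3 * m) x z * (ennreal (K / r) * row_sum T m z * row_sum T' m y))"
    by (intro nsum_mono mult_left_mono upper) auto
  also have "\<dots> = nsum (\<lambda>z. (ennreal (K / r) * row_sum T' m y) * (kpow T (i - 3 * m) x z * row_sum T m z))"
    by (simp only: mult_ac)
  also have "\<dots> = ennreal (K / r) * row_sum T' m y * row_sum T ((i - 3 * m) + m) x"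
    unfolding row_sum_add nsum_cmult ..
  finally show ?thesis by (simp add: add.commute)
qed

end

section \<open>Summation of the tails\<close>

lemma nsum_inverse_square:
  assumes r: "r \<ge> (1::nat)" and C: "C \<ge> 0"
  shows "nsum (\<lambda>x. ennreal (C * (real r / of_int x)\<^sup>2) * indicator {int r..} x) \<le> ennreal (2 * C * r)"
proof -
  have bij: "bij_betw (\<lambda>k. int (r + k)) UNIV {int r..}"
    by (rule bij_betwI[where g="\<lambda>x. nat x - r"]) auto
  have "nsum (\<lambda>x. ennreal (C * (real r / of_int x)\<^sup>2) * indicator {int r..} x) = (\<integral>\<^sup>+x. ennreal (C * (real r / of_int x)\<^sup>2) \<partial>count_space {int r..})"
    by (subst nn_integral_count_space_indicator) auto
  also have "\<dots> = (\<integral>\<^sup>+k. ennreal (C * (real r / of_int (int (r + k)))\<^sup>2) \<partial>count_space UNIV)"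
    by (rule nn_integral_bij_count_space[OF bij, symmetric])
  also have "\<dots> \<le> (\<integral>\<^sup>+k. ennreal (2 * C * (real r)\<^sup>2 * (1 / (real r + k) - 1 / (real r + Suc k))) \<partial>count_space UNIV)"
  proof (intro nn_integral_mono ennreal_leI)
    fix k :: nat
    define x where "x = real r + k"
    have x: "x \<ge> 1" using r by (simp add: x_def)
    have "x * 1 \<le> x * x" using x by (intro mult_left_mono) auto
    then have "2 / (2 * x\<^sup>2) \<le> 2 / (x * (x + 1))"
      using x by (intro divide_left_mono) (auto simp: power2_eq_square algebra_simps intro!: mult_pos_pos add_pos_pos)
    also have "\<dots> = 2 * (1 / x - 1 / (x + 1))" using x by (simp add: field_simps)
    \<comment> \<open>Comparison with a telescoping series.\<close>
    finally have "1 / x\<^sup>2 \<le> 2 * (1 / x - 1 / (x + 1))" by simp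
    then have "C * (real r)\<^sup>2 * (1 / x\<^sup>2) \<le> C * (real r)\<^sup>2 * (2 * (1 / x - 1 / (x + 1)))"
      using C by (intro mult_left_mono) auto
    moreover have "C * (real r / of_int (int (r + k)))\<^sup>2 = C * (real r)\<^sup>2 * (1 / x\<^sup>2)"
      by (simp add: x_def power_divide)
    moreover have "real r + Suc k = x + 1" by (simp add: x_def)
    then have "2 * C * (real r)\<^sup>2 * (1 / (real r + k) - 1 / (real r + Suc k)) = C * (real r)\<^sup>2 * (2 * (1 / x - 1 / (x + 1)))"
      unfolding x_def[symmetric] by (simp only: mult_ac)
    ultimately show "C * (real r / of_int (int (r + k)))\<^sup>2 \<le> 2 * C * (real r)\<^sup>2 * (1 / (real r + k) - 1 / (real r + Suc k))"
      by (simp only:)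
  qed
  also have "\<dots> = (\<Sum>k. ennreal (2 * C * (real r)\<^sup>2 * (1 / (real r + k) - 1 / (real r + Suc k))))"
    by (rule nn_integral_count_space_nat)
  also have "\<dots> = ennreal (2 * C * r)"
  proof (rule suminf_ennreal_eq)
    show "0 \<le> 2 * C * (real r)\<^sup>2 * (1 / (real r + k) - 1 / (real r + Suc k))" for k
      using C r by (intro mult_nonneg_nonneg) (auto simp: frac_le)
    have "(\<lambda>k. 1 / (real r + k)) \<longlonglongrightarrow> 0"
      by (intro tendsto_divide_0[OF tendsto_const] filterlim_at_top_imp_at_infinity
          filterlim_tendsto_add_at_top[OF tendsto_const] filterlim_real_sequentially)
    from telescope_sums'[OF this] have "(\<lambda>k. 1 / (real r + k) - 1 / (real r + Suc k)) sums (1 / r)" by simp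
    from sums_mult[OF this, of "2 * C * (real r)\<^sup>2"]
    have "(\<lambda>k. 2 * C * (real r)\<^sup>2 * (1 / (real r + k) - 1 / (real r + Suc k))) sums (2 * C * (real r)\<^sup>2 * (1 / r))" .
    moreover have "2 * C * (real r)\<^sup>2 * (1 / r) = 2 * C * r" using r by (simp add: power2_eq_square)
    ultimately show "(\<lambda>k. 2 * C * (real r)\<^sup>2 * (1 / (real r + k) - 1 / (real r + Suc k))) sums (2 * C * r)"
      by (simp only:)
  qed
  finally show ?thesis .
qed

lemma tail_sum:
  assumes "tail T r m C" "r \<ge> 1" "C \<ge> 0"
  shows "nsum (\<lambda>x. row_sum T m x * indicator {int r..} x) \<le> ennreal (2 * C * r)"
proof -
  have "nsum (\<lambda>x. row_sum T m x * indicator {int r..} x) \<le> nsum (\<lambda>x. ennreal (C * (real r / of_int x)\<^sup>2) * indicator {int r..} x)"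
    using assms(1) by (intro nsum_mono) (auto simp: tail_def indicator_def)
  also have "\<dots> \<le> ennreal (2 * C * r)" by (rule nsum_inverse_square[OF assms(2,3)])
  finally show ?thesis .
qed

lemma tail_at:
  assumes "tail T r m C" "r \<ge> 1" "C \<ge> 0" "M \<ge> 1" "x > int (M * r)"
  shows "row_sum T m x \<le> ennreal (C / (real M)\<^sup>2)"
proof -
  have "1 * r \<le> M * r" using assms by (intro mult_right_mono) auto
  then have "int r \<le> int (M * r)" by (simp only: mult_1 of_nat_le_iff)
  then have "x \<ge> int r" using assms(5) by linarith
  then have "row_sum T m x \<le> ennreal (C * (real r / of_int x)\<^sup>2)" using assms(1) by (simp add: tail_def)
  also have "\<dots> \<le> ennreal (C / (real M)\<^sup>2)"
  proof (rule ennreal_leI)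
    have "real_of_int x \<ge> of_int (int (M * r))" using assms(5) by (subst of_int_le_iff) simp
    then have "real M * r \<le> of_int x" by simp
    moreover have "real M * r > 0" using assms by simp
    ultimately have "real r / of_int x \<le> real r / (real M * r)" by (intro divide_left_mono) auto
    also have "\<dots> = 1 / M" using assms by simp
    finally have "(real r / of_int x)\<^sup>2 \<le> (1 / M)\<^sup>2"
      using \<open>real M * r \<le> of_int x\<close> \<open>real M * r > 0\<close> by (intro power_mono) auto
    then have "C * (real r / of_int x)\<^sup>2 \<le> C * (1 / M)\<^sup>2" using assms by (intro mult_left_mono)
    then show "C * (real r / of_int x)\<^sup>2 \<le> C / (real M)\<^sup>2" by (simp add: power_divide)
  qed
  finally show ?thesis .
qed

text \<open>One factor is bounded by its supremum \<open>C / M^2\<close> above \<open>M * r\<close>,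
  the other one is summed. The gain \<open>1 / M^2\<close> is what makes great heights
  negligible.\<close>

lemma tail_product:
  assumes "tail T r m C" "tail T' r m C" "r \<ge> 1" "C \<ge> 0" "M \<ge> 1"
  shows "nsum (\<lambda>x. row_sum T' m x * row_sum T m x * indicator {int (M * r)<..} x) \<le> ennreal (2 * C\<^sup>2 * r / (real M)\<^sup>2)"
proof -
  have "1 * r \<le> M * r" using assms by (intro mult_right_mono) auto
  then have rM: "int r \<le> int (M * r)" by (simp only: mult_1 of_nat_le_iff)
  have "nsum (\<lambda>x. row_sum T' m x * row_sum T m x * indicator {int (M * r)<..} x)
     \<le> nsum (\<lambda>x. ennreal (C / (real M)\<^sup>2) * (row_sum T m x * indicator {int r..} x))"
  proof (rule nsum_mono)
    fix x
    show "row_sum T' m x * row_sum T m x * indicator {int (M * r)<..} x \<le> ennreal (C / (real M)\<^sup>2) * (row_sum T m x * indicator {int r..} x)"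
    proof (cases "x > int (M * r)")
      case True
      then have "x \<ge> int r" using rM by linarith
      then show ?thesis using tail_at[OF assms(2-5) True] True by (simp add: mult_right_mono)
    next
      case False
      then have "indicator {int (M * r)<..} x = (0::ennreal)" by (simp only: indicator_def greaterThan_iff of_bool_eq)
      then show ?thesis by (simp only: mult_zero_right zero_le)
    qed
  qed
  also have "\<dots> \<le> ennreal (C / (real M)\<^sup>2) * ennreal (2 * C * r)"
    unfolding nsum_cmult by (intro mult_left_mono tail_sum assms) auto
  also have "\<dots> = ennreal (2 * C\<^sup>2 * r / (real M)\<^sup>2)"
    using assms by (subst ennreal_mult[symmetric]) (auto simp: power2_eq_square mult_ac)
  finally show ?thesis .
qed

context band
begin

text \<open>Induction on time. At time \<open>i\<close>, positions below \<open>M1 * r\<close> are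
  handled by \<open>region\<close>. Positions above have weight at most a small multiple of the mass
  at the time \<open>m + (i - 3 * m)\<close>, to which the induction hypothesis applies;
  \<open>growth\<close> carries the result back to the present time.\<close>

lemma domination:
  assumes tail: "tail T r m C" "tail T' r m C" and C: "C > 0" and M1: "M1 \<ge> 1"
    and small: "2 * K * C\<^sup>2 / (real M1)\<^sup>2 \<le> \<kappa> ^ 3 / 2"
    and reg: "region T r m M0 M1 \<kappa>1" and \<kappa>1: "\<kappa>1 > 0"
  shows "m \<le> t \<Longrightarrow> t \<le> 7 * m \<Longrightarrow> ennreal \<kappa>1 * row_sum T (m + i) 0 \<le> 2 * kset T (i + t) 0 Bk"
proof (induction i arbitrary: t rule: less_induct)
  case (less i)
  show ?case
  proof (cases "i < 3 * m")
    \<comment> \<open>Here \<open>i + t \<le> 10 * m\<close> is still inside the window of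
      \<open>region\<close>, which is applied at the start 0 itself.\<close>
    case True
    have "ennreal \<kappa>1 * row_sum T (m + i) 0 \<le> ennreal \<kappa>1 * row_sum T m 0"
      by (intro mult_left_mono row_sum_decr) auto
    also have "\<dots> \<le> kset T (i + t) 0 Bk" using reg True less.prems by (auto simp: region_def)
    also have "\<dots> \<le> 2 * kset T (i + t) 0 Bk" by (simp add: mult_2)
    finally show ?thesis .
  next
    case False
    then have i: "3 * m \<le> i" by simp
    let ?j = "i - 3 * m"
    let ?H = "{int (M1 * r)<..}"
    have "ennreal \<kappa>1 * row_sum T (m + i) 0 = nsum (\<lambda>x. kpow T i 0 x * (ennreal \<kappa>1 * row_sum T m x))"
      unfolding add.commute[of m i] row_sum_add nsum_cmult[symmetric] by (simp only: mult_ac)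
    also have "\<dots> \<le> nsum (\<lambda>x. kpow T i 0 x * kset T t x Bk
        + (ennreal \<kappa>1 * ennreal (K / r) * row_sum T (m + ?j) 0) * (row_sum T' m x * row_sum T m x * indicator ?H x))"
    proof (rule nsum_mono)
      fix x
      show "kpow T i 0 x * (ennreal \<kappa>1 * row_sum T m x) \<le> kpow T i 0 x * kset T t x Bk
        + (ennreal \<kappa>1 * ennreal (K / r) * row_sum T (m + ?j) 0) * (row_sum T' m x * row_sum T m x * indicator ?H x)"
      proof (cases "x \<le> int (M1 * r)")
        case True
        have "ennreal \<kappa>1 * row_sum T m x \<le> kset T t x Bk"
          using reg True less.prems unfolding region_def by auto
        then have "kpow T i 0 x * (ennreal \<kappa>1 * row_sum T m x) \<le> kpow T i 0 x * kset T t x Bk" by (rule mult_left_mono) auto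
        then show ?thesis by (rule order_trans) simp
      next
        case False
        then have "indicator ?H x = (1::ennreal)" by simp
        moreover have "kpow T i 0 x * (ennreal \<kappa>1 * row_sum T m x) \<le> (ennreal (K / r) * row_sum T' m x * row_sum T (m + ?j) 0) * (ennreal \<kappa>1 * row_sum T m x)"
          by (intro mult_right_mono upper_split i) auto
        ultimately have "kpow T i 0 x * (ennreal \<kappa>1 * row_sum T m x) \<le> (ennreal \<kappa>1 * ennreal (K / r) * row_sum T (m + ?j) 0) * (row_sum T' m x * row_sum T m x * indicator ?H x)"
          by (simp only: mult_ac mult_1_right mult_1)
        then show ?thesis by (rule order_trans) simp
      qed
    qed
    also have "\<dots> = kset T (i + t) 0 Bk + (ennreal \<kappa>1 * ennreal (K / r) * row_sum T (m + ?j) 0) * nsum (\<lambda>x. row_sum T' m x * row_sum T m x * indicator ?H x)"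
      by (simp only: nsum_add nsum_cmult kset_add)
    also have "\<dots> \<le> kset T (i + t) 0 Bk + (ennreal \<kappa>1 * ennreal (K / r) * row_sum T (m + ?j) 0) * ennreal (2 * C\<^sup>2 * r / (real M1)\<^sup>2)"
      using fw.pos C by (intro add_left_mono mult_left_mono tail_product tail M1) auto
    also have "(ennreal \<kappa>1 * ennreal (K / r) * row_sum T (m + ?j) 0) * ennreal (2 * C\<^sup>2 * r / (real M1)\<^sup>2)
        = ennreal (2 * K * C\<^sup>2 / (real M1)\<^sup>2) * (ennreal \<kappa>1 * row_sum T (m + ?j) 0)"
    proof -
      have "ennreal (K / r) * ennreal (2 * C\<^sup>2 * r / (real M1)\<^sup>2) = ennreal (2 * K * C\<^sup>2 / (real M1)\<^sup>2)"
        using fw.pos by (subst ennreal_mult[symmetric]) auto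
      moreover have "a * b * c * d = (b * d) * (a * c)" for a b c d :: ennreal by (simp only: mult_ac)
      ultimately show ?thesis by (simp only:)
    qed
    \<comment> \<open>The coefficient \<open>\<kappa>^3 / 2\<close> offsets the factor 2 of the
      induction hypothesis, so that the high part costs one further copy of the bulk mass and the
      factor 2 reproduces itself.\<close>
    also have "\<dots> \<le> ennreal (\<kappa> ^ 3 / 2) * (2 * kset T (?j + m) 0 Bk)"
    proof (rule mult_mono[OF ennreal_leI[OF small]])
      show "ennreal \<kappa>1 * row_sum T (m + ?j) 0 \<le> 2 * kset T (?j + m) 0 Bk"
        by (rule less.IH) (use fw.pos i in auto)
    qed auto
    also have "\<dots> = ennreal (\<kappa> ^ 3) * kset T (?j + m) 0 Bk"
    proof -
      have "ennreal (\<kappa> ^ 3 / 2) * 2 = ennreal (\<kappa> ^ 3 / 2 * 2)"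
        using fw.pos by (subst ennreal_mult) auto
      then show ?thesis by (simp only: mult.assoc[symmetric]) simp
    qed
    also have "\<dots> \<le> kset T (?j + 3 * m + t) 0 Bk" using less.prems by (intro growth) auto
    also have "?j + 3 * m + t = i + t" using i by simp
    finally show ?thesis by (simp add: mult_2 add_left_mono)
  qed
qed

text \<open>Mass above \<open>r\<close> at time \<open>i\<close> is counted here without asking for
  survival afterwards, as the bound by \<open>tail\<close> in \<open>moment\<close> requires. For
  \<open>i < 3 * m\<close> both sides are compared with \<open>q\<close>; later the column sums
  above \<open>r\<close> are of order \<open>r\<close>, which cancels the \<open>1 / r\<close> of
  \<open>upper_split\<close>.\<close>

lemma high_domination:
  assumes tail: "tail T' r m C" and C: "C > 0"
    and dom: "\<And>i t. m \<le> t \<Longrightarrow> t \<le> 7 * m \<Longrightarrow> ennreal \<delta> * row_sum T (m + i) 0 \<le> kset T (i + t) 0 Bk"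
    and \<delta>: "\<delta> > 0" and \<delta>': "0 < \<delta>'" "\<delta>' \<le> \<kappa>" "2 * K * C * \<delta>' \<le> \<kappa> ^ 3 * \<delta>"
    and t: "m \<le> t" "t \<le> 7 * m"
  shows "ennreal \<delta>' * kset T i 0 {int r..} \<le> kset T (i + t) 0 Bk"
proof (cases "i < 3 * m")
  case True
  obtain q where q: "q \<ge> 0" "kset T i 0 {int r..} \<le> ennreal q"
      "\<And>t. m \<le> t \<Longrightarrow> t \<le> 25 * m \<Longrightarrow> ennreal (\<kappa> * q) \<le> kset T t 0 Bk"
    using fw.start by blast
  have "ennreal \<delta>' * kset T i 0 {int r..} \<le> ennreal \<kappa> * ennreal q"
    using q \<delta>' by (intro mult_mono ennreal_leI) auto
  also have "\<dots> = ennreal (\<kappa> * q)" using q fw.pos by (subst ennreal_mult) auto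
  also have "\<dots> \<le> kset T (i + t) 0 Bk" using True t by (intro q) auto
  finally show ?thesis .
next
  case False
  then have i: "3 * m \<le> i" by simp
  let ?j = "i - 3 * m"
  have "kset T i 0 {int r..} \<le> nsum (\<lambda>x. (ennreal (K / r) * row_sum T (m + ?j) 0) * (row_sum T' m x * indicator {int r..} x))"
    unfolding kset_def
  proof (rule nsum_mono)
    fix x
    have "kpow T i 0 x * indicator {int r..} x \<le> (ennreal (K / r) * row_sum T' m x * row_sum T (m + ?j) 0) * indicator {int r..} x"
      by (intro mult_right_mono upper_split i) auto
    then show "kpow T i 0 x * indicator {int r..} x \<le> (ennreal (K / r) * row_sum T (m + ?j) 0) * (row_sum T' m x * indicator {int r..} x)"
      by (simp only: mult_ac)
  qed
  also have "\<dots> \<le> (ennreal (K / r) * row_sum T (m + ?j) 0) * ennreal (2 * C * r)"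
    unfolding nsum_cmult using fw.pos C by (intro mult_left_mono tail_sum tail) auto
  also have "\<dots> = ennreal (2 * K * C) * row_sum T (m + ?j) 0"
  proof -
    have "ennreal (K / r) * ennreal (2 * C * r) = ennreal (2 * K * C)"
      using fw.pos C by (subst ennreal_mult[symmetric]) (auto simp: mult_ac)
    moreover have "b * c * d = (b * d) * c" for b c d :: ennreal by (simp only: mult_ac)
    ultimately show ?thesis by (simp only:)
  qed
  finally have "ennreal \<delta>' * kset T i 0 {int r..} \<le> ennreal \<delta>' * (ennreal (2 * K * C) * row_sum T (m + ?j) 0)"
    by (rule mult_left_mono) auto
  also have "\<dots> = ennreal (2 * K * C * \<delta>') * row_sum T (m + ?j) 0"
  proof -
    have "ennreal (2 * K * C * \<delta>') = ennreal \<delta>' * ennreal (2 * K * C)"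
      using \<delta>' C fw.pos by (subst ennreal_mult[symmetric]) (auto simp: mult_ac)
    then show ?thesis by (simp only: mult.assoc)
  qed
  also have "\<dots> \<le> ennreal (\<kappa> ^ 3 * \<delta>) * row_sum T (m + ?j) 0"
    by (intro mult_right_mono ennreal_leI \<delta>') auto
  also have "\<dots> = ennreal (\<kappa> ^ 3) * (ennreal \<delta> * row_sum T (m + ?j) 0)"
    using fw.pos \<delta> by (subst ennreal_mult) (auto simp: mult.assoc)
  also have "\<dots> \<le> ennreal (\<kappa> ^ 3) * kset T (?j + m) 0 Bk"
    using fw.pos by (intro mult_left_mono dom) auto
  also have "\<dots> \<le> kset T (?j + 3 * m + t) 0 Bk" using t by (intro growth) auto
  also have "?j + 3 * m + t = i + t" using i by simp
  finally show ?thesis .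
qed

end

context band
begin

text \<open>For a bounded number of blocks the data at the start suffice, without any tail estimate:
  numerator and partition function both contain \<open>q * q' / r\<close>, with \<open>q'\<close>
  the number of the reversed side.\<close>

lemma small_time_second_moment:
  assumes n: "3 * m \<le> n" and N: "i + n \<le> 24 * m"
  shows "ennreal (\<kappa> ^ 3) * nsum (\<lambda>x. kpow T i 0 x * (ennreal ((of_int x)\<^sup>2) * kpow T n x 0))
    \<le> ennreal (K\<^sup>2 * (real r)\<^sup>2) * kpow T (i + n) 0 0"
proof -
  define j where "j = n - 3 * m"
  have nj: "n = m + m + m + j" using n by (simp add: j_def)
  obtain q where q: "q \<ge> 0" "\<And>t. m \<le> t \<Longrightarrow> t \<le> 25 * m \<Longrightarrow> ennreal (\<kappa> * q) \<le> kset T t 0 Bk"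
    "\<And>t. t \<le> 25 * m \<Longrightarrow> nsum (\<lambda>y. kpow T t 0 y * ennreal ((of_int y)\<^sup>2)) \<le> ennreal (K * (real r)\<^sup>2 * q)"
    using fw.start by blast
  obtain q' where q': "q' \<ge> 0" "row_sum T' m 0 \<le> ennreal q'" "\<And>t. m \<le> t \<Longrightarrow> t \<le> 25 * m \<Longrightarrow> ennreal (\<kappa> * q') \<le> kset T' t 0 Bk"
    using bw.start by blast
  interpret d: band T' by (rule dual)
  have "nsum (\<lambda>x. kpow T i 0 x * (ennreal ((of_int x)\<^sup>2) * kpow T n x 0))
     \<le> nsum (\<lambda>x. (kpow T i 0 x * ennreal ((of_int x)\<^sup>2)) * (ennreal (K / r) * ennreal q'))"
  proof (rule nsum_mono)
    fix x
    have "kpow T n x 0 \<le> ennreal (K / r) * row_sum T m x * row_sum T' (m + j) 0"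
      using d.upper_split[OF n, of 0 x] by (simp add: kpow' j_def)
    also have "\<dots> \<le> ennreal (K / r) * 1 * ennreal q'"
      by (intro mult_mono fw.row_sum_le order_trans[OF d.row_sum_decr q'(2)]) auto
    finally have "kpow T n x 0 \<le> ennreal (K / r) * ennreal q'" by simp
    then have "(kpow T i 0 x * ennreal ((of_int x)\<^sup>2)) * kpow T n x 0 \<le> (kpow T i 0 x * ennreal ((of_int x)\<^sup>2)) * (ennreal (K / r) * ennreal q')"
      by (rule mult_left_mono) simp
    then show "kpow T i 0 x * (ennreal ((of_int x)\<^sup>2) * kpow T n x 0) \<le> (kpow T i 0 x * ennreal ((of_int x)\<^sup>2)) * (ennreal (K / r) * ennreal q')"
      by (simp only: mult.assoc)
  qed
  also have "\<dots> \<le> ennreal (K * (real r)\<^sup>2 * q) * (ennreal (K / r) * ennreal q')"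
    unfolding nsum_multc using N by (intro mult_right_mono q) auto
  also have "\<dots> = ennreal (K * (real r)\<^sup>2 * q * (K / r * q'))"
    using fw.pos q(1) q'(1) by (simp add: ennreal_mult[symmetric])
  finally have "ennreal (\<kappa> ^ 3) * nsum (\<lambda>x. kpow T i 0 x * (ennreal ((of_int x)\<^sup>2) * kpow T n x 0))
     \<le> ennreal (\<kappa> ^ 3) * ennreal (K * (real r)\<^sup>2 * q * (K / r * q'))"
    by (rule mult_left_mono) simp
  also have "\<dots> = ennreal (K\<^sup>2 * (real r)\<^sup>2) * (ennreal (\<kappa> / r) * ennreal (\<kappa> * q) * ennreal (\<kappa> * q'))"
    using fw.pos q(1) q'(1) by (simp add: ennreal_mult[symmetric] power2_eq_square power3_eq_cube)
  also have "\<dots> \<le> ennreal (K\<^sup>2 * (real r)\<^sup>2) * (ennreal (\<kappa> / r) * kset T (i + m) 0 Bk * kset T' (m + j) 0 Bk)"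
    using N nj by (intro mult_left_mono mult_mono q q') auto
  also have "\<dots> \<le> ennreal (K\<^sup>2 * (real r)\<^sup>2) * kpow T ((i + m) + m + (m + j)) 0 0"
    by (intro mult_left_mono lower) simp
  also have "(i + m) + m + (m + j) = i + n" using nj by simp
  finally show ?thesis .
qed

end

text \<open>\<open>dom\<close> and \<open>hi\<close> extend the comparison with the bulk from the
  bounded time window of \<open>side\<close> to all times \<open>i\<close>.\<close>

locale controlled = band T r m M0 \<kappa> K for T r m M0 \<kappa> K +
  fixes C \<delta> :: real
  assumes C: "C > 0" and \<delta>: "\<delta> > 0"
    and tail_fw: "tail T r m C" and tail_bw: "tail (\<lambda>x y. T y x) r m C"
    and dom: "m \<le> t \<Longrightarrow> t \<le> 7 * m \<Longrightarrow> ennreal \<delta> * row_sum T (m + i) 0 \<le> kset T (i + t) 0 Bk"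
    and dom': "m \<le> t \<Longrightarrow> t \<le> 7 * m \<Longrightarrow> ennreal \<delta> * row_sum (\<lambda>x y. T y x) (m + i) 0 \<le> kset (\<lambda>x y. T y x) (i + t) 0 Bk"
    and hi: "m \<le> t \<Longrightarrow> t \<le> 7 * m \<Longrightarrow> ennreal \<delta> * kset T i 0 {int r..} \<le> kset T (i + t) 0 Bk"
    and hi': "m \<le> t \<Longrightarrow> t \<le> 7 * m \<Longrightarrow> ennreal \<delta> * kset (\<lambda>x y. T y x) i 0 {int r..} \<le> kset (\<lambda>x y. T y x) (i + t) 0 Bk"
begin

lemma controlled_dual: "controlled (\<lambda>x y. T y x) r m M0 \<kappa> K C \<delta>"
  using dual C \<delta> tail_fw tail_bw dom dom' hi hi'
  by (simp add: controlled_def controlled_axioms_def)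

text \<open>Below \<open>r\<close> the power is at most \<open>r^k\<close>; above \<open>r\<close>
  the factor \<open>(r / x)^2\<close> of the row sum compensates \<open>x^k\<close> as long as
  \<open>k \<le> 2\<close>.\<close>

lemma moment:
  assumes t: "m \<le> t" "t \<le> 7 * m" and k: "k = 1 \<or> k = (2::nat)"
  shows "ennreal \<delta> * nsum (\<lambda>x. kpow T i 0 x * (ennreal (of_int x ^ k) * row_sum T m x)) \<le> ennreal ((1 + C) * real r ^ k) * kset T (i + t) 0 Bk"
proof -
  have pt: "ennreal (of_int x ^ k) * row_sum T m x \<le> ennreal (real r ^ k) * row_sum T m x + ennreal (C * real r ^ k) * indicator {int r..} x" for x
  proof -
    consider "x < 0" | "0 \<le> x" "x < int r" | "x \<ge> int r" by linarith
    then show ?thesis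
    proof cases
      case 1
      have "kpow T m x y = 0" for y using fw.neg[OF 1] fw.pos by (cases m) auto
      then have "row_sum T m x = 0" by (simp add: row_sum_def)
      then show ?thesis by simp
    next
      case 2
      then have "real_of_int x ^ k \<le> real r ^ k" by (intro power_mono) linarith+
      then have "ennreal (of_int x ^ k) * row_sum T m x \<le> ennreal (real r ^ k) * row_sum T m x"
        by (intro mult_right_mono ennreal_leI) auto
      then show ?thesis by (rule order_trans) simp
    next
      case 3
      have xp: "real_of_int x \<ge> r" "real_of_int x > 0" using 3 fw.pos(3) by linarith+
      have "ennreal (of_int x ^ k) * row_sum T m x \<le> ennreal (of_int x ^ k) * ennreal (C * (real r / of_int x)\<^sup>2)"
        using tail_fw 3 by (intro mult_left_mono) (auto simp: tail_def)
      also have "\<dots> = ennreal (of_int x ^ k * (C * (real r / of_int x)\<^sup>2))"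
        using xp C by (subst ennreal_mult) auto
      also have "\<dots> \<le> ennreal (C * real r ^ k)"
      proof (rule ennreal_leI)
        have "(real r / of_int x)\<^sup>2 \<le> (real r / of_int x) ^ k"
          using xp k by (intro power_decreasing) auto
        then have "of_int x ^ k * (C * (real r / of_int x)\<^sup>2) \<le> of_int x ^ k * (C * (real r / of_int x) ^ k)"
          using xp C by (intro mult_left_mono) auto
        also have "\<dots> = C * real r ^ k" using xp by (simp add: power_divide)
        finally show "of_int x ^ k * (C * (real r / of_int x)\<^sup>2) \<le> C * real r ^ k" .
      qed
      finally have "ennreal (of_int x ^ k) * row_sum T m x \<le> ennreal (C * real r ^ k) * indicator {int r..} x" using 3 by simp
      then show ?thesis by (rule order_trans) simp
    qed
  qed
  have "nsum (\<lambda>x. kpow T i 0 x * (ennreal (of_int x ^ k) * row_sum T m x))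
    \<le> nsum (\<lambda>x. ennreal (real r ^ k) * (kpow T i 0 x * row_sum T m x) + ennreal (C * real r ^ k) * (kpow T i 0 x * indicator {int r..} x))"
  proof (rule nsum_mono)
    fix x
    have "kpow T i 0 x * (ennreal (of_int x ^ k) * row_sum T m x) \<le> kpow T i 0 x * (ennreal (real r ^ k) * row_sum T m x + ennreal (C * real r ^ k) * indicator {int r..} x)"
      by (intro mult_left_mono pt) simp
    then show "kpow T i 0 x * (ennreal (of_int x ^ k) * row_sum T m x) \<le> ennreal (real r ^ k) * (kpow T i 0 x * row_sum T m x) + ennreal (C * real r ^ k) * (kpow T i 0 x * indicator {int r..} x)"
      by (simp only: distrib_left mult_ac)
  qed
  also have "\<dots> = ennreal (real r ^ k) * row_sum T (m + i) 0 + ennreal (C * real r ^ k) * kset T i 0 {int r..}"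
    by (simp only: nsum_add nsum_cmult row_sum_add[symmetric] kset_def[symmetric] add.commute)
  finally have "ennreal \<delta> * nsum (\<lambda>x. kpow T i 0 x * (ennreal (of_int x ^ k) * row_sum T m x))
    \<le> ennreal \<delta> * (ennreal (real r ^ k) * row_sum T (m + i) 0 + ennreal (C * real r ^ k) * kset T i 0 {int r..})"
    by (rule mult_left_mono) simp
  also have "\<dots> = ennreal (real r ^ k) * (ennreal \<delta> * row_sum T (m + i) 0) + ennreal (C * real r ^ k) * (ennreal \<delta> * kset T i 0 {int r..})"
    by (simp only: distrib_left mult_ac)
  also have "\<dots> \<le> ennreal (real r ^ k) * kset T (i + t) 0 Bk + ennreal (C * real r ^ k) * kset T (i + t) 0 Bk"
    by (intro add_mono mult_left_mono dom hi t) auto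
  also have "\<dots> = ennreal ((1 + C) * real r ^ k) * kset T (i + t) 0 Bk"
  proof -
    have "ennreal ((1 + C) * real r ^ k) = ennreal (real r ^ k) + ennreal (C * real r ^ k)"
      using C by (subst ennreal_plus[symmetric]) (auto simp: distrib_right)
    then show ?thesis by (simp only: distrib_right)
  qed
  finally show ?thesis .
qed

text \<open>\<open>upper_split\<close> from the right end separates the bridge into a weighted mass
  on the left, bounded by \<open>moment\<close>, and the mass of the reversed walk on the right,
  bounded by \<open>dom'\<close>. Their product is the lower bound for the partition
  function.\<close>

lemma second_moment_right:
  assumes n: "3 * m \<le> n"
  shows "ennreal (\<delta>\<^sup>2 * \<kappa>) * nsum (\<lambda>x. kpow T i 0 x * (ennreal ((of_int x)\<^sup>2) * kpow T n x 0))
    \<le> ennreal (K * (1 + C) * (real r)\<^sup>2) * kpow T (i + n) 0 0"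
proof -
  define j where "j = n - 3 * m"
  have nj: "n = m + m + m + j" using n by (simp add: j_def)
  interpret d: controlled T' by (rule controlled_dual)
  let ?M2 = "nsum (\<lambda>x. kpow T i 0 x * (ennreal (of_int x ^ 2) * row_sum T m x))"
  have "nsum (\<lambda>x. kpow T i 0 x * (ennreal ((of_int x)\<^sup>2) * kpow T n x 0))
     \<le> nsum (\<lambda>x. (ennreal (K / r) * row_sum T' (m + j) 0) * (kpow T i 0 x * (ennreal (of_int x ^ 2) * row_sum T m x)))"
  proof (rule nsum_mono)
    fix x
    have "kpow T n x 0 \<le> ennreal (K / r) * row_sum T m x * row_sum T' (m + j) 0"
      using d.upper_split[OF n, of 0 x] by (simp add: kpow' j_def)
    then have "kpow T i 0 x * (ennreal ((of_int x)\<^sup>2) * kpow T n x 0) \<le> kpow T i 0 x * (ennreal ((of_int x)\<^sup>2) * (ennreal (K / r) * row_sum T m x * row_sum T' (m + j) 0))"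
      by (intro mult_left_mono) auto
    then show "kpow T i 0 x * (ennreal ((of_int x)\<^sup>2) * kpow T n x 0) \<le> (ennreal (K / r) * row_sum T' (m + j) 0) * (kpow T i 0 x * (ennreal (of_int x ^ 2) * row_sum T m x))"
      by (simp only: mult_ac)
  qed
  also have "\<dots> = (ennreal (K / r) * row_sum T' (m + j) 0) * ?M2" by (rule nsum_cmult)
  finally have "ennreal (\<delta>\<^sup>2 * \<kappa>) * nsum (\<lambda>x. kpow T i 0 x * (ennreal ((of_int x)\<^sup>2) * kpow T n x 0))
    \<le> ennreal (\<delta>\<^sup>2 * \<kappa>) * ((ennreal (K / r) * row_sum T' (m + j) 0) * ?M2)"
    by (rule mult_left_mono) simp
  also have "\<dots> = ennreal \<kappa> * ennreal (K / r) * ((ennreal \<delta> * row_sum T' (m + j) 0) * (ennreal \<delta> * ?M2))"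
  proof -
    have "ennreal (\<delta>\<^sup>2 * \<kappa>) = ennreal \<delta> * ennreal \<delta> * ennreal \<kappa>"
      using \<delta> fw.pos by (simp add: ennreal_mult[symmetric] power2_eq_square)
    then show ?thesis by (simp only: mult_ac)
  qed
  also have "\<dots> \<le> ennreal \<kappa> * ennreal (K / r) * (kset T' (j + m) 0 Bk * (ennreal ((1 + C) * real r ^ 2) * kset T (i + m) 0 Bk))"
    by (intro mult_left_mono mult_mono dom' moment) auto
  also have "\<dots> = ennreal (K * (1 + C) * (real r)\<^sup>2) * (ennreal (\<kappa> / r) * kset T (i + m) 0 Bk * kset T' (m + j) 0 Bk)"
  proof -
    have "ennreal \<kappa> * ennreal (K / r) * ennreal ((1 + C) * real r ^ 2) = ennreal (K * (1 + C) * (real r)\<^sup>2) * ennreal (\<kappa> / r)"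
      using fw.pos C by (simp add: ennreal_mult[symmetric] mult_ac)
    then have "ennreal \<kappa> * ennreal (K / r) * ennreal ((1 + C) * real r ^ 2) * (kset T' (j + m) 0 Bk * kset T (i + m) 0 Bk)
      = ennreal (K * (1 + C) * (real r)\<^sup>2) * ennreal (\<kappa> / r) * (kset T' (j + m) 0 Bk * kset T (i + m) 0 Bk)" by (simp only:)
    then show ?thesis by (simp only: mult_ac add.commute)
  qed
  also have "\<dots> \<le> ennreal (K * (1 + C) * (real r)\<^sup>2) * kpow T ((i + m) + m + (m + j)) 0 0"
    by (intro mult_left_mono lower) simp
  also have "(i + m) + m + (m + j) = i + n" using nj by simp
  finally show ?thesis .
qed

end

section \<open>An abstract contraction step\<close>

lemma integrable_mult_bounded:
  fixes k g :: "'a \<Rightarrow> real"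
  assumes "integrable (count_space UNIV) k" "\<And>y. \<bar>g y\<bar> \<le> B"
  shows "integrable (count_space UNIV) (\<lambda>y. k y * g y)"
proof (rule Bochner_Integration.integrable_bound[of _ "\<lambda>y. B * k y"])
  show "AE y in count_space UNIV. norm (k y * g y) \<le> norm (B * k y)"
  proof (rule AE_I2)
    fix y
    have "\<bar>k y\<bar> * \<bar>g y\<bar> \<le> \<bar>k y\<bar> * \<bar>B\<bar>" using assms(2)[of y] by (intro mult_left_mono) auto
    then show "norm (k y * g y) \<le> norm (B * k y)" by (simp add: abs_mult mult.commute)
  qed
qed (use assms in auto)

text \<open>Doeblin's argument for a kernel that need not be Markovian: on \<open>G\<close> the part \<open>\<theta> * \<rho> x * e\<close> is
  split off, outside \<open>G\<close> the function \<open>\<rho>\<close> is negligible against the constant \<open>w\<close>.\<close>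

lemma contraction_step:
  fixes k :: "int \<Rightarrow> int \<Rightarrow> real" and e \<rho>' f' \<rho> f :: "int \<Rightarrow> real"
  assumes k0: "\<And>x y. 0 \<le> k x y" and kint: "\<And>x. integrable (count_space UNIV) (k x)"
    and f'B: "\<And>y. \<bar>f' y\<bar> \<le> B" and \<rho>'0: "\<And>y. 0 \<le> \<rho>' y" and \<rho>'B: "\<And>y. \<rho>' y \<le> B"
    and f: "\<And>x. f x = (\<integral>y. k x y * f' y \<partial>count_space UNIV)"
    and \<rho>: "\<And>x. \<rho> x = (\<integral>y. k x y * \<rho>' y \<partial>count_space UNIV)"
    and near: "\<And>y. \<bar>f' y - c * \<rho>' y\<bar> \<le> A * (\<rho>' y + \<beta> * w')"
    and A: "A \<ge> 0" and \<beta>: "\<beta> > 0" "\<beta> \<le> 1" and w: "w' \<ge> 0"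
    and e0: "\<And>y. 0 \<le> e y" and eint: "integrable (count_space UNIV) e"
    and \<theta>: "\<theta> \<ge> 0" and minor: "\<And>x y. x \<in> G \<Longrightarrow> \<theta> * \<rho> x * e y \<le> k x y"
    and \<epsilon>: "0 < \<epsilon>" "\<epsilon> \<le> 1" "\<epsilon> \<le> \<theta> * (\<integral>y. e y * \<rho>' y \<partial>count_space UNIV)"
    and \<tau>: "\<theta> * (\<integral>y. e y * \<rho>' y \<partial>count_space UNIV) + \<theta> * w' * (\<integral>y. e y \<partial>count_space UNIV) \<le> Ce * \<epsilon>"
    and Cd: "Cd \<ge> 1" and drift: "\<And>x. w' * (\<integral>y. k x y \<partial>count_space UNIV) \<le> Cd * \<rho> x + w / 4"
    and \<beta>_def: "\<beta> = \<epsilon> / (2 * Cd)"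
    and Ce: "Ce \<ge> 0" and outside: "\<And>x. x \<notin> G \<Longrightarrow> \<rho> x \<le> w / (8 * Cd * (1 + Ce))" and w0: "w \<ge> 0"
  shows "\<exists>c'. \<forall>x. \<bar>f x - c' * \<rho> x\<bar> \<le> A * (1 - \<epsilon> / 2) * (\<rho> x + \<beta> * w)"
proof -
  let ?I = "\<lambda>g. integral\<^sup>L (count_space (UNIV :: int set)) g"
  define g where "g y = f' y - c * \<rho>' y" for y
  define h where "h y = \<rho>' y + \<beta> * w'" for y
  \<comment> \<open>The new coefficient is \<open>c + d\<close>: integrating \<open>g\<close>
    against the common part \<open>\<theta> * \<rho> x * e\<close> gives
    \<open>d * \<rho> x\<close>, and subtracting this leaves the smaller positive kernel
    \<open>k'\<close>.\<close>
  define d where "d = \<theta> * ?I (\<lambda>y. e y * g y)"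
  have \<rho>'B': "\<bar>\<rho>' y\<bar> \<le> B" for y using \<rho>'0[of y] \<rho>'B[of y] by simp
  have gB: "\<bar>g y\<bar> \<le> B + \<bar>c\<bar> * B" for y
  proof -
    have "\<bar>g y\<bar> \<le> \<bar>f' y\<bar> + \<bar>c\<bar> * \<bar>\<rho>' y\<bar>" unfolding g_def by (simp add: abs_mult[symmetric] abs_triangle_ineq4)
    then show ?thesis using f'B[of y] mult_left_mono[OF \<rho>'B'[of y], of "\<bar>c\<bar>"] by simp
  qed
  have hB: "\<bar>h y\<bar> \<le> B + \<bar>\<beta> * w'\<bar>" for y using \<rho>'B'[of y] unfolding h_def by linarith
  have h0: "0 \<le> h y" for y using \<rho>'0[of y] \<beta> w by (simp add: h_def)
  have gh: "\<bar>g y\<bar> \<le> A * h y" for y using near[of y] by (simp add: g_def h_def)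
  note kf = integrable_mult_bounded[OF kint f'B] and k\<rho> = integrable_mult_bounded[OF kint \<rho>'B']
  note kg = integrable_mult_bounded[OF kint gB] and kh = integrable_mult_bounded[OF kint hB]
  note eg = integrable_mult_bounded[OF eint gB] and eh = integrable_mult_bounded[OF eint hB]
  note e\<rho> = integrable_mult_bounded[OF eint \<rho>'B']
  have fc: "f x - c * \<rho> x = ?I (\<lambda>y. k x y * g y)" for x
  proof -
    have "?I (\<lambda>y. k x y * g y) = ?I (\<lambda>y. k x y * f' y - c * (k x y * \<rho>' y))"
      by (simp add: g_def algebra_simps)
    also have "\<dots> = ?I (\<lambda>y. k x y * f' y) - c * ?I (\<lambda>y. k x y * \<rho>' y)"
      using kf k\<rho> by (subst Bochner_Integration.integral_diff) auto
    finally show ?thesis by (simp add: f \<rho>)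
  qed
  have kh_eq: "?I (\<lambda>y. k x y * h y) = \<rho> x + \<beta> * w' * ?I (k x)" for x
  proof -
    have "?I (\<lambda>y. k x y * h y) = ?I (\<lambda>y. k x y * \<rho>' y + (\<beta> * w') * k x y)"
      by (simp add: h_def algebra_simps)
    also have "\<dots> = ?I (\<lambda>y. k x y * \<rho>' y) + (\<beta> * w') * ?I (k x)"
      using k\<rho> kint by (subst Bochner_Integration.integral_add) auto
    finally show ?thesis by (simp add: \<rho>)
  qed
  have eh_eq: "?I (\<lambda>y. e y * h y) = ?I (\<lambda>y. e y * \<rho>' y) + \<beta> * w' * ?I e"
  proof -
    have "?I (\<lambda>y. e y * h y) = ?I (\<lambda>y. e y * \<rho>' y + (\<beta> * w') * e y)"
      by (simp add: h_def algebra_simps)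
    also have "\<dots> = ?I (\<lambda>y. e y * \<rho>' y) + (\<beta> * w') * ?I e"
      using e\<rho> eint by (subst Bochner_Integration.integral_add) auto
    finally show ?thesis by simp
  qed
  have \<rho>0: "0 \<le> \<rho> x" for x unfolding \<rho> using k0 \<rho>'0 by (intro integral_nonneg_AE) auto
  have eI0: "0 \<le> ?I e" using e0 by (intro integral_nonneg_AE) auto
  \<comment> \<open>With \<open>\<beta> = \<epsilon> / (2 * Cd)\<close> the drift costs
    \<open>\<epsilon> / 2 * \<rho> x\<close>, half of what the minorization gains on
    \<open>G\<close>.\<close>
  have bd: "\<beta> * (w' * ?I (k x)) \<le> \<epsilon> / 2 * \<rho> x + \<beta> * w / 4" for x
  proof -
    have "\<beta> * (w' * ?I (k x)) \<le> \<beta> * (Cd * \<rho> x + w / 4)" using drift \<beta> by (intro mult_left_mono) auto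
    also have "\<dots> = \<epsilon> / 2 * \<rho> x + \<beta> * w / 4" using Cd by (simp add: \<beta>_def distrib_left)
    finally show ?thesis .
  qed
  have abs_int: "\<bar>?I g'\<bar> \<le> A * ?I h'" if "integrable (count_space UNIV) g'" "integrable (count_space UNIV) h'" "\<And>y. \<bar>g' y\<bar> \<le> A * h' y" for g' h' :: "int \<Rightarrow> real"
  proof -
    have "\<bar>?I g'\<bar> \<le> ?I (\<lambda>y. \<bar>g' y\<bar>)" using integral_norm_bound[of "count_space UNIV" g'] by simp
    also have "\<dots> \<le> ?I (\<lambda>y. A * h' y)" using that by (intro integral_mono) auto
    finally show ?thesis by simp
  qed
  have d_le: "\<bar>d\<bar> \<le> A * (Ce * \<epsilon>)"
  proof -
    have "\<bar>?I (\<lambda>y. e y * g y)\<bar> \<le> A * ?I (\<lambda>y. e y * h y)"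
    proof (rule abs_int[OF eg eh])
      fix y show "\<bar>e y * g y\<bar> \<le> A * (e y * h y)"
        using mult_left_mono[OF gh[of y] e0[of y]] e0[of y] by (simp add: abs_mult mult_ac)
    qed
    then have "\<theta> * \<bar>?I (\<lambda>y. e y * g y)\<bar> \<le> \<theta> * (A * ?I (\<lambda>y. e y * h y))" using \<theta> by (rule mult_left_mono)
    then have "\<bar>d\<bar> \<le> A * (\<theta> * ?I (\<lambda>y. e y * \<rho>' y) + \<theta> * \<beta> * w' * ?I e)"
      using \<theta> by (simp add: d_def abs_mult eh_eq algebra_simps)
    also have "\<dots> \<le> A * (Ce * \<epsilon>)"
    proof (rule mult_left_mono[OF _ A])
      have "\<beta> * (\<theta> * w' * ?I e) \<le> 1 * (\<theta> * w' * ?I e)" using \<beta> \<theta> w eI0 by (intro mult_right_mono) auto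
      then show "\<theta> * ?I (\<lambda>y. e y * \<rho>' y) + \<theta> * \<beta> * w' * ?I e \<le> Ce * \<epsilon>" using \<tau> by (simp add: mult_ac)
    qed
    finally show ?thesis .
  qed
  show ?thesis
  proof (intro exI[of _ "c + d"] allI)
    fix x
    show "\<bar>f x - (c + d) * \<rho> x\<bar> \<le> A * (1 - \<epsilon> / 2) * (\<rho> x + \<beta> * w)"
    proof (cases "x \<in> G")
      case True
      define k' where "k' y = k x y - \<theta> * \<rho> x * e y" for y
      have k'0: "0 \<le> k' y" for y using minor[OF True, of y] by (simp add: k'_def)
      have k'int: "integrable (count_space UNIV) k'" unfolding k'_def[abs_def] using kint eint by auto
      note k'g = integrable_mult_bounded[OF k'int gB] and k'h = integrable_mult_bounded[OF k'int hB]
      have split: "?I (\<lambda>y. k' y * u y) = ?I (\<lambda>y. k x y * u y) - \<theta> * \<rho> x * ?I (\<lambda>y. e y * u y)"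
        if "integrable (count_space UNIV) (\<lambda>y. k x y * u y)" "integrable (count_space UNIV) (\<lambda>y. e y * u y)" for u
      proof -
        have "?I (\<lambda>y. k' y * u y) = ?I (\<lambda>y. k x y * u y - (\<theta> * \<rho> x) * (e y * u y))"
          by (simp add: k'_def algebra_simps)
        also have "\<dots> = ?I (\<lambda>y. k x y * u y) - (\<theta> * \<rho> x) * ?I (\<lambda>y. e y * u y)"
          using that by (subst Bochner_Integration.integral_diff) auto
        finally show ?thesis .
      qed
      have "f x - (c + d) * \<rho> x = ?I (\<lambda>y. k' y * g y)"
        using fc[of x] split[of g, OF kg eg] by (simp add: d_def algebra_simps)
      also have "\<bar>\<dots>\<bar> \<le> A * ?I (\<lambda>y. k' y * h y)"
      proof (rule abs_int[OF k'g k'h])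
        fix y show "\<bar>k' y * g y\<bar> \<le> A * (k' y * h y)"
          using mult_left_mono[OF gh[of y] k'0[of y]] k'0[of y] by (simp add: abs_mult mult_ac)
      qed
      also have "\<dots> \<le> A * ((1 - \<epsilon> / 2) * (\<rho> x + \<beta> * w))"
      proof (rule mult_left_mono[OF _ A])
        have "?I (\<lambda>y. k' y * h y) = \<rho> x + \<beta> * w' * ?I (k x) - \<theta> * \<rho> x * (?I (\<lambda>y. e y * \<rho>' y) + \<beta> * w' * ?I e)"
          using split[of h, OF kh eh] by (simp add: kh_eq eh_eq)
        moreover have "\<theta> * \<rho> x * (?I (\<lambda>y. e y * \<rho>' y) + \<beta> * w' * ?I e) \<ge> \<rho> x * \<epsilon>"
        proof -
          have "\<rho> x * \<epsilon> \<le> \<rho> x * (\<theta> * ?I (\<lambda>y. e y * \<rho>' y))" using \<epsilon> \<rho>0 by (intro mult_left_mono) auto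
          moreover have "0 \<le> \<theta> * \<rho> x * (\<beta> * w' * ?I e)" using \<theta> \<rho>0[of x] \<beta> w eI0 by simp
          ultimately show ?thesis by (simp add: algebra_simps)
        qed
        moreover have "\<rho> x + \<beta> * w' * ?I (k x) - \<rho> x * \<epsilon> \<le> (1 - \<epsilon> / 2) * \<rho> x + \<beta> * w / 4"
          using bd[of x] by (simp add: algebra_simps)
        moreover have "(1 - \<epsilon> / 2) * \<rho> x + \<beta> * w / 4 \<le> (1 - \<epsilon> / 2) * (\<rho> x + \<beta> * w)"
        proof -
          have "1 / 4 * (\<beta> * w) \<le> (1 - \<epsilon> / 2) * (\<beta> * w)" using \<beta> w0 \<epsilon> by (intro mult_right_mono) auto
          then show ?thesis by (simp add: distrib_left)
        qed
        ultimately show "?I (\<lambda>y. k' y * h y) \<le> (1 - \<epsilon> / 2) * (\<rho> x + \<beta> * w)" by linarith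
      qed
      finally show ?thesis by (simp add: mult.assoc)
    next
      case False
      have "\<bar>f x - c * \<rho> x\<bar> \<le> A * ?I (\<lambda>y. k x y * h y)"
        unfolding fc
      proof (rule abs_int[OF kg kh])
        fix y show "\<bar>k x y * g y\<bar> \<le> A * (k x y * h y)"
          using mult_left_mono[OF gh[of y] k0[of x y]] k0[of x y] by (simp add: abs_mult mult_ac)
      qed
      also have "\<dots> \<le> A * ((1 + \<epsilon> / 2) * \<rho> x + \<beta> * w / 4)"
        unfolding kh_eq using bd[of x] by (intro mult_left_mono[OF _ A]) (simp add: algebra_simps)
      finally have 1: "\<bar>f x - c * \<rho> x\<bar> \<le> A * ((1 + \<epsilon> / 2) * \<rho> x + \<beta> * w / 4)" .
      have 2: "\<bar>d * \<rho> x\<bar> \<le> A * (Ce * \<epsilon> * \<rho> x)"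
        using mult_right_mono[OF d_le \<rho>0[of x]] \<rho>0[of x] by (simp add: abs_mult mult_ac)
      have "\<bar>f x - (c + d) * \<rho> x\<bar> \<le> \<bar>f x - c * \<rho> x\<bar> + \<bar>d * \<rho> x\<bar>"
        by (simp add: distrib_right) 
      also have "\<dots> \<le> A * ((1 + \<epsilon> / 2) * \<rho> x + \<beta> * w / 4 + Ce * \<epsilon> * \<rho> x)"
        using 1 2 by (simp add: distrib_left)
      also have "\<dots> \<le> A * ((1 - \<epsilon> / 2) * (\<rho> x + \<beta> * w))"
      proof (rule mult_left_mono[OF _ A])
        \<comment> \<open>The excess terms are paid by \<open>\<beta> * w\<close>: a quarter goes to
          \<open>(1 + Ce) * \<epsilon> * \<rho> x\<close>, a quarter to the drift, and at most half
          to shrinking the weight itself.\<close>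
        have "(1 + Ce) * \<epsilon> * \<rho> x \<le> (1 + Ce) * \<epsilon> * (w / (8 * Cd * (1 + Ce)))"
          using outside[OF False] \<epsilon> Ce by (intro mult_left_mono) auto
        also have "\<dots> = \<beta> * w / 4"
        proof -
          have "a * \<epsilon> * (w / (8 * Cd * a)) = \<epsilon> / (2 * Cd) * w / 4" if "a \<noteq> 0" for a
            using that Cd by (simp add: field_simps)
          from this[of "1 + Ce"] Ce show ?thesis by (simp add: \<beta>_def)
        qed
        finally have "(1 + Ce) * \<epsilon> * \<rho> x \<le> \<beta> * w / 4" .
        moreover have "\<epsilon> / 2 * (\<beta> * w) \<le> 1 / 2 * (\<beta> * w)" using \<beta> w0 \<epsilon> by (intro mult_right_mono) auto
        ultimately show "(1 + \<epsilon> / 2) * \<rho> x + \<beta> * w / 4 + Ce * \<epsilon> * \<rho> x \<le> (1 - \<epsilon> / 2) * (\<rho> x + \<beta> * w)"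
          by (simp add: algebra_simps)
      qed
      finally show ?thesis by (simp add: mult.assoc)
    qed
  qed
qed

section \<open>Contraction and decay of covariances\<close>

lemma lint_enn2real:
  assumes "\<And>y. F y < \<top>"
  shows "(\<integral>y. enn2real (F y) \<partial>count_space (UNIV :: int set)) = enn2real (nsum F)"
    and "nsum F < \<top> \<Longrightarrow> integrable (count_space UNIV) (\<lambda>y. enn2real (F y))"
proof -
  have eq: "ennreal (enn2real (F y)) = F y" for y using assms[of y] by (simp add: less_top)
  show "(\<integral>y. enn2real (F y) \<partial>count_space (UNIV :: int set)) = enn2real (nsum F)"
    by (subst integral_eq_nn_integral) (auto simp: eq)
  show "nsum F < \<top> \<Longrightarrow> integrable (count_space UNIV) (\<lambda>y. enn2real (F y))"
    by (rule integrableI_nonneg) (auto simp: eq)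
qed

text \<open>\<open>M3\<close> serves the drift and \<open>M2\<close> the minorization.
  \<open>M2_large\<close> involves \<open>\<kappa>3\<close> but not \<open>\<kappa>2\<close>: the
  region up to \<open>M2 * r\<close> may have a bad constant, which only slows the
  contraction.\<close>

locale mixing = controlled T r m M0 \<kappa> K C \<delta> for T r m M0 \<kappa> K C \<delta> +
  fixes M2 M3 :: nat and \<kappa>2 \<kappa>3 :: real
  assumes reg2: "region T r m M0 M2 \<kappa>2" "region (\<lambda>x y. T y x) r m M0 M2 \<kappa>2" and reg3: "region T r m M0 M3 \<kappa>3"
    and \<kappa>23: "0 < \<kappa>2" "\<kappa>2 \<le> 1" "0 < \<kappa>3" "\<kappa>3 \<le> 1" and \<kappa>1: "\<kappa> \<le> 1" and K1: "K \<ge> 1"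
    and M23: "M2 \<ge> 1" "M3 \<ge> 1"
    and M3_large: "C / (real M3)\<^sup>2 \<le> \<kappa> ^ 3 / 4"
    and M2_large: "K * C / ((real M2)\<^sup>2 * \<delta> * \<kappa> ^ 3) \<le> \<kappa> * \<kappa>3 / (8 * (5 + 4 * C))"
      "2 * K * C\<^sup>2 / ((real M2)\<^sup>2 * \<delta> * \<kappa> ^ 3) \<le> 1 / 2"
begin

text \<open>Errors are measured against \<open>kr s x 0 + \<beta> * wt s\<close>. The constant \<open>wt s\<close> has the size of \<open>kr s x 0\<close> in the bulk; it takes
  over at heights where \<open>kr s x 0\<close> is too small for the minorization.\<close>

definition \<epsilon> :: real where "\<epsilon> = \<kappa> * \<kappa>2\<^sup>2 / (2 * K)"
definition \<beta> :: real where "\<beta> = \<epsilon> / (2 * (1 / (\<kappa> * \<kappa>3)))"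

definition kr :: "nat \<Rightarrow> int \<Rightarrow> int \<Rightarrow> real" where "kr s x y = enn2real (kpow T s x y)"
definition Sf :: "int \<Rightarrow> real" where "Sf x = enn2real (row_sum T m x)"
definition Sb :: "int \<Rightarrow> real" where "Sb x = enn2real (row_sum T' m x)"
definition tot :: "nat \<Rightarrow> real" where "tot s = enn2real (row_sum T' (m + s) 0)"
definition bm :: "nat \<Rightarrow> real" where "bm s = enn2real (kset T' (m + s) 0 Bk)"
definition wt :: "nat \<Rightarrow> real" where "wt s = bm s / r"

lemma le_1_fin: "a \<le> 1 \<Longrightarrow> a < \<top>" for a :: ennreal
  by (rule le_less_trans[OF _ ennreal_one_less_top])

lemma kpow_le_rs: "kpow T s x y \<le> row_sum T s x"
proof -
  have "kpow T s x y = nsum (\<lambda>z. kpow T s x z * of_bool (z = y))" by (simp only: nsum_delta')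
  also have "\<dots> \<le> row_sum T s x" unfolding row_sum_def by (intro nsum_mono) (auto simp: of_bool_def)
  finally show ?thesis .
qed

lemma kpow_le_1: "kpow T s x y \<le> 1" by (rule order_trans[OF kpow_le_rs fw.row_sum_le])

lemma kset'_le_1: "kset T' s x A \<le> 1"
proof -
  interpret d: band T' by (rule dual)
  show ?thesis by (rule order_trans[OF d.kset_le_rs bw.row_sum_le])
qed

lemma kr_eq: "kpow T s x y = ennreal (kr s x y)"
  unfolding kr_def using le_1_fin[OF kpow_le_1, of s x y] by (simp add: less_top)
lemma Sf_eq: "row_sum T m x = ennreal (Sf x)"
  unfolding Sf_def using le_1_fin[OF fw.row_sum_le] by (simp add: less_top)
lemma Sb_eq: "row_sum T' m x = ennreal (Sb x)"
  unfolding Sb_def using le_1_fin[OF bw.row_sum_le] by (simp add: less_top)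
lemma tot_eq: "row_sum T' (m + s) 0 = ennreal (tot s)"
  unfolding tot_def using le_1_fin[OF bw.row_sum_le] by (simp add: less_top)
lemma bm_eq: "kset T' (m + s) 0 Bk = ennreal (bm s)"
  unfolding bm_def using le_1_fin[OF kset'_le_1] by (simp add: less_top)

lemma nn: "0 \<le> kr s x y" "0 \<le> Sf x" "0 \<le> Sb x" "0 \<le> tot s" "0 \<le> bm s" "0 \<le> wt s"
  by (simp_all add: kr_def Sf_def Sb_def tot_def bm_def wt_def)

lemma kr_le_1: "kr s x y \<le> 1"
  using kpow_le_1[of s x y] by (simp add: kr_eq)

lemma r_pos: "real r \<ge> 1" using fw.pos by simp

text \<open>The product form in \<open>x\<close> and \<open>y\<close> is what the minorization asks
  for; \<open>Sb\<close> will be the common measure.\<close>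

lemma kr_minor: "x \<le> int (M2 * r) \<Longrightarrow> y \<le> int (M2 * r) \<Longrightarrow> \<kappa> * \<kappa>2\<^sup>2 / r * (Sf x * Sb y) \<le> kr (3 * m) x y"
proof -
  assume x: "x \<le> int (M2 * r)" and y: "y \<le> int (M2 * r)"
  have "ennreal (\<kappa> / r) * (ennreal \<kappa>2 * row_sum T m x) * (ennreal \<kappa>2 * row_sum T' m y) \<le> ennreal (\<kappa> / r) * kset T m x Bk * kset T' m y Bk"
    using reg2 x y unfolding region_def by (intro mult_mono) auto
  also have "\<dots> \<le> kpow T (m + m + m) x y" by (rule lower)
  also have "m + m + m = 3 * m" by simp
  finally show ?thesis
    using \<kappa>23 fw.pos nn by (simp add: Sf_eq Sb_eq kr_eq ennreal_mult[symmetric] power2_eq_square mult_ac)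
qed

lemma R_upper: "kr (s + 3 * m) x 0 \<le> K / r * Sf x * tot s"
proof -
  interpret d: band T' by (rule dual)
  have "kpow T (s + 3 * m) x 0 \<le> ennreal (K / r) * row_sum T m x * row_sum T' (m + s) 0"
    using d.upper_split[of "s + 3 * m" 0 x] by (simp add: kpow')
  then show ?thesis using fw.pos nn by (simp add: Sf_eq tot_eq kr_eq ennreal_mult[symmetric])
qed

lemma R_lower: "x \<le> int (M3 * r) \<Longrightarrow> \<kappa> * \<kappa>3 * (Sf x * wt s) \<le> kr (s + 3 * m) x 0"
proof -
  assume x: "x \<le> int (M3 * r)"
  have "ennreal (\<kappa> / r) * (ennreal \<kappa>3 * row_sum T m x) * kset T' (m + s) 0 Bk \<le> ennreal (\<kappa> / r) * kset T m x Bk * kset T' (m + s) 0 Bk"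
    using reg3 x unfolding region_def by (intro mult_mono) auto
  also have "\<dots> \<le> kpow T (m + m + (m + s)) x 0" by (rule lower)
  also have "m + m + (m + s) = s + 3 * m" by simp
  finally have "\<kappa> / r * (\<kappa>3 * Sf x) * bm s \<le> kr (s + 3 * m) x 0"
    using \<kappa>23 fw.pos nn unfolding Sf_eq bm_eq kr_eq by (simp add: ennreal_mult[symmetric])
  then show ?thesis by (simp add: wt_def mult_ac)
qed

lemma bm_tot: "bm s \<le> tot s" "\<delta> * tot s \<le> bm s"
proof -
  interpret d: band T' by (rule dual)
  have "kset T' (m + s) 0 Bk \<le> row_sum T' (m + s) 0" by (rule d.kset_le_rs)
  then show "bm s \<le> tot s" using nn unfolding bm_eq tot_eq by simp
  have "ennreal \<delta> * row_sum T' (m + s) 0 \<le> kset T' (s + m) 0 Bk" by (rule dom') auto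
  then show "\<delta> * tot s \<le> bm s"
    using nn \<delta> unfolding add.commute[of s] bm_eq tot_eq by (simp add: ennreal_mult[symmetric])
qed

lemma bm_growth: "\<kappa> ^ 3 * bm s \<le> bm (s + 3 * m)"
proof -
  interpret d: band T' by (rule dual)
  have "ennreal (\<kappa> ^ 3) * kset T' (s + m) 0 Bk \<le> kset T' (s + 3 * m + m) 0 Bk" by (rule d.growth) auto
  then have "ennreal (\<kappa> ^ 3) * kset T' (m + s) 0 Bk \<le> kset T' (m + (s + 3 * m)) 0 Bk"
    by (simp only: add.commute[of _ m])
  then show ?thesis using nn fw.pos unfolding bm_eq by (simp add: ennreal_mult[symmetric])
qed

lemma Sf_tail: "M \<ge> 1 \<Longrightarrow> x > int (M * r) \<Longrightarrow> Sf x \<le> C / (real M)\<^sup>2"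
  using tail_at[OF tail_fw fw.pos(3) _ _ , of M x] C nn by (simp add: Sf_eq)

lemma neg0: "x < 0 \<Longrightarrow> kr (s + 3 * m) x 0 = 0" "x < 0 \<Longrightarrow> Sf x = 0" "x < 0 \<Longrightarrow> Sb x = 0"
proof -
  assume x: "x < 0"
  have 1: "kpow T (Suc s) x y = 0" for s y using fw.neg[OF x] by simp
  have 2: "kpow T' (Suc s) x y = 0" for s y using bw.neg[OF x] by simp
  obtain a where m: "m = Suc a" using fw.pos by (cases m) auto
  show "kr (s + 3 * m) x 0 = 0" using 1[of "s + 2 + 3 * a" 0] unfolding kr_def m by (simp add: numeral_3_eq_3)
  have "kpow T m x = (\<lambda>_. 0)" "kpow T' m x = (\<lambda>_. 0)" using 1[of a] 2[of a] m by (simp_all add: fun_eq_iff)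
  then show "Sf x = 0" "Sb x = 0" unfolding Sf_def Sb_def row_sum_def by simp_all
qed

lemma Sb_sum: "integrable (count_space UNIV) Sb" "(\<integral>y. Sb y \<partial>count_space UNIV) \<le> (1 + 2 * C) * r"
proof -
  have fin: "row_sum T' m y < \<top>" for y by (rule le_1_fin[OF bw.row_sum_le])
  have "nsum (row_sum T' m) \<le> nsum (\<lambda>y. ennreal 1 * indicator {int 0..int (r - 1)} y + row_sum T' m y * indicator {int r..} y)"
  proof (rule nsum_mono)
    fix y
    consider "y < 0" | "0 \<le> y" "y \<le> int (r - 1)" | "y \<ge> int r" using fw.pos(3) by linarith
    then show "row_sum T' m y \<le> ennreal 1 * indicator {int 0..int (r - 1)} y + row_sum T' m y * indicator {int r..} y"
      using neg0(3)[of y] bw.row_sum_le[of m y] by cases (auto simp: Sb_eq add_increasing2)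
  qed
  also have "\<dots> \<le> ennreal (1 * real (Suc (r - 1) - 0)) + ennreal (2 * C * r)"
    unfolding nsum_add using fw.pos C by (intro add_mono tail_sum[OF tail_bw]) (auto simp only: nsum_int_multc zero_le_one order_refl)
  also have "\<dots> = ennreal ((1 + 2 * C) * r)"
    using fw.pos C by (simp add: ennreal_plus[symmetric] distrib_right del: ennreal_plus)
  finally have le: "nsum (row_sum T' m) \<le> ennreal ((1 + 2 * C) * r)" .
  then have "nsum (row_sum T' m) < \<top>" by (rule le_less_trans) simp
  from lint_enn2real(2)[OF fin this] show "integrable (count_space UNIV) Sb" by (simp add: Sb_def[abs_def])
  have "(\<integral>y. Sb y \<partial>count_space UNIV) = enn2real (nsum (row_sum T' m))"
    using lint_enn2real(1)[of "row_sum T' m", OF fin] by (simp add: Sb_def)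
  also have "\<dots> \<le> enn2real (ennreal ((1 + 2 * C) * r))" by (rule enn2real_mono[OF le]) simp
  finally show "(\<integral>y. Sb y \<partial>count_space UNIV) \<le> (1 + 2 * C) * r" using C by simp
qed

lemma kr_int: "integrable (count_space UNIV) (kr s x)" "(\<integral>y. kr s x y \<partial>count_space UNIV) = enn2real (row_sum T s x)"
proof -
  have fin: "kpow T s x y < \<top>" for y by (rule le_1_fin[OF kpow_le_1])
  have "nsum (kpow T s x) < \<top>" using le_1_fin[OF fw.row_sum_le[of s x]] by (simp add: row_sum_def)
  from lint_enn2real(2)[OF fin this] show "integrable (count_space UNIV) (kr s x)" by (simp add: kr_def[abs_def])
  show "(\<integral>y. kr s x y \<partial>count_space UNIV) = enn2real (row_sum T s x)"
    using lint_enn2real(1)[of "kpow T s x", OF fin] by (simp add: kr_def row_sum_def)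
qed

lemma kr_add: "kr (s + t) x 0 = (\<integral>y. kr s x y * kr t y 0 \<partial>count_space UNIV)"
proof -
  have fin: "kpow T s x y * kpow T t y 0 < \<top>" for y
    using le_1_fin[OF kpow_le_1] by (simp add: ennreal_mult_less_top)
  show ?thesis
    unfolding kr_def kpow_add using lint_enn2real(1)[of "\<lambda>y. kpow T s x y * kpow T t y 0", OF fin] by (simp add: enn2real_mult)
qed

lemma tot_eq_integral: "tot s = (\<integral>y. Sb y * kr s y 0 \<partial>count_space UNIV)"
proof -
  have fin: "row_sum T' m y * kpow T s y 0 < \<top>" for y
    using le_1_fin[OF kpow_le_1] le_1_fin[OF bw.row_sum_le] by (simp add: ennreal_mult_less_top)
  have "row_sum T' (m + s) 0 = nsum (\<lambda>y. row_sum T' m y * kpow T s y 0)"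
    unfolding add.commute[of m s] row_sum_add kpow' by (simp only: mult.commute)
  then show ?thesis
    unfolding tot_def kr_def Sb_def using lint_enn2real(1)[of "\<lambda>y. row_sum T' m y * kpow T s y 0", OF fin] by (simp add: enn2real_mult)
qed

abbreviation low :: "int set" where "low \<equiv> {..int (M2 * r)}"

text \<open>The common measure is cut off at \<open>M2 * r\<close> and must keep half of its pairing
  with the bridge weights. Above the cut-off \<open>R_upper\<close> and \<open>tail_product\<close>
  give a small multiple of \<open>tot s\<close>, and \<open>\<delta>\<close> and
  \<open>growth\<close> bound \<open>tot s\<close> by \<open>tot (s + 3 * m)\<close>.\<close>

lemma low_part: "tot (s + 3 * m) / 2 \<le> (\<integral>y. (Sb y * indicator low y) * kr (s + 3 * m) y 0 \<partial>count_space UNIV)"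
proof -
  let ?s = "s + 3 * m" let ?H = "{int (M2 * r)<..}"
  have M2p: "real M2 > 0" using M23 by simp
  have i1: "integrable (count_space UNIV) (\<lambda>y. Sb y * g y)" if "\<And>y. \<bar>g y\<bar> \<le> 1" for g
    by (rule integrable_mult_bounded[OF Sb_sum(1) that])
  have split: "tot ?s = (\<integral>y. (Sb y * indicator low y) * kr ?s y 0 \<partial>count_space UNIV) + (\<integral>y. (Sb y * indicator ?H y) * kr ?s y 0 \<partial>count_space UNIV)"
  proof -
    have "tot ?s = (\<integral>y. (Sb y * indicator low y) * kr ?s y 0 + (Sb y * indicator ?H y) * kr ?s y 0 \<partial>count_space UNIV)"
      unfolding tot_eq_integral by (rule Bochner_Integration.integral_cong) (auto simp: indicator_def)
    also have "\<dots> = (\<integral>y. (Sb y * indicator low y) * kr ?s y 0 \<partial>count_space UNIV) + (\<integral>y. (Sb y * indicator ?H y) * kr ?s y 0 \<partial>count_space UNIV)"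
      unfolding mult.assoc using kr_le_1 nn(1) by (intro Bochner_Integration.integral_add i1) (auto simp: indicator_def abs_le_iff order_trans[OF _ nn(1)])
    finally show ?thesis .
  qed
  have "(\<integral>y. (Sb y * indicator ?H y) * kr ?s y 0 \<partial>count_space UNIV) \<le> tot ?s / 2"
  proof -
    have fin: "row_sum T' m y * row_sum T m y * indicator ?H y < \<top>" for y
      using le_1_fin[OF fw.row_sum_le] le_1_fin[OF bw.row_sum_le] by (simp add: ennreal_mult_less_top indicator_def)
    have prod: "nsum (\<lambda>y. row_sum T' m y * row_sum T m y * indicator ?H y) \<le> ennreal (2 * C\<^sup>2 * r / (real M2)\<^sup>2)"
      using C fw.pos M23 by (intro tail_product tail_fw tail_bw) auto
    then have "nsum (\<lambda>y. row_sum T' m y * row_sum T m y * indicator ?H y) < \<top>" by (rule le_less_trans) simp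
    from lint_enn2real[OF fin] this prod
    have ii: "integrable (count_space UNIV) (\<lambda>y. Sb y * Sf y * indicator ?H y)"
      and il: "(\<integral>y. Sb y * Sf y * indicator ?H y \<partial>count_space UNIV) \<le> 2 * C\<^sup>2 * r / (real M2)\<^sup>2"
    proof -
      have eq: "enn2real (row_sum T' m y * row_sum T m y * indicator ?H y) = Sb y * Sf y * indicator ?H y" for y
        by (simp add: enn2real_mult Sb_def Sf_def indicator_def)
      show "integrable (count_space UNIV) (\<lambda>y. Sb y * Sf y * indicator ?H y)"
        using lint_enn2real(2)[OF fin \<open>nsum (\<lambda>y. row_sum T' m y * row_sum T m y * indicator ?H y) < \<top>\<close>] unfolding eq .
      have "(\<integral>y. Sb y * Sf y * indicator ?H y \<partial>count_space UNIV) = enn2real (nsum (\<lambda>y. row_sum T' m y * row_sum T m y * indicator ?H y))"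
        using lint_enn2real(1)[OF fin] unfolding eq .
      also have "\<dots> \<le> enn2real (ennreal (2 * C\<^sup>2 * r / (real M2)\<^sup>2))" by (rule enn2real_mono[OF prod]) simp
      finally show "(\<integral>y. Sb y * Sf y * indicator ?H y \<partial>count_space UNIV) \<le> 2 * C\<^sup>2 * r / (real M2)\<^sup>2" using C by simp
    qed
    have "(\<integral>y. (Sb y * indicator ?H y) * kr ?s y 0 \<partial>count_space UNIV) \<le> (\<integral>y. (K / r * tot s) * (Sb y * Sf y * indicator ?H y) \<partial>count_space UNIV)"
    proof (rule integral_mono)
      show "integrable (count_space UNIV) (\<lambda>y. Sb y * indicator ?H y * kr ?s y 0)"
        unfolding mult.assoc using kr_le_1 nn(1) by (intro i1) (auto simp: indicator_def abs_le_iff order_trans[OF _ nn(1)])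
      show "integrable (count_space UNIV) (\<lambda>y. (K / r * tot s) * (Sb y * Sf y * indicator ?H y))" using ii by simp
      fix y
      have "(Sb y * indicator ?H y) * kr ?s y 0 \<le> (Sb y * indicator ?H y) * (K / r * Sf y * tot s)"
        using nn by (intro mult_left_mono R_upper) auto
      then show "(Sb y * indicator ?H y) * kr ?s y 0 \<le> (K / r * tot s) * (Sb y * Sf y * indicator ?H y)" by (simp only: mult_ac)
    qed
    also have "\<dots> = (K / r * tot s) * (\<integral>y. Sb y * Sf y * indicator ?H y \<partial>count_space UNIV)" by simp
    also have "\<dots> \<le> (K / r * tot s) * (2 * C\<^sup>2 * r / (real M2)\<^sup>2)"
      using il nn fw.pos by (intro mult_left_mono) auto
    also have "\<dots> = 2 * K * C\<^sup>2 / (real M2)\<^sup>2 * tot s" using fw.pos by simp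
    also have "\<dots> \<le> 2 * K * C\<^sup>2 / (real M2)\<^sup>2 * (tot ?s / (\<delta> * \<kappa> ^ 3))"
    proof (rule mult_left_mono)
      have "\<kappa> ^ 3 * (\<delta> * tot s) \<le> \<kappa> ^ 3 * bm s" using bm_tot(2)[of s] fw.pos by (intro mult_left_mono) auto
      also have "\<dots> \<le> bm ?s" by (rule bm_growth)
      also have "\<dots> \<le> tot ?s" by (rule bm_tot)
      finally show "tot s \<le> tot ?s / (\<delta> * \<kappa> ^ 3)" using \<delta> fw.pos by (simp add: field_simps)
    qed (use fw.pos in simp)
    also have "\<dots> = 2 * K * C\<^sup>2 / ((real M2)\<^sup>2 * \<delta> * \<kappa> ^ 3) * tot ?s" by (simp add: mult_ac)
    also have "\<dots> \<le> 1 / 2 * tot ?s" by (intro mult_right_mono M2_large nn)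
    finally show ?thesis by simp
  qed
  then show ?thesis using split by simp
qed

end

section \<open>Iterated contraction along a bridge\<close>

context mixing
begin

lemma const_bounds: "0 < \<epsilon>" "\<epsilon> \<le> 1" "0 < \<beta>" "\<beta> \<le> 1" "1 \<le> 1 / (\<kappa> * \<kappa>3)"
proof -
  have k: "\<kappa> * \<kappa>3 \<le> 1" using \<kappa>1 \<kappa>23 fw.pos by (simp add: mult_le_one)
  have kp: "0 < \<kappa> * \<kappa>3" using \<kappa>23 fw.pos by simp
  show "1 \<le> 1 / (\<kappa> * \<kappa>3)" using k kp by simp
  show e: "0 < \<epsilon>" using \<kappa>23 fw.pos by (simp add: \<epsilon>_def)
  have "\<kappa> * \<kappa>2\<^sup>2 \<le> 1" using \<kappa>1 \<kappa>23 fw.pos by (intro mult_le_one power_le_one) auto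
  then show e1: "\<epsilon> \<le> 1" using K1 by (simp add: \<epsilon>_def)
  show "0 < \<beta>" using e kp by (simp add: \<beta>_def)
  have "\<epsilon> * (\<kappa> * \<kappa>3) \<le> 1" by (rule mult_le_one[OF e1 less_imp_le[OF kp] k])
  then show "\<beta> \<le> 1" by (simp add: \<beta>_def)
qed

lemma tot_decr: "\<delta> * \<kappa> ^ 3 * tot s \<le> bm (s + 3 * m)"
proof -
  have "\<kappa> ^ 3 * (\<delta> * tot s) \<le> \<kappa> ^ 3 * bm s" using bm_tot(2)[of s] fw.pos by (intro mult_left_mono) auto
  also have "\<dots> \<le> bm (s + 3 * m)" by (rule bm_growth)
  finally show ?thesis by (simp add: mult_ac)
qed

lemma rs3_le_Sf: "enn2real (row_sum T (3 * m) x) \<le> Sf x"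
proof -
  have "row_sum T (m + 2 * m) x \<le> row_sum T m x" by (rule row_sum_decr)
  then have "row_sum T (3 * m) x \<le> row_sum T m x" by simp
  then show ?thesis unfolding Sf_def by (rule enn2real_mono) (rule le_1_fin[OF fw.row_sum_le])
qed

lemma contract:
  assumes s: "s = s' + 3 * m" and pos: "tot s > 0" and f'B: "\<And>y. \<bar>f' y\<bar> \<le> B" and A: "A \<ge> 0"
    and near: "\<And>y. \<bar>f' y - c * kr s y 0\<bar> \<le> A * (kr s y 0 + \<beta> * wt s)"
    and f: "\<And>x. f x = (\<integral>y. kr (3 * m) x y * f' y \<partial>count_space UNIV)"
  shows "\<exists>c'. \<forall>x. \<bar>f x - c' * kr (s + 3 * m) x 0\<bar> \<le> A * (1 - \<epsilon> / 2) * (kr (s + 3 * m) x 0 + \<beta> * wt (s + 3 * m))"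
proof -
  \<comment> \<open>Normalized so that \<theta> times the pairing of \<open>e\<close> with the
    bridge weights lies between \<epsilon> and \<open>2 * \<epsilon>\<close>, as this pairing is
    between \<open>tot s / 2\<close> and \<open>tot s\<close>.\<close>
  define \<theta> where "\<theta> = 2 * \<epsilon> / tot s"
  define e where "e y = Sb y * indicator low y" for y
  \<comment> \<open>The sum of \<open>2 * \<epsilon>\<close> and
    \<open>(1 + 2 * C) * 2 * \<epsilon>\<close>, divided by \<epsilon>.\<close>
  define C3 where "C3 = 4 + 4 * C"
  have \<theta>0: "\<theta> \<ge> 0" using const_bounds pos by (simp add: \<theta>_def)
  have \<theta>tot: "\<theta> * tot s = 2 * \<epsilon>" using pos by (simp add: \<theta>_def)
  have e0: "0 \<le> e y" for y using nn by (simp add: e_def)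
  have e_le: "e y \<le> Sb y" for y using nn by (simp add: e_def indicator_def)
  have eint: "integrable (count_space UNIV) e"
    unfolding e_def[abs_def] by (rule integrable_mult_bounded[OF Sb_sum(1), where B=1]) (simp add: indicator_def)
  have eR: "integrable (count_space UNIV) (\<lambda>y. e y * kr s y 0)" and SR: "integrable (count_space UNIV) (\<lambda>y. Sb y * kr s y 0)"
    using kr_le_1 nn(1) by (auto intro!: integrable_mult_bounded[where B=1] eint Sb_sum(1))
  let ?I1 = "\<integral>y. e y * kr s y 0 \<partial>count_space UNIV"
  have I1: "tot s / 2 \<le> ?I1" "?I1 \<le> tot s"
  proof -
    show "tot s / 2 \<le> ?I1" using low_part[of s'] by (simp add: e_def s)
    show "?I1 \<le> tot s" unfolding tot_eq_integral using e_le nn by (intro integral_mono[OF eR SR] mult_right_mono) auto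
  qed
  have I2: "wt s * (\<integral>y. e y \<partial>count_space UNIV) \<le> (1 + 2 * C) * tot s"
  proof -
    have "(\<integral>y. e y \<partial>count_space UNIV) \<le> (\<integral>y. Sb y \<partial>count_space UNIV)"
      by (intro integral_mono eint Sb_sum(1) e_le)
    also have "\<dots> \<le> (1 + 2 * C) * r" by (rule Sb_sum(2))
    finally have "wt s * (\<integral>y. e y \<partial>count_space UNIV) \<le> wt s * ((1 + 2 * C) * r)" using nn by (intro mult_left_mono) auto
    also have "\<dots> = (1 + 2 * C) * bm s" using r_pos by (simp add: wt_def)
    also have "\<dots> \<le> (1 + 2 * C) * tot s" using bm_tot C by (intro mult_left_mono) auto
    finally show ?thesis .
  qed
  have wt_growth: "\<kappa> ^ 3 * wt s \<le> wt (s + 3 * m)"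
    using divide_right_mono[OF bm_growth[of s], of "real r"] by (simp add: wt_def)
  have kr_add3: "kr (s + 3 * m) x 0 = (\<integral>y. kr (3 * m) x y * kr s y 0 \<partial>count_space UNIV)" for x
    using kr_add[of "3 * m" s x] by (simp only: add.commute)
  show ?thesis
  proof (rule contraction_step[where k="kr (3 * m)" and e=e and \<rho>'="\<lambda>y. kr s y 0" and f'=f' and G=low and \<theta>=\<theta>
        and w'="wt s" and Cd="1 / (\<kappa> * \<kappa>3)" and Ce=C3 and B="max B 1" and c=c])
    show "0 \<le> kr (3 * m) x y" for x y by (rule nn)
    show "integrable (count_space UNIV) (kr (3 * m) x)" for x by (rule kr_int)
    show "\<bar>f' y\<bar> \<le> max B 1" for y using f'B[of y] by simp
    show "0 \<le> kr s y 0" for y by (rule nn)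
    show "kr s y 0 \<le> max B 1" for y using kr_le_1[of s y 0] by simp
    show "f x = (\<integral>y. kr (3 * m) x y * f' y \<partial>count_space UNIV)" for x by (rule f)
    show "kr (s + 3 * m) x 0 = (\<integral>y. kr (3 * m) x y * kr s y 0 \<partial>count_space UNIV)" for x by (rule kr_add3)
    show "\<bar>f' y - c * kr s y 0\<bar> \<le> A * (kr s y 0 + \<beta> * wt s)" for y by (rule near)
    show "0 \<le> A" "0 < \<beta>" "\<beta> \<le> 1" "0 \<le> wt s" "0 < \<epsilon>" "\<epsilon> \<le> 1" "1 \<le> 1 / (\<kappa> * \<kappa>3)" "0 \<le> \<theta>"
      using A const_bounds nn \<theta>0 by auto
    show "0 \<le> e y" for y by (rule e0)
    show "integrable (count_space UNIV) e" by (rule eint)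
    show "\<theta> * kr (s + 3 * m) x 0 * e y \<le> kr (3 * m) x y" if "x \<in> low" for x y
    proof (cases "y \<in> low")
      case True
      \<comment> \<open>By \<open>R_upper\<close> the factor \<open>tot s\<close> cancels, and
        \<open>2 * \<epsilon> * K\<close> is exactly the constant of \<open>kr_minor\<close>; this
        is the origin of \<epsilon>.\<close>
      have "\<theta> * kr (s + 3 * m) x 0 * e y \<le> \<theta> * (K / r * Sf x * tot s) * e y"
        using \<theta>0 e0 by (intro mult_right_mono mult_left_mono R_upper) auto
      also have "\<dots> = (\<theta> * tot s) * (K / r * Sf x * e y)" by (simp only: mult_ac)
      also have "\<dots> = \<kappa> * \<kappa>2\<^sup>2 / r * (Sf x * Sb y)"
        unfolding \<theta>tot using True K1 by (simp add: e_def \<epsilon>_def)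
      also have "\<dots> \<le> kr (3 * m) x y" using that True by (intro kr_minor) auto
      finally show ?thesis .
    next
      case False
      then show ?thesis using nn by (simp add: e_def)
    qed
    show "\<epsilon> \<le> \<theta> * ?I1"
      using mult_left_mono[OF I1(1) \<theta>0] \<theta>tot by simp
    show "\<theta> * ?I1 + \<theta> * wt s * (\<integral>y. e y \<partial>count_space UNIV) \<le> C3 * \<epsilon>"
    proof -
      have "\<theta> * ?I1 \<le> 2 * \<epsilon>" using mult_left_mono[OF I1(2) \<theta>0] \<theta>tot by simp
      moreover have "\<theta> * (wt s * (\<integral>y. e y \<partial>count_space UNIV)) \<le> (1 + 2 * C) * (2 * \<epsilon>)"
        using mult_left_mono[OF I2 \<theta>0] \<theta>tot by (metis (no_types, lifting) mult.assoc mult.commute)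
      ultimately show ?thesis by (simp add: C3_def algebra_simps)
    qed
    show "\<beta> = \<epsilon> / (2 * (1 / (\<kappa> * \<kappa>3)))" by (rule \<beta>_def)
    show "0 \<le> C3" using C by (simp add: C3_def)
    show "0 \<le> wt (s + 3 * m)" by (rule nn)
    show "wt s * (\<integral>y. kr (3 * m) x y \<partial>count_space UNIV) \<le> 1 / (\<kappa> * \<kappa>3) * kr (s + 3 * m) x 0 + wt (s + 3 * m) / 4" for x
    proof -
      have "wt s * (\<integral>y. kr (3 * m) x y \<partial>count_space UNIV) \<le> wt s * Sf x"
        unfolding kr_int(2) using nn by (intro mult_left_mono rs3_le_Sf) auto
      also have "\<dots> \<le> 1 / (\<kappa> * \<kappa>3) * kr (s + 3 * m) x 0 + wt (s + 3 * m) / 4"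
      \<comment> \<open>Below \<open>M3 * r\<close> the row sum is comparable with the bridge weight
        by \<open>R_lower\<close>. Above, it is at most \<open>\<kappa>^3 / 4\<close>, and growth of
        the bulk mass turns this into a quarter of the new weight.\<close>
      proof (cases "x \<le> int (M3 * r)")
        case True
        have "wt s * Sf x \<le> 1 / (\<kappa> * \<kappa>3) * kr (s + 3 * m) x 0"
          using R_lower[OF True, of s] fw.pos \<kappa>23 by (simp add: field_simps)
        then show ?thesis using nn(6)[of "s + 3 * m"] by simp
      next
        case False
        have "wt s * Sf x \<le> wt s * (\<kappa> ^ 3 / 4)"
        proof (rule mult_left_mono)
          have "Sf x \<le> C / (real M3)\<^sup>2" using False by (intro Sf_tail[OF M23(2)]) simp
          then show "Sf x \<le> \<kappa> ^ 3 / 4" using M3_large by (rule order_trans)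
        qed (rule nn)
        also have "\<dots> \<le> wt (s + 3 * m) / 4" using wt_growth by (simp add: mult_ac)
        finally show ?thesis using nn(1)[of "s + 3 * m" x 0] fw.pos \<kappa>23 by (simp add: add_increasing)
      qed
      finally show ?thesis .
    qed
    show "kr (s + 3 * m) x 0 \<le> wt (s + 3 * m) / (8 * (1 / (\<kappa> * \<kappa>3)) * (1 + C3))" if "x \<notin> low" for x
    proof -
      have "kr (s + 3 * m) x 0 \<le> K / r * Sf x * tot s" by (rule R_upper)
      also have "\<dots> \<le> K / r * (C / (real M2)\<^sup>2) * (bm (s + 3 * m) / (\<delta> * \<kappa> ^ 3))"
      proof (intro mult_mono)
        show "Sf x \<le> C / (real M2)\<^sup>2" using that by (intro Sf_tail M23) auto
        show "tot s \<le> bm (s + 3 * m) / (\<delta> * \<kappa> ^ 3)" using tot_decr[of s] \<delta> fw.pos by (simp add: field_simps)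
      qed (use fw.pos C nn in auto)
      also have "\<dots> = K * C / ((real M2)\<^sup>2 * \<delta> * \<kappa> ^ 3) * wt (s + 3 * m)" by (simp add: wt_def mult_ac)
      also have "\<dots> \<le> \<kappa> * \<kappa>3 / (8 * (5 + 4 * C)) * wt (s + 3 * m)" by (intro mult_right_mono M2_large nn)
      finally show ?thesis by (simp add: C3_def mult_ac)
    qed
  qed
qed

text \<open>Time is counted from the right end: \<open>s\<close> steps are left at \<open>x\<close>,
  and \<open>n\<close> of them follow the observation. A negative height counts as 0 through
  \<open>ennreal\<close>.\<close>

definition obs :: "nat \<Rightarrow> nat \<Rightarrow> int \<Rightarrow> ennreal" where
  "obs n s x = nsum (\<lambda>y. kpow T (s - n) x y * (ennreal (of_int y) * kpow T n y 0))"

lemma obs_step: "n \<le> s \<Longrightarrow> obs n (t + s) x = nsum (\<lambda>z. kpow T t x z * obs n s z)"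
proof -
  assume "n \<le> s"
  then have "t + s - n = t + (s - n)" by simp
  then show ?thesis unfolding obs_def by (simp only: nsum_kpow_add)
qed

text \<open>The observation is averaged over the reversed walk, where \<open>moment\<close> applies;
  the \<open>1 / r\<close> of the kernel cancels the size \<open>r\<close> of the height.\<close>

lemma obs_base:
  assumes "3 * m \<le> s0" "s0 \<le> 6 * m"
  shows "obs n (n + s0) x \<le> ennreal (K * (1 + C) / \<delta> * bm (n + s0))"
proof -
  interpret d: controlled T' by (rule controlled_dual)
  let ?X = "nsum (\<lambda>y. kpow T' n 0 y * (ennreal (of_int y ^ 1) * row_sum T' m y))"
  have "obs n (n + s0) x \<le> nsum (\<lambda>y. ennreal (K / r) * (kpow T' n 0 y * (ennreal (of_int y ^ 1) * row_sum T' m y)))"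
    unfolding obs_def
  proof (rule nsum_mono)
    fix y
    have "kpow T s0 x y \<le> ennreal (K / r) * row_sum T m x * row_sum T' m y" by (rule upper[OF assms(1)])
    also have "\<dots> \<le> ennreal (K / r) * 1 * row_sum T' m y" by (intro mult_right_mono mult_left_mono fw.row_sum_le) auto
    also have "\<dots> = ennreal (K / r) * row_sum T' m y" by simp
    finally have "kpow T (n + s0 - n) x y * (ennreal (of_int y) * kpow T n y 0) \<le> (ennreal (K / r) * row_sum T' m y) * (ennreal (of_int y) * kpow T n y 0)"
      by (intro mult_right_mono) auto
    then show "kpow T (n + s0 - n) x y * (ennreal (of_int y) * kpow T n y 0) \<le> ennreal (K / r) * (kpow T' n 0 y * (ennreal (of_int y ^ 1) * row_sum T' m y))"
      by (simp only: kpow' power_one_right mult_ac)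
  qed
  also have "\<dots> = ennreal (K / r) * ?X" by (rule nsum_cmult)
  finally have "ennreal \<delta> * obs n (n + s0) x \<le> ennreal \<delta> * (ennreal (K / r) * ?X)" by (rule mult_left_mono) simp
  also have "\<dots> = ennreal (K / r) * (ennreal \<delta> * ?X)" by (simp only: mult_ac)
  also have "\<dots> \<le> ennreal (K / r) * (ennreal ((1 + C) * real r ^ 1) * kset T' (n + (m + s0)) 0 Bk)"
    using assms by (intro mult_left_mono d.moment) auto
  also have "n + (m + s0) = m + (n + s0)" by simp
  also have "ennreal (K / r) * (ennreal ((1 + C) * real r ^ 1) * kset T' (m + (n + s0)) 0 Bk) = ennreal (K * (1 + C) * bm (n + s0))"
    unfolding bm_eq using fw.pos C nn by (simp add: ennreal_mult[symmetric])
  finally have *: "ennreal \<delta> * obs n (n + s0) x \<le> ennreal (K * (1 + C) * bm (n + s0))" .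
  have "obs n (n + s0) x = ennreal (1 / \<delta>) * (ennreal \<delta> * obs n (n + s0) x)"
    using \<delta> by (simp add: mult.assoc[symmetric] ennreal_mult[symmetric])
  also have "\<dots> \<le> ennreal (1 / \<delta>) * ennreal (K * (1 + C) * bm (n + s0))" by (intro mult_left_mono *) simp
  also have "\<dots> = ennreal (K * (1 + C) / \<delta> * bm (n + s0))"
    using \<delta> fw.pos C nn by (simp add: ennreal_mult[symmetric])
  finally show ?thesis .
qed

lemma obs_bounded:
  assumes "3 * m \<le> s0" "s0 \<le> 6 * m"
  shows "obs n (n + s0 + t) x \<le> ennreal (K * (1 + C) / \<delta> * bm (n + s0))"
proof -
  have "obs n (t + (n + s0)) x \<le> nsum (\<lambda>z. kpow T t x z * ennreal (K * (1 + C) / \<delta> * bm (n + s0)))"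
    by (subst obs_step, simp) (intro nsum_mono mult_left_mono obs_base assms, simp)
  also have "\<dots> = row_sum T t x * ennreal (K * (1 + C) / \<delta> * bm (n + s0))" by (simp only: nsum_multc row_sum_def)
  also have "\<dots> \<le> 1 * ennreal (K * (1 + C) / \<delta> * bm (n + s0))" by (intro mult_right_mono fw.row_sum_le) simp
  finally show ?thesis by (simp add: add.commute)
qed

lemma iterate:
  assumes s0: "3 * m \<le> s0" "s0 \<le> 6 * m" and pos: "\<And>j. j < k \<Longrightarrow> tot (n + s0 + 3 * m * j) > 0"
  shows "\<exists>c. \<forall>x. \<bar>enn2real (obs n (n + s0 + 3 * m * k) x) - c * kr (n + s0 + 3 * m * k) x 0\<bar>
    \<le> K * (1 + C) * r / (\<delta> * \<beta>) * (1 - \<epsilon> / 2) ^ k * (kr (n + s0 + 3 * m * k) x 0 + \<beta> * wt (n + s0 + 3 * m * k))"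
  using pos
proof (induction k)
  case 0
  have "\<bar>enn2real (obs n (n + s0) x)\<bar> \<le> K * (1 + C) * r / (\<delta> * \<beta>) * (kr (n + s0) x 0 + \<beta> * wt (n + s0))" for x
  proof -
    have "enn2real (obs n (n + s0) x) \<le> enn2real (ennreal (K * (1 + C) / \<delta> * bm (n + s0)))"
      by (rule enn2real_mono[OF obs_base[OF s0]]) simp
    also have "\<dots> = K * (1 + C) / \<delta> * bm (n + s0)" using fw.pos C \<delta> nn by simp
    also have "\<dots> = K * (1 + C) * r / (\<delta> * \<beta>) * (\<beta> * wt (n + s0))"
      using r_pos const_bounds by (simp add: wt_def)
    also have "\<dots> \<le> K * (1 + C) * r / (\<delta> * \<beta>) * (kr (n + s0) x 0 + \<beta> * wt (n + s0))"
      using fw.pos C \<delta> const_bounds nn by (intro mult_left_mono) auto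
    finally show ?thesis by simp
  qed
  \<comment> \<open>The iteration starts with coefficient 0: before any contraction
    \<open>obs\<close> is merely bounded by a multiple of the weight.\<close>
  then show ?case by (intro exI[of _ 0]) simp
next
  case (Suc k)
  let ?s = "n + s0 + 3 * m * k"
  let ?A = "K * (1 + C) * r / (\<delta> * \<beta>) * (1 - \<epsilon> / 2) ^ k"
  obtain c where c: "\<And>x. \<bar>enn2real (obs n ?s x) - c * kr ?s x 0\<bar> \<le> ?A * (kr ?s x 0 + \<beta> * wt ?s)"
    using Suc by (metis less_SucI)
  have sk: "n + s0 + 3 * m * Suc k = ?s + 3 * m" by simp
  have bd: "obs n ?s x \<le> ennreal (K * (1 + C) / \<delta> * bm (n + s0))" for x
    using obs_bounded[OF s0, of n "3 * m * k" x] by (simp add: add.assoc)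
  have fin: "obs n ?s x < \<top>" for x using bd by (rule le_less_trans) simp
  have "\<exists>c'. \<forall>x. \<bar>enn2real (obs n (?s + 3 * m) x) - c' * kr (?s + 3 * m) x 0\<bar> \<le> ?A * (1 - \<epsilon> / 2) * (kr (?s + 3 * m) x 0 + \<beta> * wt (?s + 3 * m))"
  proof (rule contract[where f'="\<lambda>x. enn2real (obs n ?s x)" and c=c])
    show "?s = (?s - 3 * m) + 3 * m" using s0 by simp
    show "tot ?s > 0" by (rule Suc.prems) simp
    show "\<bar>enn2real (obs n ?s y)\<bar> \<le> K * (1 + C) / \<delta> * bm (n + s0)" for y
    proof -
      have "enn2real (obs n ?s y) \<le> enn2real (ennreal (K * (1 + C) / \<delta> * bm (n + s0)))" by (rule enn2real_mono[OF bd]) simp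
      then show ?thesis using fw.pos C \<delta> nn by simp
    qed
    show "0 \<le> ?A" using fw.pos C \<delta> const_bounds by simp
    show "\<bar>enn2real (obs n ?s y) - c * kr ?s y 0\<bar> \<le> ?A * (kr ?s y 0 + \<beta> * wt ?s)" for y by (rule c)
    show "enn2real (obs n (?s + 3 * m) x) = (\<integral>y. kr (3 * m) x y * enn2real (obs n ?s y) \<partial>count_space UNIV)" for x
    proof -
      have f1: "kpow T (3 * m) x y * obs n ?s y < \<top>" for y
        using le_1_fin[OF kpow_le_1] fin by (simp add: ennreal_mult_less_top)
      have "obs n (?s + 3 * m) x = nsum (\<lambda>y. kpow T (3 * m) x y * obs n ?s y)"
        using obs_step[of n ?s "3 * m" x] by (simp add: add.commute)
      then show ?thesis using lint_enn2real(1)[of "\<lambda>y. kpow T (3 * m) x y * obs n ?s y", OF f1]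
        by (simp add: kr_def enn2real_mult)
    qed
  qed
  then show ?case unfolding sk by (simp only: power_Suc2 mult.assoc)
qed

text \<open>As \<open>obs\<close> and the bridge weights are nonnegative, replacing a negative
  coefficient by 0 does not increase the error. The sign lets the coefficient enter inequalities in
  \<open>ennreal\<close>.\<close>

lemma iterate_nonneg:
  assumes "3 * m \<le> s0" "s0 \<le> 6 * m" "\<And>j. j < k \<Longrightarrow> tot (n + s0 + 3 * m * j) > 0"
  obtains c where "c \<ge> 0" "\<And>x. \<bar>enn2real (obs n (n + s0 + 3 * m * k) x) - c * kr (n + s0 + 3 * m * k) x 0\<bar>
    \<le> K * (1 + C) * r / (\<delta> * \<beta>) * (1 - \<epsilon> / 2) ^ k * (kr (n + s0 + 3 * m * k) x 0 + \<beta> * wt (n + s0 + 3 * m * k))"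
proof -
  let ?s = "n + s0 + 3 * m * k"
  obtain c where c: "\<And>x. \<bar>enn2real (obs n ?s x) - c * kr ?s x 0\<bar>
    \<le> K * (1 + C) * r / (\<delta> * \<beta>) * (1 - \<epsilon> / 2) ^ k * (kr ?s x 0 + \<beta> * wt ?s)"
    using iterate[OF assms] by blast
  have "\<bar>enn2real (obs n ?s x) - max c 0 * kr ?s x 0\<bar> \<le> \<bar>enn2real (obs n ?s x) - c * kr ?s x 0\<bar>" for x
  proof (cases "c \<ge> 0")
    case False
    then have "c * kr ?s x 0 \<le> 0" using nn by (simp add: mult_nonpos_nonneg)
    moreover have "0 \<le> enn2real (obs n ?s x)" by simp
    moreover have "max c 0 = 0" using False by simp
    ultimately show ?thesis by simp
  qed simp
  then show ?thesis using c order_trans by (intro that[of "max c 0"]) fastforce+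
qed

text \<open>\<open>D1 * r\<close> bounds the mean height at time \<open>i\<close>. \<open>D2\<close>
  collects the three error terms of \<open>covariance_decay\<close>, each a multiple of the initial
  error.\<close>

definition D1 :: real where "D1 = K * (1 + C) / (\<delta>\<^sup>2 * \<kappa> ^ 4)"
definition D2 :: real where
  "D2 = K * (1 + C) / (\<delta> * \<beta>) * (D1 + \<beta> * (1 + C) / (\<delta> * \<kappa>) + D1 * (1 + \<beta> / (\<delta> * \<kappa>)))"

lemma tot_pos:
  assumes "kpow T (a + (m + s)) 0 0 > 0"
  shows "tot s > 0"
proof (rule ccontr)
  assume "\<not> tot s > 0"
  then have "tot s = 0" using nn(4)[of s] by simp
  then have "row_sum T' (m + s) 0 = 0" by (simp only: tot_eq) simp
  moreover have "kpow T (m + s) x 0 \<le> row_sum T' (m + s) 0" for x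
  proof -
    interpret d: band T' by (rule dual)
    have "kpow T' (m + s) 0 x = nsum (\<lambda>z. kpow T' (m + s) 0 z * of_bool (z = x))" by (simp only: nsum_delta')
    also have "\<dots> \<le> row_sum T' (m + s) 0" unfolding row_sum_def by (intro nsum_mono) (auto simp: of_bool_def)
    finally show ?thesis by (simp only: kpow')
  qed
  ultimately have "kpow T (m + s) x 0 = 0" for x by (metis le_zero_eq)
  then have "kpow T (a + (m + s)) 0 0 = 0" by (simp add: kpow_add[of T a])
  then show False using assms by simp
qed

text \<open>If \<open>obs\<close> were exactly a multiple of the bridge weight, the heights at the
  two times would be uncorrelated. What remains of the covariance is the contracted error,
  integrated against the left part of the bridge. The \<open>3 * m\<close> steps after time
  \<open>i\<close> smooth this left part.\<close>

theorem covariance_decay: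
  assumes s0: "3 * m \<le> s0" "s0 \<le> 6 * m"
    and N: "N = i + 3 * m + (s0 + 3 * m * k) + n" and Z: "kpow T N 0 0 > 0"
  shows "\<exists>z u v c. kpow T N 0 0 = ennreal z \<and> 0 < z
    \<and> nsum (\<lambda>x. kpow T i 0 x * (ennreal (of_int x) * kpow T (N - i) x 0)) = ennreal u
    \<and> nsum (\<lambda>x. kpow T (N - n) 0 x * (ennreal (of_int x) * kpow T n x 0)) = ennreal v
    \<and> nsum (\<lambda>x. kpow T i 0 x * (ennreal (of_int x) * obs n (N - i) x)) = ennreal c
    \<and> 0 \<le> u \<and> 0 \<le> v \<and> 0 \<le> c \<and> c / z - u / z * (v / z) \<le> D2 * (real r)\<^sup>2 * (1 - \<epsilon> / 2) ^ k"
proof -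
  define s where "s = n + s0 + 3 * m * k"
  \<comment> \<open>The left part up to \<open>3 * m\<close> steps after time \<open>i\<close>,
    weighted with the height at \<open>i\<close>; \<open>L\<close> is the same without the
    height.\<close>
  define V where "V y = nsum (\<lambda>x. kpow T i 0 x * (ennreal (of_int x) * kpow T (3 * m) x y))" for y
  define A where "A = K * (1 + C) * r / (\<delta> * \<beta>) * (1 - \<epsilon> / 2) ^ k"
  define L where "L y = kpow T (i + 3 * m) 0 y" for y
  have A0: "A \<ge> 0" using fw.pos C \<delta> const_bounds by (simp add: A_def)
  have Ns: "N = (i + 3 * m) + s" "N - i = 3 * m + s" "N - n = (i + 3 * m) + (s - n)" "n \<le> s"
    using N by (auto simp: s_def)
  have tp: "tot t > 0" if "t \<le> s" for t
  proof (rule tot_pos)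
    have "(N - (m + t)) + (m + t) = N" using that Ns fw.pos by simp
    then show "kpow T ((N - (m + t)) + (m + t)) 0 0 > 0" using Z by simp
  qed
  have pos': "tot (n + s0 + 3 * m * j) > 0" if "j < k" for j
    by (rule tp) (use that in \<open>simp add: s_def\<close>)
  obtain c where c: "c \<ge> 0" "\<And>x. \<bar>enn2real (obs n s x) - c * kr s x 0\<bar> \<le> A * (kr s x 0 + \<beta> * wt s)"
    using iterate_nonneg[OF s0 pos'] unfolding A_def s_def by blast
  have obs_fin: "obs n s x < \<top>" for x
    using obs_bounded[OF s0, of n "3 * m * k" x] unfolding s_def by (rule le_less_trans) simp
  have obs_eq: "obs n s x = ennreal (enn2real (obs n s x))" for x using obs_fin by (simp add: less_top)
  have up: "obs n s x \<le> ennreal (c + A) * kpow T s x 0 + ennreal (A * \<beta> * wt s)" for x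
  proof -
    have "enn2real (obs n s x) \<le> (c + A) * kr s x 0 + A * \<beta> * wt s"
      using c(2)[of x] by (simp add: algebra_simps)
    then have "obs n s x \<le> ennreal ((c + A) * kr s x 0 + A * \<beta> * wt s)" by (subst obs_eq) (rule ennreal_leI)
    also have "\<dots> = ennreal ((c + A) * kr s x 0) + ennreal (A * \<beta> * wt s)"
      by (rule ennreal_plus) (use c A0 const_bounds nn in auto)
    also have "ennreal ((c + A) * kr s x 0) = ennreal (c + A) * kpow T s x 0"
      unfolding kr_eq by (rule ennreal_mult) (use c A0 nn in auto)
    finally show ?thesis .
  qed
  have dn: "ennreal c * kpow T s x 0 \<le> obs n s x + ennreal A * kpow T s x 0 + ennreal (A * \<beta> * wt s)" for x
  proof -
    have "c * kr s x 0 \<le> enn2real (obs n s x) + A * kr s x 0 + A * \<beta> * wt s"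
      using c(2)[of x] by (simp add: algebra_simps)
    then have "ennreal (c * kr s x 0) \<le> ennreal (enn2real (obs n s x) + A * kr s x 0 + A * \<beta> * wt s)" by (rule ennreal_leI)
    then show ?thesis using c A0 const_bounds nn obs_eq[of x] by (simp add: kr_eq ennreal_mult)
  qed
  define z where "z = kr N 0 0"
  have z: "kpow T N 0 0 = ennreal z" "0 < z" using Z nn by (simp_all add: z_def kr_eq)
  have swapV: "nsum (\<lambda>x. kpow T i 0 x * (ennreal (of_int x) * nsum (\<lambda>y. kpow T (3 * m) x y * g y))) = nsum (\<lambda>y. V y * g y)" for g
  proof -
    have "nsum (\<lambda>x. kpow T i 0 x * (ennreal (of_int x) * nsum (\<lambda>y. kpow T (3 * m) x y * g y)))
      = nsum (\<lambda>x. nsum (\<lambda>y. kpow T i 0 x * (ennreal (of_int x) * kpow T (3 * m) x y) * g y))"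
      by (simp only: nsum_cmult[symmetric] mult.assoc)
    also have "\<dots> = nsum (\<lambda>y. nsum (\<lambda>x. kpow T i 0 x * (ennreal (of_int x) * kpow T (3 * m) x y) * g y))"
      by (rule nsum_swap)
    finally show ?thesis by (simp only: nsum_multc V_def)
  qed
  define a where "a = enn2real (kset T (i + m) 0 Bk)"
  have a: "kset T (i + m) 0 Bk = ennreal a" "0 \<le> a"
    using le_1_fin[OF order_trans[OF kset_le_rs fw.row_sum_le]] by (simp_all add: a_def less_top)
  \<comment> \<open>\<open>a\<close> and \<open>bm s\<close> are the bulk masses of the two halves.
    The error terms below are bounded by multiples of \<open>a * wt s\<close> and hence of the
    partition function.\<close>
  have zlow: "\<kappa> * (a * wt s) \<le> z"
  proof -
    have "ennreal (\<kappa> / r) * kset T (i + m) 0 Bk * kset T' (m + s) 0 Bk \<le> kpow T ((i + m) + m + (m + s)) 0 0" by (rule lower)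
    also have "(i + m) + m + (m + s) = N" using Ns by simp
    finally have "ennreal (\<kappa> / r * a * bm s) \<le> ennreal z"
      unfolding a(1) bm_eq z(1) using a nn fw.pos by (simp add: ennreal_mult[symmetric])
    then show ?thesis using z by (simp add: wt_def mult_ac)
  qed
  define sv where "sv = enn2real (nsum V)"
  have V_rs: "nsum V = nsum (\<lambda>x. kpow T i 0 x * (ennreal (of_int x) * row_sum T (3 * m) x))"
    using swapV[of "\<lambda>_. 1"] by (simp add: row_sum_def)
  have V_le: "ennreal \<delta> * nsum V \<le> ennreal ((1 + C) * r * a)"
  proof -
    have "nsum V \<le> nsum (\<lambda>x. kpow T i 0 x * (ennreal (of_int x ^ 1) * row_sum T m x))"
    proof -
      have "row_sum T (3 * m) x \<le> row_sum T m x" for x using row_sum_decr[of m "2 * m" x] by simp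
      then show ?thesis unfolding V_rs power_one_right by (intro nsum_mono mult_left_mono) auto
    qed
    then have "ennreal \<delta> * nsum V \<le> ennreal \<delta> * nsum (\<lambda>x. kpow T i 0 x * (ennreal (of_int x ^ 1) * row_sum T m x))"
      by (rule mult_left_mono) simp
    also have "\<dots> \<le> ennreal ((1 + C) * real r ^ 1) * kset T (i + m) 0 Bk" by (rule moment) auto
    also have "\<dots> = ennreal ((1 + C) * r * a)" unfolding a(1) using a C by (simp add: ennreal_mult[symmetric])
    finally show ?thesis .
  qed
  have sv: "nsum V = ennreal sv" "0 \<le> sv" "\<delta> * sv \<le> (1 + C) * r * a"
  proof -
    have "ennreal \<delta> * nsum V < \<top>" using V_le by (rule le_less_trans) simp
    then have "nsum V < \<top>" using \<delta> by (auto simp: ennreal_mult_less_top)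
    then show 1: "nsum V = ennreal sv" by (simp add: sv_def less_top)
    show 2: "0 \<le> sv" by (simp add: sv_def)
    show "\<delta> * sv \<le> (1 + C) * r * a" using V_le \<delta> 2 a C unfolding 1 by (simp add: ennreal_mult[symmetric])
  qed
  define U where "U = nsum (\<lambda>y. V y * kpow T s y 0)"
  define Q where "Q = nsum (\<lambda>y. V y * obs n s y)"
  define W where "W = nsum (\<lambda>y. L y * obs n s y)"
  have Ueq: "nsum (\<lambda>x. kpow T i 0 x * (ennreal (of_int x) * kpow T (N - i) x 0)) = U"
    unfolding Ns(2) kpow_add swapV U_def ..
  have Qeq: "nsum (\<lambda>x. kpow T i 0 x * (ennreal (of_int x) * obs n (N - i) x)) = Q"
    unfolding Ns(2) obs_step[OF Ns(4)] swapV Q_def ..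
  have Weq: "nsum (\<lambda>x. kpow T (N - n) 0 x * (ennreal (of_int x) * kpow T n x 0)) = W"
    unfolding Ns(3) nsum_kpow_add W_def L_def obs_def ..
  have Zeq: "ennreal z = nsum (\<lambda>y. L y * kpow T s y 0)" unfolding z(1)[symmetric] Ns(1) kpow_add L_def ..
  define l where "l = enn2real (nsum L)"
  have l: "nsum L = ennreal l" "0 \<le> l" "\<delta> * l \<le> a"
  proof -
    have nL: "nsum L = row_sum T (i + 3 * m) 0" by (simp add: L_def[abs_def] row_sum_def)
    show 1: "nsum L = ennreal l" using le_1_fin[OF fw.row_sum_le[of "i + 3 * m" 0]] by (simp add: l_def nL less_top)
    show 2: "0 \<le> l" by (simp add: l_def)
    have "row_sum T ((m + i) + 2 * m) 0 \<le> row_sum T (m + i) 0" by (rule row_sum_decr)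
    then have "ennreal \<delta> * nsum L \<le> ennreal \<delta> * row_sum T (m + i) 0"
      unfolding nL by (intro mult_left_mono) (auto simp: algebra_simps)
    also have "\<dots> \<le> kset T (i + m) 0 Bk" by (rule dom) auto
    finally show "\<delta> * l \<le> a" unfolding 1 a(1) using \<delta> 2 a by (simp add: ennreal_mult[symmetric])
  qed
  have U_le: "U \<le> ennreal (K * wt s / (\<delta> * \<kappa> ^ 3) * sv)"
  proof -
    have "U \<le> nsum (\<lambda>y. V y * ennreal (K * wt s / (\<delta> * \<kappa> ^ 3)))"
      unfolding U_def
    proof (intro nsum_mono mult_left_mono)
      fix y
      have "s = (s - 3 * m) + 3 * m" using s0 by (simp add: s_def)
      then obtain s' where s': "s = s' + 3 * m" by blast
      have "kr s y 0 \<le> K / r * Sf y * tot s'" unfolding s' by (rule R_upper)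
      also have "\<dots> \<le> K / r * 1 * (bm s / (\<delta> * \<kappa> ^ 3))"
      proof (intro mult_mono)
        show "Sf y \<le> 1" using fw.row_sum_le[of m y] by (simp add: Sf_eq)
        show "tot s' \<le> bm s / (\<delta> * \<kappa> ^ 3)" using tot_decr[of s'] \<delta> fw.pos by (simp add: s' field_simps)
      qed (use fw.pos nn in auto)
      also have "\<dots> = K * wt s / (\<delta> * \<kappa> ^ 3)" by (simp add: wt_def)
      finally show "kpow T s y 0 \<le> ennreal (K * wt s / (\<delta> * \<kappa> ^ 3))" unfolding kr_eq by (rule ennreal_leI)
    qed simp
    also have "\<dots> = ennreal (K * wt s / (\<delta> * \<kappa> ^ 3) * sv)"
      unfolding nsum_multc sv(1) using sv nn fw.pos \<delta> by (simp add: ennreal_mult[symmetric] mult_ac)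
    finally show ?thesis .
  qed
  define u where "u = enn2real U"
  have u: "U = ennreal u" "0 \<le> u" "u \<le> K * wt s / (\<delta> * \<kappa> ^ 3) * sv"
  proof -
    have "U < \<top>" using U_le by (rule le_less_trans) simp
    then show 1: "U = ennreal u" by (simp add: u_def less_top)
    show "0 \<le> u" by (simp add: u_def)
    then show "u \<le> K * wt s / (\<delta> * \<kappa> ^ 3) * sv"
      using U_le sv nn fw.pos \<delta> unfolding 1 by simp
  qed
  have Q_le: "Q \<le> ennreal ((c + A) * u + A * \<beta> * wt s * sv)"
  proof -
    have "Q \<le> nsum (\<lambda>y. ennreal (c + A) * (V y * kpow T s y 0) + ennreal (A * \<beta> * wt s) * V y)"
      unfolding Q_def
    proof (rule nsum_mono)
      fix y
      have "V y * obs n s y \<le> V y * (ennreal (c + A) * kpow T s y 0 + ennreal (A * \<beta> * wt s))" by (intro mult_left_mono up) simp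
      then show "V y * obs n s y \<le> ennreal (c + A) * (V y * kpow T s y 0) + ennreal (A * \<beta> * wt s) * V y"
        by (simp only: distrib_left mult_ac)
    qed
    also have "\<dots> = ennreal (c + A) * U + ennreal (A * \<beta> * wt s) * nsum V"
      by (simp only: nsum_add nsum_cmult U_def)
    also have "\<dots> = ennreal ((c + A) * u + A * \<beta> * wt s * sv)"
      unfolding u(1) sv(1) using c A0 u sv nn const_bounds by (simp add: ennreal_mult)
    finally show ?thesis .
  qed
  define qr where "qr = enn2real Q"
  have qr: "Q = ennreal qr" "0 \<le> qr" "qr \<le> (c + A) * u + A * \<beta> * wt s * sv"
  proof -
    have "Q < \<top>" using Q_le by (rule le_less_trans) simp
    then show 1: "Q = ennreal qr" by (simp add: qr_def less_top)
    show "0 \<le> qr" by (simp add: qr_def)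
    then show "qr \<le> (c + A) * u + A * \<beta> * wt s * sv"
      using Q_le c A0 u sv nn const_bounds unfolding 1 by (simp del: ennreal_plus)
  qed
  have "W \<le> ennreal (c + A) * ennreal z + ennreal (A * \<beta> * wt s) * nsum L"
  proof -
    have "W \<le> nsum (\<lambda>y. ennreal (c + A) * (L y * kpow T s y 0) + ennreal (A * \<beta> * wt s) * L y)"
      unfolding W_def
    proof (rule nsum_mono)
      fix y
      have "L y * obs n s y \<le> L y * (ennreal (c + A) * kpow T s y 0 + ennreal (A * \<beta> * wt s))" by (intro mult_left_mono up) simp
      then show "L y * obs n s y \<le> ennreal (c + A) * (L y * kpow T s y 0) + ennreal (A * \<beta> * wt s) * L y"
        by (simp only: distrib_left mult_ac)
    qed
    then show ?thesis by (simp only: nsum_add nsum_cmult Zeq)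
  qed
  then have Wfin: "W < \<top>" by (rule le_less_trans) (simp add: l(1) ennreal_mult_less_top)
  define v where "v = enn2real W"
  have v: "W = ennreal v" "0 \<le> v" using Wfin by (simp_all add: v_def less_top)
  \<comment> \<open>The opposite direction: the coefficient is at most the mean height at the later
    time, up to the error.\<close>
  have "ennreal c * ennreal z \<le> W + ennreal A * ennreal z + ennreal (A * \<beta> * wt s) * nsum L"
  proof -
    have "ennreal c * ennreal z = nsum (\<lambda>y. ennreal c * (L y * kpow T s y 0))" by (simp only: Zeq nsum_cmult)
    also have "\<dots> \<le> nsum (\<lambda>y. L y * obs n s y + ennreal A * (L y * kpow T s y 0) + ennreal (A * \<beta> * wt s) * L y)"
    proof (rule nsum_mono)
      fix y
      have "L y * (ennreal c * kpow T s y 0) \<le> L y * (obs n s y + ennreal A * kpow T s y 0 + ennreal (A * \<beta> * wt s))" by (intro mult_left_mono dn) simp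
      then show "ennreal c * (L y * kpow T s y 0) \<le> L y * obs n s y + ennreal A * (L y * kpow T s y 0) + ennreal (A * \<beta> * wt s) * L y"
        by (simp only: distrib_left mult_ac)
    qed
    finally show ?thesis by (simp only: nsum_add nsum_cmult Zeq W_def)
  qed
  then have cz: "c * z \<le> v + A * z + A * \<beta> * wt s * l"
    unfolding v(1) l(1) using c A0 z v l nn const_bounds by (simp add: ennreal_mult[symmetric] ennreal_plus[symmetric] del: ennreal_plus)
  have u_z: "u / z \<le> D1 * r"
  proof -
    have "\<kappa> * (\<delta> * sv * wt s) \<le> \<kappa> * ((1 + C) * r * a * wt s)" using sv nn fw.pos by (intro mult_left_mono mult_right_mono) auto
    also have "\<dots> = (1 + C) * r * (\<kappa> * (a * wt s))" by (simp only: mult_ac)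
    also have "\<dots> \<le> (1 + C) * r * z" using zlow C by (intro mult_left_mono) auto
    finally have "\<kappa> * (\<delta> * sv * wt s) \<le> (1 + C) * r * z" .
    then have "sv * wt s \<le> (1 + C) * r * z / (\<delta> * \<kappa>)" using \<delta> fw.pos by (simp add: field_simps)
    then have "K / (\<delta> * \<kappa> ^ 3) * (sv * wt s) \<le> K / (\<delta> * \<kappa> ^ 3) * ((1 + C) * r * z / (\<delta> * \<kappa>))"
      using fw.pos \<delta> by (intro mult_left_mono) auto
    also have "\<dots> = D1 * r * z" by (simp add: D1_def power2_eq_square eval_nat_numeral mult_ac)
    finally have "u \<le> D1 * r * z" using u(3) by (simp add: mult_ac)
    then show ?thesis using z by (simp add: field_simps)
  qed
  have wsv: "wt s * sv / z \<le> (1 + C) * r / (\<delta> * \<kappa>)"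
  proof -
    have "\<kappa> * (\<delta> * sv * wt s) \<le> \<kappa> * ((1 + C) * r * a * wt s)" using sv nn fw.pos by (intro mult_left_mono mult_right_mono) auto
    also have "\<dots> = (1 + C) * r * (\<kappa> * (a * wt s))" by (simp add: mult_ac)
    also have "\<dots> \<le> (1 + C) * r * z" using zlow C by (intro mult_left_mono) auto
    finally show ?thesis using z \<delta> fw.pos by (simp add: field_simps)
  qed
  have wl: "wt s * l / z \<le> 1 / (\<delta> * \<kappa>)"
  proof -
    have "\<kappa> * (\<delta> * l * wt s) \<le> \<kappa> * (a * wt s)" using l nn fw.pos by (intro mult_left_mono mult_right_mono) auto
    also have "\<dots> \<le> z" by (rule zlow)
    finally show ?thesis using z \<delta> fw.pos by (simp add: field_simps)
  qed
  have D1: "D1 \<ge> 0" using fw.pos C by (simp add: D1_def)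
  have r1: "real r \<ge> 1" by (rule r_pos)
  have "qr / z \<le> c * (u / z) + A * (u / z) + A * \<beta> * (wt s * sv / z)"
    using divide_right_mono[OF qr(3), of z] z by (simp add: add_divide_distrib distrib_right mult.assoc)
  moreover have "c \<le> v / z + A + A * \<beta> * (wt s * l / z)"
  proof -
    have "c = c * z / z" using z by simp
    also have "\<dots> \<le> (v + A * z + A * \<beta> * wt s * l) / z" using cz z by (intro divide_right_mono) auto
    also have "\<dots> = v / z + A + A * \<beta> * (wt s * l / z)" using z by (simp add: add_divide_distrib)
    finally show ?thesis .
  qed
  then have "c * (u / z) \<le> (v / z + A + A * \<beta> * (wt s * l / z)) * (u / z)"
    using u z by (intro mult_right_mono) auto
  \<comment> \<open>The main terms with \<open>c\<close> cancel between the mixed moment and the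
    product of the means; only multiples of \<open>A\<close> are left.\<close>
  moreover have "q - U * V \<le> A * U + A * \<beta> * S + U * (A * (1 + \<beta> * W))"
    if "q \<le> c * U + A * U + A * \<beta> * S" "c * U \<le> (V + A + A * \<beta> * W) * U" for q U V S W :: real
    using that by (simp add: algebra_simps)
  ultimately have "qr / z - u / z * (v / z) \<le> A * (u / z) + A * \<beta> * (wt s * sv / z) + (u / z) * (A * (1 + \<beta> * (wt s * l / z)))"
    by blast
  also have "\<dots> \<le> A * (D1 * r) + A * \<beta> * ((1 + C) * r / (\<delta> * \<kappa>)) + (D1 * r) * (A * (1 + \<beta> * (1 / (\<delta> * \<kappa>))))"
    using A0 const_bounds u_z wsv wl D1 u z l nn fw.pos C \<delta>
    by (intro add_mono mult_left_mono mult_mono) auto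
  also have "\<dots> = D2 * (real r)\<^sup>2 * (1 - \<epsilon> / 2) ^ k"
  proof -
    have 1: "a * (d * R) + a * b * (e * R / g) + (d * R) * (a * (1 + b * (1 / g))) = a * R * (d + b * e / g + d * (1 + b / g))"
      for a b d e g R :: real by (simp add: algebra_simps)
    show ?thesis unfolding 1 by (simp add: A_def D2_def power2_eq_square mult_ac)
  qed
  finally have final: "qr / z - u / z * (v / z) \<le> D2 * (real r)\<^sup>2 * (1 - \<epsilon> / 2) ^ k" .
  show ?thesis unfolding Ueq Weq Qeq
    using z u(1,2) v qr(1,2) final by blast
qed

end

section \<open>Choice of the constants\<close>

definition sq_bounded :: "(int \<Rightarrow> int \<Rightarrow> ennreal) \<Rightarrow> nat \<Rightarrow> real \<Rightarrow> nat \<Rightarrow> bool" where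
  "sq_bounded T r D N \<longleftrightarrow> (\<forall>i\<le>N. nsum (\<lambda>x. kpow T i 0 x * (ennreal ((of_int x)\<^sup>2) * kpow T (N - i) x 0))
    \<le> ennreal (D * (real r)\<^sup>2) * kpow T N 0 0)"

text \<open>The conclusion of \<open>covariance_decay\<close> with \<open>obs\<close> written out,
  so that it can be stated for a kernel alone.\<close>

definition cov_decay :: "(int \<Rightarrow> int \<Rightarrow> ennreal) \<Rightarrow> nat \<Rightarrow> nat \<Rightarrow> real \<Rightarrow> real \<Rightarrow> bool" where
  "cov_decay T r m D \<epsilon> \<longleftrightarrow> (\<forall>i n N s k. 3 * m \<le> s \<longrightarrow> s \<le> 6 * m \<longrightarrow> N = i + 3 * m + (s + 3 * m * k) + n \<longrightarrow> kpow T N 0 0 > 0 \<longrightarrow>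
    (\<exists>z u v c. kpow T N 0 0 = ennreal z \<and> 0 < z
    \<and> nsum (\<lambda>x. kpow T i 0 x * (ennreal (of_int x) * kpow T (N - i) x 0)) = ennreal u
    \<and> nsum (\<lambda>x. kpow T (N - n) 0 x * (ennreal (of_int x) * kpow T n x 0)) = ennreal v
    \<and> nsum (\<lambda>x. kpow T i 0 x * (ennreal (of_int x) *
        nsum (\<lambda>y. kpow T (N - i - n) x y * (ennreal (of_int y) * kpow T n y 0)))) = ennreal c
    \<and> 0 \<le> u \<and> 0 \<le> v \<and> 0 \<le> c \<and> c / z - u / z * (v / z) \<le> D * (real r)\<^sup>2 * (1 - \<epsilon> / 2) ^ k))"

lemma scale_le:
  assumes "ennreal a * x \<le> ennreal b * y" "a > 0" "b \<ge> 0" "b / a \<le> d"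
  shows "x \<le> ennreal d * y"
proof -
  have "x = ennreal (1 / a) * (ennreal a * x)"
    using assms(2) by (simp add: mult.assoc[symmetric] ennreal_mult[symmetric])
  also have "\<dots> \<le> ennreal (1 / a) * (ennreal b * y)" by (intro mult_left_mono assms(1)) simp
  also have "\<dots> = ennreal (b / a) * y"
    using assms(2,3) by (simp add: mult.assoc[symmetric] ennreal_mult[symmetric])
  also have "\<dots> \<le> ennreal d * y" by (intro mult_right_mono ennreal_leI assms(4)) simp
  finally show ?thesis .
qed

text \<open>Because \<open>N \<ge> 6 * m\<close>, at least one side of time \<open>i\<close> has
  \<open>3 * m\<close> steps; transposition reduces to the right side.\<close>

lemma (in band) sq_bounded_small_time:
  assumes D: "K\<^sup>2 / \<kappa> ^ 3 \<le> D" and N: "6 * m \<le> N" "N \<le> 24 * m"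
  shows "sq_bounded T r D N"
  unfolding sq_bounded_def
proof (intro allI impI)
  interpret d: band T' by (rule dual)
  have DD: "K\<^sup>2 * (real r)\<^sup>2 / \<kappa> ^ 3 \<le> D * (real r)\<^sup>2"
    using mult_right_mono[OF D, of "(real r)\<^sup>2"] by simp
  fix i assume i: "i \<le> N"
  show "nsum (\<lambda>x. kpow T i 0 x * (ennreal ((of_int x)\<^sup>2) * kpow T (N - i) x 0)) \<le> ennreal (D * (real r)\<^sup>2) * kpow T N 0 0"
  proof (cases "3 * m \<le> N - i")
    case True
    show ?thesis
      by (rule scale_le[OF _ _ _ DD]) (use small_time_second_moment[OF True, of i] i N fw.pos in auto)
  next
    case False
    then have "3 * m \<le> i" "(N - i) + i = N" using i N by auto
    then have "ennreal (\<kappa> ^ 3) * nsum (\<lambda>x. kpow T i 0 x * (ennreal ((of_int x)\<^sup>2) * kpow T (N - i) x 0)) \<le> ennreal (K\<^sup>2 * (real r)\<^sup>2) * kpow T N 0 0"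
      using d.small_time_second_moment[of i "N - i"] N \<open>(N - i) + i = N\<close> by (simp add: kpow_transpose[of T] mult_ac)
    then show ?thesis by (rule scale_le[OF _ _ _ DD]) (use fw.pos in auto)
  qed
qed

lemma (in controlled) sq_bounded_long:
  assumes D: "K * (1 + C) / (\<delta>\<^sup>2 * \<kappa>) \<le> D" and N: "6 * m \<le> N"
  shows "sq_bounded T r D N"
  unfolding sq_bounded_def
proof (intro allI impI)
  interpret d: controlled T' by (rule controlled_dual)
  have DD: "K * (1 + C) * (real r)\<^sup>2 / (\<delta>\<^sup>2 * \<kappa>) \<le> D * (real r)\<^sup>2"
    using mult_right_mono[OF D, of "(real r)\<^sup>2"] by simp
  fix i assume i: "i \<le> N"
  show "nsum (\<lambda>x. kpow T i 0 x * (ennreal ((of_int x)\<^sup>2) * kpow T (N - i) x 0)) \<le> ennreal (D * (real r)\<^sup>2) * kpow T N 0 0"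
  proof (cases "3 * m \<le> N - i")
    case True
    show ?thesis
      by (rule scale_le[OF _ _ _ DD]) (use second_moment_right[OF True, of i] i N fw.pos \<delta> C in auto)
  next
    case False
    then have "3 * m \<le> i" "(N - i) + i = N" using i N by auto
    then have "ennreal (\<delta>\<^sup>2 * \<kappa>) * nsum (\<lambda>x. kpow T i 0 x * (ennreal ((of_int x)\<^sup>2) * kpow T (N - i) x 0)) \<le> ennreal (K * (1 + C) * (real r)\<^sup>2) * kpow T N 0 0"
      using d.second_moment_right[of i "N - i"] N \<open>(N - i) + i = N\<close> by (simp add: kpow_transpose[of T] mult_ac)
    then show ?thesis by (rule scale_le[OF _ _ _ DD]) (use fw.pos \<delta> C in auto)
  qed
qed

lemma tk_mirror': "tk (mirror p) u = (\<lambda>x y. tk p u y x)"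
  using tk_mirror[of p u] by (intro ext) (simp add: tk_mirror)

context walk
begin

lemma band_exist:
  obtains C0 M0 :: nat where "C0 \<ge> 1"
    "\<And>b. \<exists>\<kappa> K r0. 0 < \<kappa> \<and> \<kappa> \<le> 1 \<and> 1 \<le> K \<and> r0 \<ge> 1 \<and>
       (\<forall>r\<ge>r0. \<forall>u. adm b u r \<longrightarrow> band (tk p u) r (2 * C0 * r\<^sup>2) M0 \<kappa> K)"
    "\<And>b M. M \<ge> M0 \<Longrightarrow> \<exists>\<kappa> r0. 0 < \<kappa> \<and> \<kappa> \<le> 1 \<and> r0 \<ge> 1 \<and>
       (\<forall>r\<ge>r0. \<forall>u. adm b u r \<longrightarrow> region (tk p u) r (2 * C0 * r\<^sup>2) M0 M \<kappa> \<and> region (\<lambda>x y. tk p u y x) r (2 * C0 * r\<^sup>2) M0 M \<kappa>)"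
proof -
  interpret d: walk "mirror p" by (rule walk_mirror)
  obtain Ca Ma :: nat where a: "Ca \<ge> 1" "Ma \<ge> 2"
    "\<And>C0 M0 b. C0 \<ge> Ca \<Longrightarrow> M0 \<ge> Ma \<Longrightarrow> \<exists>\<kappa> K r0. \<kappa> > 0 \<and> K > 0 \<and> r0 \<ge> 1 \<and>
       (\<forall>r\<ge>r0. \<forall>u. adm b u r \<longrightarrow> side (tk p u) r (2 * C0 * r\<^sup>2) M0 \<kappa> K)"
    "\<And>C0 M0 b M. C0 \<ge> Ca \<Longrightarrow> M0 \<ge> Ma \<Longrightarrow> M \<ge> M0 \<Longrightarrow> \<exists>\<kappa> r0. \<kappa> > 0 \<and> r0 \<ge> 1 \<and>
       (\<forall>r\<ge>r0. \<forall>u. adm b u r \<longrightarrow> region (tk p u) r (2 * C0 * r\<^sup>2) M0 M \<kappa>)"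
    by (rule side_region_exist) blast
  obtain Cb Mb :: nat where b: "Cb \<ge> 1" "Mb \<ge> 2"
    "\<And>C0 M0 b. C0 \<ge> Cb \<Longrightarrow> M0 \<ge> Mb \<Longrightarrow> \<exists>\<kappa> K r0. \<kappa> > 0 \<and> K > 0 \<and> r0 \<ge> 1 \<and>
       (\<forall>r\<ge>r0. \<forall>u. adm b u r \<longrightarrow> side (tk (mirror p) u) r (2 * C0 * r\<^sup>2) M0 \<kappa> K)"
    "\<And>C0 M0 b M. C0 \<ge> Cb \<Longrightarrow> M0 \<ge> Mb \<Longrightarrow> M \<ge> M0 \<Longrightarrow> \<exists>\<kappa> r0. \<kappa> > 0 \<and> r0 \<ge> 1 \<and>
       (\<forall>r\<ge>r0. \<forall>u. adm b u r \<longrightarrow> region (tk (mirror p) u) r (2 * C0 * r\<^sup>2) M0 M \<kappa>)"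
    by (rule d.side_region_exist) blast
  define C0 where "C0 = max Ca Cb"
  define M0 where "M0 = max Ma Mb"
  have C0: "C0 \<ge> Ca" "C0 \<ge> Cb" and M0: "M0 \<ge> Ma" "M0 \<ge> Mb" by (simp_all add: C0_def M0_def)
  show thesis
  proof (rule that[of C0 M0])
    show "C0 \<ge> 1" using a(1) C0 by simp
    fix \<beta> :: "nat \<Rightarrow> real"
    obtain \<kappa> K r0 where 1: "\<kappa> > 0" "K > 0" "r0 \<ge> 1"
      "\<And>r u. r \<ge> r0 \<Longrightarrow> adm \<beta> u r \<Longrightarrow> side (tk p u) r (2 * C0 * r\<^sup>2) M0 \<kappa> K"
      using a(3)[OF C0(1) M0(1), of \<beta>] by blast
    obtain \<kappa>' K' r0' where 2: "\<kappa>' > 0" "K' > 0" "r0' \<ge> 1"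
      "\<And>r u. r \<ge> r0' \<Longrightarrow> adm \<beta> u r \<Longrightarrow> side (tk (mirror p) u) r (2 * C0 * r\<^sup>2) M0 \<kappa>' K'"
      using b(3)[OF C0(2) M0(2), of \<beta>] by blast
    define \<kappa>0 where "\<kappa>0 = min 1 (min \<kappa> \<kappa>')"
    define K0 where "K0 = max 1 (max K K')"
    show "\<exists>\<kappa> K r0. 0 < \<kappa> \<and> \<kappa> \<le> 1 \<and> 1 \<le> K \<and> r0 \<ge> 1 \<and>
       (\<forall>r\<ge>r0. \<forall>u. adm \<beta> u r \<longrightarrow> band (tk p u) r (2 * C0 * r\<^sup>2) M0 \<kappa> K)"
    proof (rule exI[of _ \<kappa>0], rule exI[of _ K0], rule exI[of _ "max r0 r0'"], intro conjI allI impI)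
      fix r u assume r: "r \<ge> max r0 r0'" and u: "adm \<beta> u r"
      have "side (tk p u) r (2 * C0 * r\<^sup>2) M0 \<kappa>0 K0"
        by (rule side_mono[OF 1(4)]) (use r u 1 2 in \<open>auto simp: \<kappa>0_def K0_def\<close>)
      moreover have "side (tk (mirror p) u) r (2 * C0 * r\<^sup>2) M0 \<kappa>0 K0"
        by (rule side_mono[OF 2(4)]) (use r u 1 2 in \<open>auto simp: \<kappa>0_def K0_def\<close>)
      ultimately show "band (tk p u) r (2 * C0 * r\<^sup>2) M0 \<kappa>0 K0" by (simp add: band_def tk_mirror')
    qed (use 1 2 in \<open>auto simp: \<kappa>0_def K0_def\<close>)
    fix M assume M: "M \<ge> M0"
    obtain \<kappa> r0 where 1: "\<kappa> > 0" "r0 \<ge> 1"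
      "\<And>r u. r \<ge> r0 \<Longrightarrow> adm \<beta> u r \<Longrightarrow> region (tk p u) r (2 * C0 * r\<^sup>2) M0 M \<kappa>"
      using a(4)[OF C0(1) M0(1) M, of \<beta>] by blast
    obtain \<kappa>' r0' where 2: "\<kappa>' > 0" "r0' \<ge> 1"
      "\<And>r u. r \<ge> r0' \<Longrightarrow> adm \<beta> u r \<Longrightarrow> region (tk (mirror p) u) r (2 * C0 * r\<^sup>2) M0 M \<kappa>'"
      using b(4)[OF C0(2) M0(2) M, of \<beta>] by blast
    show "\<exists>\<kappa> r0. 0 < \<kappa> \<and> \<kappa> \<le> 1 \<and> r0 \<ge> 1 \<and>
       (\<forall>r\<ge>r0. \<forall>u. adm \<beta> u r \<longrightarrow> region (tk p u) r (2 * C0 * r\<^sup>2) M0 M \<kappa> \<and> region (\<lambda>x y. tk p u y x) r (2 * C0 * r\<^sup>2) M0 M \<kappa>)"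
      by (intro exI[of _ "min 1 (min \<kappa> \<kappa>')"] exI[of _ "max r0 r0'"])
        (use 1 2 in \<open>auto simp: tk_mirror' intro!: region_mono[OF 1(3)] region_mono[OF 2(3)[unfolded tk_mirror']]\<close>)
  qed
qed

lemma large_enough: "\<exists>M::nat. M \<ge> M0 \<and> M \<ge> 1 \<and> a / (real M)\<^sup>2 \<le> e" if "e > 0" "a \<ge> 0" for a e :: real
proof -
  obtain M1 :: nat where M1: "a / e \<le> M1" using real_arch_simple by blast
  define M where "M = max M1 (max M0 1)"
  have "M \<ge> 1" by (simp add: M_def)
  then have "real M * 1 \<le> real M * real M" by (intro mult_left_mono) auto
  moreover have "real M1 \<le> real M" by (simp add: M_def)
  ultimately have "a / e \<le> (real M)\<^sup>2" using M1 unfolding power2_eq_square by linarith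
  then have "a / (real M)\<^sup>2 \<le> e" using that \<open>M \<ge> 1\<close> by (simp add: field_simps)
  then show ?thesis using \<open>M \<ge> 1\<close> by (intro exI[of _ M]) (auto simp: M_def)
qed

text \<open>\<open>C0\<close> depends on the walk only, while \<open>D\<close>, \<epsilon> and
  \<open>r0\<close> also depend on the cost function \<open>b\<close>. The estimate for lengths
  within a factor 4 holds without confinement and covers bridges that are too short for the scale
  \<open>H\<close>.\<close>

theorem kernel_estimates:
  obtains C0 :: nat where "C0 \<ge> 1"
    "\<And>b. \<exists>D \<epsilon> r0. 0 \<le> D \<and> 0 < \<epsilon> \<and> \<epsilon> \<le> 1 \<and> r0 \<ge> 1 \<and> (\<forall>r\<ge>r0. \<forall>u. adm b u r \<longrightarrow>
       (\<forall>N. 12 * C0 * r\<^sup>2 \<le> N \<longrightarrow> N \<le> 48 * C0 * r\<^sup>2 \<longrightarrow> sq_bounded (tk p u) r D N) \<and>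
       (confining u r \<longrightarrow> (\<forall>N. 12 * C0 * r\<^sup>2 \<le> N \<longrightarrow> sq_bounded (tk p u) r D N) \<and> cov_decay (tk p u) r (2 * C0 * r\<^sup>2) D \<epsilon>))"
proof -
  interpret d: walk "mirror p" by (rule walk_mirror)
  obtain C0 M0 where C0: "C0 \<ge> 1" and bd:
    "\<And>b. \<exists>\<kappa> K r0. 0 < \<kappa> \<and> \<kappa> \<le> 1 \<and> 1 \<le> K \<and> r0 \<ge> 1 \<and>
       (\<forall>r\<ge>r0. \<forall>u. adm b u r \<longrightarrow> band (tk p u) r (2 * C0 * r\<^sup>2) M0 \<kappa> K)"
    and rg: "\<And>b M. M \<ge> M0 \<Longrightarrow> \<exists>\<kappa> r0. 0 < \<kappa> \<and> \<kappa> \<le> 1 \<and> r0 \<ge> 1 \<and>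
       (\<forall>r\<ge>r0. \<forall>u. adm b u r \<longrightarrow> region (tk p u) r (2 * C0 * r\<^sup>2) M0 M \<kappa> \<and> region (\<lambda>x y. tk p u y x) r (2 * C0 * r\<^sup>2) M0 M \<kappa>)"
    using band_exist by metis
  show thesis
  proof (rule that[OF C0])
    fix b
    define C where "C = 8192 + 8 * s2 * C0"
    have C: "C > 0" using s2_pos by (simp add: C_def add_pos_nonneg)
    obtain \<kappa> K r0 where 0: "0 < \<kappa>" "\<kappa> \<le> 1" "1 \<le> K" "r0 \<ge> 1"
      "\<And>r u. r \<ge> r0 \<Longrightarrow> adm b u r \<Longrightarrow> band (tk p u) r (2 * C0 * r\<^sup>2) M0 \<kappa> K"
      using bd by metis
    obtain M1 where M1: "M1 \<ge> M0" "M1 \<ge> 1" "2 * K * C\<^sup>2 / (real M1)\<^sup>2 \<le> \<kappa> ^ 3 / 2"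
      using large_enough[of "\<kappa> ^ 3 / 2" "2 * K * C\<^sup>2" M0] 0 by auto
    obtain \<kappa>1 r1 where 1: "0 < \<kappa>1" "\<kappa>1 \<le> 1" "r1 \<ge> 1"
      "\<And>r u. r \<ge> r1 \<Longrightarrow> adm b u r \<Longrightarrow> region (tk p u) r (2 * C0 * r\<^sup>2) M0 M1 \<kappa>1 \<and> region (\<lambda>x y. tk p u y x) r (2 * C0 * r\<^sup>2) M0 M1 \<kappa>1"
      using rg[OF M1(1)] by metis
    \<comment> \<open>Half of \<open>\<kappa>1\<close> undoes the factor 2 of
      \<open>domination\<close>; the other two entries are the requirements of
      \<open>high_domination\<close>.\<close>
    define \<delta> where "\<delta> = min (\<kappa>1 / 2) (min \<kappa> (\<kappa> ^ 3 * (\<kappa>1 / 2) / (2 * K * C)))"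
    have \<delta>: "0 < \<delta>" "\<delta> \<le> \<kappa>1 / 2" "\<delta> \<le> \<kappa>" using 0 1 C by (auto simp: \<delta>_def)
    have \<delta>3: "2 * K * C * \<delta> \<le> \<kappa> ^ 3 * (\<kappa>1 / 2)"
    proof -
      have "\<delta> \<le> \<kappa> ^ 3 * (\<kappa>1 / 2) / (2 * K * C)" by (simp add: \<delta>_def)
      then show ?thesis using 0 C by (simp add: field_simps)
    qed
    obtain M3 where M3: "M3 \<ge> M0" "M3 \<ge> 1" "C / (real M3)\<^sup>2 \<le> \<kappa> ^ 3 / 4"
      using large_enough[of "\<kappa> ^ 3 / 4" C M0] 0 C by auto
    obtain \<kappa>3 r3 where 3: "0 < \<kappa>3" "\<kappa>3 \<le> 1" "r3 \<ge> 1"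
      "\<And>r u. r \<ge> r3 \<Longrightarrow> adm b u r \<Longrightarrow> region (tk p u) r (2 * C0 * r\<^sup>2) M0 M3 \<kappa>3 \<and> region (\<lambda>x y. tk p u y x) r (2 * C0 * r\<^sup>2) M0 M3 \<kappa>3"
      using rg[OF M3(1)] by metis
    define e2 where "e2 = min (\<kappa> * \<kappa>3 / (8 * (5 + 4 * C))) (1 / 2)"
    have e2: "e2 > 0" using 0 3 C by (simp add: e2_def)
    \<comment> \<open>One numerator for both conditions on \<open>M2\<close>; \<open>e2\<close> is
      the smaller of their right sides.\<close>
    define A2 where "A2 = max (K * C) (2 * K * C\<^sup>2) / (\<delta> * \<kappa> ^ 3)"
    have A2: "A2 \<ge> 0" using 0 \<delta> C by (simp add: A2_def le_max_iff_disj)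
    obtain M2 where M2: "M2 \<ge> M0" "M2 \<ge> 1" "A2 / (real M2)\<^sup>2 \<le> e2"
      using large_enough[OF e2 A2, of M0] by auto
    have M2': "K * C / ((real M2)\<^sup>2 * \<delta> * \<kappa> ^ 3) \<le> \<kappa> * \<kappa>3 / (8 * (5 + 4 * C))"
      "2 * K * C\<^sup>2 / ((real M2)\<^sup>2 * \<delta> * \<kappa> ^ 3) \<le> 1 / 2"
    proof -
      have q: "a / ((real M2)\<^sup>2 * \<delta> * \<kappa> ^ 3) \<le> e2" if "a \<le> max (K * C) (2 * K * C\<^sup>2)" for a
      proof -
        have "a / ((real M2)\<^sup>2 * \<delta> * \<kappa> ^ 3) = (a / (\<delta> * \<kappa> ^ 3)) / (real M2)\<^sup>2" by (simp add: mult_ac)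
        also have "\<dots> \<le> A2 / (real M2)\<^sup>2" unfolding A2_def using that 0 \<delta> by (intro divide_right_mono) auto
        finally show ?thesis using M2(3) by simp
      qed
      show "K * C / ((real M2)\<^sup>2 * \<delta> * \<kappa> ^ 3) \<le> \<kappa> * \<kappa>3 / (8 * (5 + 4 * C))" using q[of "K * C"] by (simp add: e2_def)
      show "2 * K * C\<^sup>2 / ((real M2)\<^sup>2 * \<delta> * \<kappa> ^ 3) \<le> 1 / 2" using q[of "2 * K * C\<^sup>2"] by (simp add: e2_def)
    qed
    obtain \<kappa>2 r2 where 2: "0 < \<kappa>2" "\<kappa>2 \<le> 1" "r2 \<ge> 1"
      "\<And>r u. r \<ge> r2 \<Longrightarrow> adm b u r \<Longrightarrow> region (tk p u) r (2 * C0 * r\<^sup>2) M0 M2 \<kappa>2 \<and> region (\<lambda>x y. tk p u y x) r (2 * C0 * r\<^sup>2) M0 M2 \<kappa>2"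
      using rg[OF M2(1)] by metis
    have mix: "mixing (tk p u) r (2 * C0 * r\<^sup>2) M0 \<kappa> K C \<delta> M2 M3 \<kappa>2 \<kappa>3"
      if r: "r \<ge> r0" "r \<ge> r1" "r \<ge> r2" "r \<ge> r3" and u: "adm b u r" "confining u r" for r u
    proof -
      let ?T = "tk p u" and ?T' = "\<lambda>x y. tk p u y x" and ?m = "2 * C0 * r\<^sup>2" and ?B = "{int r..int (M0 * r)}"
      interpret bd: band ?T r ?m M0 \<kappa> K using 0 r u by blast
      interpret bd': band ?T' r ?m M0 \<kappa> K by (rule bd.dual)
      have r1: "r \<ge> 1" using r 0 by simp
      have tl: "tail ?T r ?m C" unfolding C_def by (rule tail_bound[OF u C0 r1])
      have tl': "tail ?T' r ?m C"
        using d.tail_bound[OF u C0 r1] unfolding s2_mirror tk_mirror' C_def .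
      have half: "ennreal (\<kappa>1 / 2) * a \<le> bb" if "ennreal \<kappa>1 * a \<le> 2 * bb" for a bb
        using scale_le[of \<kappa>1 a 2 bb "2 / \<kappa>1"] that 1
      proof -
        have "ennreal (\<kappa>1 / 2) * a \<le> ennreal (\<kappa>1 / 2) * (ennreal (2 / \<kappa>1) * bb)"
          by (intro mult_left_mono scale_le[of \<kappa>1 a 2 bb]) (use that 1 in auto)
        also have "\<dots> = bb" using 1 by (simp add: mult.assoc[symmetric] ennreal_mult[symmetric])
        finally show ?thesis .
      qed
      have dm: "ennreal (\<kappa>1 / 2) * row_sum ?T (?m + i) 0 \<le> kset ?T (i + t) 0 ?B" if "?m \<le> t" "t \<le> 7 * ?m" for i t
        by (rule half, rule bd.domination[OF tl tl' C M1(2,3)]) (use 1 r u that in auto)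
      have dm': "ennreal (\<kappa>1 / 2) * row_sum ?T' (?m + i) 0 \<le> kset ?T' (i + t) 0 ?B" if "?m \<le> t" "t \<le> 7 * ?m" for i t
        by (rule half, rule bd'.domination[OF tl' tl C M1(2,3)]) (use 1 r u that in auto)
      have le: "ennreal \<delta> * a \<le> ennreal (\<kappa>1 / 2) * a" for a using \<delta> by (intro mult_right_mono ennreal_leI) auto
      show ?thesis
      proof (unfold_locales, goal_cases)
        case (5 t i) then show ?case using dm[of t i] le order_trans by blast
      next
        case (6 t i) then show ?case using dm'[of t i] le order_trans by blast
      next
        case (7 t i) then show ?case
          using bd.high_domination[OF tl' C dm _ _ \<delta>(3) \<delta>3] 1 \<delta> by auto
      next
        case (8 t i) then show ?case
          using bd'.high_domination[OF tl C dm' _ _ \<delta>(3) \<delta>3] 1 \<delta> by auto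
      qed (use C \<delta> tl tl' 0 2 3 M2 M2' M3 r u in auto)
    qed
    define \<epsilon> where "\<epsilon> = \<kappa> * \<kappa>2\<^sup>2 / (2 * K)"
    define \<beta> where "\<beta> = \<epsilon> / (2 * (1 / (\<kappa> * \<kappa>3)))"
    define D1 where "D1 = K * (1 + C) / (\<delta>\<^sup>2 * \<kappa> ^ 4)"
    define D2 where "D2 = K * (1 + C) / (\<delta> * \<beta>) * (D1 + \<beta> * (1 + C) / (\<delta> * \<kappa>) + D1 * (1 + \<beta> / (\<delta> * \<kappa>)))"
    define D where "D = max (max 0 D2) (max (K\<^sup>2 / \<kappa> ^ 3) (K * (1 + C) / (\<delta>\<^sup>2 * \<kappa>)))"
    have \<epsilon>: "0 < \<epsilon>" "\<epsilon> \<le> 1"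
    proof -
      show "0 < \<epsilon>" using 0 2 by (simp add: \<epsilon>_def)
      have "\<kappa> * \<kappa>2\<^sup>2 \<le> 1" using 0 2 by (intro mult_le_one power_le_one) auto
      then show "\<epsilon> \<le> 1" using 0 by (simp add: \<epsilon>_def)
    qed
    show "\<exists>D \<epsilon> r0. 0 \<le> D \<and> 0 < \<epsilon> \<and> \<epsilon> \<le> 1 \<and> r0 \<ge> 1 \<and> (\<forall>r\<ge>r0. \<forall>u. adm b u r \<longrightarrow>
       (\<forall>N. 12 * C0 * r\<^sup>2 \<le> N \<longrightarrow> N \<le> 48 * C0 * r\<^sup>2 \<longrightarrow> sq_bounded (tk p u) r D N) \<and>
       (confining u r \<longrightarrow> (\<forall>N. 12 * C0 * r\<^sup>2 \<le> N \<longrightarrow> sq_bounded (tk p u) r D N) \<and> cov_decay (tk p u) r (2 * C0 * r\<^sup>2) D \<epsilon>))"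
    proof (rule exI[of _ D], rule exI[of _ \<epsilon>], rule exI[of _ "max (max r0 r1) (max r2 r3)"], intro conjI allI impI \<epsilon>)
      fix r u assume r: "max (max r0 r1) (max r2 r3) \<le> r" and u: "adm b u r"
      interpret bd: band "tk p u" r "2 * C0 * r\<^sup>2" M0 \<kappa> K using 0 r u by auto
      { fix N assume N: "12 * C0 * r\<^sup>2 \<le> N" "N \<le> 48 * C0 * r\<^sup>2"
        show "sq_bounded (tk p u) r D N" by (rule bd.sq_bounded_small_time) (use N in \<open>auto simp: D_def\<close>) }
      assume conf: "confining u r"
      interpret mx: mixing "tk p u" r "2 * C0 * r\<^sup>2" M0 \<kappa> K C \<delta> M2 M3 \<kappa>2 \<kappa>3
        by (rule mix) (use r u conf in auto)
      { fix N assume N: "12 * C0 * r\<^sup>2 \<le> N"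
        show "sq_bounded (tk p u) r D N" by (rule mx.sq_bounded_long) (use N in \<open>auto simp: D_def\<close>) }
      have me: "mx.\<epsilon> = \<epsilon>" "mx.D2 = D2"
        by (simp_all add: mx.\<epsilon>_def \<epsilon>_def mx.D2_def D2_def mx.D1_def D1_def mx.\<beta>_def \<beta>_def)
      show "cov_decay (tk p u) r (2 * C0 * r\<^sup>2) D \<epsilon>"
        unfolding cov_decay_def
      proof (intro allI impI)
        fix i n N s k assume "3 * (2 * C0 * r\<^sup>2) \<le> s" "s \<le> 6 * (2 * C0 * r\<^sup>2)"
          "N = i + 3 * (2 * C0 * r\<^sup>2) + (s + 3 * (2 * C0 * r\<^sup>2) * k) + n" "kpow (tk p u) N 0 0 > 0"
        note cd = mx.covariance_decay[OF this, unfolded me mx.obs_def]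
        have "D2 * (real r)\<^sup>2 * (1 - \<epsilon> / 2) ^ k \<le> D * (real r)\<^sup>2 * (1 - \<epsilon> / 2) ^ k"
          using \<epsilon> by (intro mult_right_mono) (auto simp: D_def)
        then show "\<exists>z ua v c. kpow (tk p u) N 0 0 = ennreal z \<and> 0 < z
          \<and> nsum (\<lambda>x. kpow (tk p u) i 0 x * (ennreal (of_int x) * kpow (tk p u) (N - i) x 0)) = ennreal ua
          \<and> nsum (\<lambda>x. kpow (tk p u) (N - n) 0 x * (ennreal (of_int x) * kpow (tk p u) n x 0)) = ennreal v
          \<and> nsum (\<lambda>x. kpow (tk p u) i 0 x * (ennreal (of_int x) *
              nsum (\<lambda>y. kpow (tk p u) (N - i - n) x y * (ennreal (of_int y) * kpow (tk p u) n y 0)))) = ennreal c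
          \<and> 0 \<le> ua \<and> 0 \<le> v \<and> 0 \<le> c \<and> c / z - ua / z * (v / z) \<le> D * (real r)\<^sup>2 * (1 - \<epsilon> / 2) ^ k"
          using cd order_trans by meson
      qed
    qed (use 0 in \<open>auto simp: D_def\<close>)
  qed
qed

end

section \<open>The path measure\<close>

definition site :: "(real \<Rightarrow> real) \<Rightarrow> real \<Rightarrow> int \<Rightarrow> real" where
  "site V lam x = (if x < 0 then 0 else exp (- lam * V (of_int x) / 2))"

text \<open>The row vector of the kernel after \<open>n\<close> steps from 0, with the function
  \<open>\<phi> t\<close> inserted at each time \<open>t < n\<close>. It grows at the right end, as
  paths do in \<open>path_weight_Suc\<close>.\<close>

primrec gpow :: "(int \<Rightarrow> int \<Rightarrow> ennreal) \<Rightarrow> (nat \<Rightarrow> int \<Rightarrow> ennreal) \<Rightarrow> nat \<Rightarrow> int \<Rightarrow> ennreal" where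
  "gpow T \<phi> 0 y = of_bool (y = 0)"
| "gpow T \<phi> (Suc n) y = nsum (\<lambda>x. (gpow T \<phi> n x * \<phi> n x) * T x y)"

lemma nsum_delta_0: "nsum (\<lambda>x. of_bool (x = 0) * f x) = f 0"
  using nsum_delta'[of f 0] by (simp only: mult.commute)

lemma gpow_free:
  assumes "\<And>t x. s < t \<Longrightarrow> t < s + Suc k \<Longrightarrow> \<phi> t x = 1"
  shows "gpow T \<phi> (s + Suc k) y = nsum (\<lambda>x. (gpow T \<phi> s x * \<phi> s x) * kpow T (Suc k) x y)"
  using assms
proof (induction k arbitrary: y)
  case 0
  have "kpow T (Suc 0) x y = T x y" for x by (simp add: nsum_delta')
  then show ?case by simp
next
  case (Suc k)
  have "gpow T \<phi> (s + Suc (Suc k)) y = nsum (\<lambda>z. gpow T \<phi> (s + Suc k) z * T z y)"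
    using Suc.prems[of "s + Suc k"] by simp
  also have "\<dots> = nsum (\<lambda>z. nsum (\<lambda>x. (gpow T \<phi> s x * \<phi> s x) * kpow T (Suc k) x z * T z y))"
  proof (rule arg_cong[where f=nsum], rule ext)
    fix z
    have "gpow T \<phi> (s + Suc k) z = nsum (\<lambda>x. (gpow T \<phi> s x * \<phi> s x) * kpow T (Suc k) x z)"
      by (rule Suc.IH) (use Suc.prems in auto)
    then show "gpow T \<phi> (s + Suc k) z * T z y = nsum (\<lambda>x. (gpow T \<phi> s x * \<phi> s x) * kpow T (Suc k) x z * T z y)"
      by (simp only: nsum_multc)
  qed
  also have "\<dots> = nsum (\<lambda>x. nsum (\<lambda>z. (gpow T \<phi> s x * \<phi> s x) * kpow T (Suc k) x z * T z y))"
    by (rule nsum_swap)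
  also have "\<dots> = nsum (\<lambda>x. (gpow T \<phi> s x * \<phi> s x) * kpow T (Suc (Suc k)) x y)"
    using kpow_add[of T "Suc k" 1] by (simp add: mult.assoc nsum_cmult nsum_delta')
  finally show ?case .
qed

lemma gpow_one:
  assumes "\<And>t x. t < n \<Longrightarrow> \<phi> t x = 1"
  shows "gpow T \<phi> n y = kpow T n 0 y"
proof (cases n)
  case (Suc k)
  then show ?thesis using gpow_free[of 0 k \<phi> T y] assms by (simp add: nsum_delta_0)
qed auto

lemma gpow_single:
  assumes "i < N" "\<And>t x. t < N \<Longrightarrow> t \<noteq> i \<Longrightarrow> \<phi> t x = 1"
  shows "gpow T \<phi> N y = nsum (\<lambda>x. kpow T i 0 x * (\<phi> i x * kpow T (N - i) x y))"
proof -
  obtain k where k: "N = i + Suc k" using assms(1) less_iff_Suc_add by auto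
  have "gpow T \<phi> i x = kpow T i 0 x" for x by (rule gpow_one) (use assms in auto)
  then show ?thesis using gpow_free[of i k \<phi> T y] assms(2) unfolding k by (simp add: mult.assoc)
qed

lemma gpow_double:
  assumes "i < j" "j < N" "\<And>t x. t < N \<Longrightarrow> t \<noteq> i \<Longrightarrow> t \<noteq> j \<Longrightarrow> \<phi> t x = 1"
  shows "gpow T \<phi> N y = nsum (\<lambda>x. kpow T i 0 x * (\<phi> i x * nsum (\<lambda>z. kpow T (j - i) x z * (\<phi> j z * kpow T (N - j) z y))))"
proof -
  obtain k where k: "N = j + Suc k" using assms(2) less_iff_Suc_add by auto
  have "gpow T \<phi> j z = nsum (\<lambda>x. kpow T i 0 x * (\<phi> i x * kpow T (j - i) x z))" for z
    by (rule gpow_single) (use assms in auto)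
  then have "gpow T \<phi> N y = nsum (\<lambda>z. nsum (\<lambda>x. kpow T i 0 x * (\<phi> i x * kpow T (j - i) x z)) * (\<phi> j z * kpow T (N - j) z y))"
    using gpow_free[of j k \<phi> T y] assms unfolding k by (simp add: mult.assoc)
  also have "\<dots> = nsum (\<lambda>z. nsum (\<lambda>x. kpow T i 0 x * (\<phi> i x * kpow T (j - i) x z) * (\<phi> j z * kpow T (N - j) z y)))"
    by (simp only: nsum_multc)
  also have "\<dots> = nsum (\<lambda>x. nsum (\<lambda>z. kpow T i 0 x * (\<phi> i x * kpow T (j - i) x z) * (\<phi> j z * kpow T (N - j) z y)))"
    by (rule nsum_swap)
  finally show ?thesis by (simp only: mult.assoc nsum_cmult)
qed

lemma nn_integral_count_pair:
  "(\<integral>\<^sup>+z. f z \<partial>count_space (A \<times> UNIV)) = (\<integral>\<^sup>+y. \<integral>\<^sup>+x. f (x, y) \<partial>count_space A \<partial>count_space UNIV)"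
proof -
  have "(\<integral>\<^sup>+z. f z \<partial>count_space (A \<times> UNIV)) = (\<integral>\<^sup>+z. f z * indicator (A \<times> UNIV) z \<partial>count_space UNIV)"
    by (rule nn_integral_count_space_indicator) simp
  also have "\<dots> = (\<integral>\<^sup>+y. \<integral>\<^sup>+x. f (x, y) * indicator (A \<times> UNIV) (x, y) \<partial>count_space UNIV \<partial>count_space UNIV)"
    by (rule nn_integral_snd_count_space[symmetric])
  also have "\<dots> = (\<integral>\<^sup>+y. \<integral>\<^sup>+x. f (x, y) \<partial>count_space A \<partial>count_space UNIV)"
    by (subst nn_integral_count_space_indicator[of A]) (auto simp: indicator_def)
  finally show ?thesis .
qed

lemma nn_integral_paths_Suc:
  assumes "n \<ge> 1"
  shows "(\<integral>\<^sup>+X. f X \<partial>count_space (paths (Suc n))) = (\<integral>\<^sup>+a. \<integral>\<^sup>+X. f (X(n := a)) \<partial>count_space (paths n) \<partial>count_space UNIV)"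
proof -
  have set: "{1..<Suc n} = insert n {1..<n}" using assms by auto
  have "bij_betw (\<lambda>(X, a). X(n := a)) (paths n \<times> UNIV) (paths (Suc n))"
  \<comment> \<open>Dropping the last value resets it to \<open>undefined\<close>, since paths are
    extensional functions.\<close>
  proof (rule bij_betwI[where g="\<lambda>X. (X(n := undefined), X n)"])
    show "(\<lambda>(X, a). X(n := a)) \<in> paths n \<times> UNIV \<rightarrow> paths (Suc n)"
      by (use assms in \<open>auto simp: paths_def PiE_def extensional_def\<close>)
    show "(\<lambda>X. (X(n := undefined), X n)) \<in> paths (Suc n) \<rightarrow> paths n \<times> UNIV"
      by (use assms in \<open>auto simp: paths_def PiE_def extensional_def\<close>)
  qed (use assms in \<open>auto simp: paths_def PiE_def extensional_def fun_eq_iff\<close>)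
  from nn_integral_bij_count_space[OF this, of f] show ?thesis
    by (simp add: nn_integral_count_pair split_beta)
qed

lemma nsum_nat:
  assumes "\<And>x. x < 0 \<Longrightarrow> f x = 0"
  shows "nsum f = (\<integral>\<^sup>+a. f (int a) \<partial>count_space UNIV)"
proof -
  have "nsum f = (\<integral>\<^sup>+x. f x * indicator {0..} x \<partial>count_space UNIV)"
    by (intro nn_integral_cong) (auto simp: assms indicator_def)
  also have "\<dots> = (\<integral>\<^sup>+x. f x \<partial>count_space {0..})"
    by (rule nn_integral_count_space_indicator[symmetric]) simp
  also have "\<dots> = (\<integral>\<^sup>+a. f (int a) \<partial>count_space UNIV)"
    by (rule nn_integral_bij_count_space[symmetric])
      (rule bij_betwI[where g=nat], auto)
  finally show ?thesis .
qed

lemma path_weight_Suc: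
  assumes "n \<ge> 1" "X \<in> paths n"
  shows "path_weight p V lam (Suc n) 0 b (X(n := a))
    = path_weight p V lam n 0 a X * exp (- lam * V (real a)) * pmf p (int b - int a)"
proof -
  have set: "{1..<Suc n} = insert n {1..<n}" using assms by auto
  have "(\<Sum>i=1..<Suc n. V (real ((X(n := a)) i))) = V (real a) + (\<Sum>i=1..<n. V (real (X i)))"
    unfolding set by (subst sum.insert) (auto intro!: sum.cong)
  moreover have "(\<Prod>i<n. pmf p (int (with_ends (Suc n) 0 b (X(n := a)) (Suc i)) - int (with_ends (Suc n) 0 b (X(n := a)) i)))
     = (\<Prod>i<n. pmf p (int (with_ends n 0 a X (Suc i)) - int (with_ends n 0 a X i)))"
    using assms(1) by (intro prod.cong) (auto simp: with_ends_def)
  ultimately show ?thesis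
    using assms(1) by (simp add: path_weight_def with_ends_def algebra_simps exp_add[symmetric])
qed

text \<open>\<open>path_weight\<close> gives no weight to the end points, whereas the kernel puts
  half a site weight on each. At 0 this half weight is 1 because \<open>V 0 = 0\<close>; at
  \<open>b\<close> it is the extra factor on the left.\<close>

theorem path_integral:
  assumes V0: "V 0 = 0" and n: "n \<ge> 1" and \<phi>0: "\<And>x. \<phi> 0 x = 1"
  shows "(\<integral>\<^sup>+X. ennreal (path_weight p V lam n 0 b X) * (\<Prod>i=1..<n. \<phi> i (int (X i))) \<partial>count_space (paths n)) * ennreal (site V lam (int b))
    = gpow (tk p (site V lam)) \<phi> n (int b)"
  using n
proof (induction n arbitrary: b rule: nat_induct_at_least)
  case base
  have "paths 1 = {\<lambda>_. undefined}" by (simp add: paths_def)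
  then show ?case
    using V0 by (simp add: \<phi>0 path_weight_def with_ends_def nsum_delta_0 tk_def site_def ennreal_mult[symmetric] nn_integral_count_space_finite)
next
  case (Suc n)
  let ?u = "site V lam" let ?T = "tk p ?u"
  let ?W = "\<lambda>a. \<integral>\<^sup>+X. ennreal (path_weight p V lam n 0 a X) * (\<Prod>i=1..<n. \<phi> i (int (X i))) \<partial>count_space (paths n)"
  have set: "{1..<Suc n} = insert n {1..<n}" using Suc by auto
  have "(\<integral>\<^sup>+X. ennreal (path_weight p V lam (Suc n) 0 b X) * (\<Prod>i=1..<Suc n. \<phi> i (int (X i))) \<partial>count_space (paths (Suc n)))
    = (\<integral>\<^sup>+a. \<integral>\<^sup>+X. (ennreal (exp (- lam * V (real a)) * pmf p (int b - int a)) * \<phi> n (int a)) *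
        (ennreal (path_weight p V lam n 0 a X) * (\<Prod>i=1..<n. \<phi> i (int (X i)))) \<partial>count_space (paths n) \<partial>count_space UNIV)"
    unfolding nn_integral_paths_Suc[OF Suc(1)]
  proof (intro nn_integral_cong)
    fix a X assume "X \<in> space (count_space (paths n))"
    then have X: "X \<in> paths n" by simp
    have "(\<Prod>i=1..<Suc n. \<phi> i (int ((X(n := a)) i))) = \<phi> n (int a) * (\<Prod>i=1..<n. \<phi> i (int (X i)))"
      unfolding set by (subst prod.insert) (auto intro!: prod.cong)
    moreover have "path_weight p V lam n 0 a X \<ge> 0" by (simp add: path_weight_def prod_nonneg)
    ultimately show "ennreal (path_weight p V lam (Suc n) 0 b (X(n := a))) * (\<Prod>i=1..<Suc n. \<phi> i (int ((X(n := a)) i)))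
      = (ennreal (exp (- lam * V (real a)) * pmf p (int b - int a)) * \<phi> n (int a)) *
        (ennreal (path_weight p V lam n 0 a X) * (\<Prod>i=1..<n. \<phi> i (int (X i))))"
      unfolding path_weight_Suc[OF Suc(1) X] by (simp add: ennreal_mult mult_ac)
  qed
  also have "\<dots> = (\<integral>\<^sup>+a. (ennreal (exp (- lam * V (real a)) * pmf p (int b - int a)) * \<phi> n (int a)) * ?W a \<partial>count_space UNIV)"
    by (simp add: nn_integral_cmult)
  finally have "(\<integral>\<^sup>+X. ennreal (path_weight p V lam (Suc n) 0 b X) * (\<Prod>i=1..<Suc n. \<phi> i (int (X i))) \<partial>count_space (paths (Suc n))) * ennreal (?u (int b))
    = (\<integral>\<^sup>+a. (ennreal (exp (- lam * V (real a)) * pmf p (int b - int a)) * \<phi> n (int a)) * ?W a \<partial>count_space UNIV) * ennreal (?u (int b))"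
    by (rule arg_cong)
  also have "\<dots> = (\<integral>\<^sup>+a. (ennreal (exp (- lam * V (real a)) * pmf p (int b - int a)) * \<phi> n (int a)) * ?W a * ennreal (?u (int b)) \<partial>count_space UNIV)"
    by (rule nn_integral_multc[symmetric]) simp
  also have "\<dots> = (\<integral>\<^sup>+a. gpow ?T \<phi> n (int a) * \<phi> n (int a) * ?T (int a) (int b) \<partial>count_space UNIV)"
  proof (rule nn_integral_cong)
    fix a
    have u: "?u x \<ge> 0" for x by (simp add: site_def)
    have "?u (int a) * ?u (int a) = exp (- lam * V (real a) / 2 + - lam * V (real a) / 2)"
      unfolding exp_add by (simp add: site_def)
    also have "- lam * V (real a) / 2 + - lam * V (real a) / 2 = - lam * V (real a)" by simp
    finally have e: "exp (- lam * V (real a)) = ?u (int a) * ?u (int a)" ..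
    \<comment> \<open>One half weight of the site \<open>a\<close> goes to the step that arrives
      there, the other to the step that leaves.\<close>
    have "exp (- lam * V (real a)) * pmf p (int b - int a) * ?u (int b) = ?u (int a) * (?u (int a) * ?u (int b) * pmf p (int b - int a))"
      unfolding e by (simp only: mult_ac)
    then have "ennreal (exp (- lam * V (real a)) * pmf p (int b - int a)) * ennreal (?u (int b)) = ennreal (?u (int a)) * ?T (int a) (int b)"
      unfolding tk_def using u[of "int a"] u[of "int b"] by (subst (1 2) ennreal_mult[symmetric]) simp_all
    moreover have "(x * f) * w * y = v * t * (f * w)" if "x * y = v * t" for x y v t f w :: ennreal
      unfolding that[symmetric] by (simp only: mult_ac)
    ultimately have "(ennreal (exp (- lam * V (real a)) * pmf p (int b - int a)) * \<phi> n (int a)) * ?W a * ennreal (?u (int b))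
      = (ennreal (?u (int a)) * ?T (int a) (int b)) * (\<phi> n (int a) * ?W a)"
      by blast
    also have "\<dots> = gpow ?T \<phi> n (int a) * \<phi> n (int a) * ?T (int a) (int b)"
      unfolding Suc.IH[symmetric] by (simp only: mult_ac)
    finally show "(ennreal (exp (- lam * V (real a)) * pmf p (int b - int a)) * \<phi> n (int a)) * ?W a * ennreal (?u (int b))
      = gpow ?T \<phi> n (int a) * \<phi> n (int a) * ?T (int a) (int b)" .
  qed
  also have "\<dots> = gpow ?T \<phi> (Suc n) (int b)"
    by (simp, rule nsum_nat[symmetric]) (simp add: tk_def site_def)
  finally show ?case .
qed

section \<open>Moments and covariances under the path measure\<close>

lemma (in prob_space) covariance_of_squares:
  fixes F G :: "'a \<Rightarrow> real"
  assumes F: "F \<in> borel_measurable M" "\<And>x. F x \<ge> 0" "(\<integral>\<^sup>+x. ennreal ((F x)\<^sup>2) \<partial>M) \<le> ennreal a"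
    and G: "G \<in> borel_measurable M" "\<And>x. G x \<ge> 0" "(\<integral>\<^sup>+x. ennreal ((G x)\<^sup>2) \<partial>M) \<le> ennreal a"
    and a: "a \<ge> 0"
  shows "integrable M F" "integrable M G" "integrable M (\<lambda>x. F x * G x)"
    "covariance M F G = expectation (\<lambda>x. F x * G x) - expectation F * expectation G"
    "covariance M F G \<le> a"
proof -
  have sq: "integrable M (\<lambda>x. (H x)\<^sup>2)" "expectation (\<lambda>x. (H x)\<^sup>2) \<le> a"
    if "H \<in> borel_measurable M" "(\<integral>\<^sup>+x. ennreal ((H x)\<^sup>2) \<partial>M) \<le> ennreal a" for H :: "'a \<Rightarrow> real"
  proof -
    show 1: "integrable M (\<lambda>x. (H x)\<^sup>2)"
      using that by (intro integrableI_nonneg) (auto intro: le_less_trans)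
    have "ennreal (expectation (\<lambda>x. (H x)\<^sup>2)) \<le> ennreal a"
      using nn_integral_eq_integral[OF 1] that(2) by simp
    then show "expectation (\<lambda>x. (H x)\<^sup>2) \<le> a" using a by simp
  qed
  note sF = sq[OF F(1,3)] and sG = sq[OF G(1,3)]
  have int: "integrable M H" if "H \<in> borel_measurable M" "\<And>x. H x \<ge> 0" "integrable M (\<lambda>x. (H x)\<^sup>2)" for H :: "'a \<Rightarrow> real"
  proof (rule Bochner_Integration.integrable_bound[of M "\<lambda>x. 1 + (H x)\<^sup>2"])
    show "AE x in M. norm (H x) \<le> norm (1 + (H x)\<^sup>2)"
    proof (rule AE_I2)
      fix x
      have "0 \<le> (H x - 1)\<^sup>2" by simp
      then have "2 * H x \<le> 1 + (H x)\<^sup>2" by (simp add: power2_diff)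
      then show "norm (H x) \<le> norm (1 + (H x)\<^sup>2)" using that(2)[of x] by simp
    qed
  qed (use that in auto)
  show iF: "integrable M F" by (rule int[OF F(1,2) sF(1)])
  show iG: "integrable M G" by (rule int[OF G(1,2) sG(1)])
  have am: "F x * G x \<le> ((F x)\<^sup>2 + (G x)\<^sup>2) / 2" for x
    using sum_squares_bound[of "F x" "G x"] by simp
  show iFG: "integrable M (\<lambda>x. F x * G x)"
  proof (rule Bochner_Integration.integrable_bound[of M "\<lambda>x. ((F x)\<^sup>2 + (G x)\<^sup>2) / 2"])
    show "AE x in M. norm (F x * G x) \<le> norm (((F x)\<^sup>2 + (G x)\<^sup>2) / 2)"
      using am F(2) G(2) by (intro AE_I2) simp
  qed (use F G sF sG in auto)
  let ?f = "expectation F" and ?g = "expectation G"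
  have "covariance M F G = expectation (\<lambda>x. F x * G x - ?g * F x - ?f * G x + ?f * ?g)"
    unfolding covariance_def by (intro Bochner_Integration.integral_cong) (auto simp: algebra_simps)
  also have "\<dots> = expectation (\<lambda>x. F x * G x) - ?f * ?g"
    using iF iG iFG by (simp add: prob_space)
  finally show cov: "covariance M F G = expectation (\<lambda>x. F x * G x) - ?f * ?g" .
  have "expectation (\<lambda>x. F x * G x) \<le> expectation (\<lambda>x. ((F x)\<^sup>2 + (G x)\<^sup>2) / 2)"
    using iFG sF sG am by (intro integral_mono) auto
  also have "\<dots> \<le> a" using sF sG by simp
  moreover have "0 \<le> ?f * ?g" using F(2) G(2) by simp
  ultimately show "covariance M F G \<le> a" using cov by linarith
qed

locale path =
  fixes p :: "int pmf" and V :: "real \<Rightarrow> real" and lam :: real and N :: nat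
  assumes V0: "V 0 = 0" and N: "N \<ge> 1" and fin: "kpow (tk p (site V lam)) N 0 0 < \<top>"
begin

abbreviation "T \<equiv> tk p (site V lam)"
abbreviation "Z \<equiv> partition_fun p V lam N 0 0"
abbreviation "M \<equiv> path_measure p V lam N 0 0"

lemma site_0: "site V lam 0 = 1"
  by (simp add: site_def V0)

lemma weight_nonneg: "path_weight p V lam N 0 0 X \<ge> 0"
  by (simp add: path_weight_def prod_nonneg)

lemma nn_weight:
  assumes "\<And>x. \<phi> 0 x = 1"
  shows "(\<integral>\<^sup>+X. ennreal (path_weight p V lam N 0 0 X) * (\<Prod>i=1..<N. \<phi> i (int (X i))) \<partial>count_space (paths N)) = gpow T \<phi> N 0"
  using path_integral[where V=V and n=N and \<phi>=\<phi> and p=p and lam=lam and b=0] V0 N assms by (simp add: site_0)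

lemma partition_eq: "ennreal Z = kpow T N 0 0"
proof -
  let ?w = "path_weight p V lam N 0 0"
  have nn: "(\<integral>\<^sup>+X. ennreal (?w X) \<partial>count_space (paths N)) = kpow T N 0 0"
    using nn_weight[of "\<lambda>_ _. 1"] gpow_one[of N "\<lambda>_ _. 1" T 0] by simp
  have int: "integrable (count_space (paths N)) ?w"
    by (rule integrableI_nonneg) (use weight_nonneg nn fin in auto)
  then have "infsetsum ?w (paths N) = infsum ?w (paths N)"
    by (intro infsetsum_infsum) (simp add: Infinite_Set_Sum.abs_summable_on_def)
  then have "Z = (\<integral>X. ?w X \<partial>count_space (paths N))"
    by (simp add: partition_fun_def infsetsum_def)
  then show "ennreal Z = kpow T N 0 0"
    using nn_integral_eq_integral[OF int] weight_nonneg nn by simp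
qed

lemma measurable_M: "f \<in> borel_measurable M" for f :: "(nat \<Rightarrow> nat) \<Rightarrow> real"
  by (simp add: path_measure_def measurable_point_measure_eq1)

lemma nn_integral_M:
  assumes "Z > 0" "\<And>x. \<phi> 0 x = 1"
  shows "(\<integral>\<^sup>+X. (\<Prod>i=1..<N. \<phi> i (int (X i))) \<partial>M) * ennreal Z = gpow T \<phi> N 0"
proof -
  have "(\<integral>\<^sup>+X. (\<Prod>i=1..<N. \<phi> i (int (X i))) \<partial>M)
    = (\<integral>\<^sup>+X. ennreal (path_weight p V lam N 0 0 X / Z) * (\<Prod>i=1..<N. \<phi> i (int (X i))) \<partial>count_space (paths N))"
    unfolding path_measure_def point_measure_def by (subst nn_integral_density) auto
  then have "(\<integral>\<^sup>+X. (\<Prod>i=1..<N. \<phi> i (int (X i))) \<partial>M) * ennreal Z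
    = (\<integral>\<^sup>+X. ennreal (path_weight p V lam N 0 0 X / Z) * (\<Prod>i=1..<N. \<phi> i (int (X i))) * ennreal Z \<partial>count_space (paths N))"
    by (simp only:) (rule nn_integral_multc[symmetric], simp)
  also have "\<dots> = (\<integral>\<^sup>+X. ennreal (path_weight p V lam N 0 0 X) * (\<Prod>i=1..<N. \<phi> i (int (X i))) \<partial>count_space (paths N))"
  proof (rule nn_integral_cong)
    fix X
    have "ennreal (path_weight p V lam N 0 0 X) = ennreal (path_weight p V lam N 0 0 X / Z) * ennreal Z"
      using assms(1) weight_nonneg by (subst ennreal_mult[symmetric]) auto
    then show "ennreal (path_weight p V lam N 0 0 X / Z) * (\<Prod>i=1..<N. \<phi> i (int (X i))) * ennreal Z
      = ennreal (path_weight p V lam N 0 0 X) * (\<Prod>i=1..<N. \<phi> i (int (X i)))" by (simp only: mult_ac)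
  qed
  finally show ?thesis using nn_weight[of \<phi>] assms(2) by simp
qed

lemma divide_Z: "a * ennreal Z = b \<Longrightarrow> Z > 0 \<Longrightarrow> a = b * ennreal (1 / Z)"
  by (auto simp: mult.assoc ennreal_mult[symmetric])

lemma prob: "Z > 0 \<Longrightarrow> prob_space M"
proof
  assume Z: "Z > 0"
  have "(\<integral>\<^sup>+X. 1 \<partial>M) * ennreal Z = ennreal Z"
    using nn_integral_M[of "\<lambda>_ _. 1"] gpow_one[of N "\<lambda>_ _. 1" T 0] Z by (simp add: partition_eq)
  then have "(\<integral>\<^sup>+X. 1 \<partial>M) = ennreal Z * ennreal (1 / Z)" by (rule divide_Z[OF _ Z])
  then show "emeasure M (space M) = 1" using Z by (simp add: ennreal_mult[symmetric])
qed

lemma one_point: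
  assumes "Z > 0" "i \<in> {0<..<N}"
  shows "(\<integral>\<^sup>+X. \<psi> (int (X i)) \<partial>M) = nsum (\<lambda>x. kpow T i 0 x * (\<psi> x * kpow T (N - i) x 0)) * ennreal (1 / Z)"
proof (rule divide_Z[OF _ assms(1)])
  let ?\<phi> = "\<lambda>t x. if t = i then \<psi> x else 1"
  have "(\<Prod>t=1..<N. ?\<phi> t (int (X t))) = \<psi> (int (X i))" for X
    using assms(2) by (subst prod.delta) auto
  then show "(\<integral>\<^sup>+X. \<psi> (int (X i)) \<partial>M) * ennreal Z = nsum (\<lambda>x. kpow T i 0 x * (\<psi> x * kpow T (N - i) x 0))"
    using nn_integral_M[of ?\<phi>] gpow_single[of i N ?\<phi> T 0] assms by simp
qed

lemma two_point:
  assumes "Z > 0" "0 < i" "i < j" "j < N"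
  shows "(\<integral>\<^sup>+X. \<psi> (int (X i)) * \<eta> (int (X j)) \<partial>M)
    = nsum (\<lambda>x. kpow T i 0 x * (\<psi> x * nsum (\<lambda>z. kpow T (j - i) x z * (\<eta> z * kpow T (N - j) z 0)))) * ennreal (1 / Z)"
proof (rule divide_Z[OF _ assms(1)])
  let ?\<phi> = "\<lambda>t x. if t = i then \<psi> x else if t = j then \<eta> x else 1"
  have "(\<Prod>t=1..<N. ?\<phi> t (int (X t))) = \<psi> (int (X i)) * \<eta> (int (X j))" for X
  proof -
    have "(\<Prod>t=1..<N. ?\<phi> t (int (X t))) = (\<Prod>t\<in>{i, j}. ?\<phi> t (int (X t)))"
      by (rule prod.mono_neutral_right) (use assms in auto)
    then show ?thesis using assms by simp
  qed
  then show "(\<integral>\<^sup>+X. \<psi> (int (X i)) * \<eta> (int (X j)) \<partial>M) * ennreal Z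
    = nsum (\<lambda>x. kpow T i 0 x * (\<psi> x * nsum (\<lambda>z. kpow T (j - i) x z * (\<eta> z * kpow T (N - j) z 0))))"
    using nn_integral_M[of ?\<phi>] gpow_double[of i j N ?\<phi> T 0] assms by simp
qed

lemma second_moment:
  assumes Z: "Z > 0" and sq: "sq_bounded T r D N" and D: "D \<ge> 0" and i: "i \<in> {0<..<N}"
  shows "(\<integral>\<^sup>+X. ennreal ((real (X i))\<^sup>2) \<partial>M) \<le> ennreal (D * (real r)\<^sup>2)"
proof -
  have "(\<integral>\<^sup>+X. ennreal ((real (X i))\<^sup>2) \<partial>M) = (\<integral>\<^sup>+X. ennreal ((of_int (int (X i)))\<^sup>2) \<partial>M)" by simp
  also have "\<dots> = nsum (\<lambda>x. kpow T i 0 x * (ennreal ((of_int x)\<^sup>2) * kpow T (N - i) x 0)) * ennreal (1 / Z)"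
    by (rule one_point[OF Z i])
  also have "\<dots> \<le> (ennreal (D * (real r)\<^sup>2) * ennreal Z) * ennreal (1 / Z)"
    unfolding partition_eq using sq i by (intro mult_right_mono) (auto simp: sq_bounded_def)
  also have "\<dots> = ennreal (D * (real r)\<^sup>2)" using Z D by (simp add: ennreal_mult[symmetric] mult.assoc)
  finally show ?thesis .
qed

lemma covariance_le_moment:
  assumes "Z > 0" "sq_bounded T r D N" "D \<ge> 0" "i \<in> {0<..<N}" "j \<in> {0<..<N}"
  shows "covariance M (\<lambda>X. real (X i)) (\<lambda>X. real (X j)) \<le> D * (real r)\<^sup>2"
  using prob_space.covariance_of_squares(5)[OF prob] assms second_moment measurable_M by simp

lemma covariance_le_decay:
  assumes Z: "Z > 0" and sq: "sq_bounded T r D N" and D: "D \<ge> 0" and ij: "0 < i" "i < j" "j < N"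
    and dec: "cov_decay T r m D \<epsilon>" and s: "3 * m \<le> s" "s \<le> 6 * m" "j - i = 3 * m + (s + 3 * m * k)"
  shows "covariance M (\<lambda>X. real (X i)) (\<lambda>X. real (X j)) \<le> D * (real r)\<^sup>2 * (1 - \<epsilon> / 2) ^ k"
proof -
  \<comment> \<open>In the count from the right end, the later observation has \<open>N - j\<close>
    steps after it.\<close>
  have Nd: "N = i + 3 * m + (s + 3 * m * k) + (N - j)" "N - (N - j) = j" "N - i - (N - j) = j - i" using s ij by auto
  have kZ: "kpow T N 0 0 > 0" using Z by (simp add: partition_eq[symmetric])
  obtain z u v c where zc: "kpow T N 0 0 = ennreal z" "0 < z"
    "nsum (\<lambda>x. kpow T i 0 x * (ennreal (of_int x) * kpow T (N - i) x 0)) = ennreal u"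
    "nsum (\<lambda>x. kpow T j 0 x * (ennreal (of_int x) * kpow T (N - j) x 0)) = ennreal v"
    "nsum (\<lambda>x. kpow T i 0 x * (ennreal (of_int x) *
        nsum (\<lambda>y. kpow T (j - i) x y * (ennreal (of_int y) * kpow T (N - j) y 0)))) = ennreal c"
    "0 \<le> u" "0 \<le> v" "0 \<le> c" "c / z - u / z * (v / z) \<le> D * (real r)\<^sup>2 * (1 - \<epsilon> / 2) ^ k"
    using dec[unfolded cov_decay_def, rule_format, OF s(1,2) Nd(1) kZ] unfolding Nd(2,3) by blast
  have zZ: "z = Z" using zc(1,2) Z by (simp add: partition_eq[symmetric])
  have ij': "i \<in> {0<..<N}" "j \<in> {0<..<N}" using ij by auto
  have a: "D * (real r)\<^sup>2 \<ge> 0" using D by simp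
  interpret prob_space M by (rule prob[OF Z])
  note cs = covariance_of_squares[OF measurable_M _ second_moment[OF Z sq D ij'(1)] measurable_M _ second_moment[OF Z sq D ij'(2)] a]
  have i1: "(\<integral>X. real (X i) \<partial>M) = u / z"
  proof -
    have "(\<integral>\<^sup>+X. ennreal (real (X i)) \<partial>M) = (\<integral>\<^sup>+X. ennreal (of_int (int (X i))) \<partial>M)" by simp
    also have "\<dots> = ennreal u * ennreal (1 / Z)" by (simp only: one_point[OF Z ij'(1), of "\<lambda>x. ennreal (of_int x)"] zc(3))
    also have "\<dots> = ennreal (u / z)" unfolding zZ using zc Z by (simp add: ennreal_mult[symmetric])
    finally show ?thesis using nn_integral_eq_integral[OF cs(1)] zc by (simp add: integral_nonneg)
  qed
  have i2: "(\<integral>X. real (X j) \<partial>M) = v / z"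
  proof -
    have "(\<integral>\<^sup>+X. ennreal (real (X j)) \<partial>M) = (\<integral>\<^sup>+X. ennreal (of_int (int (X j))) \<partial>M)" by simp
    also have "\<dots> = ennreal v * ennreal (1 / Z)" by (simp only: one_point[OF Z ij'(2), of "\<lambda>x. ennreal (of_int x)"] zc(4))
    also have "\<dots> = ennreal (v / z)" unfolding zZ using zc Z by (simp add: ennreal_mult[symmetric])
    finally show ?thesis using nn_integral_eq_integral[OF cs(2)] zc by (simp add: integral_nonneg)
  qed
  have i3: "(\<integral>X. real (X i) * real (X j) \<partial>M) = c / z"
  proof -
    have "(\<integral>\<^sup>+X. ennreal (real (X i) * real (X j)) \<partial>M) = (\<integral>\<^sup>+X. ennreal (of_int (int (X i))) * ennreal (of_int (int (X j))) \<partial>M)"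
      by (simp add: ennreal_mult)
    also have "\<dots> = ennreal c * ennreal (1 / Z)" by (simp only: two_point[OF Z ij, of "\<lambda>x. ennreal (of_int x)" "\<lambda>x. ennreal (of_int x)"] zc(5))
    also have "\<dots> = ennreal (c / z)" unfolding zZ using zc Z by (simp add: ennreal_mult[symmetric])
    finally show ?thesis using nn_integral_eq_integral[OF cs(3)] zc by (simp add: integral_nonneg)
  qed
  show ?thesis using cs(4) zc(9) by (simp add: i1 i2 i3)
qed

end

lemma covariance_commute: "covariance M F G = covariance M G F"
  by (simp add: covariance_def mult.commute)

section \<open>The potential and the scale\<close>

locale potential_fun =
  fixes V :: "real \<Rightarrow> real"
  assumes pot: "potential V"
begin

lemma V_nonneg: "x \<ge> 0 \<Longrightarrow> V x \<ge> 0" and V_0: "V 0 = 0"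
  and V_mono: "0 \<le> x \<Longrightarrow> x \<le> y \<Longrightarrow> V x \<le> V y"
  and V_cont: "continuous_on {0..} V" and V_top: "filterlim V at_top at_top"
  and V_convex: "convex_on {0..} V"
  using pot by (auto simp: potential_def mono_on_def)

lemma V_convex_0:
  assumes "0 \<le> y" "y \<le> x" "x > 0"
  shows "V y \<le> y / x * V x"
proof -
  have "V ((1 - y / x) *\<^sub>R 0 + (y / x) *\<^sub>R x) \<le> (1 - y / x) * V 0 + y / x * V x"
    by (rule convex_onD[OF V_convex]) (use assms in auto)
  then show ?thesis using assms by (simp add: V_0)
qed

lemma H1:
  assumes "lam > 0"
  shows "H1 V lam > 0" "lam * (H1 V lam)\<^sup>2 * V (2 * H1 V lam) = 1"
proof -
  obtain X where X: "\<And>x. x \<ge> X \<Longrightarrow> V x \<ge> 1 / lam"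
    using V_top by (auto simp: filterlim_at_top eventually_at_top_linorder)
  define b where "b = max 1 X"
  have "1 / lam * 1 \<le> V (2 * b) * b\<^sup>2"
    using X[of "2 * b"] V_nonneg[of "2 * b"] assms by (intro mult_mono) (auto simp: b_def)
  then have b: "1 / lam \<le> b\<^sup>2 * V (2 * b)" by (simp add: mult.commute)
  have "\<exists>x\<ge>0. x \<le> b \<and> x\<^sup>2 * V (2 * x) = 1 / lam"
  proof (rule IVT')
    show "continuous_on {0..b} (\<lambda>x. x\<^sup>2 * V (2 * x))"
      by (intro continuous_intros continuous_on_compose2[OF V_cont]) auto
  qed (use b assms in \<open>auto simp: V_0 b_def\<close>)
  then obtain x where x: "x \<ge> 0" "x\<^sup>2 * V (2 * x) = 1 / lam" by blast
  have x0: "x > 0" using x assms by (cases "x = 0") auto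
  have uniq: "y = z" if "y > 0" "lam * y\<^sup>2 * V (2 * y) = 1" "z > 0" "lam * z\<^sup>2 * V (2 * z) = 1" for y z
  proof -
    have False if "0 < y" "y < z" "lam * y\<^sup>2 * V (2 * y) = 1" "lam * z\<^sup>2 * V (2 * z) = 1" for y z
    proof -
      have "V (2 * y) > 0" using that(1,3) V_nonneg[of "2 * y"] by (cases "V (2 * y) = 0") auto
      then have "lam * y\<^sup>2 * V (2 * y) < lam * z\<^sup>2 * V (2 * y)"
        using that assms by (intro mult_strict_right_mono mult_strict_left_mono power_strict_mono) auto
      also have "\<dots> \<le> lam * z\<^sup>2 * V (2 * z)" using that assms by (intro mult_left_mono V_mono) auto
      finally show False using that by simp
    qed
    then show ?thesis using that by (meson linorder_neqE_linordered_idom)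
  qed
  have x1: "lam * x\<^sup>2 * V (2 * x) = 1" using x assms by (simp add: mult.assoc)
  have "\<exists>!H. H > 0 \<and> lam * H\<^sup>2 * V (2 * H) = 1"
  proof (rule ex1I[of _ x])
    show "x > 0 \<and> lam * x\<^sup>2 * V (2 * x) = 1" using x0 x1 by simp
    show "y = x" if "y > 0 \<and> lam * y\<^sup>2 * V (2 * y) = 1" for y
      by (rule uniq) (use that x0 x1 in auto)
  qed
  from theI'[OF this] show "H1 V lam > 0" "lam * (H1 V lam)\<^sup>2 * V (2 * H1 V lam) = 1"
    unfolding H1_def by auto
qed

lemma H1_large:
  assumes "R > 0"
  obtains lam0 where "lam0 > 0" "\<And>lam. 0 < lam \<Longrightarrow> lam \<le> lam0 \<Longrightarrow> H1 V lam > R"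
proof (rule that[of "1 / (R\<^sup>2 * V (2 * R) + 1)"])
  have nn: "R\<^sup>2 * V (2 * R) \<ge> 0" using assms V_nonneg by simp
  then show "1 / (R\<^sup>2 * V (2 * R) + 1) > 0" by (simp add: add_nonneg_pos)
  fix lam assume lam: "0 < lam" "lam \<le> 1 / (R\<^sup>2 * V (2 * R) + 1)"
  show "H1 V lam > R"
  proof (rule ccontr)
    assume "\<not> R < H1 V lam"
    then have "lam * ((H1 V lam)\<^sup>2 * V (2 * H1 V lam)) \<le> lam * (R\<^sup>2 * V (2 * R))"
      using H1[OF lam(1)] assms lam by (intro mult_left_mono mult_mono power_mono V_mono V_nonneg) auto
    also have "\<dots> < lam * (R\<^sup>2 * V (2 * R) + 1)" using lam by simp
    also have "\<dots> \<le> 1" using lam nn by (simp add: pos_le_divide_eq add_nonneg_pos)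
    finally show False using H1[OF lam(1)] by (simp add: mult.assoc)
  qed
qed

text \<open>With \<open>\<alpha> = M / 2\<close> the growth condition compares
  \<open>V (M * H)\<close> with \<open>V (2 * H)\<close>. It is an asymptotic statement; on the
  remaining bounded range of \<open>H\<close> monotonicity and \<open>V (2 * H) \<ge> 1\<close> take
  over.\<close>

lemma doubling:
  obtains H0 :: real and B :: "nat \<Rightarrow> real" where "H0 > 0" "\<And>M. B M \<ge> 0" "\<And>M H. H \<ge> H0 \<Longrightarrow> V (real M * H) \<le> B M * V (2 * H)"
proof -
  obtain X where X: "\<And>x. x \<ge> X \<Longrightarrow> V x \<ge> 1"
    using V_top by (auto simp: filterlim_at_top eventually_at_top_linorder)
  define H0 where "H0 = max 1 X"
  have H0: "H0 \<ge> 1" by (simp add: H0_def)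
  have V1: "V (2 * H) \<ge> 1" if "H \<ge> H0" for H using that X[of "2 * H"] by (simp add: H0_def)
  have "\<exists>B\<ge>0. \<forall>H\<ge>H0. V (real M * H) \<le> B * V (2 * H)" for M :: nat
  proof (cases "M = 0")
    case True
    then show ?thesis by (intro exI[of _ 0]) (simp add: V_0)
  next
    case False
    define \<alpha> where "\<alpha> = real M / 2"
    have "\<alpha> > 0" using False by (simp add: \<alpha>_def)
    then obtain f where f: "f > 0" "Limsup at_top (\<lambda>x. ereal (V (\<alpha> * x) / V x)) \<le> ereal f"
      using pot unfolding potential_def by blast
    then have "Limsup at_top (\<lambda>x. ereal (V (\<alpha> * x) / V x)) < ereal (f + 1)"
      by (rule_tac le_less_trans) auto
    then have "eventually (\<lambda>x. ereal (V (\<alpha> * x) / V x) < ereal (f + 1)) at_top" by (rule Limsup_lessD)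
    then obtain Y where Y: "\<And>x. x \<ge> Y \<Longrightarrow> V (\<alpha> * x) / V x < f + 1"
      by (auto simp: eventually_at_top_linorder)
    \<comment> \<open>A bound for \<open>V (M * H)\<close> as long as \<open>2 * H\<close> is below
      the threshold \<open>Y\<close>.\<close>
    define W where "W = V (real M * \<bar>Y\<bar>)"
    have W: "W \<ge> 0" by (simp add: W_def V_nonneg)
    have "V (real M * H) \<le> max (f + 1) W * V (2 * H)" if H: "H \<ge> H0" for H
      proof (cases "2 * H \<ge> Y")
        case True
        have "V (real M * H) = V (\<alpha> * (2 * H))" by (simp add: \<alpha>_def)
        also have "\<dots> \<le> (f + 1) * V (2 * H)" using Y[OF True] V1[OF H] by (simp add: divide_less_eq)
        also have "\<dots> \<le> max (f + 1) W * V (2 * H)" using V1[OF H] by (intro mult_right_mono) auto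
        finally show ?thesis .
      next
        case False
        have "V (real M * H) \<le> W" unfolding W_def using False H H0 by (intro V_mono mult_left_mono) auto
        also have "\<dots> \<le> W * V (2 * H)" using V1[OF H] W mult_left_mono[of 1 "V (2 * H)" W] by simp
        also have "\<dots> \<le> max (f + 1) W * V (2 * H)" using V1[OF H] by (intro mult_right_mono) auto
        finally show ?thesis .
      qed
    then show ?thesis using f by (intro exI[of _ "max (f + 1) W"]) auto
  qed
  then obtain B where "\<And>M. B M \<ge> 0 \<and> (\<forall>H\<ge>H0. V (real M * H) \<le> B M * V (2 * H))" by metis
  then show thesis using that[of H0 B] H0 by auto
qed

lemma site_bounds: "lam > 0 \<Longrightarrow> 0 \<le> site V lam x \<and> site V lam x \<le> 1"
  using V_nonneg[of "of_int x"] by (simp add: site_def)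

text \<open>By the equation for \<open>H\<close>, the cost per step below \<open>M * H\<close> is at
  most \<open>B M / H^2\<close>, hence at most \<open>B M / r^2\<close> for every scale
  \<open>r\<close> up to \<open>H\<close>. The smaller scales are needed for short bridges.\<close>

lemma adm_site:
  fixes B :: "nat \<Rightarrow> real"
  assumes lam: "lam > 0" and H: "H > 0" "lam * H\<^sup>2 * V (2 * H) = 1" and r: "real r \<le> H" "r \<ge> 1"
    and B: "\<And>M. B M \<ge> 0" "\<And>M. V (real M * H) \<le> B M * V (2 * H)"
  shows "adm B (site V lam) r"
  unfolding adm_def
proof (intro conjI allI impI)
  fix M and x :: int assume x: "0 \<le> x \<and> x \<le> int (M * r)"
  have "real_of_int x \<le> real (M * r)" using x by (metis of_int_le_iff of_int_of_nat_eq)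
  also have "\<dots> \<le> M * H" using r by (simp add: mult_left_mono)
  finally have "V (of_int x) \<le> V (real M * H)" using x by (intro V_mono) auto
  then have "lam * V (of_int x) \<le> lam * (B M * V (2 * H))" using lam B(2)[of M] by (intro mult_left_mono) auto
  also have "\<dots> = B M * (1 / H\<^sup>2)" using H by (simp add: field_simps)
  also have "\<dots> \<le> B M * (1 / (real r)\<^sup>2)" using r H B by (intro mult_left_mono divide_left_mono power_mono) auto
  finally have "lam * V (of_int x) \<le> B M / (real r)\<^sup>2" by simp
  moreover have "lam * V (of_int x) / 2 \<le> lam * V (of_int x)" using lam x V_nonneg[of "of_int x"] by simp
  ultimately have "lam * V (of_int x) / 2 \<le> B M / (real r)\<^sup>2" by linarith
  then have "- B M / (real r)\<^sup>2 \<le> - lam * V (of_int x) / 2" by simp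
  then show "exp (- B M / (real r)\<^sup>2) \<le> site V lam x" using x by (simp add: site_def)
qed (use site_bounds[OF lam] in \<open>auto simp: site_def\<close>)

text \<open>Confinement, unlike admissibility, needs \<open>r\<close> to be comparable with
  \<open>H\<close> from below: convexity compares \<open>V x\<close> with \<open>V (2 * H)\<close>
  at heights \<open>x \<ge> 4 * r \<ge> 2 * H\<close>.\<close>

lemma confining_site:
  assumes lam: "lam > 0" and H: "H > 0" "lam * H\<^sup>2 * V (2 * H) = 1" and r: "H \<le> real r + 1" "r \<ge> 1"
  shows "confining (site V lam) r"
  unfolding confining_def
proof (intro allI impI)
  fix x :: int assume x: "4 * int r \<le> x"
  have xr: "real_of_int x \<ge> 4 * r" using x by linarith
  have Hr: "H \<le> 2 * r" using r by (simp add: add_increasing)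
  have xH: "2 * H \<le> real_of_int x" using xr Hr by linarith
  have xp: "real_of_int x > 0" using xH H by linarith
  have "V (2 * H) \<le> 2 * H / of_int x * V (of_int x)" by (rule V_convex_0) (use xH H in auto)
  then have "lam * H\<^sup>2 * V (2 * H) \<le> lam * H\<^sup>2 * (2 * H / of_int x * V (of_int x))" using lam by (intro mult_left_mono) auto
  then have "1 \<le> 2 * H ^ 3 * (lam * V (of_int x)) / of_int x" using H by (simp add: power2_eq_square power3_eq_cube mult_ac)
  then have 1: "of_int x \<le> 2 * H ^ 3 * (lam * V (of_int x))" using xp by (simp add: pos_le_divide_eq)
  also have "\<dots> \<le> 2 * (2 * real r) ^ 3 * (lam * V (of_int x))"
    using Hr H lam xp V_nonneg by (intro mult_right_mono mult_left_mono power_mono) auto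
  finally have "of_int x \<le> 16 * real r ^ 3 * (lam * V (of_int x))" by (simp add: power3_eq_cube)
  then have "of_int x / (32 * real r ^ 3) \<le> lam * V (of_int x) / 2" using r by (simp add: field_simps)
  then show "site V lam x \<le> exp (- of_int x / (32 * real r ^ 3))" using xp by (simp add: site_def)
qed

lemma site_mono: "lam \<le> lam' \<Longrightarrow> site V lam' x \<le> site V lam x"
  using V_nonneg[of "of_int x"] by (auto simp: site_def mult_right_mono)

lemma tk_site_mono: "lam \<le> lam' \<Longrightarrow> tk p (site V lam') x y \<le> tk p (site V lam) x y"
  unfolding tk_def by (intro ennreal_leI mult_mono site_mono) (auto simp: site_def)

end

section \<open>Bridges of bounded length\<close>

lemma tk_site_zero: "tk p (site V lam) x y = 0 \<longleftrightarrow> x < 0 \<or> y < 0 \<or> pmf p (y - x) = 0"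
proof (cases "x < 0 \<or> y < 0 \<or> pmf p (y - x) = 0")
  case False
  then have "site V lam x * site V lam y * pmf p (y - x) > 0"
    by (simp add: site_def pmf_nonneg order_less_le)
  then show ?thesis using False by (simp add: tk_def ennreal_eq_0_iff)
qed (auto simp: tk_def site_def)

lemma kpow_zero:
  assumes "\<And>x y. T x y = 0 \<Longrightarrow> S x y = 0"
  shows "kpow T n x y = 0 \<Longrightarrow> kpow S n x y = 0"
proof (induction n arbitrary: x)
  case (Suc n)
  have "T x z * kpow T n z y = 0" for z
  proof -
    have "T x z * kpow T n z y = nsum (\<lambda>w. of_bool (z = w) * (T x w * kpow T n w y))" by (simp only: nsum_delta)
    also have "\<dots> \<le> nsum (\<lambda>w. T x w * kpow T n w y)" by (intro nsum_mono) (auto simp: of_bool_def)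
    also have "\<dots> = 0" using Suc.prems by simp
    finally show ?thesis by simp
  qed
  then have "S x z * kpow S n z y = 0" for z using Suc.IH[of z] assms[of x z] by auto
  then have "nsum (\<lambda>z. S x z * kpow S n z y) = nsum (\<lambda>z. 0)" by (intro arg_cong[where f=nsum] ext)
  then show ?case by simp
qed simp

context walk
begin

text \<open>For a fixed length the partition function decreases in \<open>lam\<close>, and whether
  it vanishes depends only on \<open>p\<close>. So it is at least its positive value at
  \<open>lam0\<close>, and the second moment of the walk killed below 0 bounds the
  numerator.\<close>

lemma sq_bounded_fixed_length:
  assumes "potential V" "lam0 > 0"
  obtains D where "D \<ge> 0" "\<And>lam. 0 < lam \<Longrightarrow> lam \<le> lam0 \<Longrightarrow> kpow (tk p (site V lam)) N 0 0 > 0 \<Longrightarrow> sq_bounded (tk p (site V lam)) 1 D N"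
proof -
  interpret potential_fun V by standard fact
  let ?T = "\<lambda>lam. tk p (site V lam)"
  have le1: "kpow (?T lam) n x y \<le> 1" if "lam > 0" for lam n x y
    using kpow_le_free[OF site_bounds[OF that]] by (rule order_trans) (simp add: pmf_le_1)
  define z where "z = enn2real (kpow (?T lam0) N 0 0)"
  have z: "kpow (?T lam0) N 0 0 = ennreal z"
    using le_less_trans[OF le1[OF assms(2)] ennreal_one_less_top] by (simp add: z_def less_top)
  have z0: "z \<ge> 0" by (simp add: z_def)
  show thesis
  proof (rule that[of "s2 * N / z"])
    show "s2 * N / z \<ge> 0" using s2_pos z0 by simp
    fix lam assume lam: "0 < lam" "lam \<le> lam0" and pos: "kpow (?T lam) N 0 0 > 0"
    have "kpow (?T lam0) N 0 0 \<noteq> 0"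
    proof
      assume "kpow (?T lam0) N 0 0 = 0"
      then have "kpow (?T lam) N 0 0 = 0"
        by (rule kpow_zero[rotated]) (simp add: tk_site_zero)
      then show False using pos by simp
    qed
    then have zp: "z > 0" using z z0 by (cases "z = 0") auto
    \<comment> \<open>Scale 1 is admissible with a suitable cost function; this gives access to
      \<open>sq_moment\<close>.\<close>
    obtain b where adm: "adm b (site V lam) 1"
    proof
      show "adm (\<lambda>M. lam * V M) (site V lam) 1"
        unfolding adm_def
      proof (intro conjI allI impI)
        fix M and x :: int assume x: "0 \<le> x \<and> x \<le> int (M * 1)"
        then have "V (of_int x) \<le> V (real M)" by (intro V_mono) auto
        then have "lam * V (of_int x) \<le> lam * V M" using lam by (intro mult_left_mono) auto
        moreover have "lam * V (of_int x) / 2 \<le> lam * V (of_int x)" using lam x V_nonneg[of "of_int x"] by simp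
        ultimately have "- (lam * V M) \<le> - lam * V (of_int x) / 2" by simp
        then show "exp (- (lam * V M) / (real 1)\<^sup>2) \<le> site V lam x" using x by (simp add: site_def)
      qed (use site_bounds[OF lam(1)] in \<open>auto simp: site_def\<close>)
    qed
    show "sq_bounded (?T lam) 1 (s2 * N / z) N"
      unfolding sq_bounded_def
    proof (intro allI impI)
      fix i assume i: "i \<le> N"
      have "nsum (\<lambda>x. kpow (?T lam) i 0 x * (ennreal ((of_int x)\<^sup>2) * kpow (?T lam) (N - i) x 0))
        \<le> nsum (\<lambda>x. kpow (?T lam) i 0 x * (ennreal ((of_int x)\<^sup>2) * 1))"
        by (intro nsum_mono mult_left_mono le1 lam) auto
      also have "\<dots> \<le> ennreal (s2 * exit_time {0..} i 0)" using sq_moment[OF adm, of 0 i] by simp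
      also have "\<dots> \<le> ennreal (s2 * N)" using exit_time_bounds[of "{0..}" i 0] i s2_pos by (intro ennreal_leI mult_left_mono) auto
      also have "\<dots> = ennreal (s2 * N / z * (real 1)\<^sup>2) * ennreal z" using zp s2_pos by (simp add: ennreal_mult[symmetric])
      also have "\<dots> \<le> ennreal (s2 * N / z * (real 1)\<^sup>2) * kpow (?T lam) N 0 0"
        unfolding z[symmetric] by (intro mult_left_mono kpow_mono tk_site_mono lam) auto
      finally show "nsum (\<lambda>x. kpow (?T lam) i 0 x * (ennreal ((of_int x)\<^sup>2) * kpow (?T lam) (N - i) x 0))
        \<le> ennreal (s2 * N / z * (real 1)\<^sup>2) * kpow (?T lam) N 0 0" .
    qed
  qed
qed

end

section \<open>From blocks of steps to the final bound\<close>

lemma exp_decay_short: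
  fixes A c d H :: real
  assumes "0 \<le> A" "c \<ge> 0" "H \<ge> 1" "d \<le> L * H\<^sup>2" "X \<le> A * H\<^sup>2"
  shows "X \<le> A * exp (c * L) * H powr (5/2) * exp (- c * d * H powr (-2))"
proof -
  have "c * (d / H\<^sup>2) \<le> c * L" using assms by (intro mult_left_mono) (auto simp: divide_le_eq)
  \<comment> \<open>For times up to \<open>L * H^2\<close> the exponential factor is at least
    \<open>exp (- c * L)\<close>, so a constant restores it.\<close>
  then have e: "1 \<le> exp (c * L) * exp (- c * d * H powr (-2))"
    using assms by (simp add: exp_add[symmetric] powr_minus divide_inverse)
  have "H\<^sup>2 = H powr 2" using assms by simp
  also have "\<dots> \<le> H powr (5/2)" using assms by (intro powr_mono) auto
  finally have "A * H\<^sup>2 * 1 \<le> A * H powr (5/2) * (exp (c * L) * exp (- c * d * H powr (-2)))"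
    using assms e by (intro mult_mono) auto
  then show ?thesis using assms(5) by (simp add: mult_ac)
qed

text \<open>Each block of \<open>6 * C0 * r^2\<close> steps contributes
  \<open>exp (- \<epsilon> / 2)\<close>, which gives the rate \<open>\<epsilon> / (12 * C0)\<close>
  per \<open>H^2\<close> steps; the factor \<open>exp (3 * \<epsilon> / 2)\<close> pays for up to
  three blocks without contraction.\<close>

lemma exp_decay_long:
  fixes A \<epsilon> H :: real and m k l C0 r :: nat
  assumes A: "0 \<le> A" and \<epsilon>: "0 < \<epsilon>" "\<epsilon> \<le> 1" and H: "H \<ge> 1" "real r \<le> H" and C0: "C0 \<ge> 1" and r: "r \<ge> 1"
    and k: "real l \<le> 3 * (2 * C0 * r\<^sup>2) * (real k + 3)" and X: "X \<le> A * (real r)\<^sup>2 * (1 - \<epsilon> / 2) ^ k"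
  shows "X \<le> A * exp (3 * \<epsilon> / 2) * H powr (5/2) * exp (- (\<epsilon> / (12 * C0)) * l * H powr (-2))"
proof -
  have "(1 - \<epsilon> / 2) ^ k \<le> exp (- (\<epsilon> / 2)) ^ k"
    using exp_ge_add_one_self[of "- (\<epsilon> / 2)"] \<epsilon> by (intro power_mono) auto
  also have "\<dots> = exp (- (\<epsilon> / 2) * k)" by (simp add: exp_of_nat_mult[symmetric] mult.commute)
  also have "\<dots> \<le> exp (3 * \<epsilon> / 2 - \<epsilon> / (12 * C0) * l * H powr (-2))"
  proof -
    have "real l / H\<^sup>2 \<le> real l / (real r)\<^sup>2"
      using H r by (intro divide_left_mono power_mono) auto
    also have "\<dots> \<le> 6 * C0 * (real k + 3)"
      using k r by (simp add: divide_le_eq algebra_simps)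
    finally have "\<epsilon> / (12 * C0) * (real l / H\<^sup>2) \<le> \<epsilon> / (12 * C0) * (6 * C0 * (real k + 3))"
      using \<epsilon> by (intro mult_left_mono) auto
    also have "\<dots> = \<epsilon> / 2 * (real k + 3)" using C0 by simp
    finally have "\<epsilon> / (12 * C0) * (real l / H\<^sup>2) \<le> \<epsilon> / 2 * (real k + 3)" .
    moreover have "H powr (-2) = 1 / H\<^sup>2" using H by (simp add: powr_minus_divide)
    then have "\<epsilon> / (12 * C0) * l * H powr (-2) = \<epsilon> / (12 * C0) * (real l / H\<^sup>2)" by simp
    ultimately show ?thesis by (simp add: distrib_left)
  qed
  also have "\<dots> = exp (3 * \<epsilon> / 2) * exp (- (\<epsilon> / (12 * C0)) * l * H powr (-2))"
    by (simp add: exp_add[symmetric])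
  finally have e: "(1 - \<epsilon> / 2) ^ k \<le> exp (3 * \<epsilon> / 2) * exp (- (\<epsilon> / (12 * C0)) * l * H powr (-2))" .
  have "(real r)\<^sup>2 \<le> H\<^sup>2" using H by (intro power_mono) auto
  also have "H\<^sup>2 = H powr 2" using H by simp
  also have "\<dots> \<le> H powr (5/2)" using H by (intro powr_mono) auto
  finally have "A * (real r)\<^sup>2 * (1 - \<epsilon> / 2) ^ k
    \<le> A * H powr (5/2) * (exp (3 * \<epsilon> / 2) * exp (- (\<epsilon> / (12 * C0)) * l * H powr (-2)))"
    using A \<epsilon> e by (intro mult_mono) auto
  then show ?thesis using X by (simp add: mult_ac)
qed

lemma block_decomposition:
  fixes m l :: nat
  assumes "m \<ge> 1" "6 * m \<le> l"
  obtains s k where "3 * m \<le> s" "s \<le> 6 * m" "l = 3 * m + (s + 3 * m * k)" "real l \<le> 3 * m * (real k + 3)"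
proof
  let ?k = "(l - 6 * m) div (3 * m)" and ?s = "3 * m + (l - 6 * m) mod (3 * m)"
  have md: "(l - 6 * m) mod (3 * m) < 3 * m" using assms by simp
  have dm: "3 * m * ?k + (l - 6 * m) mod (3 * m) = l - 6 * m" by (rule mult_div_mod_eq)
  show "3 * m \<le> ?s" by simp
  show "?s \<le> 6 * m" using md by simp
  show l: "l = 3 * m + (?s + 3 * m * ?k)" using dm assms by linarith
  have "l \<le> 3 * m * (?k + 3)" using l md unfolding distrib_left by linarith
  then have "real l \<le> real (3 * m * (?k + 3))" by (rule of_nat_mono)
  then show "real l \<le> 3 * m * (real ?k + 3)" by simp
qed

text \<open>The largest scale that fits: twice of it no longer fits, hence the factor 4, which
  matches the window between \<open>12 * C0 * r^2\<close> and \<open>48 * C0 * r^2\<close>.\<close>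

lemma scale_for_length:
  fixes c N r0 :: nat
  assumes "c * r0\<^sup>2 \<le> N" "c \<ge> 1" "r0 \<ge> 1"
  obtains r where "r \<ge> r0" "c * r\<^sup>2 \<le> N" "N < 4 * (c * r\<^sup>2)"
proof -
  let ?P = "\<lambda>r. c * r\<^sup>2 \<le> N"
  have bnd: "r \<le> N" if "?P r" for r
  proof -
    have "r \<le> r\<^sup>2" by (cases r) (auto simp: power2_eq_square)
    also have "1 * r\<^sup>2 \<le> c * r\<^sup>2" using assms by (intro mult_right_mono) auto
    finally show ?thesis using that by simp
  qed
  define r where "r = (GREATEST r. ?P r)"
  have P: "?P r" unfolding r_def using assms(1) bnd by (rule GreatestI_nat)
  have ge: "r0 \<le> r" unfolding r_def using assms(1) bnd by (rule Greatest_le_nat)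
  have "\<not> ?P (r + 1)"
  proof
    assume "?P (r + 1)"
    then have "r + 1 \<le> r" unfolding r_def using bnd by (rule Greatest_le_nat)
    then show False by simp
  qed
  moreover have "c * (r + 1)\<^sup>2 \<le> c * (2 * r)\<^sup>2" using ge assms by (intro mult_left_mono power_mono) auto
  moreover have "c * (2 * r)\<^sup>2 = 4 * (c * r\<^sup>2)" by (simp add: power_mult_distrib)
  ultimately have "N < 4 * (c * r\<^sup>2)" by linarith
  then show thesis using that ge P by blast
qed

text \<open>Contraction is used only for long bridges with distant times. If the times are within
  order \<open>H^2\<close>, a bound of order \<open>H^2\<close> on the covariance suffices; it comes
  from second moments at the scale that suits the length of the bridge.\<close>

lemma (in walk) covariance_bound:
  assumes pot: "potential V"
  obtains C c lam0 :: real where "C > 0" "c > 0" "lam0 > 0"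
    "\<And>lam N i j. 0 < lam \<Longrightarrow> lam \<le> lam0 \<Longrightarrow> partition_fun p V lam N 0 0 > 0 \<Longrightarrow> 0 < i \<Longrightarrow> i \<le> j \<Longrightarrow> j < N \<Longrightarrow>
      covariance (path_measure p V lam N 0 0) (\<lambda>X. real (X i)) (\<lambda>X. real (X j))
        \<le> C * H1 V lam powr (5/2) * exp (- c * real (j - i) * H1 V lam powr (-2))"
proof -
  interpret potential_fun V by standard fact
  obtain C0 :: nat where C0: "C0 \<ge> 1" and est:
    "\<And>b. \<exists>D \<epsilon> r0. 0 \<le> D \<and> 0 < \<epsilon> \<and> \<epsilon> \<le> 1 \<and> r0 \<ge> 1 \<and> (\<forall>r\<ge>r0. \<forall>u. adm b u r \<longrightarrow>
       (\<forall>N. 12 * C0 * r\<^sup>2 \<le> N \<longrightarrow> N \<le> 48 * C0 * r\<^sup>2 \<longrightarrow> sq_bounded (tk p u) r D N) \<and>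
       (confining u r \<longrightarrow> (\<forall>N. 12 * C0 * r\<^sup>2 \<le> N \<longrightarrow> sq_bounded (tk p u) r D N) \<and> cov_decay (tk p u) r (2 * C0 * r\<^sup>2) D \<epsilon>))"
    using kernel_estimates by metis
  obtain H0 :: real and B :: "nat \<Rightarrow> real" where H0: "H0 > 0" and B: "\<And>M. B M \<ge> 0" "\<And>M H. H \<ge> H0 \<Longrightarrow> V (real M * H) \<le> B M * V (2 * H)"
    by (rule doubling) blast
  obtain D \<epsilon> r0 where D: "0 \<le> D" and \<epsilon>: "0 < \<epsilon>" "\<epsilon> \<le> 1" and r0: "r0 \<ge> 1" and
    scales: "\<And>r u. r \<ge> r0 \<Longrightarrow> adm B u r \<Longrightarrow>
       (\<forall>N. 12 * C0 * r\<^sup>2 \<le> N \<longrightarrow> N \<le> 48 * C0 * r\<^sup>2 \<longrightarrow> sq_bounded (tk p u) r D N) \<and>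
       (confining u r \<longrightarrow> (\<forall>N. 12 * C0 * r\<^sup>2 \<le> N \<longrightarrow> sq_bounded (tk p u) r D N) \<and> cov_decay (tk p u) r (2 * C0 * r\<^sup>2) D \<epsilon>)"
    using est[of B] by blast
  have small: "sq_bounded (tk p u) r D N" if "r \<ge> r0" "adm B u r" "12 * C0 * r\<^sup>2 \<le> N" "N \<le> 48 * C0 * r\<^sup>2" for r u N
    using scales that by blast
  have long: "sq_bounded (tk p u) r D N" if "r \<ge> r0" "adm B u r" "confining u r" "12 * C0 * r\<^sup>2 \<le> N" for r u N
    using scales that by blast
  have dec: "cov_decay (tk p u) r (2 * C0 * r\<^sup>2) D \<epsilon>" if "r \<ge> r0" "adm B u r" "confining u r" for r u
    using scales that by blast
  \<comment> \<open>For \<open>H > R\<close> the doubling bound holds at \<open>H\<close>, and the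
    integer part of \<open>H\<close> is at least \<open>r0\<close>.\<close>
  define R where "R = max H0 (real r0)"
  have R: "R \<ge> 1" "R \<ge> H0" "R \<ge> real r0" using r0 by (auto simp: R_def)
  obtain lam0 where lam0: "lam0 > 0" and large: "\<And>lam. 0 < lam \<Longrightarrow> lam \<le> lam0 \<Longrightarrow> H1 V lam > R"
    using H1_large[of R] R by auto
  define N1 where "N1 = 12 * C0 * r0\<^sup>2"
  have "\<exists>E\<ge>0. \<forall>lam. 0 < lam \<longrightarrow> lam \<le> lam0 \<longrightarrow> kpow (tk p (site V lam)) N 0 0 > 0 \<longrightarrow> sq_bounded (tk p (site V lam)) 1 E N" for N
    using sq_bounded_fixed_length[OF pot lam0, of N] by metis
  then obtain E where E: "\<And>N. E N \<ge> 0" "\<And>lam N. 0 < lam \<Longrightarrow> lam \<le> lam0 \<Longrightarrow> kpow (tk p (site V lam)) N 0 0 > 0 \<Longrightarrow> sq_bounded (tk p (site V lam)) 1 (E N) N"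
    by metis
  \<comment> \<open>Only finitely many lengths are below the smallest usable scale; one constant
    covers them all.\<close>
  define E' where "E' = (\<Sum>N<N1. E N)"
  have E': "E' \<ge> 0" unfolding E'_def by (intro sum_nonneg E)
  define c where "c = \<epsilon> / (12 * C0)"
  have c: "c > 0" using \<epsilon> C0 by (simp add: c_def)
  \<comment> \<open>Measured in \<open>H^2\<close>, a bound for the distances in all cases without
    contraction: very short bridges, bridges too short for \<open>r\<close>, and nearby
    times.\<close>
  define L where "L = max (12 * C0) N1"
  define C where "C = (D + E' + 1) * (exp (3 * \<epsilon> / 2) + exp (c * L))"
  have C: "C > 0" "D * exp (3 * \<epsilon> / 2) \<le> C" "D * exp (c * L) \<le> C" "E' * exp (c * L) \<le> C"
    unfolding C_def using D E' by (auto intro!: mult_pos_pos add_nonneg_pos mult_mono)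
  show thesis
  proof (rule that[OF C(1) c lam0])
    fix lam :: real and N i j :: nat
    assume lam: "0 < lam" "lam \<le> lam0" and Z: "partition_fun p V lam N 0 0 > 0" and ij: "0 < i" "i \<le> j" "j < N"
    define H where "H = H1 V lam"
    have H: "H > 0" "lam * H\<^sup>2 * V (2 * H) = 1" "H > R" using H1[OF lam(1)] large[OF lam] by (auto simp: H_def)
    have H1: "H \<ge> 1" using H R by simp
    define r where "r = nat \<lfloor>H\<rfloor>"
    have r: "real r \<le> H" "H \<le> real r + 1" using H by (simp_all add: r_def)
    have rr0: "r \<ge> r0" using H(3) R(3) r0 unfolding r_def by linarith
    let ?T = "tk p (site V lam)"
    have adm: "adm B (site V lam) q" if "q \<ge> 1" "q \<le> r" for q
      using that r H R B by (intro adm_site[OF lam(1) H(1,2)]) auto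
    have conf: "confining (site V lam) r" using r rr0 r0 by (intro confining_site[OF lam(1) H(1,2)]) auto
    have "kpow ?T N 0 0 \<le> ennreal (pmf (nstep p N) (0 - 0))" by (rule kpow_le_free[OF site_bounds[OF lam(1)]])
    then interpret path p V lam N
      by unfold_locales (use ij V_0 in \<open>auto intro: le_less_trans\<close>)
    have ij': "i \<in> {0<..<N}" "j \<in> {0<..<N}" using ij by auto
    let ?c = "covariance (path_measure p V lam N 0 0) (\<lambda>X. real (X i)) (\<lambda>X. real (X j))"
    let ?E = "H powr (5/2) * exp (- c * real (j - i) * H powr (-2))"
    have short: "?c \<le> C * ?E" if "?c \<le> A * H\<^sup>2" "0 \<le> A" "A * exp (c * L) \<le> C" "real (j - i) \<le> L * H\<^sup>2" for A
    proof -
      have "?c \<le> A * exp (c * L) * ?E" using exp_decay_short[of A c H "real (j - i)" L ?c] that c H1 by (simp add: mult.assoc)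
      also have "\<dots> \<le> C * ?E" using that by (intro mult_right_mono) auto
      finally show ?thesis .
    qed
    have rH: "(real q)\<^sup>2 \<le> H\<^sup>2" if "q \<le> r" for q using that r by (intro power_mono) auto
    have LN: "12 * C0 * H\<^sup>2 \<le> L * H\<^sup>2" by (intro mult_right_mono) (auto simp: L_def)
    have "?c \<le> C * ?E"
    proof (cases "N < N1")
      case True
      have "sq_bounded ?T 1 (E N) N" by (rule E(2)[OF lam]) (use Z in \<open>simp add: partition_eq[symmetric]\<close>)
      from covariance_le_moment[OF Z this E(1) ij'] have "?c \<le> E N" by simp
      also have "E N \<le> E'" unfolding E'_def using True E by (intro member_le_sum) auto
      also have "E' \<le> E' * H\<^sup>2" using E' H1 mult_left_mono[of 1 "H\<^sup>2" E'] by simp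
      finally have 1: "?c \<le> E' * H\<^sup>2" .
      have "real (j - i) \<le> L" using True ij by (simp add: L_def le_max_iff_disj)
      also have "L \<le> L * H\<^sup>2" using H1 mult_left_mono[of 1 "H\<^sup>2" L] by (simp add: L_def)
      finally show ?thesis using short[OF 1 E' C(4)] by simp
    next
      case large: False
      show ?thesis
      proof (cases "N < 12 * C0 * r\<^sup>2")
        case True
        \<comment> \<open>The scale is fitted to the length of the bridge instead of to
          \<open>H\<close>. Since \<open>q \<le> r\<close>, the second moments are still of order
          \<open>H^2\<close>.\<close>
        obtain q where q: "q \<ge> r0" "12 * C0 * q\<^sup>2 \<le> N" "N < 4 * (12 * C0 * q\<^sup>2)"
          using scale_for_length[of "12 * C0" r0 N] large C0 r0 by (auto simp: N1_def)
        have "12 * C0 * q\<^sup>2 < 12 * C0 * r\<^sup>2" using q(2) True by (rule le_less_trans)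
        then have "q\<^sup>2 < r\<^sup>2" by simp
        then have qr: "q \<le> r" by (simp add: power2_less_imp_less less_imp_le)
        have "sq_bounded ?T q D N" by (rule small[OF q(1)]) (use adm qr q r0 in auto)
        from covariance_le_moment[OF Z this D ij'] have "?c \<le> D * (real q)\<^sup>2" .
        also have "\<dots> \<le> D * H\<^sup>2" using D rH[OF qr] by (intro mult_left_mono)
        finally have 1: "?c \<le> D * H\<^sup>2" .
        have "real (j - i) \<le> real (12 * C0 * r\<^sup>2)" using True ij by (intro of_nat_mono) auto
        also have "\<dots> \<le> 12 * C0 * H\<^sup>2" using rH[of r] by (simp add: mult_left_mono)
        finally show ?thesis using short[OF 1 D C(3)] LN by simp
      next
        case False
        then have N: "12 * C0 * r\<^sup>2 \<le> N" by simp
        have ad: "adm B (site V lam) r" using rr0 r0 by (intro adm) auto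
        have sq: "sq_bounded ?T r D N" by (rule long[OF rr0 ad conf N])
        show ?thesis
        proof (cases "j - i < 6 * (2 * C0 * r\<^sup>2)")
          case True
          from covariance_le_moment[OF Z sq D ij'] have "?c \<le> D * (real r)\<^sup>2" .
          also have "\<dots> \<le> D * H\<^sup>2" using D rH[of r] by (intro mult_left_mono) auto
          finally have 1: "?c \<le> D * H\<^sup>2" .
          have "real (j - i) \<le> real (12 * C0 * r\<^sup>2)" using True by (intro of_nat_mono) auto
          also have "\<dots> \<le> 12 * C0 * H\<^sup>2" using rH[of r] by (simp add: mult_left_mono)
          finally show ?thesis using short[OF 1 D C(3)] LN by simp
        next
          case far: False
          have m: "2 * C0 * r\<^sup>2 \<ge> 1" using C0 r0 rr0 by simp
          obtain s k where sk: "3 * (2 * C0 * r\<^sup>2) \<le> s" "s \<le> 6 * (2 * C0 * r\<^sup>2)"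
            "j - i = 3 * (2 * C0 * r\<^sup>2) + (s + 3 * (2 * C0 * r\<^sup>2) * k)" "real (j - i) \<le> 3 * (2 * C0 * r\<^sup>2) * (real k + 3)"
            using block_decomposition[OF m, of "j - i"] far by (metis not_less)
          have lt: "i < j" using far m by (cases "i = j") (use ij in auto)
          have "?c \<le> D * (real r)\<^sup>2 * (1 - \<epsilon> / 2) ^ k"
            by (rule covariance_le_decay[OF Z sq D ij(1) lt ij(3) dec[OF rr0 ad conf] sk(1-3)])
          then have "?c \<le> D * exp (3 * \<epsilon> / 2) * H powr (5/2) * exp (- (\<epsilon> / (12 * C0)) * (j - i) * H powr (-2))"
            using rr0 r0 by (intro exp_decay_long[OF D \<epsilon> H1 r(1) C0 _ sk(4)]) auto
          also have "\<dots> = D * exp (3 * \<epsilon> / 2) * ?E" by (simp add: c_def mult.assoc)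
          also have "\<dots> \<le> C * ?E" using C by (intro mult_right_mono) auto
          finally show ?thesis .
        qed
      qed
    qed
    then show "?c \<le> C * H1 V lam powr (5/2) * exp (- c * real (j - i) * H1 V lam powr (-2))"
      by (simp add: H_def mult.assoc)
  qed
qed

theorem theorem1p4:
  fixes p :: "int pmf" and V :: "real \<Rightarrow> real"
  assumes "walk_step p" and "potential V"
  shows "\<exists>C c lam0 :: real. C > 0 \<and> c > 0 \<and> lam0 > 0 \<and>
    (\<forall>lam \<in> {0<..lam0}. \<forall>N::nat. N \<ge> 1 \<longrightarrow> partition_fun p V lam N 0 0 > 0 \<longrightarrow>
      (\<forall>i \<in> {0<..<N}. \<forall>j \<in> {0<..<N}.
        covariance (path_measure p V lam N 0 0) (\<lambda>X. real (X i)) (\<lambda>X. real (X j))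
          \<le> C * H1 V lam powr (5/2) *
            exp (- c * \<bar>real i - real j\<bar> * H1 V lam powr (-2))))"
proof -
  interpret walk p by standard fact
  obtain C c lam0 :: real where cs: "C > 0" "c > 0" "lam0 > 0" and bound:
    "\<And>lam N i j. 0 < lam \<Longrightarrow> lam \<le> lam0 \<Longrightarrow> partition_fun p V lam N 0 0 > 0 \<Longrightarrow> 0 < i \<Longrightarrow> i \<le> j \<Longrightarrow> j < N \<Longrightarrow>
      covariance (path_measure p V lam N 0 0) (\<lambda>X. real (X i)) (\<lambda>X. real (X j))
        \<le> C * H1 V lam powr (5/2) * exp (- c * real (j - i) * H1 V lam powr (-2))"
    using covariance_bound[OF assms(2)] by blast
  show ?thesis
  proof (rule exI[of _ C], rule exI[of _ c], rule exI[of _ lam0], intro conjI ballI allI impI cs)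
    fix lam :: real and N i j :: nat
    assume a: "lam \<in> {0<..lam0}" "partition_fun p V lam N 0 0 > 0" "i \<in> {0<..<N}" "j \<in> {0<..<N}"
    show "covariance (path_measure p V lam N 0 0) (\<lambda>X. real (X i)) (\<lambda>X. real (X j))
      \<le> C * H1 V lam powr (5/2) * exp (- c * \<bar>real i - real j\<bar> * H1 V lam powr (-2))"
    proof (cases "i \<le> j")
      case True
      then have "\<bar>real i - real j\<bar> = real (j - i)" by simp
      then show ?thesis using bound[of lam N i j] a True by simp
    next
      case False
      then have "\<bar>real i - real j\<bar> = real (i - j)" by simp
      then show ?thesis using bound[of lam N j i] a False by (subst covariance_commute) simp
    qed
  qed
qed

end
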